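(* Let $M$ be a connected smooth manifold of dimension $n$, and let $f_0,f_1,\ldots,f_m$ be smooth vector fields on $M$ such that $\{f_1,\ldots,f_m\}$ satisfies the Hörmander condition and is equiregular, with degree of non-holonomy $r$. Assume there exists $s\in\mathbb N$, $s\ge 1$, such that $f_0(p)\in\Delta^s(p)\setminus\Delta^{s-1}(p)$ for every $p\in M$. Let $q\in M$ and let $z=(z_1,\ldots,z_n)$ be a system of privileged coordinates at $q$ for $\{f_1,\ldots,f_m\}$ rectifying $f_0$ as the $k$-th coordinate vector field, i.e. $z_*f_0=\partial_{z_k}$, for some $1\le k\le n$. Then for all sufficiently small $T>0$ and $\varepsilon>0$ there is a constant $C>0$ such that for every $q'\in M$ with $\rho^{f_0}_T(q,q')\le\varepsilon$, $$\frac1C\,\operatorname{dist}\big(z(q'),z(e^{[0,T]f_0}q)\big)\le \rho^{f_0}_T(q,q')\le C\,\operatorname{dist}\big(z(q'),z(e^{[0,T]f_0}q)\big)^{1/r},$$ where the constant $C$ is independent of $q'$.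
   Context: Define $\Delta^0=\{0\}$, let $\Delta^1$ be the $C^\infty(M)$-module generated by $f_1,\ldots,f_m$, and $\Delta^{s+1}=\Delta^s+[\Delta^s,\Delta^1]$; $\Delta^s(p)=\{f(p): f\in\Delta^s\}\subset T_pM$. The family satisfies the Hörmander condition if $\bigcup_{s}\Delta^s(p)=T_pM$ for all $p\in M$. It is equiregular if, for each $s$, $\dim\Delta^s(p)$ does not depend on $p\in M$; then the degree of non-holonomy is the minimal $r$ with $\Delta^r(p)=T_pM$ for all $p$. Weights at $q$: with $n_s=\dim\Delta^s(q)$, $n_0=0$, set $w_i=s$ if $n_{s-1}<i\le n_s$. For a smooth function $a$ near $q$, $\operatorname{ord}_q(a)$ is the minimal $s\ge0$ for which there are $i_1,\ldots,i_s\in\{1,\ldots,m\}$ with $(f_{i_1}\cdots f_{i_s}a)(q)\ne0$. Privileged coordinates at $q$ are local coordinates $z=(z_1,\ldots,z_n)$ centered at $q$ with $\operatorname{ord}_q(z_i)=w_i$ for $1\le i\le n$. Control-affine system: an absolutely continuous curve $\gamma:[0,T']\to M$ is admissible if there is $u\in L^1([0,T'],\mathbb R^m)$ with $\dot\gamma(t)=f_0(\gamma(t))+\sum_{i=1}^m u_i(t)f_i(\gamma(t))$ for a.e. $t$. Its cost is $c_{f_0}(\gamma)=\min\int_0^{T'}|u(t)|\,dt$, the minimum over all such $u$ ($|\cdot|$ is the Euclidean norm). The value function is $\rho^{f_0}_T(q,q')=\inf\{c_{f_0}(\gamma):\ \gamma:[0,T']\to M\text{ admissible},\ \gamma(0)=q,\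 \gamma(T')=q',\ T'\le T\}$. $e^{tf_0}$ is the flow of $f_0$, $e^{[0,T]f_0}q=\{e^{tf_0}q:0\le t\le T\}$, and $\operatorname{dist}(x,A)=\inf_{y\in A}|x-y|$ is the Euclidean distance in $\mathbb R^n$. The numbers $T,\varepsilon$ are small enough that all points involved lie in the domain of $z$. *)

theory Defs
  imports "HOL-Analysis.Analysis" "HOL-Library.Function_Algebras" "HOL-Library.Extended_Nat"
begin

section \<open>Smooth manifolds\<close>

primrec Ck_on :: "nat \<Rightarrow> 'a::real_normed_vector set \<Rightarrow> ('a \<Rightarrow> 'b::real_normed_vector) \<Rightarrow> bool" where
  "Ck_on 0 S g \<longleftrightarrow> continuous_on S g"
| "Ck_on (Suc k) S g \<longleftrightarrow>
     (\<forall>x\<in>S. g differentiable (at x)) \<and> (\<forall>v. Ck_on k S (\<lambda>x. frechet_derivative g (at x) v))"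

text \<open>Only used for open \<open>S\<close>; the derivatives are those of the ambient space.\<close>

definition smooth_on :: "'a::real_normed_vector set \<Rightarrow> ('a \<Rightarrow> 'b::real_normed_vector) \<Rightarrow> bool" where
  "smooth_on S g \<longleftrightarrow> (\<forall>k. Ck_on k S g)"

text \<open>A chart is a domain \<open>U\<close> together with a coordinate map, whose values outside \<open>U\<close> are
  irrelevant. The dimension of the manifold is \<open>CARD('n)\<close>.\<close>

type_synonym ('a, 'n) chart = "'a set \<times> ('a \<Rightarrow> real ^ 'n)"

definition is_chart :: "'a topology \<Rightarrow> ('a, 'n::finite) chart \<Rightarrow> bool" where
  "is_chart M c \<longleftrightarrow> (case c of (U, \<phi>) \<Rightarrow>
     openin M U \<and> open (\<phi> ` U) \<and>
     homeomorphic_map (subtopology M U) (top_of_set (\<phi> ` U)) \<phi>)"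

definition smooth_transition :: "('a, 'n::finite) chart \<Rightarrow> ('a, 'n) chart \<Rightarrow> bool" where
  "smooth_transition c d \<longleftrightarrow> (case (c, d) of ((U, \<phi>), (V, \<psi>)) \<Rightarrow>
     smooth_on (\<phi> ` (U \<inter> V)) (\<lambda>x. \<psi> (inv_into U \<phi> x)))"

definition smooth_manifold :: "'a topology \<Rightarrow> ('a, 'n::finite) chart set \<Rightarrow> bool" where
  "smooth_manifold M A \<longleftrightarrow>
     Hausdorff_space M \<and> second_countable M \<and>
     (\<forall>c\<in>A. is_chart M c) \<and> (\<Union>c\<in>A. fst c) = topspace M \<and>
     (\<forall>c\<in>A. \<forall>d\<in>A. smooth_transition c d)"

text \<open>Local coordinates are the charts of the maximal atlas containing \<open>A\<close>.\<close>

definition local_coordinates :: "'a topology \<Rightarrow> ('a, 'n::finite) chart set \<Rightarrow> ('a, 'n) chart \<Rightarrow> bool" where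
  "local_coordinates M A c \<longleftrightarrow>
     is_chart M c \<and> (\<forall>d\<in>A. smooth_transition c d \<and> smooth_transition d c)"

definition smooth_fun_on :: "'a topology \<Rightarrow> ('a, 'n::finite) chart set \<Rightarrow> 'a set \<Rightarrow> ('a \<Rightarrow> real) \<Rightarrow> bool" where
  "smooth_fun_on M A W a \<longleftrightarrow>
     openin M W \<and> (\<forall>(U, \<phi>)\<in>A. smooth_on (\<phi> ` (U \<inter> W)) (\<lambda>x. a (inv_into U \<phi> x)))"

definition smooth_fun_near :: "'a topology \<Rightarrow> ('a, 'n::finite) chart set \<Rightarrow> 'a \<Rightarrow> ('a \<Rightarrow> real) \<Rightarrow> bool" where
  "smooth_fun_near M A p a \<longleftrightarrow> (\<exists>W. p \<in> W \<and> smooth_fun_on M A W a)"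

section \<open>Tangent vectors and vector fields\<close>

text \<open>Tangent vectors at \<open>p\<close> are derivations of the germs at \<open>p\<close> of smooth functions. They are
  represented as functionals on all functions \<open>'a \<Rightarrow> real\<close>, with value \<open>0\<close> on the functions
  that are not smooth near \<open>p\<close>, so that equality of functionals is equality of tangent vectors.\<close>

type_synonym 'a tvec = "('a \<Rightarrow> real) \<Rightarrow> real"
type_synonym 'a vfield = "'a \<Rightarrow> 'a tvec"

definition tscale :: "real \<Rightarrow> 'a tvec \<Rightarrow> 'a tvec" where
  "tscale c v = (\<lambda>a. c * v a)"

global_interpretation tvec: vector_space tscale
  by unfold_locales (auto simp: tscale_def fun_eq_iff algebra_simps)

definition tangent_space :: "'a topology \<Rightarrow> ('a, 'n::finite) chart set \<Rightarrow> 'a \<Rightarrow> 'a tvec set" where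
  "tangent_space M A p = {v.
     (\<forall>a b. smooth_fun_near M A p a \<and> smooth_fun_near M A p b \<longrightarrow>
        v (\<lambda>x. a x + b x) = v a + v b \<and>
        v (\<lambda>x. a x * b x) = a p * v b + b p * v a) \<and>
     (\<forall>c a. smooth_fun_near M A p a \<longrightarrow> v (\<lambda>x. c * a x) = c * v a) \<and>
     (\<forall>a b. smooth_fun_near M A p a \<and> smooth_fun_near M A p b \<and>
        (\<exists>W. openin M W \<and> p \<in> W \<and> (\<forall>x\<in>W. a x = b x)) \<longrightarrow> v a = v b) \<and>
     (\<forall>a. \<not> smooth_fun_near M A p a \<longrightarrow> v a = 0)}"

text \<open>For a vector field \<open>X\<close>, the function \<open>X a\<close> obtained by differentiating \<open>a\<close> along \<open>X\<close>
  is \<open>\<lambda>p. X p a\<close>.\<close>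

definition smooth_vfield :: "'a topology \<Rightarrow> ('a, 'n::finite) chart set \<Rightarrow> 'a vfield \<Rightarrow> bool" where
  "smooth_vfield M A X \<longleftrightarrow>
     (\<forall>p\<in>topspace M. X p \<in> tangent_space M A p) \<and>
     (\<forall>W a. smooth_fun_on M A W a \<longrightarrow> smooth_fun_on M A W (\<lambda>p. X p a))"

text \<open>The case distinction is needed: \<open>\<lambda>x. Y x a\<close> can be smooth near \<open>p\<close> although \<open>a\<close> is not.\<close>

definition lie_bracket :: "'a topology \<Rightarrow> ('a, 'n::finite) chart set \<Rightarrow> 'a vfield \<Rightarrow> 'a vfield \<Rightarrow> 'a vfield" where
  "lie_bracket M A X Y = (\<lambda>p a. if smooth_fun_near M A p a
     then X p (\<lambda>x. Y x a) - Y p (\<lambda>x. X x a) else 0)"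

definition coordinate_vfield ::
    "'a topology \<Rightarrow> ('a, 'n::finite) chart set \<Rightarrow> ('a, 'n) chart \<Rightarrow> 'n \<Rightarrow> 'a vfield" where
  "coordinate_vfield M A c k = (case c of (U, z) \<Rightarrow> (\<lambda>p a. if smooth_fun_near M A p a
     then frechet_derivative (\<lambda>x. a (inv_into U z x)) (at (z p)) (axis k 1) else 0))"

section \<open>The flag of a family of vector fields\<close>

text \<open>\<open>[\<Delta>\<^sup>s, \<Delta>\<^sup>1]\<close> is the set of finite sums of brackets. It is not necessary to
  multiply these by smooth functions, as \<open>g [X, Y] = [X, g Y] - (X g) Y\<close>.\<close>

fun flag :: "'a topology \<Rightarrow> ('a, 'n::finite) chart set \<Rightarrow> ('m::finite \<Rightarrow> 'a vfield) \<Rightarrow> nat \<Rightarrow> 'a vfield set" where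
  "flag M A f 0 = {0}"
| "flag M A f (Suc 0) =
     {\<lambda>p. \<Sum>i\<in>UNIV. tscale (g i p) (f i p) | g. \<forall>i. smooth_fun_on M A (topspace M) (g i)}"
| "flag M A f (Suc (Suc s)) =
     {X + (\<Sum>j<N. lie_bracket M A (Y j) (Z j)) | X (N::nat) Y Z.
        X \<in> flag M A f (Suc s) \<and>
        (\<forall>j<N. Y j \<in> flag M A f (Suc s) \<and> Z j \<in> flag M A f (Suc 0))}"

definition flag_at ::
    "'a topology \<Rightarrow> ('a, 'n::finite) chart set \<Rightarrow> ('m::finite \<Rightarrow> 'a vfield) \<Rightarrow> nat \<Rightarrow> 'a \<Rightarrow> 'a tvec set" where
  "flag_at M A f s p = (\<lambda>X. X p) ` flag M A f s"

definition flag_dim ::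
    "'a topology \<Rightarrow> ('a, 'n::finite) chart set \<Rightarrow> ('m::finite \<Rightarrow> 'a vfield) \<Rightarrow> nat \<Rightarrow> 'a \<Rightarrow> nat" where
  "flag_dim M A f s p = tvec.dim (flag_at M A f s p)"

definition hormander :: "'a topology \<Rightarrow> ('a, 'n::finite) chart set \<Rightarrow> ('m::finite \<Rightarrow> 'a vfield) \<Rightarrow> bool" where
  "hormander M A f \<longleftrightarrow> (\<forall>p\<in>topspace M. (\<Union>s. flag_at M A f s p) = tangent_space M A p)"

definition equiregular :: "'a topology \<Rightarrow> ('a, 'n::finite) chart set \<Rightarrow> ('m::finite \<Rightarrow> 'a vfield) \<Rightarrow> bool" where
  "equiregular M A f \<longleftrightarrow>
     (\<forall>s. \<forall>p\<in>topspace M. \<forall>p'\<in>topspace M. flag_dim M A f s p = flag_dim M A f s p')"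

text \<open>Meaningful for equiregular families satisfying the Hormander condition.\<close>

definition nonholonomy_degree ::
    "'a topology \<Rightarrow> ('a, 'n::finite) chart set \<Rightarrow> ('m::finite \<Rightarrow> 'a vfield) \<Rightarrow> nat" where
  "nonholonomy_degree M A f =
     (LEAST r. \<forall>p\<in>topspace M. flag_at M A f r p = tangent_space M A p)"

section \<open>Privileged coordinates\<close>

definition weight ::
    "'a topology \<Rightarrow> ('a, 'n::finite) chart set \<Rightarrow> ('m::finite \<Rightarrow> 'a vfield) \<Rightarrow> 'a \<Rightarrow> nat \<Rightarrow> nat" where
  "weight M A f q i =
     (THE s. 1 \<le> s \<and> flag_dim M A f (s - 1) q < i \<and> i \<le> flag_dim M A f s q)"

text \<open>\<open>iterated_derivative f [i\<^sub>1, \<dots>, i\<^sub>s] a\<close> is the function \<open>f\<^bsub>i\<^sub>1\<^esub> \<cdots> f\<^bsub>i\<^sub>s\<^esub> a\<close>.\<close>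

definition iterated_derivative :: "('m \<Rightarrow> 'a vfield) \<Rightarrow> 'm list \<Rightarrow> ('a \<Rightarrow> real) \<Rightarrow> 'a \<Rightarrow> real" where
  "iterated_derivative f is a = foldr (\<lambda>i b p. f i p b) is a"

definition nonholonomic_order :: "('m \<Rightarrow> 'a vfield) \<Rightarrow> 'a \<Rightarrow> ('a \<Rightarrow> real) \<Rightarrow> enat" where
  "nonholonomic_order f q a = Inf {enat (length is) | is. iterated_derivative f is a q \<noteq> 0}"

text \<open>The linear order of the index type numbers the coordinates: \<open>i :: 'n\<close> is the coordinate
  with number \<open>card {..i} \<in> {1..CARD('n)}\<close>.\<close>

definition privileged_coordinates ::
    "'a topology \<Rightarrow> ('a, 'n::{finite,linorder}) chart set \<Rightarrow> ('m::finite \<Rightarrow> 'a vfield) \<Rightarrow> 'a \<Rightarrow>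
       ('a, 'n) chart \<Rightarrow> bool" where
  "privileged_coordinates M A f q c \<longleftrightarrow> (case c of (U, z) \<Rightarrow>
     local_coordinates M A (U, z) \<and> q \<in> U \<and> z q = 0 \<and>
     (\<forall>i. nonholonomic_order f q (\<lambda>p. z p $ i) = enat (weight M A f q (card {..i}))))"

section \<open>Curves and flows\<close>

text \<open>Absolute continuity on \<open>[a, b]\<close>, for finite sequences of non-overlapping subintervals
  \<open>[x\<^sub>i, y\<^sub>i]\<close> listed from left to right.\<close>

definition abs_continuous_on :: "real \<Rightarrow> real \<Rightarrow> (real \<Rightarrow> 'b::metric_space) \<Rightarrow> bool" where
  "abs_continuous_on a b g \<longleftrightarrow>
     (\<forall>e>0. \<exists>d>0. \<forall>(N::nat) x y.
        (\<forall>i<N. a \<le> x i \<and> x i \<le> y i \<and> y i \<le> b) \<and>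
        (\<forall>i. Suc i < N \<longrightarrow> y i \<le> x (Suc i)) \<and>
        (\<Sum>i<N. y i - x i) < d \<longrightarrow>
        (\<Sum>i<N. dist (g (x i)) (g (y i))) < e)"

definition abs_continuous_curve ::
    "'a topology \<Rightarrow> ('a, 'n::finite) chart set \<Rightarrow> real \<Rightarrow> (real \<Rightarrow> 'a) \<Rightarrow> bool" where
  "abs_continuous_curve M A T \<gamma> \<longleftrightarrow>
     continuous_map (top_of_set {0..T}) M \<gamma> \<and>
     (\<forall>(U, \<phi>)\<in>A. \<forall>a b. 0 \<le> a \<and> a \<le> b \<and> b \<le> T \<and> \<gamma> ` {a..b} \<subseteq> U \<longrightarrow>
        abs_continuous_on a b (\<lambda>t. \<phi> (\<gamma> t)))"

definition has_velocity ::
    "'a topology \<Rightarrow> ('a, 'n::finite) chart set \<Rightarrow> (real \<Rightarrow> 'a) \<Rightarrow> 'a tvec \<Rightarrow> real \<Rightarrow> real set \<Rightarrow> bool" where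
  "has_velocity M A \<gamma> v t S \<longleftrightarrow>
     (\<forall>a. smooth_fun_near M A (\<gamma> t) a \<longrightarrow>
        ((\<lambda>\<tau>. a (\<gamma> \<tau>)) has_real_derivative v a) (at t within S))"

definition integral_curve ::
    "'a topology \<Rightarrow> ('a, 'n::finite) chart set \<Rightarrow> 'a vfield \<Rightarrow> 'a \<Rightarrow> real \<Rightarrow> (real \<Rightarrow> 'a) \<Rightarrow> bool" where
  "integral_curve M A X q t \<gamma> \<longleftrightarrow>
     continuous_map (top_of_set (closed_segment 0 t)) M \<gamma> \<and> \<gamma> 0 = q \<and>
     (\<forall>\<tau>\<in>closed_segment 0 t. has_velocity M A \<gamma> (X (\<gamma> \<tau>)) \<tau> (closed_segment 0 t))"

definition flow_defined ::
    "'a topology \<Rightarrow> ('a, 'n::finite) chart set \<Rightarrow> 'a vfield \<Rightarrow> real \<Rightarrow> 'a \<Rightarrow> bool" where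
  "flow_defined M A X t q \<longleftrightarrow> (\<exists>\<gamma>. integral_curve M A X q t \<gamma>)"

definition flow :: "'a topology \<Rightarrow> ('a, 'n::finite) chart set \<Rightarrow> 'a vfield \<Rightarrow> real \<Rightarrow> 'a \<Rightarrow> 'a" where
  "flow M A X t q = (THE p. \<exists>\<gamma>. integral_curve M A X q t \<gamma> \<and> p = \<gamma> t)"

section \<open>The control-affine system\<close>

definition is_control ::
    "'a topology \<Rightarrow> ('a, 'n::finite) chart set \<Rightarrow> 'a vfield \<Rightarrow> ('m::finite \<Rightarrow> 'a vfield) \<Rightarrow>
       real \<Rightarrow> (real \<Rightarrow> 'a) \<Rightarrow> (real \<Rightarrow> real ^ 'm) \<Rightarrow> bool" where
  "is_control M A f0 f T \<gamma> u \<longleftrightarrow>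
     set_integrable lebesgue {0..T} u \<and>
     (AE t\<in>{0..T} in lebesgue.
        has_velocity M A \<gamma> (f0 (\<gamma> t) + (\<Sum>i\<in>UNIV. tscale (u t $ i) (f i (\<gamma> t)))) t {0..T})"

definition admissible ::
    "'a topology \<Rightarrow> ('a, 'n::finite) chart set \<Rightarrow> 'a vfield \<Rightarrow> ('m::finite \<Rightarrow> 'a vfield) \<Rightarrow>
       real \<Rightarrow> (real \<Rightarrow> 'a) \<Rightarrow> bool" where
  "admissible M A f0 f T \<gamma> \<longleftrightarrow>
     abs_continuous_curve M A T \<gamma> \<and> (\<exists>u. is_control M A f0 f T \<gamma> u)"

text \<open>The infimum is attained, by the control whose value at almost every time has minimal norm.\<close>

definition cost ::
    "'a topology \<Rightarrow> ('a, 'n::finite) chart set \<Rightarrow> 'a vfield \<Rightarrow> ('m::finite \<Rightarrow> 'a vfield) \<Rightarrow>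
       real \<Rightarrow> (real \<Rightarrow> 'a) \<Rightarrow> ereal" where
  "cost M A f0 f T \<gamma> =
     Inf {ereal (LINT t:{0..T}|lebesgue. norm (u t)) | u. is_control M A f0 f T \<gamma> u}"

definition value_function ::
    "'a topology \<Rightarrow> ('a, 'n::finite) chart set \<Rightarrow> 'a vfield \<Rightarrow> ('m::finite \<Rightarrow> 'a vfield) \<Rightarrow>
       real \<Rightarrow> 'a \<Rightarrow> 'a \<Rightarrow> ereal" where
  "value_function M A f0 f T q q' =
     Inf {cost M A f0 f T' \<gamma> | T' \<gamma>.
        0 \<le> T' \<and> T' \<le> T \<and> admissible M A f0 f T' \<gamma> \<and> \<gamma> 0 = q \<and> \<gamma> T' = q'}"

end

theory Submission
  imports Defs
begin

text \<open>In the given chart the drift is \<open>\<partial>\<^sub>k\<close>, so the endpoint of a curve with control \<open>u\<close> that takes time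
  \<open>t\<close> differs from \<open>t e\<^sub>k = z(e\<^bsup>t f0\<^esup> q)\<close> by at most \<open>C \<integral>|u|\<close>. This keeps curves of small time and cost
  inside the chart and gives the lower bound.

  For the upper bound, drift at no cost almost to the point \<open>p = t e\<^sub>k\<close> nearest to \<open>z(q')\<close>, and spend an
  arbitrarily short remaining time on steering to \<open>z(q')\<close> with large controls. A composite of flows of
  the fields \<open>\<plusminus>f\<^sub>i\<close>, each for time \<open>\<tau>\<close>, acts on functions by a product of exponentials in noncommuting
  variables, up to any order in \<open>\<tau>\<close>; so a commutator path of a bracket \<open>f\<^sub>I\<close> of length \<open>l\<close> moves points
  by \<open>\<tau>\<^sup>l f\<^sub>I + O(\<tau>\<^bsup>l+1\<^esup>)\<close>. The brackets of length at most \<open>r\<close> span at \<open>q\<close>; concatenating their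
  paths with \<open>\<tau>\<close> the \<open>l\<close>-th root of a coefficient linear in \<open>w \<in> \<real>\<^sup>n\<close> yields an end-point map
  \<open>p + w + o(|w|)\<close> whose cost is \<open>O(|w|\<^bsup>1/r\<^esup>)\<close>. In a short time the drift changes this map as little as we
  please, and Brouwer's theorem shows that \<open>z(q')\<close> is still attained.\<close>

section \<open>Smooth functions\<close>

text \<open>Cost is unchanged when a control is run faster: \<open>\<theta> / \<eta>\<close> held
  for time \<eta> costs \<open>\<bar>\<theta>\<bar>\<close> whatever \<eta> is, while the drift
  contributes only \<eta> times a unit vector. The time spent on steering can therefore be chosen
  after the target, small compared with its distance from the drift segment. Three obstacles shape
  the estimates. The parameters enter through l-th roots, so the end-point map is continuous with a
  first-order expansion at w = 0 only; this is why a topological fixed point theorem is used. The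
  nearest point p moves along the segment, while the brackets are solved for the coordinate
  directions at q alone; the coefficients are frozen at q and all bounds are uniform in p close to
  q. And the lower bound concerns every absolutely continuous curve on M, which might leave the
  chart, has a velocity only almost everywhere, and is known to be absolutely continuous only in the
  charts of the atlas. The exponent 1/r comes from the longest brackets: a coefficient s \<le> 1 of
  a bracket of length l \<le> r costs a multiple of the l-th root of s, which is at most its r-th
  root.\<close>

lemma Ck_on_cong:
  assumes "open S" "\<And>x. x \<in> S \<Longrightarrow> g x = h x"
  shows "Ck_on k S g \<longleftrightarrow> Ck_on k S h"
  using assms
proof (induction k arbitrary: g h)
  case 0
  then show ?case using continuous_on_cong[of S S g h] by simp
next
  case (Suc k)
  have der: "(g has_derivative D) (at x) \<longleftrightarrow> (h has_derivative D) (at x)" if "x \<in> S" for x D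
  proof
    assume "(g has_derivative D) (at x)"
    then show "(h has_derivative D) (at x)"
      by (rule has_derivative_transform_within_open[OF _ Suc.prems(1) that Suc.prems(2)])
  next
    assume "(h has_derivative D) (at x)"
    then show "(g has_derivative D) (at x)"
      by (rule has_derivative_transform_within_open[OF _ Suc.prems(1) that Suc.prems(2)[symmetric]])
  qed
  have "frechet_derivative g (at x) = frechet_derivative h (at x)" if "x \<in> S" for x
    unfolding frechet_derivative_def using der[OF that] by simp
  moreover have "g differentiable at x \<longleftrightarrow> h differentiable at x" if "x \<in> S" for x
    unfolding differentiable_def using der[OF that] by simp
  ultimately show ?case
    using Suc.IH[OF Suc.prems(1), of "\<lambda>x. frechet_derivative g (at x) v"
        "\<lambda>x. frechet_derivative h (at x) v" for v] by simp
qed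

lemma Ck_on_subset: "Ck_on k S g \<Longrightarrow> T \<subseteq> S \<Longrightarrow> Ck_on k T g"
  by (induction k arbitrary: g) (auto intro: continuous_on_subset)

lemma Ck_on_Suc_imp: "Ck_on (Suc k) S g \<Longrightarrow> Ck_on k S g"
proof (induction k arbitrary: g)
  case 0
  then show ?case
    by (auto intro!: continuous_at_imp_continuous_on differentiable_imp_continuous_within)
qed auto

lemma Ck_on_open_cover:
  assumes "\<And>x. x \<in> S \<Longrightarrow> \<exists>T. open T \<and> x \<in> T \<and> Ck_on k T g"
  shows "Ck_on k S g"
  using assms
proof (induction k arbitrary: g)
  case 0
  then show ?case
    by (fastforce intro!: continuous_at_imp_continuous_on simp: continuous_on_eq_continuous_at)
next
  case (Suc k)
  have "g differentiable at x" if "x \<in> S" for x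
    using Suc.prems[OF that] by auto
  moreover have "Ck_on k S (\<lambda>x. frechet_derivative g (at x) v)" for v
    by (rule Suc.IH) (use Suc.prems in fastforce)
  ultimately show ?case by simp
qed

lemma Ck_on_const: "Ck_on k S (\<lambda>x. c)"
  by (induction k arbitrary: c) (auto simp: frechet_derivative_const)

lemma frechet_derivative_eqI:
  "(g has_derivative D) (at x) \<Longrightarrow> frechet_derivative g (at x) = D"
  by (rule frechet_derivative_at[symmetric])

lemma has_derivative_frechet:
  "g differentiable (at x) \<Longrightarrow> (g has_derivative frechet_derivative g (at x)) (at x)"
  by (simp add: frechet_derivative_works)

lemma Ck_on_add:
  assumes "open S" "Ck_on k S g" "Ck_on k S h"
  shows "Ck_on k S (\<lambda>x. g x + h x)"
  using assms(2,3)
proof (induction k arbitrary: g h)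
  case 0
  then show ?case by (simp add: continuous_on_add)
next
  case (Suc k)
  have D: "((\<lambda>x. g x + h x) has_derivative
      (\<lambda>v. frechet_derivative g (at x) v + frechet_derivative h (at x) v)) (at x)" if "x \<in> S" for x
    using Suc.prems that by (auto intro!: has_derivative_add has_derivative_frechet)
  have "Ck_on k S (\<lambda>x. frechet_derivative (\<lambda>x. g x + h x) (at x) v)" for v
  proof -
    have "Ck_on k S (\<lambda>x. frechet_derivative g (at x) v + frechet_derivative h (at x) v)"
      using Suc by auto
    then show ?thesis
      by (subst Ck_on_cong[OF assms(1)]) (auto simp: frechet_derivative_eqI[OF D])
  qed
  with D show ?case by (auto simp: differentiable_def)
qed

lemma Ck_on_bilinear:
  assumes "open S" "bounded_bilinear B" "Ck_on k S g" "Ck_on k S h"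
  shows "Ck_on k S (\<lambda>x. B (g x) (h x))"
  using assms(3,4)
proof (induction k arbitrary: g h)
  case 0
  then show ?case by (simp add: bounded_bilinear.continuous_on[OF assms(2)])
next
  case (Suc k)
  have D: "((\<lambda>x. B (g x) (h x)) has_derivative
      (\<lambda>v. B (g x) (frechet_derivative h (at x) v) + B (frechet_derivative g (at x) v) (h x))) (at x)"
    if "x \<in> S" for x
    using Suc.prems that
    by (auto intro!: bounded_bilinear.FDERIV[OF assms(2)] has_derivative_frechet)
  have "Ck_on k S (\<lambda>x. frechet_derivative (\<lambda>x. B (g x) (h x)) (at x) v)" for v
  proof -
    have "Ck_on k S (\<lambda>x. B (g x) (frechet_derivative h (at x) v) + B (frechet_derivative g (at x) v) (h x))"
      using Suc.prems Suc.IH Ck_on_Suc_imp[OF Suc.prems(1)] Ck_on_Suc_imp[OF Suc.prems(2)]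
      by (intro Ck_on_add[OF assms(1)]) auto
    then show ?thesis
      by (subst Ck_on_cong[OF assms(1)]) (auto simp: frechet_derivative_eqI[OF D])
  qed
  with D show ?case by (auto simp: differentiable_def)
qed

lemma Ck_on_sum:
  assumes "open S" "finite I" "\<And>i. i \<in> I \<Longrightarrow> Ck_on k S (g i)"
  shows "Ck_on k S (\<lambda>x. \<Sum>i\<in>I. g i x)"
  using assms(2,3) by (induction I) (auto intro!: Ck_on_add Ck_on_const assms(1))

lemma Ck_on_bounded_linear:
  assumes "open S" "bounded_linear l" "Ck_on k S g"
  shows "Ck_on k S (\<lambda>x. l (g x))"
  using assms(3)
proof (induction k arbitrary: g)
  case 0
  then show ?case by (simp add: bounded_linear.continuous_on[OF assms(2)])
next
  case (Suc k)
  have D: "((\<lambda>x. l (g x)) has_derivative (\<lambda>v. l (frechet_derivative g (at x) v))) (at x)"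
    if "x \<in> S" for x
    using Suc.prems that by (auto intro!: bounded_linear.has_derivative[OF assms(2)] has_derivative_frechet)
  have "Ck_on k S (\<lambda>x. frechet_derivative (\<lambda>x. l (g x)) (at x) v)" for v
  proof -
    have "Ck_on k S (\<lambda>x. l (frechet_derivative g (at x) v))"
      using Suc.prems Suc.IH by auto
    then show ?thesis
      by (subst Ck_on_cong[OF assms(1)]) (auto simp: frechet_derivative_eqI[OF D])
  qed
  with D show ?case by (auto simp: differentiable_def)
qed

text \<open>\<open>Ck_on\<close> differentiates in a fixed direction. In the chain rule and in
  derivatives along a vector field the direction depends on the point; expanding it in the basis
  reduces these to sums of products of derivatives in fixed directions.\<close>

lemma frechet_derivative_basis_sum:
  fixes g :: "'a::euclidean_space \<Rightarrow> 'b::real_normed_vector"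
  assumes "g differentiable (at x)"
  shows "frechet_derivative g (at x) v = (\<Sum>b\<in>Basis. (v \<bullet> b) *\<^sub>R frechet_derivative g (at x) b)"
proof -
  have l: "linear (frechet_derivative g (at x))"
    by (rule linear_frechet_derivative[OF assms])
  show ?thesis
    by (subst (1) euclidean_representation[of v, symmetric])
      (simp only: linear_sum[OF l] linear_scale[OF l] o_def)
qed

text \<open>Induction on k for all outer functions g at once: the derivative of the composite is a
  sum of components of the derivative of h times derivatives of g in basis directions, again
  composed with h.\<close>

lemma Ck_on_compose:
  fixes h :: "'a::euclidean_space \<Rightarrow> 'b::euclidean_space"
    and g :: "'b \<Rightarrow> 'c::real_normed_vector"
  assumes "open S" "open T" "h ` S \<subseteq> T" "Ck_on k S h" "Ck_on k T g"
  shows "Ck_on k S (\<lambda>x. g (h x))"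
  using assms(4,5)
proof (induction k arbitrary: g)
  case 0
  then show ?case using assms(3) by (auto intro: continuous_on_compose2)
next
  case (Suc k)
  have D: "((\<lambda>x. g (h x)) has_derivative
      (\<lambda>v. frechet_derivative g (at (h x)) (frechet_derivative h (at x) v))) (at x)" if "x \<in> S" for x
    using Suc.prems that assms(3)
    by (intro has_derivative_compose[of h _ x UNIV g, simplified] has_derivative_frechet) auto
  have "Ck_on k S (\<lambda>x. frechet_derivative (\<lambda>x. g (h x)) (at x) v)" for v
  proof -
    have "Ck_on k S (\<lambda>x. \<Sum>b\<in>Basis. (frechet_derivative h (at x) v \<bullet> b) *\<^sub>R frechet_derivative g (at (h x)) b)"
      using Suc.prems Ck_on_Suc_imp[OF Suc.prems(1)]
      by (intro Ck_on_sum assms(1) Ck_on_bilinear[OF assms(1) bounded_bilinear_scaleR] Suc.IH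
          Ck_on_bounded_linear[OF assms(1) bounded_linear_inner_left]) auto
    moreover have "frechet_derivative (\<lambda>x. g (h x)) (at x) v =
        (\<Sum>b\<in>Basis. (frechet_derivative h (at x) v \<bullet> b) *\<^sub>R frechet_derivative g (at (h x)) b)"
      if "x \<in> S" for x
      using frechet_derivative_basis_sum[of g "h x" "frechet_derivative h (at x) v"]
        frechet_derivative_eqI[OF D[OF that]] that assms(3) Suc.prems(2) by auto
    ultimately show ?thesis
      by (subst Ck_on_cong[OF assms(1)]) auto
  qed
  with D show ?case by (auto simp: differentiable_def)
qed

lemma smooth_on_cong:
  assumes "open S" "\<And>x. x \<in> S \<Longrightarrow> g x = h x"
  shows "smooth_on S g \<longleftrightarrow> smooth_on S h"
  unfolding smooth_on_def using Ck_on_cong[OF assms] by simp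

lemma smooth_on_transform:
  "open S \<Longrightarrow> smooth_on S g \<Longrightarrow> (\<And>x. x \<in> S \<Longrightarrow> g x = h x) \<Longrightarrow> smooth_on S h"
  by (metis smooth_on_cong)

lemma smooth_on_subset: "smooth_on S g \<Longrightarrow> T \<subseteq> S \<Longrightarrow> smooth_on T g"
  unfolding smooth_on_def using Ck_on_subset by blast

lemma smooth_on_open_cover:
  "(\<And>x. x \<in> S \<Longrightarrow> \<exists>T. open T \<and> x \<in> T \<and> smooth_on T g) \<Longrightarrow> smooth_on S g"
  unfolding smooth_on_def using Ck_on_open_cover by metis

lemma smooth_on_const [simp]: "smooth_on S (\<lambda>x. c)"
  by (simp add: smooth_on_def Ck_on_const)

lemma smooth_on_add:
  "open S \<Longrightarrow> smooth_on S g \<Longrightarrow> smooth_on S h \<Longrightarrow> smooth_on S (\<lambda>x. g x + h x)"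
  by (simp add: smooth_on_def Ck_on_add)

lemma smooth_on_scaleR:
  "open S \<Longrightarrow> smooth_on S g \<Longrightarrow> smooth_on S h \<Longrightarrow> smooth_on S (\<lambda>x. g x *\<^sub>R h x)"
  by (simp add: smooth_on_def Ck_on_bilinear[OF _ bounded_bilinear_scaleR])

lemma smooth_on_mult:
  fixes g h :: "_ \<Rightarrow> real"
  shows "open S \<Longrightarrow> smooth_on S g \<Longrightarrow> smooth_on S h \<Longrightarrow> smooth_on S (\<lambda>x. g x * h x)"
  using smooth_on_scaleR[of S g h] by simp

lemma smooth_on_sum:
  "open S \<Longrightarrow> finite I \<Longrightarrow> (\<And>i. i \<in> I \<Longrightarrow> smooth_on S (g i)) \<Longrightarrow> smooth_on S (\<lambda>x. \<Sum>i\<in>I. g i x)"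
  by (simp add: smooth_on_def Ck_on_sum)

lemma smooth_on_bounded_linear:
  "open S \<Longrightarrow> bounded_linear l \<Longrightarrow> smooth_on S g \<Longrightarrow> smooth_on S (\<lambda>x. l (g x))"
  by (simp add: smooth_on_def Ck_on_bounded_linear)

lemma smooth_on_id: "smooth_on S (\<lambda>x::'a::real_normed_vector. x)"
  unfolding smooth_on_def
proof
  fix k show "Ck_on k S (\<lambda>x. x)"
  proof (cases k)
    case (Suc l)
    have "frechet_derivative (\<lambda>x::'a. x) (at y) = (\<lambda>v. v)" for y
      by (rule frechet_derivative_eqI[OF has_derivative_ident])
    then show ?thesis using Suc by (simp add: Ck_on_const)
  qed (simp add: continuous_on_id)
qed

lemma smooth_on_compose:
  fixes h :: "'a::euclidean_space \<Rightarrow> 'b::euclidean_space"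
  assumes "open S" "open T" "h ` S \<subseteq> T" "smooth_on S h" "smooth_on T g"
  shows "smooth_on S (\<lambda>x. g (h x))"
  unfolding smooth_on_def
proof
  fix k show "Ck_on k S (\<lambda>x. g (h x))"
    by (rule Ck_on_compose[OF assms(1-3)]) (use assms(4,5) in \<open>simp_all add: smooth_on_def\<close>)
qed

lemma smooth_on_differentiable: "smooth_on S g \<Longrightarrow> x \<in> S \<Longrightarrow> g differentiable (at x)"
  unfolding smooth_on_def by (drule spec[of _ "Suc 0"]) simp

lemma smooth_on_has_derivative:
  "smooth_on S g \<Longrightarrow> x \<in> S \<Longrightarrow> (g has_derivative frechet_derivative g (at x)) (at x)"
  by (simp add: smooth_on_differentiable has_derivative_frechet)

lemma smooth_on_continuous: "smooth_on S g \<Longrightarrow> continuous_on S g"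
  unfolding smooth_on_def by (drule spec[of _ 0]) simp

lemma smooth_on_frechet_derivative:
  assumes "smooth_on S g"
  shows "smooth_on S (\<lambda>x. frechet_derivative g (at x) v)"
  unfolding smooth_on_def
proof
  fix k show "Ck_on k S (\<lambda>x. frechet_derivative g (at x) v)"
    using assms[unfolded smooth_on_def, rule_format, of "Suc k"] by simp
qed

lemma smooth_on_frechet_derivative_field:
  fixes g :: "'a::euclidean_space \<Rightarrow> 'b::real_normed_vector"
  assumes "open S" "smooth_on S g" "smooth_on S X"
  shows "smooth_on S (\<lambda>x. frechet_derivative g (at x) (X x))"
proof -
  have "smooth_on S (\<lambda>x. \<Sum>b\<in>Basis. (X x \<bullet> b) *\<^sub>R frechet_derivative g (at x) b)"
    by (rule smooth_on_sum[OF assms(1) finite_Basis],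
        rule smooth_on_scaleR[OF assms(1) _ smooth_on_frechet_derivative[OF assms(2)]],
        rule smooth_on_bounded_linear[OF assms(1) bounded_linear_inner_left assms(3)])
  then show ?thesis
    by (subst smooth_on_cong[OF assms(1)])
      (rule frechet_derivative_basis_sum[OF smooth_on_differentiable[OF assms(2)]])
qed

lemma smooth_on_vec_iff:
  fixes g :: "'a::euclidean_space \<Rightarrow> real ^ 'n::finite"
  assumes "open S"
  shows "smooth_on S g \<longleftrightarrow> (\<forall>i. smooth_on S (\<lambda>x. g x $ i))"
proof
  assume "\<forall>i. smooth_on S (\<lambda>x. g x $ i)"
  then have "smooth_on S (\<lambda>x. \<Sum>i\<in>UNIV. (g x $ i) *\<^sub>R (axis i 1 :: real ^ 'n))"
    by (intro smooth_on_sum[OF assms finite] smooth_on_scaleR[OF assms _ smooth_on_const]) simp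
  moreover have "(\<lambda>x. \<Sum>i\<in>UNIV. (g x $ i) *\<^sub>R (axis i 1 :: real ^ 'n)) = g"
    using basis_expansion[of "g _"] by (simp add: scalar_mult_eq_scaleR)
  ultimately show "smooth_on S g" by simp
qed (simp add: smooth_on_bounded_linear[OF assms bounded_linear_vec_nth])

text \<open>The derivatives in the basis directions are bounded on the compact set, the sum of these
  bounds dominates the operator norm, and convexity allows the mean value inequality.\<close>

lemma smooth_on_lipschitz:
  fixes g :: "'a::euclidean_space \<Rightarrow> 'b::euclidean_space"
  assumes "open S" "smooth_on S g" "compact K" "convex K" "K \<subseteq> S"
  shows "\<exists>L\<ge>0. \<forall>x\<in>K. \<forall>y\<in>K. norm (g x - g y) \<le> L * norm (x - y)"
proof -
  have "\<exists>C. \<forall>x\<in>K. norm (frechet_derivative g (at x) b) \<le> C" for b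
  proof -
    have "continuous_on K (\<lambda>x. frechet_derivative g (at x) b)"
      using smooth_on_continuous[OF smooth_on_frechet_derivative[OF assms(2)]] assms(5)
      by (rule continuous_on_subset)
    from compact_imp_bounded[OF compact_continuous_image[OF this assms(3)]]
    show ?thesis by (auto simp: bounded_iff)
  qed
  then obtain C where C: "\<And>b x. x \<in> K \<Longrightarrow> norm (frechet_derivative g (at x) b) \<le> C b" by metis
  define L where "L = (\<Sum>b\<in>Basis. \<bar>C b\<bar>)"
  have L0: "L \<ge> 0" unfolding L_def by (simp add: sum_nonneg)
  have D: "norm (frechet_derivative g (at x) v) \<le> L * norm v" if x: "x \<in> K" for x v
  proof -
    have "frechet_derivative g (at x) v = (\<Sum>b\<in>Basis. (v \<bullet> b) *\<^sub>R frechet_derivative g (at x) b)"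
      using x assms(5) by (intro frechet_derivative_basis_sum smooth_on_differentiable[OF assms(2)]) auto
    also have "norm \<dots> \<le> (\<Sum>b\<in>Basis. norm v * \<bar>C b\<bar>)"
    proof (rule order_trans[OF norm_sum sum_mono])
      fix b :: 'a assume b: "b \<in> Basis"
      show "norm ((v \<bullet> b) *\<^sub>R frechet_derivative g (at x) b) \<le> norm v * \<bar>C b\<bar>"
        using C[OF x, of b] Basis_le_norm[OF b, of v]
        by (simp, intro mult_mono) auto
    qed
    finally show ?thesis unfolding L_def by (simp add: sum_distrib_left mult.commute)
  qed
  show ?thesis
  proof (intro exI conjI ballI)
    fix x y assume xy: "x \<in> K" "y \<in> K"
    show "norm (g x - g y) \<le> L * norm (x - y)"
    proof (rule differentiable_bound[OF assms(4), of g "\<lambda>x. frechet_derivative g (at x)"])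
      show "(g has_derivative frechet_derivative g (at x)) (at x within K)" if "x \<in> K" for x
        using smooth_on_has_derivative[OF assms(2)] that assms(5) has_derivative_at_withinI by blast
      show "onorm (frechet_derivative g (at x)) \<le> L" if "x \<in> K" for x
        using D[OF that] by (intro onorm_le) auto
    qed (use xy in auto)
  qed (rule L0)
qed

section \<open>Hadamard's lemma\<close>

lemma ray_in_ball:
  fixes c x :: "'a::real_normed_vector"
  assumes "x \<in> ball c e" "0 \<le> t" "t \<le> 1"
  shows "c + t *\<^sub>R (x - c) \<in> ball c e"
proof -
  have "norm (t *\<^sub>R (x - c)) \<le> norm (x - c)"
    using assms(2,3) by (simp add: mult_left_le_one_le)
  then show ?thesis using assms(1) by (simp add: dist_norm norm_minus_commute)
qed

text \<open>Differentiation under the integral sign replaces h by a directional derivative and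
  produces a further factor t, the derivative of the ray with respect to x. The family with all
  weights \<open>t ^ m\<close> is thus closed under differentiation, which makes the induction on k
  work; only m = 0 is wanted later.\<close>

lemma Ck_on_ray_integral:
  fixes h :: "'a::euclidean_space \<Rightarrow> real"
  assumes "smooth_on (ball c e) h"
  shows "Ck_on k (ball c e) (\<lambda>x. integral {0..1} (\<lambda>t. t ^ m * h (c + t *\<^sub>R (x - c))))"
  using assms
proof (induction k arbitrary: m h)
  case 0
  have "continuous_on (ball c e \<times> cbox 0 1) (\<lambda>(x, t). t ^ m * h (c + t *\<^sub>R (x - c)))"
    unfolding split_beta
    by (intro continuous_intros continuous_on_compose2[OF smooth_on_continuous[OF 0]])
      (auto simp del: mem_ball intro!: ray_in_ball)
  from integral_continuous_on_param[OF this] show ?case by simp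
next
  case (Suc k)
  define D where "D x t = frechet_derivative h (at (c + t *\<^sub>R (x - c)))" for x t
  define fx where "fx x t = Blinfun (\<lambda>v. t ^ Suc m * D x t v)" for x t
  have hd: "(h has_derivative D x t) (at (c + t *\<^sub>R (x - c)))"
    if "x \<in> ball c e" "t \<in> {0..1}" for x t
    unfolding D_def using that by (intro smooth_on_has_derivative[OF Suc.prems] ray_in_ball) auto
  have bl: "bounded_linear (\<lambda>v. t ^ Suc m * D x t v)" if "x \<in> ball c e" "t \<in> {0..1}" for x t
    by (intro bounded_linear_const_mult has_derivative_bounded_linear[OF hd[OF that]])
  have fx: "blinfun_apply (fx x t) = (\<lambda>v. t ^ Suc m * D x t v)" if "x \<in> ball c e" "t \<in> {0..1}" for x t
    unfolding fx_def by (rule bounded_linear_Blinfun_apply[OF bl[OF that]])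
  have ray: "((\<lambda>x. c + t *\<^sub>R (x - c)) has_derivative (\<lambda>v. t *\<^sub>R v)) (at x within S)" for t x S
    by (auto intro!: derivative_eq_intros)
  have der: "((\<lambda>x. t ^ m * h (c + t *\<^sub>R (x - c))) has_derivative blinfun_apply (fx x t)) (at x within ball c e)"
    if xt: "x \<in> ball c e" "t \<in> cbox 0 1" for x t
  proof -
    have "((\<lambda>x. h (c + t *\<^sub>R (x - c))) has_derivative (\<lambda>v. D x t (t *\<^sub>R v))) (at x within ball c e)"
      using has_derivative_compose[OF ray hd[of x t]] xt by simp
    then have "((\<lambda>x. t ^ m * h (c + t *\<^sub>R (x - c))) has_derivative (\<lambda>v. t ^ m * D x t (t *\<^sub>R v))) (at x within ball c e)"
      by (rule has_derivative_mult_right)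
    moreover have "D x t (t *\<^sub>R v) = t * D x t v" for v
      using linear_scale[OF has_derivative_linear[OF hd[of x t]], of t v] xt by simp
    ultimately show ?thesis using fx[of x t] xt by (simp add: mult.assoc mult.left_commute)
  qed
  have cont: "continuous_on (ball c e \<times> cbox 0 1) (\<lambda>(x, t). t ^ j * g (c + t *\<^sub>R (x - c)))"
    if "smooth_on (ball c e) g" for g :: "'a \<Rightarrow> real" and j
    unfolding split_beta
    by (intro continuous_intros continuous_on_compose2[OF smooth_on_continuous[OF that]])
      (auto simp del: mem_ball intro!: ray_in_ball)
  have cfx: "continuous_on (ball c e \<times> cbox 0 1) (\<lambda>(x, t). fx x t)"
  proof (rule continuous_on_blinfun_componentwise)
    fix i :: 'a
    have "continuous_on (ball c e \<times> cbox 0 1) (\<lambda>(x, t). t ^ Suc m * D x t i)"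
      unfolding D_def by (rule cont[OF smooth_on_frechet_derivative[OF Suc.prems]])
    then show "continuous_on (ball c e \<times> cbox 0 1) (\<lambda>p. blinfun_apply (case p of (x, t) \<Rightarrow> fx x t) i)"
      by (rule continuous_on_cong[THEN iffD1, rotated 2]) (auto simp: fx)
  qed
  have sect: "continuous_on (cbox 0 1) (G x)"
    if "continuous_on (ball c e \<times> cbox 0 1) (\<lambda>(x, t). G x t)" "x \<in> ball c e"
    for G :: "'a \<Rightarrow> real \<Rightarrow> 'z::real_normed_vector" and x
  proof -
    have "continuous_on (cbox 0 1) ((\<lambda>(x, t). G x t) \<circ> (\<lambda>t. (x, t)))"
      by (rule continuous_on_compose[OF _ continuous_on_subset[OF that(1)]])
        (use that(2) in \<open>auto intro!: continuous_intros\<close>)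
    then show ?thesis by (simp add: o_def)
  qed
  have int: "(\<lambda>t. t ^ m * h (c + t *\<^sub>R (x - c))) integrable_on cbox 0 1" if "x \<in> ball c e" for x
    using sect[OF cont[OF Suc.prems] that] by (simp add: integrable_continuous_real)
  have F: "((\<lambda>x. integral {0..1} (\<lambda>t. t ^ m * h (c + t *\<^sub>R (x - c)))) has_derivative
      (\<lambda>v. integral {0..1} (\<lambda>t. t ^ Suc m * D x t v))) (at x)" if x: "x \<in> ball c e" for x
  proof -
    have "((\<lambda>x. integral (cbox 0 1) (\<lambda>t. t ^ m * h (c + t *\<^sub>R (x - c)))) has_derivative
       blinfun_apply (integral (cbox 0 1) (fx x))) (at x within ball c e)"
      by (rule leibniz_rule[where f="\<lambda>x t. t ^ m * h (c + t *\<^sub>R (x - c))" and fx=fx,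
            OF _ _ cfx x convex_ball]) (rule der int; assumption)+
    then have L: "((\<lambda>x. integral {0..1} (\<lambda>t. t ^ m * h (c + t *\<^sub>R (x - c)))) has_derivative
       blinfun_apply (integral {0..1} (fx x))) (at x)"
      unfolding at_within_open[OF x open_ball] box_real(2) .
    have "fx x integrable_on {0..1}"
      using sect[OF cfx x] by (simp add: integrable_continuous_real)
    from blinfun_apply_integral[OF this]
    have "blinfun_apply (integral {0..1} (fx x)) v = integral {0..1} (\<lambda>t. t ^ Suc m * D x t v)" for v
      by (simp, intro integral_cong) (use fx[OF x] in auto)
    then have "blinfun_apply (integral {0..1} (fx x)) = (\<lambda>v. integral {0..1} (\<lambda>t. t ^ Suc m * D x t v))"
      by auto
    with L show ?thesis by simp
  qed
  have "Ck_on k (ball c e) (\<lambda>x. frechet_derivative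
      (\<lambda>x. integral {0..1} (\<lambda>t. t ^ m * h (c + t *\<^sub>R (x - c)))) (at x) v)" for v
    using Suc.IH[OF smooth_on_frechet_derivative[OF Suc.prems, of v], of "Suc m"]
    by (subst Ck_on_cong[OF open_ball]) (auto simp: frechet_derivative_eqI[OF F] D_def)
  moreover have "(\<lambda>x. integral {0..1} (\<lambda>t. t ^ m * h (c + t *\<^sub>R (x - c)))) differentiable (at x)"
    if "x \<in> ball c e" for x
    using F[OF that] by (auto simp: differentiable_def)
  ultimately show ?case unfolding Ck_on.simps by blast
qed

text \<open>The functions \<open>g i\<close> are averages of the partial derivatives over the
  segment from c to x; the fundamental theorem of calculus along that segment gives the identity. It
  is the reason why a derivation of germs depends on first derivatives only.\<close>

lemma hadamard:
  fixes b :: "'a::euclidean_space \<Rightarrow> real"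
  assumes b: "smooth_on (ball c e) b"
  obtains g where "\<And>i. smooth_on (ball c e) (g i)"
    "\<And>x. x \<in> ball c e \<Longrightarrow> b x = b c + (\<Sum>i\<in>Basis. ((x - c) \<bullet> i) * g i x)"
    "\<And>i. g i c = frechet_derivative b (at c) i"
proof
  define g where "g i x = integral {0..1} (\<lambda>t. frechet_derivative b (at (c + t *\<^sub>R (x - c))) i)" for i x
  show "smooth_on (ball c e) (g i)" for i
    using Ck_on_ray_integral[OF smooth_on_frechet_derivative[OF b, of i], of _ 0]
    unfolding smooth_on_def g_def by simp
  show "g i c = frechet_derivative b (at c) i" for i by (simp add: g_def)
  show "b x = b c + (\<Sum>i\<in>Basis. ((x - c) \<bullet> i) * g i x)" if x: "x \<in> ball c e" for x
  proof -
    have "((\<lambda>t. b (c + t *\<^sub>R (x - c))) has_vector_derivative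
       frechet_derivative b (at (c + t *\<^sub>R (x - c))) (x - c)) (at t within {0..1})"
      if "t \<in> {0..1}" for t
    proof -
      have "((\<lambda>t. c + t *\<^sub>R (x - c)) has_vector_derivative (x - c)) (at t within {0..1})"
        by (auto intro!: derivative_eq_intros)
      moreover have "(b has_derivative frechet_derivative b (at (c + t *\<^sub>R (x - c)))) 
          (at (c + t *\<^sub>R (x - c)) within (\<lambda>t. c + t *\<^sub>R (x - c)) ` {0..1})"
        by (rule has_derivative_at_withinI, rule smooth_on_has_derivative[OF b], rule ray_in_ball)
          (use x that in auto)
      ultimately show ?thesis
        using vector_derivative_diff_chain_within[of "\<lambda>t. c + t *\<^sub>R (x - c)"] by (simp add: o_def)
    qed
    then have "((\<lambda>t. frechet_derivative b (at (c + t *\<^sub>R (x - c))) (x - c)) has_integral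
       b (c + 1 *\<^sub>R (x - c)) - b (c + 0 *\<^sub>R (x - c))) {0..1}"
      by (intro fundamental_theorem_of_calculus) auto
    then have 1: "b x - b c = integral {0..1} (\<lambda>t. frechet_derivative b (at (c + t *\<^sub>R (x - c))) (x - c))"
      by (simp add: integral_unique)
    have "\<dots> = integral {0..1} (\<lambda>t. \<Sum>i\<in>Basis. ((x - c) \<bullet> i) * frechet_derivative b (at (c + t *\<^sub>R (x - c))) i)"
    proof (rule integral_cong)
      fix t :: real assume t: "t \<in> {0..1}"
      have "b differentiable (at (c + t *\<^sub>R (x - c)))"
        by (rule smooth_on_differentiable[OF b], rule ray_in_ball) (use x t in auto)
      from frechet_derivative_basis_sum[OF this, of "x - c"]
      show "frechet_derivative b (at (c + t *\<^sub>R (x - c))) (x - c) =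
         (\<Sum>i\<in>Basis. ((x - c) \<bullet> i) * frechet_derivative b (at (c + t *\<^sub>R (x - c))) i)" by simp
    qed
    also have "\<dots> = (\<Sum>i\<in>Basis. ((x - c) \<bullet> i) * g i x)"
    proof -
      have "(\<lambda>t. frechet_derivative b (at (c + t *\<^sub>R (x - c))) i) integrable_on {0..1}" for i
      proof (rule integrable_continuous_real,
          rule continuous_on_compose2[OF smooth_on_continuous[OF smooth_on_frechet_derivative[OF b]]])
        show "(\<lambda>t. c + t *\<^sub>R (x - c)) ` {0..1} \<subseteq> ball c e"
          using x by (auto simp del: mem_ball intro!: ray_in_ball)
      qed (auto intro!: continuous_intros)
      then show ?thesis
        unfolding g_def by (subst integral_sum) (auto intro!: integrable_on_mult_right simp: integral_mult_right)
    qed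
    finally show ?thesis using 1 by simp
  qed
qed

section \<open>Charts and tangent vectors\<close>

lemma chart_open: "is_chart M (U, z) \<Longrightarrow> openin M U"
  by (simp add: is_chart_def)

lemma chart_subset: "is_chart M (U, z) \<Longrightarrow> U \<subseteq> topspace M"
  by (simp add: is_chart_def openin_subset)

lemma chart_homeo: "is_chart M (U, z) \<Longrightarrow> homeomorphic_map (subtopology M U) (top_of_set (z ` U)) z"
  by (simp add: is_chart_def)

lemma chart_topspace: "is_chart M (U, z) \<Longrightarrow> topspace (subtopology M U) = U"
  using chart_subset by (metis topspace_subtopology_subset)

lemma chart_inj: "is_chart M (U, z) \<Longrightarrow> inj_on z U"
  using homeomorphic_imp_injective_map[OF chart_homeo] chart_topspace by metis

lemma chart_inv: "is_chart M (U, z) \<Longrightarrow> p \<in> U \<Longrightarrow> inv_into U z (z p) = p"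
  using chart_inj inv_into_f_f by metis

lemma chart_open_image:
  assumes "is_chart M (U, z)" "openin M W" "W \<subseteq> U"
  shows "open (z ` W)"
proof -
  have "openin (subtopology M U) W"
    using assms chart_open openin_open_subtopology by metis
  then have "openin (top_of_set (z ` U)) (z ` W)"
    using homeomorphic_map_openness_eq[OF chart_homeo[OF assms(1)]] assms(3) chart_topspace[OF assms(1)]
    by metis
  then show ?thesis
    using assms(1) openin_open_eq unfolding is_chart_def by blast
qed

lemma chart_openin_inv:
  assumes "is_chart M (U, z)" "open S" "S \<subseteq> z ` U"
  shows "openin M (inv_into U z ` S)"
proof -
  have sub: "inv_into U z ` S \<subseteq> U"
    using assms(3) by (auto intro: inv_into_into)
  have im: "z ` (inv_into U z ` S) = S"
    using assms(3) by (auto simp: image_image f_inv_into_f subset_eq)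
  have "openin (top_of_set (z ` U)) S"
    using assms(2,3) by (simp add: open_subset)
  then have "openin (subtopology M U) (inv_into U z ` S)"
    using homeomorphic_map_openness[OF chart_homeo[OF assms(1)], of "inv_into U z ` S"] sub im
      chart_topspace[OF assms(1)] by metis
  then show ?thesis
    using chart_open[OF assms(1)] openin_open_subtopology by metis
qed

lemma smooth_chart_change:
  fixes z :: "'a \<Rightarrow> real ^ 'n::finite" and \<phi> :: "'a \<Rightarrow> real ^ 'n" and a :: "'a \<Rightarrow> real"
  assumes c: "is_chart M (U, z)" and d: "is_chart M (V, \<phi>)"
    and t: "smooth_transition (U, z) (V, \<phi>)" and W: "openin M W"
    and a: "smooth_on (\<phi> ` (V \<inter> W)) (\<lambda>x. a (inv_into V \<phi> x))"
  shows "smooth_on (z ` (U \<inter> V \<inter> W)) (\<lambda>x. a (inv_into U z x))"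
proof -
  have o: "open (z ` (U \<inter> V \<inter> W))"
    using chart_open[OF c] chart_open[OF d] W by (intro chart_open_image[OF c]) auto
  have o': "open (\<phi> ` (V \<inter> W))"
    using chart_open[OF d] W by (intro chart_open_image[OF d]) auto
  have "smooth_on (z ` (U \<inter> V \<inter> W)) (\<lambda>x. \<phi> (inv_into U z x))"
    using t unfolding smooth_transition_def by (auto intro: smooth_on_subset)
  then have "smooth_on (z ` (U \<inter> V \<inter> W)) (\<lambda>x. a (inv_into V \<phi> (\<phi> (inv_into U z x))))"
    by (rule smooth_on_compose[OF o o' _ _ a, rotated]) (auto simp: chart_inv[OF c])
  then show ?thesis
    by (rule smooth_on_transform[OF o]) (auto simp: chart_inv[OF c] chart_inv[OF d])
qed

locale smooth_mfd =
  fixes M :: "'a topology" and A :: "('a, 'n::finite) chart set"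
  assumes mfd: "smooth_manifold M A"
begin

lemma chart: "(V, \<phi>) \<in> A \<Longrightarrow> is_chart M (V, \<phi>)"
  using mfd by (auto simp: smooth_manifold_def)

lemma covered: "p \<in> topspace M \<Longrightarrow> \<exists>V \<phi>. (V, \<phi>) \<in> A \<and> p \<in> V"
proof -
  assume "p \<in> topspace M"
  moreover have "(\<Union>c\<in>A. fst c) = topspace M" using mfd unfolding smooth_manifold_def by blast
  ultimately obtain c where "c \<in> A" "p \<in> fst c" by blast
  then show ?thesis by (intro exI[of _ "fst c"] exI[of _ "snd c"]) simp
qed

lemma smooth_fun_onI:
  "openin M W \<Longrightarrow> (\<And>V \<phi>. (V, \<phi>) \<in> A \<Longrightarrow> smooth_on (\<phi> ` (V \<inter> W)) (\<lambda>x. a (inv_into V \<phi> x))) \<Longrightarrow>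
    smooth_fun_on M A W a"
  unfolding smooth_fun_on_def by auto

lemma open_chart_image: "(V, \<phi>) \<in> A \<Longrightarrow> openin M W \<Longrightarrow> open (\<phi> ` (V \<inter> W))"
  using chart_open[OF chart] by (intro chart_open_image[OF chart] openin_Int) auto

lemma smooth_fun_on_subset:
  "smooth_fun_on M A W a \<Longrightarrow> openin M W' \<Longrightarrow> W' \<subseteq> W \<Longrightarrow> smooth_fun_on M A W' a"
  unfolding smooth_fun_on_def by (fastforce intro: smooth_on_subset)

lemma smooth_fun_on_const: "openin M W \<Longrightarrow> smooth_fun_on M A W (\<lambda>p. c)"
  by (auto simp: smooth_fun_on_def)

lemma smooth_fun_on_add:
  "smooth_fun_on M A W a \<Longrightarrow> smooth_fun_on M A W b \<Longrightarrow> smooth_fun_on M A W (\<lambda>p. a p + b p)"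
  using open_chart_image by (fastforce simp: smooth_fun_on_def intro!: smooth_on_add)

lemma smooth_fun_on_mult:
  "smooth_fun_on M A W a \<Longrightarrow> smooth_fun_on M A W b \<Longrightarrow> smooth_fun_on M A W (\<lambda>p. a p * b p)"
  using open_chart_image by (fastforce simp: smooth_fun_on_def intro!: smooth_on_mult)

lemma smooth_fun_on_sum:
  assumes "openin M W" "finite I" "\<And>i. i \<in> I \<Longrightarrow> smooth_fun_on M A W (a i)"
  shows "smooth_fun_on M A W (\<lambda>p. \<Sum>i\<in>I. a i p)"
  using assms(2,3) by (induction I) (auto intro!: smooth_fun_on_add smooth_fun_on_const assms(1))

abbreviation near :: "'a \<Rightarrow> ('a \<Rightarrow> real) \<Rightarrow> bool" where "near \<equiv> smooth_fun_near M A"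

lemma near_openD: "near p a \<Longrightarrow> \<exists>W. openin M W \<and> p \<in> W \<and> smooth_fun_on M A W a"
  by (auto simp: smooth_fun_near_def smooth_fun_on_def)

lemma near_topspace: "near p a \<Longrightarrow> p \<in> topspace M"
  using near_openD openin_subset by blast

lemma near_const: "p \<in> topspace M \<Longrightarrow> near p (\<lambda>x. c)"
  unfolding smooth_fun_near_def by (blast intro: smooth_fun_on_const)

lemma near_combine:
  assumes "near p a" "near p b"
  obtains W where "openin M W" "p \<in> W" "smooth_fun_on M A W a" "smooth_fun_on M A W b"
proof -
  from near_openD[OF assms(1)] near_openD[OF assms(2)]
  obtain W W' where W: "openin M W" "p \<in> W" "smooth_fun_on M A W a"
    "openin M W'" "p \<in> W'" "smooth_fun_on M A W' b" by auto
  show ?thesis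
    by (rule that[of "W \<inter> W'"]) (use W in \<open>auto intro: smooth_fun_on_subset\<close>)
qed

lemma near_add: "near p a \<Longrightarrow> near p b \<Longrightarrow> near p (\<lambda>x. a x + b x)"
  by (erule (1) near_combine) (auto simp: smooth_fun_near_def dest: smooth_fun_on_add)

lemma near_mult: "near p a \<Longrightarrow> near p b \<Longrightarrow> near p (\<lambda>x. a x * b x)"
  by (erule (1) near_combine) (auto simp: smooth_fun_near_def dest: smooth_fun_on_mult)

lemma near_cmult: "near p a \<Longrightarrow> near p (\<lambda>x. c * a x)"
  using near_mult near_const near_topspace by blast

lemma near_sum:
  assumes "p \<in> topspace M" "finite I" "\<And>i. i \<in> I \<Longrightarrow> near p (a i)"
  shows "near p (\<lambda>x. \<Sum>i\<in>I. a i x)"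
  using assms(2,3) by (induction I) (auto intro!: near_add near_const assms(1))

lemma near_cong:
  assumes "near p a" "openin M W" "p \<in> W" "\<And>x. x \<in> W \<Longrightarrow> a x = b x"
  shows "near p b"
proof -
  from near_openD[OF assms(1)] obtain W' where W': "openin M W'" "p \<in> W'" "smooth_fun_on M A W' a" by auto
  have "smooth_fun_on M A (W \<inter> W') b"
  proof (rule smooth_fun_onI)
    show oW: "openin M (W \<inter> W')" using assms(2) W'(1) by auto
    fix V \<phi> assume V: "(V, \<phi>) \<in> A"
    have "smooth_on (\<phi> ` (V \<inter> (W \<inter> W'))) (\<lambda>x. a (inv_into V \<phi> x))"
      using W'(3) V unfolding smooth_fun_on_def by (auto intro: smooth_on_subset)
    then show "smooth_on (\<phi> ` (V \<inter> (W \<inter> W'))) (\<lambda>x. b (inv_into V \<phi> x))"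
      by (rule smooth_on_transform[OF open_chart_image[OF V oW]])
        (auto simp: chart_inv[OF chart[OF V]] assms(4))
  qed
  then show ?thesis using assms(3) W'(2) unfolding smooth_fun_near_def by blast
qed

lemma near_transfer: "near p a \<Longrightarrow> \<exists>W. openin M W \<and> p \<in> W \<and> (\<forall>x\<in>W. near x a)"
  using near_openD unfolding smooth_fun_near_def by blast

abbreviation TS :: "'a \<Rightarrow> 'a tvec set" where "TS \<equiv> tangent_space M A"

lemma tangent_add: "v \<in> TS p \<Longrightarrow> near p a \<Longrightarrow> near p b \<Longrightarrow> v (\<lambda>x. a x + b x) = v a + v b"
  by (simp add: tangent_space_def)

lemma tangent_mult: "v \<in> TS p \<Longrightarrow> near p a \<Longrightarrow> near p b \<Longrightarrow> v (\<lambda>x. a x * b x) = a p * v b + b p * v a"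
  by (simp add: tangent_space_def)

lemma tangent_cmult: "v \<in> TS p \<Longrightarrow> near p a \<Longrightarrow> v (\<lambda>x. c * a x) = c * v a"
  by (simp add: tangent_space_def)

lemma tangent_cong:
  assumes "v \<in> TS p" "near p a" "openin M W" "p \<in> W" "\<And>x. x \<in> W \<Longrightarrow> a x = b x"
  shows "v a = v b"
proof -
  have "near p b" by (rule near_cong[OF assms(2-5)])
  moreover have "\<exists>W. openin M W \<and> p \<in> W \<and> (\<forall>x\<in>W. a x = b x)" using assms(3-5) by blast
  ultimately show ?thesis using assms(1,2) unfolding tangent_space_def by simp
qed

lemma tangent_not_near: "v \<in> TS p \<Longrightarrow> \<not> near p a \<Longrightarrow> v a = 0"
  by (simp add: tangent_space_def)

lemma tangent_const:
  assumes "v \<in> TS p" "p \<in> topspace M"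
  shows "v (\<lambda>x. c) = 0"
proof -
  have "v (\<lambda>x. 1 * 1) = 1 * v (\<lambda>x. 1) + 1 * v (\<lambda>x. 1)"
    using tangent_mult[OF assms(1) near_const[OF assms(2), of 1] near_const[OF assms(2), of 1]] by simp
  then have "v (\<lambda>x. 1) = 0" by simp
  then show ?thesis
    using tangent_cmult[OF assms(1) near_const[OF assms(2), of 1], of c] by simp
qed

lemma tangent_sum:
  assumes "v \<in> TS p" "p \<in> topspace M" "finite I" "\<And>i. i \<in> I \<Longrightarrow> near p (a i)"
  shows "v (\<lambda>x. \<Sum>i\<in>I. a i x) = (\<Sum>i\<in>I. v (a i))"
  using assms(3,4)
  by (induction I) (auto simp: tangent_const[OF assms(1,2)] tangent_add[OF assms(1)] near_sum[OF assms(2)])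

lemma vfield_tangent: "smooth_vfield M A X \<Longrightarrow> p \<in> topspace M \<Longrightarrow> X p \<in> TS p"
  by (simp add: smooth_vfield_def)

lemma vfield_near: "smooth_vfield M A X \<Longrightarrow> near p a \<Longrightarrow> near p (\<lambda>x. X x a)"
  unfolding smooth_vfield_def smooth_fun_near_def by blast

lemma tangentI:
  assumes "\<And>a b. near p a \<Longrightarrow> near p b \<Longrightarrow> v (\<lambda>x. a x + b x) = v a + v b"
    and "\<And>a b. near p a \<Longrightarrow> near p b \<Longrightarrow> v (\<lambda>x. a x * b x) = a p * v b + b p * v a"
    and "\<And>c a. near p a \<Longrightarrow> v (\<lambda>x. c * a x) = c * v a"
    and "\<And>a b W. near p a \<Longrightarrow> near p b \<Longrightarrow> openin M W \<Longrightarrow> p \<in> W \<Longrightarrow> \<forall>x\<in>W. a x = b x \<Longrightarrow> v a = v b"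
    and "\<And>a. \<not> near p a \<Longrightarrow> v a = 0"
  shows "v \<in> TS p"
  unfolding tangent_space_def mem_Collect_eq
  using assms by (intro conjI allI impI) blast+

lemma tangent_subspace: "p \<in> topspace M \<Longrightarrow> tvec.subspace (TS p)"
proof (rule tvec.subspaceI)
  show "0 \<in> TS p" by (rule tangentI) auto
next
  fix v w assume v: "v \<in> TS p" and w: "w \<in> TS p"
  show "v + w \<in> TS p"
  proof (rule tangentI)
    fix a b W assume "near p a" "openin M W" "p \<in> W" "\<forall>x\<in>W. a x = b x"
    then have "v a = v b" "w a = w b" using tangent_cong[OF v] tangent_cong[OF w] by auto
    then show "(v + w) a = (v + w) b" by simp
  qed (auto simp: tangent_add[OF v] tangent_add[OF w] tangent_mult[OF v] tangent_mult[OF w]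
      tangent_cmult[OF v] tangent_cmult[OF w] tangent_not_near[OF v] tangent_not_near[OF w] algebra_simps)
next
  fix c v assume v: "v \<in> TS p"
  show "tscale c v \<in> TS p"
  proof (rule tangentI)
    fix a b W assume "near p a" "openin M W" "p \<in> W" "\<forall>x\<in>W. a x = b x"
    then have "v a = v b" using tangent_cong[OF v] by auto
    then show "tscale c v a = tscale c v b" by (simp add: tscale_def)
  qed (auto simp: tscale_def tangent_add[OF v] tangent_mult[OF v] tangent_cmult[OF v]
      tangent_not_near[OF v] algebra_simps)
qed

end

locale coord_chart = smooth_mfd M A
  for M :: "'a topology" and A :: "('a, 'n::finite) chart set" +
  fixes U :: "'a set" and z :: "'a \<Rightarrow> real ^ 'n"
  assumes loc: "local_coordinates M A (U, z)"
begin

abbreviation zi :: "real ^ 'n \<Rightarrow> 'a" where "zi \<equiv> inv_into U z"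

lemma is_chart: "is_chart M (U, z)"
  using loc by (simp add: local_coordinates_def)

lemmas openU = chart_open[OF is_chart]
  and zi_z = chart_inv[OF is_chart]
  and open_image = chart_open_image[OF is_chart]
  and open_preimage = chart_openin_inv[OF is_chart]

lemma U_top: "p \<in> U \<Longrightarrow> p \<in> topspace M"
  using chart_subset[OF is_chart] by auto

lemma z_zi: "x \<in> z ` U \<Longrightarrow> z (zi x) = x"
  by (rule f_inv_into_f)

lemma zi_U: "x \<in> z ` U \<Longrightarrow> zi x \<in> U"
  by (rule inv_into_into)

lemma open_zU: "open (z ` U)"
  using open_image[OF openU] by simp

text \<open>\<open>smooth_fun_on\<close> quantifies over the charts of the atlas, and
  \<open>z\<close> need not be one of them. It is compatible with each of them in both directions,
  so a change of charts transfers smoothness either way.\<close>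

lemma smooth_fun_on_iff:
  assumes "openin M W" "W \<subseteq> U"
  shows "smooth_fun_on M A W a \<longleftrightarrow> smooth_on (z ` W) (\<lambda>x. a (zi x))"
proof
  assume a: "smooth_fun_on M A W a"
  show "smooth_on (z ` W) (\<lambda>x. a (zi x))"
  proof (rule smooth_on_open_cover)
    fix x assume "x \<in> z ` W"
    then obtain p where p: "p \<in> W" "x = z p" by auto
    then obtain V \<phi> where V: "(V, \<phi>) \<in> A" "p \<in> V"
      using covered assms(2) U_top by blast
    have "smooth_on (z ` (U \<inter> V \<inter> W)) (\<lambda>x. a (zi x))"
    proof (rule smooth_chart_change[OF is_chart chart[OF V(1)] _ assms(1)])
      show "smooth_transition (U, z) (V, \<phi>)"
        using loc V(1) by (auto simp: local_coordinates_def)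
      show "smooth_on (\<phi> ` (V \<inter> W)) (\<lambda>x. a (inv_into V \<phi> x))"
        using a V(1) by (auto simp: smooth_fun_on_def)
    qed
    moreover have "open (z ` (U \<inter> V \<inter> W))"
      using openU chart_open[OF chart[OF V(1)]] assms(1) by (intro open_image) auto
    moreover have "x \<in> z ` (U \<inter> V \<inter> W)" using p V assms(2) by auto
    ultimately show "\<exists>T. open T \<and> x \<in> T \<and> smooth_on T (\<lambda>x. a (zi x))" by blast
  qed
next
  assume a: "smooth_on (z ` W) (\<lambda>x. a (zi x))"
  show "smooth_fun_on M A W a"
  proof (rule smooth_fun_onI[OF assms(1)])
    fix V \<phi> assume V: "(V, \<phi>) \<in> A"
    have UW: "U \<inter> W = W" using assms(2) by auto
    have "smooth_on (\<phi> ` (V \<inter> U \<inter> W)) (\<lambda>x. a (inv_into V \<phi> x))"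
    proof (rule smooth_chart_change[OF chart[OF V] is_chart _ assms(1)])
      show "smooth_transition (V, \<phi>) (U, z)"
        using loc V by (auto simp: local_coordinates_def)
    qed (use a UW in simp)
    then show "smooth_on (\<phi> ` (V \<inter> W)) (\<lambda>x. a (inv_into V \<phi> x))"
      using UW by (simp add: Int_assoc)
  qed
qed

text \<open>Shrinking to a coordinate ball makes the domain star-shaped about \<open>z p\<close>,
  the form in which Hadamard's lemma applies.\<close>

lemma near_iff:
  assumes p: "p \<in> U"
  shows "near p a \<longleftrightarrow> (\<exists>e>0. ball (z p) e \<subseteq> z ` U \<and> smooth_on (ball (z p) e) (\<lambda>x. a (zi x)))"
proof
  assume "near p a"
  then obtain W where W: "openin M W" "p \<in> W" "smooth_fun_on M A W a" using near_openD by blast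
  have W': "openin M (W \<inter> U)" using W(1) openU by auto
  have "smooth_fun_on M A (W \<inter> U) a" by (rule smooth_fun_on_subset[OF W(3) W']) auto
  then have s: "smooth_on (z ` (W \<inter> U)) (\<lambda>x. a (zi x))" using smooth_fun_on_iff[OF W'] by simp
  obtain e where "e > 0" "ball (z p) e \<subseteq> z ` (W \<inter> U)"
    using open_image[OF W'] p W(2) by (metis IntI Int_lower2 image_eqI open_contains_ball)
  with s show "\<exists>e>0. ball (z p) e \<subseteq> z ` U \<and> smooth_on (ball (z p) e) (\<lambda>x. a (zi x))"
    by (meson smooth_on_subset image_mono inf_le2 order_trans)
next
  assume "\<exists>e>0. ball (z p) e \<subseteq> z ` U \<and> smooth_on (ball (z p) e) (\<lambda>x. a (zi x))"
  then obtain e where e: "e > 0" "ball (z p) e \<subseteq> z ` U" "smooth_on (ball (z p) e) (\<lambda>x. a (zi x))" by auto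
  let ?W = "zi ` ball (z p) e"
  have W: "openin M ?W" "?W \<subseteq> U" using open_preimage[OF open_ball e(2)] e(2) zi_U by auto
  have "z ` ?W = ball (z p) e" using z_zi e(2) by (force simp: image_image subset_eq)
  then have "smooth_fun_on M A ?W a" using smooth_fun_on_iff[OF W] e(3) by simp
  moreover have "p \<in> ?W" using zi_z[OF p] e(1) by (metis centre_in_ball image_eqI)
  ultimately show "near p a" unfolding smooth_fun_near_def by blast
qed

lemma near_comp_z:
  assumes "p \<in> U" "open S" "z p \<in> S" "smooth_on S g"
  shows "near p (\<lambda>x. g (z x))"
proof -
  obtain e where e: "e > 0" "ball (z p) e \<subseteq> S \<inter> z ` U"
    using open_Int[OF assms(2) open_zU] assms(1,3) by (metis IntI image_eqI open_contains_ball)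
  have "smooth_on (ball (z p) e) (\<lambda>x. g (z (zi x)))"
    by (rule smooth_on_transform[OF open_ball smooth_on_subset[OF assms(4), of "ball (z p) e"]])
      (use e(2) z_zi in \<open>auto simp: subset_eq\<close>)
  then show ?thesis using e by (subst near_iff[OF assms(1)]) blast
qed

lemma near_z: "p \<in> U \<Longrightarrow> near p (\<lambda>x. z x $ j)"
  using near_comp_z[of p UNIV "\<lambda>x. x $ j"]
  by (simp add: smooth_on_bounded_linear[OF open_UNIV bounded_linear_vec_nth smooth_on_id])

lemma near_differentiable: "p \<in> U \<Longrightarrow> near p a \<Longrightarrow> (\<lambda>x. a (zi x)) differentiable (at (z p))"
  using near_iff smooth_on_differentiable centre_in_ball by blast

end

lemma sum_fun_apply: "(\<Sum>i\<in>I. f i) x = (\<Sum>i\<in>I. f i x)" for f :: "'i \<Rightarrow> 'b \<Rightarrow> 'c::comm_monoid_add"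
  by (induction I rule: infinite_finite_induct) auto

lemma sum_Basis_axis:
  "(\<Sum>b\<in>Basis. f b) = (\<Sum>j\<in>UNIV. f (axis j 1 :: real ^ 'n::finite))"
proof -
  have "(Basis :: (real ^ 'n) set) = range (\<lambda>j. axis j 1)" by (auto simp: Basis_vec_def)
  moreover have "inj (\<lambda>j. axis j (1::real) :: real ^ 'n)" by (auto simp: inj_on_def axis_eq_axis)
  ultimately show ?thesis using sum.reindex[of "\<lambda>j. axis j 1 :: real ^ 'n" UNIV f] by (simp only: o_def)
qed

context coord_chart
begin

text \<open>By Hadamard's lemma, a is near p the constant \<open>a p\<close> plus the sum of the
  products of \<open>c j\<close> and \<open>G j\<close>, where \<open>c j p = 0\<close>. A
  derivation kills the constant, and the product rule leaves only \<open>v (c j) * G j p\<close>,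
  where \<open>G j p\<close> is the j-th partial derivative of a.\<close>

lemma tangent_expand:
  assumes p: "p \<in> U" and v: "v \<in> TS p" and a: "near p a"
  shows "v a = (\<Sum>j\<in>UNIV. v (\<lambda>x. z x $ j) * frechet_derivative (\<lambda>x. a (zi x)) (at (z p)) (axis j 1))"
proof -
  have pt: "p \<in> topspace M" using U_top p by auto
  from a near_iff[OF p] obtain e where e: "e > 0" "ball (z p) e \<subseteq> z ` U"
    "smooth_on (ball (z p) e) (\<lambda>x. a (zi x))" by blast
  from hadamard[OF e(3)] obtain g where g: "\<And>i. smooth_on (ball (z p) e) (g i)"
    "\<And>x. x \<in> ball (z p) e \<Longrightarrow> a (zi x) = a (zi (z p)) + (\<Sum>i\<in>Basis. ((x - z p) \<bullet> i) * g i x)"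
    "\<And>i. g i (z p) = frechet_derivative (\<lambda>x. a (zi x)) (at (z p)) i" by blast
  define G where "G j x = g (axis j 1) (z x)" for j x
  define c where "c j x = z x $ j + (- (z p $ j))" for j x
  have nG: "near p (G j)" for j
    unfolding G_def by (rule near_comp_z[OF p open_ball _ g(1)]) (use e in auto)
  have nc: "near p (c j)" for j
    unfolding c_def by (intro near_add near_z p near_const pt)
  let ?W = "zi ` ball (z p) e"
  have W: "openin M ?W" by (rule open_preimage[OF open_ball e(2)])
  have pW: "p \<in> ?W" using zi_z[OF p] e(1) by (metis centre_in_ball image_eqI)
  have eq: "a x = a p + (\<Sum>j\<in>UNIV. c j x * G j x)" if "x \<in> ?W" for x
  proof -
    from that obtain y where y: "y \<in> ball (z p) e" "x = zi y" by auto
    have zx: "z x = y" using y e(2) z_zi by auto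
    have "(\<Sum>i\<in>Basis. ((y - z p) \<bullet> i) * g i y) = (\<Sum>j\<in>UNIV. c j x * G j x)"
      unfolding sum_Basis_axis c_def G_def zx by (simp add: inner_axis)
    then show ?thesis using g(2)[OF y(1)] y zi_z[OF p] by simp
  qed
  have nS: "near p (\<lambda>x. \<Sum>j\<in>UNIV. c j x * G j x)"
    by (intro near_sum pt near_mult nc nG) simp
  have "v a = v (\<lambda>x. a p + (\<Sum>j\<in>UNIV. c j x * G j x))"
    by (rule tangent_cong[OF v a W pW eq])
  also have "\<dots> = (\<Sum>j\<in>UNIV. v (\<lambda>x. c j x * G j x))"
    using tangent_add[OF v near_const[OF pt] nS] tangent_const[OF v pt]
      tangent_sum[OF v pt finite, of UNIV "\<lambda>j x. c j x * G j x"] near_mult[OF nc nG] by simp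
  also have "\<dots> = (\<Sum>j\<in>UNIV. v (\<lambda>x. z x $ j) * G j p)"
  proof (rule sum.cong[OF refl])
    fix j
    have "v (c j) = v (\<lambda>x. z x $ j)"
      unfolding c_def using tangent_add[OF v near_z[OF p, of j] near_const[OF pt, of "- (z p $ j)"]] tangent_const[OF v pt] by simp
    moreover have "c j p = 0" by (simp add: c_def)
    ultimately show "v (\<lambda>x. c j x * G j x) = v (\<lambda>x. z x $ j) * G j p"
      using tangent_mult[OF v nc nG, of j j] by simp
  qed
  finally show ?thesis by (simp add: G_def g(3))
qed

definition field_rep :: "'a vfield \<Rightarrow> real ^ 'n \<Rightarrow> real ^ 'n" where
  "field_rep X x = (\<chi> j. X (zi x) (\<lambda>p. z p $ j))"

lemma tangent_eq_derivative:
  assumes p: "p \<in> U" and v: "v \<in> TS p" and a: "near p a"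
  shows "v a = frechet_derivative (\<lambda>x. a (zi x)) (at (z p)) (\<chi> j. v (\<lambda>x. z x $ j))"
  using frechet_derivative_basis_sum[OF near_differentiable[OF p a], of "\<chi> j. v (\<lambda>x. z x $ j)"]
    tangent_expand[OF assms] by (simp add: sum_Basis_axis inner_axis)

lemma vfield_eq_derivative:
  assumes p: "p \<in> U" and X: "smooth_vfield M A X" and a: "near p a"
  shows "X p a = frechet_derivative (\<lambda>x. a (zi x)) (at (z p)) (field_rep X (z p))"
  using tangent_eq_derivative[OF p vfield_tangent[OF X U_top[OF p]] a] zi_z[OF p]
  by (simp add: field_rep_def)

lemma smooth_field_rep:
  assumes X: "smooth_vfield M A X"
  shows "smooth_on (z ` U) (field_rep X)"
proof (subst smooth_on_vec_iff[OF open_zU], intro allI)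
  fix j
  have "smooth_fun_on M A U (\<lambda>p. z p $ j)"
  proof (subst smooth_fun_on_iff[OF openU order_refl], rule smooth_on_transform[OF open_zU])
    show "smooth_on (z ` U) (\<lambda>x. x $ j)"
      by (rule smooth_on_bounded_linear[OF open_zU bounded_linear_vec_nth smooth_on_id])
  qed (simp add: z_zi)
  then have "smooth_fun_on M A U (\<lambda>p. X p (\<lambda>p. z p $ j))"
    using X unfolding smooth_vfield_def by blast
  then show "smooth_on (z ` U) (\<lambda>x. field_rep X x $ j)"
    by (simp add: field_rep_def smooth_fun_on_iff[OF openU order_refl])
qed

abbreviation cvec :: "'a \<Rightarrow> 'n \<Rightarrow> 'a tvec" where "cvec p j \<equiv> coordinate_vfield M A (U, z) j p"

lemma cvec_near: "near p a \<Longrightarrow> cvec p j a = frechet_derivative (\<lambda>x. a (zi x)) (at (z p)) (axis j 1)"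
  by (simp add: coordinate_vfield_def)

lemma cvec_not_near: "\<not> near p a \<Longrightarrow> cvec p j a = 0"
  by (simp add: coordinate_vfield_def)

lemma near_has_derivative:
  "p \<in> U \<Longrightarrow> near p a \<Longrightarrow> ((\<lambda>x. a (zi x)) has_derivative frechet_derivative (\<lambda>x. a (zi x)) (at (z p))) (at (z p))"
  by (rule has_derivative_frechet[OF near_differentiable])

lemma cvec_tangent:
  assumes p: "p \<in> U" shows "cvec p j \<in> TS p"
proof (rule tangentI)
  fix a b assume ab: "near p a" "near p b"
  note d = near_has_derivative[OF p ab(1)] near_has_derivative[OF p ab(2)]
  show "cvec p j (\<lambda>x. a x + b x) = cvec p j a + cvec p j b"
    using frechet_derivative_eqI[OF has_derivative_add[OF d]]
    by (simp add: cvec_near ab near_add)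
  show "cvec p j (\<lambda>x. a x * b x) = a p * cvec p j b + b p * cvec p j a"
    using frechet_derivative_eqI[OF has_derivative_mult[OF d]] zi_z[OF p]
    by (simp add: cvec_near ab near_mult)
next
  fix c a assume a: "near p a"
  show "cvec p j (\<lambda>x. c * a x) = c * cvec p j a"
    using frechet_derivative_eqI[OF has_derivative_mult_right[OF near_has_derivative[OF p a], of c]]
    by (simp add: cvec_near a near_cmult)
next
  fix a b W assume a: "near p a" "near p b" and W: "openin M W" "p \<in> W" and eq: "\<forall>x\<in>W. a x = b x"
  have o: "openin M (W \<inter> U)" using W openU by auto
  have "((\<lambda>x. b (zi x)) has_derivative frechet_derivative (\<lambda>x. a (zi x)) (at (z p))) (at (z p))"
    by (rule has_derivative_transform_within_open[OF near_has_derivative[OF p a(1)] open_image[OF o]])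
      (use p W eq zi_z in auto)
  then show "cvec p j a = cvec p j b"
    by (simp add: cvec_near a frechet_derivative_eqI)
qed (simp add: cvec_not_near)

lemma cvec_z:
  assumes p: "p \<in> U" shows "cvec p j (\<lambda>x. z x $ l) = (if l = j then 1 else 0)"
proof -
  have "((\<lambda>x. z (zi x) $ l) has_derivative (\<lambda>v. v $ l)) (at (z p))"
    by (rule has_derivative_transform_within_open[OF bounded_linear.has_derivative[OF bounded_linear_vec_nth has_derivative_ident] open_zU])
      (use p z_zi in auto)
  then show ?thesis
    by (simp add: cvec_near near_z[OF p] frechet_derivative_eqI axis_def)
qed

lemma tangent_eq_sum:
  assumes p: "p \<in> U" and v: "v \<in> TS p"
  shows "v = (\<Sum>j\<in>UNIV. tscale (v (\<lambda>x. z x $ j)) (cvec p j))"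
proof
  fix a
  show "v a = (\<Sum>j\<in>UNIV. tscale (v (\<lambda>x. z x $ j)) (cvec p j)) a"
  proof (cases "near p a")
    case True
    then show ?thesis using tangent_expand[OF p v True] by (simp add: sum_fun_apply tscale_def cvec_near)
  next
    case False
    then show ?thesis using tangent_not_near[OF v] by (simp add: sum_fun_apply tscale_def cvec_not_near)
  qed
qed

lemma cvec_inj: "p \<in> U \<Longrightarrow> inj (cvec p)"
proof (rule injI)
  fix i j assume p: "p \<in> U" and "cvec p i = cvec p j"
  then have "cvec p i (\<lambda>x. z x $ i) = cvec p j (\<lambda>x. z x $ i)" by simp
  then show "i = j" by (simp add: cvec_z[OF p] split: if_splits)
qed

lemma cvec_independent:
  assumes p: "p \<in> U" shows "tvec.independent (range (cvec p))"
proof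
  assume "tvec.dependent (range (cvec p))"
  then obtain u v where u: "v \<in> range (cvec p)" "u v \<noteq> 0"
    "(\<Sum>v\<in>range (cvec p). tscale (u v) v) = 0"
    by (auto simp: tvec.dependent_finite)
  obtain i where i: "v = cvec p i" using u(1) by auto
  have "(\<Sum>j\<in>UNIV. tscale (u (cvec p j)) (cvec p j)) (\<lambda>x. z x $ i) = 0"
    using u(3) sum.reindex[OF cvec_inj[OF p], of "\<lambda>v. tscale (u v) v"] by simp
  then have "u (cvec p i) = 0"
    by (simp add: sum_fun_apply tscale_def cvec_z[OF p] if_distrib cong: if_cong)
  with u(2) i show False by simp
qed

lemma tangent_span: "p \<in> U \<Longrightarrow> tvec.span (range (cvec p)) = TS p"
proof
  assume p: "p \<in> U"
  show "tvec.span (range (cvec p)) \<subseteq> TS p"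
    by (rule tvec.span_minimal[OF _ tangent_subspace[OF U_top[OF p]]]) (auto intro: cvec_tangent p)
  show "TS p \<subseteq> tvec.span (range (cvec p))"
  proof
    fix v assume "v \<in> TS p"
    then have "v = (\<Sum>j\<in>UNIV. tscale (v (\<lambda>x. z x $ j)) (cvec p j))" by (rule tangent_eq_sum[OF p])
    moreover have "\<dots> \<in> tvec.span (range (cvec p))"
      by (intro tvec.span_sum tvec.span_scale tvec.span_base) auto
    ultimately show "v \<in> tvec.span (range (cvec p))" by simp
  qed
qed

lemma tangent_dim: "p \<in> U \<Longrightarrow> tvec.dim (TS p) = CARD('n)"
  using tvec.dim_span[of "range (cvec p)"] tvec.dim_eq_card_independent[OF cvec_independent[of p]]
    card_image[OF cvec_inj[of p]] tangent_span[of p] by simp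

end

context smooth_mfd
begin

lemma atlas_coord_chart:
  assumes "(V, \<phi>) \<in> A" shows "coord_chart M A V \<phi>"
proof
  show "local_coordinates M A (V, \<phi>)"
    using mfd assms by (auto simp: local_coordinates_def smooth_manifold_def)
qed

lemma tangent_dim_mfd: "p \<in> topspace M \<Longrightarrow> tvec.dim (TS p) = CARD('n)"
  using covered atlas_coord_chart coord_chart.tangent_dim by metis

lemma tangent_finite_basis:
  assumes "p \<in> topspace M"
  obtains B where "finite B" "tvec.independent B" "card B = CARD('n)" "tvec.span B = TS p" "B \<subseteq> TS p"
proof -
  obtain V \<phi> where V: "(V, \<phi>) \<in> A" "p \<in> V" using covered[OF assms] by auto
  interpret V: coord_chart M A V \<phi> by (rule atlas_coord_chart[OF V(1)])
  show ?thesis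
    by (rule that[of "range (\<lambda>j. coordinate_vfield M A (V, \<phi>) j p)"])
      (use V.cvec_independent V.tangent_span V(2) V.cvec_tangent card_image[OF V.cvec_inj] in auto)
qed

text \<open>The surrounding space of functionals need not be finite-dimensional, so the dimension
  count is made inside the span of a finite basis B of the tangent space: a vector outside the span
  of C would give an independent set larger than B.\<close>

lemma subspace_full_dim:
  assumes "p \<in> topspace M" "tvec.subspace S" "S \<subseteq> TS p" "tvec.dim S = CARD('n)"
  shows "S = TS p"
proof -
  obtain B where B: "finite B" "tvec.independent B" "card B = CARD('n)" "tvec.span B = TS p" "B \<subseteq> TS p"
    using tangent_finite_basis[OF assms(1)] .
  obtain C where C: "C \<subseteq> S" "tvec.independent C" "S \<subseteq> tvec.span C" "card C = tvec.dim S"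
    using tvec.basis_exists by blast
  have cC: "card C = card B" using C B assms by simp
  have CTS: "C \<subseteq> tvec.span B" using C assms B by auto
  have "finite C" using cC B by (metis card_ge_0_finite zero_less_card_finite)
  have "TS p \<subseteq> tvec.span C"
  proof (rule ccontr)
    assume "\<not> TS p \<subseteq> tvec.span C"
    then obtain v where v: "v \<in> TS p" "v \<notin> tvec.span C" by auto
    then have "tvec.independent (insert v C)" using C(2) tvec.independent_insertI by blast
    moreover have "insert v C \<subseteq> tvec.span B" using v CTS B by auto
    ultimately have "card (insert v C) \<le> card B"
      using tvec.independent_span_bound[OF B(1)] by blast
    moreover have "v \<notin> C" using v tvec.span_base by blast
    ultimately show False using cC \<open>finite C\<close> by simp
  qed
  moreover have "tvec.span C \<subseteq> S" using tvec.span_minimal[OF C(1) assms(2)] .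
  ultimately show ?thesis using assms(3) by auto
qed

end

section \<open>The flag and iterated brackets\<close>

text \<open>The list \<open>[i\<^sub>1, \<dots>, i\<^sub>s]\<close> stands for the iterated bracket
  \<open>[\<dots>[[f\<^bsub>i\<^sub>s\<^esub>, f\<^bsub>i\<^sub>s\<^sub>-\<^sub>1\<^esub>], \<dots>], f\<^bsub>i\<^sub>1\<^esub>]\<close>, applied to functions as a differential operator.\<close>

fun iterated_bracket :: "('m \<Rightarrow> 'a vfield) \<Rightarrow> 'm list \<Rightarrow> ('a \<Rightarrow> real) \<Rightarrow> 'a \<Rightarrow> real" where
  "iterated_bracket f [] a = (\<lambda>p. 0)"
| "iterated_bracket f [j] a = (\<lambda>p. f j p a)"
| "iterated_bracket f (j # I) a =
     (\<lambda>p. iterated_bracket f I (\<lambda>x. f j x a) p - f j p (iterated_bracket f I a))"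

definition words_upto :: "nat \<Rightarrow> 'm list set" where
  "words_upto s = {I. I \<noteq> [] \<and> length I \<le> s}"

lemma finite_words_upto [simp]: "finite (words_upto s :: 'm::finite list set)"
  by (rule finite_subset[OF _ finite_lists_length_le[of UNIV s]]) (auto simp: words_upto_def)

lemma words_upto_0: "words_upto 0 = {}"
  by (auto simp: words_upto_def)

context smooth_mfd
begin

lemma smooth_fun_on_cong:
  assumes "smooth_fun_on M A W a" "\<And>x. x \<in> W \<Longrightarrow> a x = b x"
  shows "smooth_fun_on M A W b"
proof (rule smooth_fun_onI)
  show o: "openin M W" using assms(1) by (simp add: smooth_fun_on_def)
  fix V \<phi> assume V: "(V, \<phi>) \<in> A"
  have "smooth_on (\<phi> ` (V \<inter> W)) (\<lambda>x. a (inv_into V \<phi> x))"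
    using assms(1) V by (auto simp: smooth_fun_on_def)
  then show "smooth_on (\<phi> ` (V \<inter> W)) (\<lambda>x. b (inv_into V \<phi> x))"
    by (rule smooth_on_transform[OF open_chart_image[OF V o]])
      (auto simp: chart_inv[OF chart[OF V]] assms(2))
qed

lemma smooth_fun_on_near: "smooth_fun_on M A W a \<Longrightarrow> p \<in> W \<Longrightarrow> near p a"
  unfolding smooth_fun_near_def by blast

lemma smooth_vfieldI:
  assumes "\<And>p. p \<in> topspace M \<Longrightarrow> X p \<in> TS p"
    "\<And>W a. smooth_fun_on M A W a \<Longrightarrow> smooth_fun_on M A W (\<lambda>p. X p a)"
  shows "smooth_vfield M A X"
  using assms unfolding smooth_vfield_def by blast

lemma vfield_smooth_fun: "smooth_vfield M A X \<Longrightarrow> smooth_fun_on M A W a \<Longrightarrow> smooth_fun_on M A W (\<lambda>p. X p a)"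
  unfolding smooth_vfield_def by blast

lemma smooth_fun_on_topspace: "smooth_fun_on M A (topspace M) a \<Longrightarrow> openin M W \<Longrightarrow> smooth_fun_on M A W a"
  using smooth_fun_on_subset openin_subset by blast

lemma smooth_fun_on_open: "smooth_fun_on M A W a \<Longrightarrow> openin M W"
  by (simp add: smooth_fun_on_def)

lemma smooth_vfield_0: "smooth_vfield M A 0"
  by (rule smooth_vfieldI)
    (auto intro: tvec.subspace_0[OF tangent_subspace] smooth_fun_on_const smooth_fun_on_open)

lemma smooth_vfield_add:
  assumes "smooth_vfield M A X" "smooth_vfield M A Y"
  shows "smooth_vfield M A (X + Y)"
proof (rule smooth_vfieldI)
  show "(X + Y) p \<in> TS p" if "p \<in> topspace M" for p
    using tvec.subspace_add[OF tangent_subspace[OF that] vfield_tangent[OF assms(1) that] vfield_tangent[OF assms(2) that]]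
    by simp
  show "smooth_fun_on M A W (\<lambda>p. (X + Y) p a)" if "smooth_fun_on M A W a" for W a
    using smooth_fun_on_add[OF vfield_smooth_fun[OF assms(1) that] vfield_smooth_fun[OF assms(2) that]] by simp
qed

lemma smooth_vfield_scale:
  assumes "smooth_vfield M A X" "smooth_fun_on M A (topspace M) g"
  shows "smooth_vfield M A (\<lambda>p. tscale (g p) (X p))"
proof (rule smooth_vfieldI)
  show "tscale (g p) (X p) \<in> TS p" if "p \<in> topspace M" for p
    using tvec.subspace_scale[OF tangent_subspace[OF that] vfield_tangent[OF assms(1) that]] .
  show "smooth_fun_on M A W (\<lambda>p. tscale (g p) (X p) a)" if "smooth_fun_on M A W a" for W a
    using smooth_fun_on_mult[OF smooth_fun_on_topspace[OF assms(2) smooth_fun_on_open[OF that]] vfield_smooth_fun[OF assms(1) that]]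
    by (simp add: tscale_def)
qed

lemma smooth_vfield_sum:
  assumes "\<And>i. i \<in> I \<Longrightarrow> smooth_vfield M A (X i)"
  shows "smooth_vfield M A (\<Sum>i\<in>I. X i)"
  using assms
  by (induction I rule: infinite_finite_induct) (auto intro: smooth_vfield_0 smooth_vfield_add)

lemma smooth_fun_on_diff:
  assumes "smooth_fun_on M A W a" "smooth_fun_on M A W b"
  shows "smooth_fun_on M A W (\<lambda>p. a p - b p)"
  using smooth_fun_on_add[OF assms(1) smooth_fun_on_mult[OF smooth_fun_on_const[OF smooth_fun_on_open[OF assms(1)], of "-1"] assms(2)]]
  by simp

lemma vfield_cong:
  assumes X: "smooth_vfield M A X" and "near p a" "openin M W" "p \<in> W" "\<And>x. x \<in> W \<Longrightarrow> near x a \<Longrightarrow> a x = b x"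
  shows "X p a = X p b"
proof -
  obtain W' where W': "openin M W'" "p \<in> W'" "\<forall>x\<in>W'. near x a"
    using near_transfer[OF assms(2)] by auto
  show ?thesis
    by (rule tangent_cong[OF vfield_tangent[OF X near_topspace[OF assms(2)]] assms(2), of "W \<inter> W'"])
      (use assms W' in auto)
qed

lemma lie_bracket_near: "near p a \<Longrightarrow> lie_bracket M A X Y p a = X p (\<lambda>x. Y x a) - Y p (\<lambda>x. X x a)"
  by (simp add: lie_bracket_def)

text \<open>A composite of two fields violates the product rule by the cross terms
  \<open>X p a * Y p b + X p b * Y p a\<close>. These are symmetric in X and Y and cancel in the
  commutator. The auxiliary facts are stated for arbitrary fields since each is used in both
  orders.\<close>

lemma smooth_vfield_bracket:
  assumes X: "smooth_vfield M A X" and Y: "smooth_vfield M A Y"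
  shows "smooth_vfield M A (lie_bracket M A X Y)"
proof (rule smooth_vfieldI)
  fix p assume p: "p \<in> topspace M"
  note tX = vfield_tangent[OF X] and tY = vfield_tangent[OF Y]
  have add: "X p (\<lambda>x. Y x (\<lambda>x. a x + b x)) = X p (\<lambda>x. Y x a) + X p (\<lambda>x. Y x b)"
    if X: "smooth_vfield M A X" and Y: "smooth_vfield M A Y" and a: "near p a" "near p b" for X Y a b
  proof -
    obtain W where W: "openin M W" "p \<in> W" "smooth_fun_on M A W a" "smooth_fun_on M A W b"
      using near_combine[OF a] .
    have "X p (\<lambda>x. Y x (\<lambda>x. a x + b x)) = X p (\<lambda>x. Y x a + Y x b)"
      by (rule vfield_cong[OF X vfield_near[OF Y near_add[OF a]] W(1,2)])
        (intro tangent_add[OF vfield_tangent[OF Y]] near_topspace smooth_fun_on_near[OF W(3)] smooth_fun_on_near[OF W(4)]; assumption)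
    then show ?thesis
      using tangent_add[OF vfield_tangent[OF X p] vfield_near[OF Y a(1)] vfield_near[OF Y a(2)]] by simp
  qed
  have cmult: "X p (\<lambda>x. Y x (\<lambda>x. c * a x)) = c * X p (\<lambda>x. Y x a)"
    if X: "smooth_vfield M A X" and Y: "smooth_vfield M A Y" and a: "near p a" for X Y a c
  proof -
    obtain W where W: "openin M W" "p \<in> W" "smooth_fun_on M A W a"
      using near_openD[OF a] by auto
    have "X p (\<lambda>x. Y x (\<lambda>x. c * a x)) = X p (\<lambda>x. c * Y x a)"
      by (rule vfield_cong[OF X vfield_near[OF Y near_cmult[OF a]] W(1,2)])
        (intro tangent_cmult[OF vfield_tangent[OF Y]] near_topspace smooth_fun_on_near[OF W(3)]; assumption)
    then show ?thesis
      using tangent_cmult[OF vfield_tangent[OF X p] vfield_near[OF Y a]] by simp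
  qed
  have mult: "X p (\<lambda>x. Y x (\<lambda>x. a x * b x)) =
      a p * X p (\<lambda>x. Y x b) + Y p b * X p a + (b p * X p (\<lambda>x. Y x a) + Y p a * X p b)"
    if X: "smooth_vfield M A X" and Y: "smooth_vfield M A Y" and a: "near p a" "near p b" for X Y a b
  proof -
    obtain W where W: "openin M W" "p \<in> W" "smooth_fun_on M A W a" "smooth_fun_on M A W b"
      using near_combine[OF a] .
    note nY = vfield_near[OF Y a(1)] vfield_near[OF Y a(2)]
    have "X p (\<lambda>x. Y x (\<lambda>x. a x * b x)) = X p (\<lambda>x. a x * Y x b + b x * Y x a)"
      by (rule vfield_cong[OF X vfield_near[OF Y near_mult[OF a]] W(1,2)])
        (intro tangent_mult[OF vfield_tangent[OF Y]] near_topspace smooth_fun_on_near[OF W(3)] smooth_fun_on_near[OF W(4)]; assumption)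
    then show ?thesis
      using tangent_add[OF vfield_tangent[OF X p] near_mult[OF a(1) nY(2)] near_mult[OF a(2) nY(1)]]
        tangent_mult[OF vfield_tangent[OF X p] a(1) nY(2)] tangent_mult[OF vfield_tangent[OF X p] a(2) nY(1)] by simp
  qed
  show "lie_bracket M A X Y p \<in> TS p"
  proof (rule tangentI)
    fix a b W assume a: "near p a" "near p b" and W: "openin M W" "p \<in> W" and eq: "\<forall>x\<in>W. a x = b x"
    have cong: "X p (\<lambda>x. Y x a) = X p (\<lambda>x. Y x b)" 
      if X: "smooth_vfield M A X" and Y: "smooth_vfield M A Y" for X Y
    proof -
      obtain W' where W': "openin M W'" "p \<in> W'" "smooth_fun_on M A W' a" using near_openD[OF a(1)] by auto
      show ?thesis
        by (rule vfield_cong[OF X vfield_near[OF Y a(1)], of "W \<inter> W'"])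
          (use W W' eq in \<open>auto intro!: vfield_cong[OF Y _ W(1)] smooth_fun_on_near[OF W'(3)]\<close>)
    qed
    show "lie_bracket M A X Y p a = lie_bracket M A X Y p b"
      using cong[OF X Y] cong[OF Y X] a by (simp add: lie_bracket_near)
  next
    fix a b assume "near p a" "near p b"
    then show "lie_bracket M A X Y p (\<lambda>x. a x * b x) = a p * lie_bracket M A X Y p b + b p * lie_bracket M A X Y p a"
      by (simp add: lie_bracket_near near_mult mult[OF X Y] mult[OF Y X] algebra_simps)
  qed (simp_all add: lie_bracket_near near_add near_cmult add[OF X Y] add[OF Y X] cmult[OF X Y] cmult[OF Y X]
      algebra_simps, simp add: lie_bracket_def)
next
  fix W a assume a: "smooth_fun_on M A W a"
  have "smooth_fun_on M A W (\<lambda>p. X p (\<lambda>x. Y x a) - Y p (\<lambda>x. X x a))"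
    by (rule smooth_fun_on_diff[OF vfield_smooth_fun[OF X vfield_smooth_fun[OF Y a]] vfield_smooth_fun[OF Y vfield_smooth_fun[OF X a]]])
  then show "smooth_fun_on M A W (\<lambda>p. lie_bracket M A X Y p a)"
    by (rule smooth_fun_on_cong) (simp add: lie_bracket_near smooth_fun_on_near[OF a])
qed

end

locale smooth_family = smooth_mfd M A
  for M :: "'a topology" and A :: "('a, 'n::finite) chart set" +
  fixes f :: "'m::finite \<Rightarrow> 'a vfield"
  assumes f_smooth: "\<And>i. smooth_vfield M A (f i)"
begin

abbreviation brk where "brk \<equiv> iterated_bracket f"

lemma brk_Cons: "I \<noteq> [] \<Longrightarrow> brk (j # I) a = (\<lambda>p. brk I (\<lambda>x. f j x a) p - f j p (brk I a))"
  by (cases I) auto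

lemma brk_smooth_fun:
  "smooth_fun_on M A W a \<Longrightarrow> smooth_fun_on M A W (brk I a)"
proof (induction I arbitrary: a)
  case Nil
  then show ?case by (simp add: smooth_fun_on_const smooth_fun_on_open)
next
  case (Cons j I)
  show ?case
  proof (cases "I = []")
    case True
    then show ?thesis using vfield_smooth_fun[OF f_smooth Cons.prems] by simp
  next
    case False
    have "smooth_fun_on M A W (\<lambda>p. brk I (\<lambda>x. f j x a) p - f j p (brk I a))"
      by (rule smooth_fun_on_diff[OF Cons.IH[OF vfield_smooth_fun[OF f_smooth Cons.prems]] vfield_smooth_fun[OF f_smooth Cons.IH[OF Cons.prems]]])
    then show ?thesis using False by (simp add: brk_Cons)
  qed
qed

lemma brk_near: "near p a \<Longrightarrow> near p (brk I a)"
  using near_openD brk_smooth_fun unfolding smooth_fun_near_def by blast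

abbreviation smooth_fun where "smooth_fun \<equiv> smooth_fun_on M A (topspace M)"

lemma smooth_fun_near_at: "smooth_fun g \<Longrightarrow> p \<in> topspace M \<Longrightarrow> near p g"
  by (rule smooth_fun_on_near)

text \<open>Membership in the module spanned by the iterated brackets of length at most s, with
  coefficients smooth on all of M. The identity is asked only for germs smooth at p: unlike a
  tangent vector, \<open>brk I a p\<close> is not set to 0 for other functions.\<close>

definition represented :: "nat \<Rightarrow> 'a vfield \<Rightarrow> bool" where
  "represented s X \<longleftrightarrow> (\<exists>g. (\<forall>I. smooth_fun (g I)) \<and>
     (\<forall>p a. near p a \<longrightarrow> X p a = (\<Sum>I\<in>words_upto s. g I p * brk I a p)))"

lemma represented_cong:
  assumes "represented s X" "\<And>p a. near p a \<Longrightarrow> X p a = Y p a"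
  shows "represented s Y"
proof -
  obtain g where g: "\<forall>I. smooth_fun (g I)" "\<forall>p a. near p a \<longrightarrow> X p a = (\<Sum>I\<in>words_upto s. g I p * brk I a p)"
    using assms(1) unfolding represented_def by blast
  have "\<forall>p a. near p a \<longrightarrow> Y p a = (\<Sum>I\<in>words_upto s. g I p * brk I a p)"
    using g(2) assms(2) by simp
  with g(1) show ?thesis unfolding represented_def by blast
qed

lemma represented_0: "represented s 0"
  unfolding represented_def by (rule exI[of _ "\<lambda>I p. 0"]) (simp add: smooth_fun_on_const)

lemma represented_add:
  assumes "represented s X" "represented s Y" shows "represented s (X + Y)"
proof -
  obtain g where "\<forall>I. smooth_fun (g I)" "\<forall>p a. near p a \<longrightarrow> X p a = (\<Sum>I\<in>words_upto s. g I p * brk I a p)"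
    using assms(1) unfolding represented_def by blast
  note g = this[rule_format]
  obtain h where "\<forall>I. smooth_fun (h I)" "\<forall>p a. near p a \<longrightarrow> Y p a = (\<Sum>I\<in>words_upto s. h I p * brk I a p)"
    using assms(2) unfolding represented_def by blast
  note h = this[rule_format]
  from g h show ?thesis
    unfolding represented_def
    by (intro exI[of _ "\<lambda>I p. g I p + h I p"]) (simp add: smooth_fun_on_add distrib_right sum.distrib)
qed

lemma represented_sum:
  assumes "\<And>i. i \<in> I \<Longrightarrow> represented s (X i)" shows "represented s (\<Sum>i\<in>I. X i)"
  using assms
  by (induction I rule: infinite_finite_induct) (auto intro: represented_0 represented_add)

lemma represented_single:
  assumes "smooth_fun h" "K \<in> words_upto s"
  shows "represented s (\<lambda>p a. h p * brk K a p)"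
proof -
  have "(\<Sum>I\<in>words_upto s. (if I = K then h p else 0) * brk I a p) = h p * brk K a p" for p a
  proof -
    have "(\<Sum>I\<in>words_upto s. (if I = K then h p else 0) * brk I a p) = (\<Sum>I\<in>words_upto s. if I = K then h p * brk I a p else 0)"
      by (rule sum.cong) auto
    then show ?thesis using assms(2) by simp
  qed
  then show ?thesis
    unfolding represented_def using assms(1) smooth_fun_on_const[of "topspace M" 0]
    by (intro exI[of _ "\<lambda>I p. if I = K then h p else 0"] conjI allI) (case_tac "I = K"; simp)+
qed

lemma represented_mono:
  assumes "represented s X" "s \<le> t" shows "represented t X"
proof -
  obtain g where "\<forall>I. smooth_fun (g I)" "\<forall>p a. near p a \<longrightarrow> X p a = (\<Sum>I\<in>words_upto s. g I p * brk I a p)"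
    using assms(1) unfolding represented_def by blast
  note g = this[rule_format]
  have "represented t (\<Sum>I\<in>words_upto s. (\<lambda>p a. g I p * brk I a p))"
    by (rule represented_sum, rule represented_single) (use g(1) assms(2) in \<open>auto simp: words_upto_def\<close>)
  then show ?thesis
    by (rule represented_cong) (simp add: sum_fun_apply g(2))
qed

text \<open>With Y the sum of \<open>g I * brk I\<close>, the product rule splits the bracket into
  three groups: \<open>?X1\<close> holds the brackets of \<open>brk I\<close> with
  \<open>f j\<close>, that is \<open>brk (j # I)\<close>; \<open>?X2\<close> comes from Y
  differentiating \<open>h j\<close>; \<open>?X3\<close> from \<open>f j\<close> differentiating
  \<open>g I\<close>. No word is longer than \<open>Suc s\<close>.\<close>

lemma represented_bracket:
  assumes Y: "smooth_vfield M A Y" and rY: "represented s Y" and s: "1 \<le> s" and h: "\<And>j. smooth_fun (h j)"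
  shows "represented (Suc s) (lie_bracket M A Y (\<lambda>p. \<Sum>j\<in>UNIV. tscale (h j p) (f j p)))"
    (is "represented _ (lie_bracket M A Y ?Z)")
proof -
  obtain g where "\<forall>I. smooth_fun (g I)" "\<forall>p a. near p a \<longrightarrow> Y p a = (\<Sum>I\<in>words_upto s. g I p * brk I a p)"
    using rY unfolding represented_def by blast
  note g = this[rule_format]
  let ?X1 = "\<Sum>j\<in>UNIV. \<Sum>I\<in>words_upto s. (\<lambda>p a. (h j p * g I p) * brk (j # I) a p)"
  let ?X2 = "\<Sum>j\<in>UNIV. (\<lambda>p a. Y p (h j) * brk [j] a p)"
  let ?X3 = "\<Sum>I\<in>words_upto s. (\<lambda>p a. (- 1 * (\<Sum>j\<in>UNIV. h j p * f j p (g I))) * brk I a p)"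
  have ot: "openin M (topspace M)" by simp
  have "represented (Suc s) (?X1 + ?X2 + ?X3)"
    by (intro represented_add represented_sum represented_single smooth_fun_on_mult smooth_fun_on_sum
        smooth_fun_on_const ot h g(1) vfield_smooth_fun[OF Y] vfield_smooth_fun[OF f_smooth] finite)
      (auto simp: words_upto_def)
  then show ?thesis
  proof (rule represented_cong)
    fix p a assume a: "near p a"
    have pt: "p \<in> topspace M" by (rule near_topspace[OF a])
    obtain W where W: "openin M W" "p \<in> W" "smooth_fun_on M A W a" using near_openD[OF a] by auto
    have Zx: "?Z x b = (\<Sum>j\<in>UNIV. h j x * f j x b)" for x b
      by (simp add: sum_fun_apply tscale_def)
    note nh = smooth_fun_near_at[OF h pt] and ng = smooth_fun_near_at[OF g(1) pt]
    have nf: "near p (\<lambda>x. f j x a)" for j by (rule vfield_near[OF f_smooth a])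
    have "Y p (\<lambda>x. ?Z x a) = (\<Sum>j\<in>UNIV. h j p * Y p (\<lambda>x. f j x a) + f j p a * Y p (h j))"
      unfolding Zx
      using tangent_sum[OF vfield_tangent[OF Y pt] pt finite, of UNIV "\<lambda>j x. h j x * f j x a"]
        near_mult[OF nh nf] tangent_mult[OF vfield_tangent[OF Y pt] nh nf] by simp
    also have "\<dots> = (\<Sum>j\<in>UNIV. \<Sum>I\<in>words_upto s. h j p * g I p * brk I (\<lambda>x. f j x a) p) + (\<Sum>j\<in>UNIV. Y p (h j) * f j p a)"
      by (simp add: g(2)[OF nf] sum.distrib sum_distrib_left mult.assoc mult.commute[of "f _ _ _"])
    finally have 1: "Y p (\<lambda>x. ?Z x a) = \<dots>" .
    have fY: "f j p (\<lambda>x. Y x a) = (\<Sum>I\<in>words_upto s. g I p * f j p (brk I a) + brk I a p * f j p (g I))" for j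
    proof -
      have "f j p (\<lambda>x. Y x a) = f j p (\<lambda>x. \<Sum>I\<in>words_upto s. g I x * brk I a x)"
        by (rule vfield_cong[OF f_smooth vfield_near[OF Y a] W(1,2)]) (rule g(2)[OF smooth_fun_on_near[OF W(3)]])
      then show ?thesis
        using tangent_sum[OF vfield_tangent[OF f_smooth pt] pt finite_words_upto, of s "\<lambda>I x. g I x * brk I a x"]
          near_mult[OF ng brk_near[OF a]] tangent_mult[OF vfield_tangent[OF f_smooth pt] ng brk_near[OF a]] by simp
    qed
    have 2: "?Z p (\<lambda>x. Y x a) = (\<Sum>j\<in>UNIV. \<Sum>I\<in>words_upto s. h j p * g I p * f j p (brk I a))
        + (\<Sum>I\<in>words_upto s. (\<Sum>j\<in>UNIV. h j p * f j p (g I)) * brk I a p)"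
      unfolding Zx fY
      by (simp add: sum_distrib_left sum_distrib_right sum.distrib distrib_left mult.assoc mult.commute mult.left_commute
          sum.swap[of _ "words_upto s"])
    have "lie_bracket M A Y ?Z p a = Y p (\<lambda>x. ?Z x a) - ?Z p (\<lambda>x. Y x a)"
      by (rule lie_bracket_near[OF a])
    also have "\<dots> = (\<Sum>j\<in>UNIV. \<Sum>I\<in>words_upto s. h j p * g I p * (brk I (\<lambda>x. f j x a) p - f j p (brk I a)))
        + (\<Sum>j\<in>UNIV. Y p (h j) * f j p a) - (\<Sum>I\<in>words_upto s. (\<Sum>j\<in>UNIV. h j p * f j p (g I)) * brk I a p)"
      unfolding 1 2 by (simp add: right_diff_distrib sum_subtractf)
    also have "(\<Sum>j\<in>UNIV. \<Sum>I\<in>words_upto s. h j p * g I p * (brk I (\<lambda>x. f j x a) p - f j p (brk I a)))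
        = (\<Sum>j\<in>UNIV. \<Sum>I\<in>words_upto s. h j p * g I p * brk (j # I) a p)"
      by (intro sum.cong refl) (auto simp: words_upto_def brk_Cons)
    finally have L: "lie_bracket M A Y ?Z p a = (\<Sum>j\<in>UNIV. \<Sum>I\<in>words_upto s. h j p * g I p * brk (j # I) a p)
        + (\<Sum>j\<in>UNIV. Y p (h j) * f j p a) - (\<Sum>I\<in>words_upto s. (\<Sum>j\<in>UNIV. h j p * f j p (g I)) * brk I a p)" .
    show "(?X1 + ?X2 + ?X3) p a = lie_bracket M A Y ?Z p a"
      unfolding L by (simp add: sum_fun_apply sum_negf)
  qed
qed

lemma flag_smooth: "X \<in> flag M A f s \<Longrightarrow> smooth_vfield M A X"
proof (induction s arbitrary: X)
  case 0
  then have "X = 0" by simp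
  then show ?case by (simp only: smooth_vfield_0)
next
  case (Suc s)
  show ?case
  proof (cases s)
    case 0
    with Suc.prems obtain g where g: "\<And>i. smooth_fun (g i)" "X = (\<lambda>p. \<Sum>i\<in>UNIV. tscale (g i p) (f i p))" by auto
    have "smooth_vfield M A (\<Sum>i\<in>UNIV. (\<lambda>p. tscale (g i p) (f i p)))"
      by (intro smooth_vfield_sum smooth_vfield_scale f_smooth g)
    moreover have "(\<Sum>i\<in>UNIV. (\<lambda>p. tscale (g i p) (f i p))) = X"
      by (rule ext) (simp add: g(2) sum_fun_apply)
    ultimately show ?thesis by simp
  next
    case s: (Suc t)
    with Suc.prems obtain X' N Y Z where X: "X = X' + (\<Sum>j<(N::nat). lie_bracket M A (Y j) (Z j))"
      "X' \<in> flag M A f s" "\<And>j. j < N \<Longrightarrow> Y j \<in> flag M A f s \<and> Z j \<in> flag M A f (Suc 0)" by auto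
    have Z: "smooth_vfield M A (Z j)" if j: "j < N" for j
    proof -
      obtain g where g: "\<And>i. smooth_fun (g i)" "Z j = (\<lambda>p. \<Sum>i\<in>UNIV. tscale (g i p) (f i p))"
        using X(3)[OF j] by auto
      have "smooth_vfield M A (\<Sum>i\<in>UNIV. (\<lambda>p. tscale (g i p) (f i p)))"
        by (intro smooth_vfield_sum smooth_vfield_scale f_smooth g)
      moreover have "(\<Sum>i\<in>UNIV. (\<lambda>p. tscale (g i p) (f i p))) = Z j"
        by (rule ext) (simp add: g(2) sum_fun_apply)
      ultimately show ?thesis by simp
    qed
    show ?thesis
      unfolding X(1)
      by (intro smooth_vfield_add smooth_vfield_sum smooth_vfield_bracket Suc.IH[OF X(2)])
        (use X(3) in \<open>auto intro: Z Suc.IH\<close>)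
  qed
qed

lemma flag_represented: "X \<in> flag M A f s \<Longrightarrow> represented s X"
proof (induction s arbitrary: X)
  case 0
  then have "X = 0" by simp
  then show ?case by (simp only: represented_0)
next
  case (Suc s)
  show ?case
  proof (cases s)
    case 0
    with Suc.prems obtain g where g: "\<And>i. smooth_fun (g i)" "X = (\<lambda>p. \<Sum>i\<in>UNIV. tscale (g i p) (f i p))" by auto
    have "represented (Suc s) (\<Sum>i\<in>UNIV. (\<lambda>p a. g i p * brk [i] a p))"
      by (intro represented_sum represented_single g) (simp add: words_upto_def)
    then show ?thesis by (rule represented_cong) (simp add: g(2) sum_fun_apply tscale_def)
  next
    case s: (Suc t)
    with Suc.prems obtain X' N Y Z where X: "X = X' + (\<Sum>j<(N::nat). lie_bracket M A (Y j) (Z j))"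
      "X' \<in> flag M A f s" "\<And>j. j < N \<Longrightarrow> Y j \<in> flag M A f s \<and> Z j \<in> flag M A f (Suc 0)" by auto
    have "represented (Suc s) (lie_bracket M A (Y j) (Z j))" if j: "j < N" for j
    proof -
      obtain h where h: "\<And>i. smooth_fun (h i)" "Z j = (\<lambda>p. \<Sum>i\<in>UNIV. tscale (h i p) (f i p))"
        using X(3)[OF j] by auto
      show ?thesis
        unfolding h(2) by (rule represented_bracket) (use X(3)[OF j] s Suc.IH flag_smooth h in auto)
    qed
    then show ?thesis
      unfolding X(1) by (intro represented_add represented_sum represented_mono[OF Suc.IH[OF X(2)]]) auto
  qed
qed

text \<open>Joins two sums of brackets into the single indexed sum that the definition of
  \<open>flag\<close> allows.\<close>

lemma sum_lessThan_append:
  "(\<Sum>j<N + N'. if j < N then g j else h (j - N)) = (\<Sum>j<N. g j) + (\<Sum>j<(N'::nat). h j)"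
  for g h :: "nat \<Rightarrow> 'b::comm_monoid_add"
  by (induction N') (simp_all add: add.assoc)

lemma flag_add: "X \<in> flag M A f s \<Longrightarrow> X' \<in> flag M A f s \<Longrightarrow> X + X' \<in> flag M A f s"
proof (induction s arbitrary: X X')
  case (Suc s)
  show ?case
  proof (cases s)
    case 0
    with Suc.prems obtain g g' where g: "\<And>i. smooth_fun (g i)" "X = (\<lambda>p. \<Sum>i\<in>UNIV. tscale (g i p) (f i p))"
      "\<And>i. smooth_fun (g' i)" "X' = (\<lambda>p. \<Sum>i\<in>UNIV. tscale (g' i p) (f i p))" by auto
    have "X + X' = (\<lambda>p. \<Sum>i\<in>UNIV. tscale (g i p + g' i p) (f i p))"
      by (intro ext) (simp add: g(2,4) tvec.scale_left_distrib sum.distrib)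
    then show ?thesis unfolding 0 flag.simps mem_Collect_eq
      by (intro exI[of _ "\<lambda>i p. g i p + g' i p"] conjI allI smooth_fun_on_add g)
  next
    case s: (Suc t)
    with Suc.prems obtain X1 N Y Z X1' N' Y' Z' where
      X: "X = X1 + (\<Sum>j<(N::nat). lie_bracket M A (Y j) (Z j))"
      "X1 \<in> flag M A f s" "\<And>j. j < N \<Longrightarrow> Y j \<in> flag M A f s \<and> Z j \<in> flag M A f (Suc 0)"
      "X' = X1' + (\<Sum>j<(N'::nat). lie_bracket M A (Y' j) (Z' j))"
      "X1' \<in> flag M A f s" "\<And>j. j < N' \<Longrightarrow> Y' j \<in> flag M A f s \<and> Z' j \<in> flag M A f (Suc 0)"
      by auto
    let ?Y = "\<lambda>j. if j < N then Y j else Y' (j - N)" and ?Z = "\<lambda>j. if j < N then Z j else Z' (j - N)"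
    have "(\<Sum>j<N + N'. lie_bracket M A (?Y j) (?Z j)) =
        (\<Sum>j<N + N'. if j < N then lie_bracket M A (Y j) (Z j) else lie_bracket M A (Y' (j - N)) (Z' (j - N)))"
      by (intro sum.cong) auto
    also have "\<dots> = (\<Sum>j<N. lie_bracket M A (Y j) (Z j)) + (\<Sum>j<N'. lie_bracket M A (Y' j) (Z' j))"
      by (rule sum_lessThan_append)
    finally have "X + X' = (X1 + X1') + (\<Sum>j<N + N'. lie_bracket M A (?Y j) (?Z j))"
      using X(1,4) by (simp add: add_ac)
    moreover have "\<forall>j<N + N'. ?Y j \<in> flag M A f s \<and> ?Z j \<in> flag M A f (Suc 0)"
      using X(3,6) by auto
    ultimately show ?thesis
      using Suc.IH[OF X(2,5)] unfolding s flag.simps mem_Collect_eq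
      by (intro exI[of _ "X1 + X1'"] exI[of _ "N + N'"] exI[of _ ?Y] exI[of _ ?Z] conjI)
  qed
qed simp

lemma flag_scale: "X \<in> flag M A f s \<Longrightarrow> (\<lambda>p. tscale c (X p)) \<in> flag M A f s"
proof (induction s arbitrary: X)
  case 0
  then show ?case by (simp add: fun_eq_iff tscale_def)
next
  case (Suc s)
  show ?case
  proof (cases s)
    case 0
    with Suc.prems obtain g where "\<And>i. smooth_fun (g i)" "X = (\<lambda>p. \<Sum>i\<in>UNIV. tscale (g i p) (f i p))" by auto
    then show ?thesis unfolding 0
      by (auto intro!: exI[of _ "\<lambda>i p. c * g i p"] smooth_fun_on_mult smooth_fun_on_const simp: tvec.scale_sum_right)
  next
    case s: (Suc t)
    with Suc.prems obtain X1 N Y Z where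
      X: "X = X1 + (\<Sum>j<(N::nat). lie_bracket M A (Y j) (Z j))"
      "X1 \<in> flag M A f s" "\<And>j. j < N \<Longrightarrow> Y j \<in> flag M A f s \<and> Z j \<in> flag M A f (Suc 0)"
      by auto
    have lb: "lie_bracket M A (\<lambda>p. tscale c (Y j p)) (Z j) = (\<lambda>p. tscale c (lie_bracket M A (Y j) (Z j) p))" if j: "j < N" for j
    proof (intro ext)
      fix p a
      show "lie_bracket M A (\<lambda>p. tscale c (Y j p)) (Z j) p a = tscale c (lie_bracket M A (Y j) (Z j) p) a"
      proof (cases "near p a")
        case True
        note sm = flag_smooth[OF conjunct1[OF X(3)[OF j]]] flag_smooth[OF conjunct2[OF X(3)[OF j]]]
        show ?thesis
          using tangent_cmult[OF vfield_tangent[OF sm(2) near_topspace[OF True]] vfield_near[OF sm(1) True], of c] True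
          by (simp add: lie_bracket_near tscale_def right_diff_distrib)
      qed (simp add: lie_bracket_def tscale_def)
    qed
    have "(\<lambda>p. tscale c (X p)) = (\<lambda>p. tscale c (X1 p)) + (\<Sum>j<N. lie_bracket M A (\<lambda>p. tscale c (Y j p)) (Z j))"
      by (rule ext) (simp add: X(1) sum_fun_apply lb tvec.scale_right_distrib tvec.scale_sum_right)
    moreover have "\<forall>j<N. (\<lambda>p. tscale c (Y j p)) \<in> flag M A f s \<and> Z j \<in> flag M A f (Suc 0)"
      using X(3) Suc.IH by auto
    ultimately show ?thesis
      using Suc.IH[OF X(2)] unfolding s flag.simps mem_Collect_eq by (intro exI conjI) 
  qed
qed

lemma flag_Suc: "X \<in> flag M A f s \<Longrightarrow> X \<in> flag M A f (Suc s)"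
proof (cases s)
  case 0
  moreover assume "X \<in> flag M A f s"
  ultimately show ?thesis by (auto intro!: exI[of _ "\<lambda>i p. 0"] simp: smooth_fun_on_const fun_eq_iff tscale_def sum_fun_apply)
next
  case (Suc t)
  moreover assume "X \<in> flag M A f s"
  ultimately show ?thesis by (auto intro!: exI[of _ X] exI[of _ "0::nat"])
qed

lemma flag_mono: "s \<le> t \<Longrightarrow> flag M A f s \<subseteq> flag M A f t"
  by (rule lift_Suc_mono_le[of "flag M A f"]) (auto intro: flag_Suc)

lemma flag_at_subspace: "tvec.subspace (flag_at M A f s p)"
proof (rule tvec.subspaceI)
  have "0 \<in> flag M A f s" using flag_mono[of 0 s] by simp
  then show "0 \<in> flag_at M A f s p" unfolding flag_at_def by (intro image_eqI[of _ _ 0]) simp_all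
  show "x + y \<in> flag_at M A f s p" if "x \<in> flag_at M A f s p" "y \<in> flag_at M A f s p" for x y
  proof -
    from that obtain X Y where "X \<in> flag M A f s" "x = X p" "Y \<in> flag M A f s" "y = Y p" by (auto simp: flag_at_def)
    then show ?thesis using flag_add[of X s Y] unfolding flag_at_def by (intro image_eqI[of _ _ "X + Y"]) auto
  qed
  show "tscale c x \<in> flag_at M A f s p" if "x \<in> flag_at M A f s p" for c x
  proof -
    from that obtain X where "X \<in> flag M A f s" "x = X p" by (auto simp: flag_at_def)
    then show ?thesis using flag_scale[of X s c] unfolding flag_at_def by (intro image_eqI[of _ _ "\<lambda>p. tscale c (X p)"]) auto
  qed
qed

lemma flag_at_mono: "s \<le> t \<Longrightarrow> flag_at M A f s p \<subseteq> flag_at M A f t p"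
  unfolding flag_at_def by (intro image_mono flag_mono)

lemma flag_at_tangent: "p \<in> topspace M \<Longrightarrow> flag_at M A f s p \<subseteq> TS p"
  unfolding flag_at_def using flag_smooth vfield_tangent by blast

text \<open>The degree is a \<open>LEAST\<close>, so one order that works at every point has to be
  exhibited. A basis of the tangent space at q is finite and the flag increases, so some order s
  catches it; equiregularity carries the full dimension to all points, and there full dimension
  forces equality.\<close>

lemma nonholonomy_degree_flag:
  assumes H: "hormander M A f" and E: "equiregular M A f" and q: "q \<in> topspace M"
  shows "flag_at M A f (nonholonomy_degree M A f) q = TS q"
proof -
  obtain B where B: "finite B" "tvec.independent B" "card B = CARD('n)" "tvec.span B = TS q" "B \<subseteq> TS q"
    using tangent_finite_basis[OF q] .
  have "\<exists>s. b \<in> flag_at M A f s q" if "b \<in> B" for b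
    using H q that B(5) unfolding hormander_def by blast
  then obtain S where S: "\<And>b. b \<in> B \<Longrightarrow> b \<in> flag_at M A f (S b) q" by metis
  define s where "s = Max (insert 0 (S ` B))"
  have "B \<subseteq> flag_at M A f s q"
  proof
    fix b assume b: "b \<in> B"
    have "S b \<le> s" unfolding s_def using B(1) b by (intro Max_ge) auto
    then show "b \<in> flag_at M A f s q" using S[OF b] flag_at_mono by blast
  qed
  then have "TS q \<subseteq> flag_at M A f s q"
    using tvec.span_minimal[OF _ flag_at_subspace] B(4) by metis
  then have "flag_at M A f s q = TS q" using flag_at_tangent[OF q] by blast
  then have "flag_dim M A f s q = CARD('n)" by (simp add: flag_dim_def tangent_dim_mfd[OF q])
  then have "\<forall>p\<in>topspace M. flag_dim M A f s p = CARD('n)"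
    using E q unfolding equiregular_def by metis
  then have "\<forall>p\<in>topspace M. flag_at M A f s p = TS p"
    using subspace_full_dim[OF _ flag_at_subspace flag_at_tangent] by (simp add: flag_dim_def)
  then have "\<forall>p\<in>topspace M. flag_at M A f (nonholonomy_degree M A f) p = TS p"
    unfolding nonholonomy_degree_def by (rule LeastI)
  with q show ?thesis by blast
qed

end

locale chart_family = coord_chart M A U z + smooth_family M A f
  for M :: "'a topology" and A :: "('a, 'n::finite) chart set" and U z and f :: "'m::finite \<Rightarrow> 'a vfield"
begin

text \<open>The j-th coordinate vector at q is the value of a field in the r-th flag; the
  coefficients of that field, evaluated at q, are the real numbers \<open>g j I\<close> with which
  steering works later. The bound \<open>1 \<le> r\<close> holds because there is at least one
  coordinate: for r = 0 the Kronecker delta would be an empty sum.\<close>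

lemma brackets_span:
  assumes "hormander M A f" "equiregular M A f" and q: "q \<in> U" and r: "r = nonholonomy_degree M A f"
  shows "1 \<le> r"
    and "\<exists>g. \<forall>j l. (\<Sum>I\<in>words_upto r. g j I * brk I (\<lambda>x. z x $ l) q) = (if l = j then 1 else (0::real))"
proof -
  have F: "flag_at M A f r q = TS q"
    using nonholonomy_degree_flag[OF assms(1,2) U_top[OF q]] r by simp
  have "\<exists>g. \<forall>l. (\<Sum>I\<in>words_upto r. g I * brk I (\<lambda>x. z x $ l) q) = (if l = j then 1 else (0::real))" for j
  proof -
    have "cvec q j \<in> flag_at M A f r q" using cvec_tangent[OF q] F by simp
    then obtain X where X: "X \<in> flag M A f r" "cvec q j = X q" unfolding flag_at_def by auto
    obtain g where g: "\<forall>p a. near p a \<longrightarrow> X p a = (\<Sum>I\<in>words_upto r. g I p * brk I a p)"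
      using flag_represented[OF X(1)] unfolding represented_def by blast
    show ?thesis
      by (rule exI[of _ "\<lambda>I. g I q"]) (simp add: g[rule_format, OF near_z[OF q], symmetric] X(2)[symmetric] cvec_z[OF q])
  qed
  then show ex: "\<exists>g. \<forall>j l. (\<Sum>I\<in>words_upto r. g j I * brk I (\<lambda>x. z x $ l) q) = (if l = j then 1 else (0::real))"
    by metis
  show "1 \<le> r"
  proof (rule ccontr)
    assume "\<not> 1 \<le> r"
    then have "r = 0" by simp
    with ex have "\<forall>j l :: 'n. (if l = j then 1 else 0) = (0::real)" by (auto simp: words_upto_0)
    from this[rule_format, of undefined undefined] show False by simp
  qed
qed

end

section \<open>Noncommutative power series\<close>

text \<open>Formal series in noncommuting letters, given by their coefficients on words. A separate
  type is used because the product is the convolution over all splittings of a word, whereas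
  \<open>*\<close> on functions is pointwise.\<close>

typedef 'm ncseries = "UNIV :: ('m list \<Rightarrow> real) set" morphisms nc_coeff NCSeries ..

setup_lifting type_definition_ncseries

lemma ncseries_eqI: "(\<And>w. nc_coeff a w = nc_coeff b w) \<Longrightarrow> a = b"
  by transfer (rule ext)

text \<open>Both sides sum over the ways of cutting w into three consecutive pieces; the two cut
  positions are reindexed by the first position and the length of the middle piece.\<close>

lemma nc_convolution_assoc:
  fixes a b c :: "'m list \<Rightarrow> real"
  shows "(\<Sum>k\<le>length w. (\<Sum>j\<le>length (take k w). a (take j (take k w)) * b (drop j (take k w))) * c (drop k w)) =
    (\<Sum>j\<le>length w. a (take j w) * (\<Sum>i\<le>length (drop j w). b (take i (drop j w)) * c (drop i (drop j w))))"
proof -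
  have "(\<Sum>k\<le>length w. (\<Sum>j\<le>length (take k w). a (take j (take k w)) * b (drop j (take k w))) * c (drop k w)) =
     (\<Sum>k\<le>length w. \<Sum>j\<le>k. a (take j w) * b (take (k - j) (drop j w)) * c (drop k w))"
    by (rule sum.cong[OF refl]) (auto simp: sum_distrib_right min_def drop_take intro!: sum.cong)
  also have "\<dots> = (\<Sum>(k,j)\<in>(SIGMA k:{..length w}. {..k}). a (take j w) * b (take (k - j) (drop j w)) * c (drop k w))"
    by (rule sum.Sigma) auto
  also have "\<dots> = (\<Sum>(j,i)\<in>(SIGMA j:{..length w}. {..length w - j}). a (take j w) * b (take i (drop j w)) * c (drop (i + j) w))"
    by (rule sum.reindex_bij_witness[of _ "\<lambda>(j,i). (i + j, j)" "\<lambda>(k,j). (j, k - j)"]) auto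
  also have "\<dots> = (\<Sum>j\<le>length w. \<Sum>i\<le>length w - j. a (take j w) * b (take i (drop j w)) * c (drop (i + j) w))"
    by (rule sum.Sigma[symmetric]) auto
  also have "\<dots> = (\<Sum>j\<le>length w. a (take j w) * (\<Sum>i\<le>length (drop j w). b (take i (drop j w)) * c (drop i (drop j w))))"
    by (rule sum.cong[OF refl]) (simp add: sum_distrib_left mult.assoc)
  finally show ?thesis .
qed

instantiation ncseries :: (type) ring_1
begin

lift_definition zero_ncseries :: "'a ncseries" is "\<lambda>w. 0" .
lift_definition one_ncseries :: "'a ncseries" is "\<lambda>w. if w = [] then 1 else 0" .
lift_definition plus_ncseries :: "'a ncseries \<Rightarrow> 'a ncseries \<Rightarrow> 'a ncseries" is "\<lambda>a b w. a w + b w" .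
lift_definition minus_ncseries :: "'a ncseries \<Rightarrow> 'a ncseries \<Rightarrow> 'a ncseries" is "\<lambda>a b w. a w - b w" .
lift_definition uminus_ncseries :: "'a ncseries \<Rightarrow> 'a ncseries" is "\<lambda>a w. - a w" .
lift_definition times_ncseries :: "'a ncseries \<Rightarrow> 'a ncseries \<Rightarrow> 'a ncseries" is
  "\<lambda>a b w. \<Sum>k\<le>length w. a (take k w) * b (drop k w)" .

instance
proof
  fix a b c :: "'a ncseries"
  show "a * b * c = a * (b * c)"
    by transfer (rule ext, rule nc_convolution_assoc)
  show "1 * a = a"
  proof (transfer, rule ext)
    fix a :: "'a list \<Rightarrow> real" and w
    have "(\<Sum>k\<le>length w. (if take k w = [] then 1 else 0) * a (drop k w)) = (\<Sum>k\<le>length w. if k = 0 then a w else 0)"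
      by (rule sum.cong) auto
    then show "(\<Sum>k\<le>length w. (if take k w = [] then 1 else 0) * a (drop k w)) = a w" by simp
  qed
  show "a * 1 = a"
  proof (transfer, rule ext)
    fix a :: "'a list \<Rightarrow> real" and w
    have "(\<Sum>k\<le>length w. a (take k w) * (if drop k w = [] then 1 else 0)) = (\<Sum>k\<le>length w. if k = length w then a w else 0)"
      by (rule sum.cong) auto
    then show "(\<Sum>k\<le>length w. a (take k w) * (if drop k w = [] then 1 else 0)) = a w" by simp
  qed
  show "(a + b) * c = a * c + b * c"
    by transfer (rule ext, simp add: distrib_right sum.distrib)
  show "a * (b + c) = a * b + a * c"
    by transfer (rule ext, simp add: distrib_left sum.distrib)
  show "(0::'a ncseries) \<noteq> 1"
    by transfer (auto simp: fun_eq_iff)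
qed (transfer; simp add: fun_eq_iff)+

end

lemma nc_coeff_simps [simp]:
  "nc_coeff 0 w = 0" "nc_coeff 1 w = (if w = [] then 1 else 0)"
  "nc_coeff (a + b) w = nc_coeff a w + nc_coeff b w"
  "nc_coeff (a - b) w = nc_coeff a w - nc_coeff b w"
  "nc_coeff (- a) w = - nc_coeff a w"
  by (transfer; simp)+

lemma nc_coeff_mult: "nc_coeff (a * b) w = (\<Sum>k\<le>length w. nc_coeff a (take k w) * nc_coeff b (drop k w))"
  by transfer simp

text \<open>The algebraic counterpart of an error of size \<open>\<tau> ^ n\<close>: in
  \<open>run_expansion\<close> a word w carries the factor \<open>\<tau> ^ length w\<close>.\<close>

definition order_ge :: "nat \<Rightarrow> 'm ncseries \<Rightarrow> bool" where
  "order_ge n a \<longleftrightarrow> (\<forall>w. length w < n \<longrightarrow> nc_coeff a w = 0)"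

lemma order_ge_mono: "order_ge n a \<Longrightarrow> m \<le> n \<Longrightarrow> order_ge m a"
  by (simp add: order_ge_def)

lemma order_ge_0: "order_ge 0 a"
  by (simp add: order_ge_def)

lemma order_ge_add: "order_ge n a \<Longrightarrow> order_ge n b \<Longrightarrow> order_ge n (a + b)"
  by (simp add: order_ge_def)

lemma order_ge_diff: "order_ge n a \<Longrightarrow> order_ge n b \<Longrightarrow> order_ge n (a - b)"
  by (simp add: order_ge_def)

lemma order_ge_mult:
  assumes "order_ge n a" "order_ge m b" shows "order_ge (n + m) (a * b)"
  unfolding order_ge_def nc_coeff_mult
proof (intro allI impI sum.neutral ballI)
  fix w :: "'a list" and k assume w: "length w < n + m" and k: "k \<in> {..length w}"
  show "nc_coeff a (take k w) * nc_coeff b (drop k w) = 0"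
  proof (cases "k < n")
    case True
    then have "nc_coeff a (take k w) = 0" using assms(1) k by (simp add: order_ge_def)
    then show ?thesis by simp
  next
    case False
    then have "length (drop k w) < m" using w k by auto
    then have "nc_coeff b (drop k w) = 0" using assms(2) unfolding order_ge_def by blast
    then show ?thesis by simp
  qed
qed

lemma order_ge_mult_left: "order_ge n a \<Longrightarrow> order_ge n (a * b)"
  using order_ge_mult[OF _ order_ge_0, of n a b] by simp

definition homogeneous :: "nat \<Rightarrow> 'm ncseries \<Rightarrow> bool" where
  "homogeneous n a \<longleftrightarrow> (\<forall>w. length w \<noteq> n \<longrightarrow> nc_coeff a w = 0)"

lemma homogeneous_order_ge: "homogeneous n a \<Longrightarrow> order_ge n a"
  by (simp add: homogeneous_def order_ge_def)

lemma homogeneous_mult: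
  assumes "homogeneous n a" "homogeneous m b" shows "homogeneous (n + m) (a * b)"
  unfolding homogeneous_def nc_coeff_mult
proof (intro allI impI sum.neutral ballI)
  fix w :: "'a list" and k assume w: "length w \<noteq> n + m" and k: "k \<in> {..length w}"
  show "nc_coeff a (take k w) * nc_coeff b (drop k w) = 0"
  proof (cases "k = n")
    case False
    then have "nc_coeff a (take k w) = 0" using assms(1) k by (simp add: homogeneous_def)
    then show ?thesis by simp
  next
    case True
    then have "nc_coeff b (drop k w) = 0" using assms(2) w k by (simp add: homogeneous_def)
    then show ?thesis by simp
  qed
qed

section \<open>Exponentials of letters and their group commutators\<close>

definition letter :: "'m \<Rightarrow> 'm ncseries" where
  "letter i = NCSeries (\<lambda>w. if w = [i] then 1 else 0)"

lemma nc_coeff_letter: "nc_coeff (letter i) w = (if w = [i] then 1 else 0)"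
  by (simp add: letter_def NCSeries_inverse)

lemma homogeneous_letter: "homogeneous 1 (letter i)"
  by (auto simp: homogeneous_def nc_coeff_letter)

text \<open>The exponential series of \<sigma> times the letter i; it encodes the Taylor series of a
  function along the flow of the i-th field for time \<sigma>.\<close>

definition exp_letter :: "'m \<Rightarrow> real \<Rightarrow> 'm ncseries" where
  "exp_letter i \<sigma> = NCSeries (\<lambda>w. if w = replicate (length w) i then \<sigma> ^ length w / fact (length w) else 0)"

lemma nc_coeff_exp_letter:
  "nc_coeff (exp_letter i \<sigma>) w = (if w = replicate (length w) i then \<sigma> ^ length w / fact (length w) else 0)"
  by (simp add: exp_letter_def NCSeries_inverse)

lemma replicate_take_drop:
  assumes "k \<le> length w"
  shows "take k w = replicate k i \<and> drop k w = replicate (length w - k) i \<longleftrightarrow> w = replicate (length w) i"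
proof
  assume h: "take k w = replicate k i \<and> drop k w = replicate (length w - k) i"
  have "w = take k w @ drop k w" by simp
  also have "\<dots> = replicate (length w) i"
    using h assms by (metis replicate_add le_add_diff_inverse)
  finally show "w = replicate (length w) i" .
next
  assume h: "w = replicate (length w) i"
  show "take k w = replicate k i \<and> drop k w = replicate (length w - k) i"
    using assms arg_cong[OF h, of "take k"] arg_cong[OF h, of "drop k"] by (simp add: min_def)
qed

text \<open>On the n-th power of the letter i the coefficient is the binomial expansion of the n-th
  power of \<sigma> - \<sigma>, divided by the factorial of n, hence 0 unless n = 0. Any other word
  cannot be split into two powers of i.\<close>

lemma exp_letter_inverse:
  fixes i :: 'm
  shows "exp_letter i \<sigma> * exp_letter i (- \<sigma>) = 1"
proof (rule ncseries_eqI)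
  fix w :: "'m list"
  let ?n = "length w"
  have t: "nc_coeff (exp_letter i \<sigma>) (take k w) * nc_coeff (exp_letter i (- \<sigma>)) (drop k w) =
     (if w = replicate ?n i then \<sigma> ^ k / fact k * ((- \<sigma>) ^ (?n - k) / fact (?n - k)) else 0)" if "k \<le> ?n" for k
    using replicate_take_drop[OF that, of i] that by (auto simp: nc_coeff_exp_letter min_def)
  show "nc_coeff (exp_letter i \<sigma> * exp_letter i (- \<sigma>)) w = nc_coeff 1 w"
  proof (cases "w = replicate ?n i")
    case True
    have "nc_coeff (exp_letter i \<sigma> * exp_letter i (- \<sigma>)) w =
        (\<Sum>k\<le>?n. \<sigma> ^ k / fact k * ((- \<sigma>) ^ (?n - k) / fact (?n - k)))"
      unfolding nc_coeff_mult using t True by (intro sum.cong) auto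
    also have "\<dots> = (\<Sum>k\<le>?n. of_nat (?n choose k) * \<sigma> ^ k * (- \<sigma>) ^ (?n - k) / fact ?n)"
      by (rule sum.cong) (auto simp: binomial_fact field_simps)
    also have "\<dots> = (\<Sum>k\<le>?n. of_nat (?n choose k) * \<sigma> ^ k * (- \<sigma>) ^ (?n - k)) / fact ?n"
      by (simp add: sum_divide_distrib)
    also have "\<dots> = (\<sigma> + - \<sigma>) ^ ?n / fact ?n"
      by (subst binomial_ring) simp
    also have "\<dots> = nc_coeff 1 w" by (simp add: power_0_left)
    finally show ?thesis .
  next
    case False
    then have "w \<noteq> []" by auto
    moreover have "nc_coeff (exp_letter i \<sigma> * exp_letter i (- \<sigma>)) w = 0"
      unfolding nc_coeff_mult using t False by (intro sum.neutral) simp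
    ultimately show ?thesis by simp
  qed
qed

text \<open>The leftmost factor belongs to the flow that is run first: pulling a function back along
  the composite makes the first flow the outermost operator, in agreement with
  \<open>iterated_derivative\<close>, which applies the head of a word last.\<close>

fun series_of :: "('m \<times> real) list \<Rightarrow> 'm ncseries" where
  "series_of [] = 1"
| "series_of ((i, \<sigma>) # L) = exp_letter i \<sigma> * series_of L"

definition reversal :: "('m \<times> real) list \<Rightarrow> ('m \<times> real) list" where
  "reversal L = rev (map (\<lambda>(i, \<sigma>). (i, - \<sigma>)) L)"

lemma series_of_append: "series_of (L @ L') = series_of L * series_of L'"
  by (induction L rule: series_of.induct) (auto simp: mult.assoc)

lemma series_of_reversal: "series_of L * series_of (reversal L) = 1"
proof (induction L rule: series_of.induct)
  case (2 i \<sigma> L)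
  have "series_of ((i, \<sigma>) # L) * series_of (reversal ((i, \<sigma>) # L)) =
      exp_letter i \<sigma> * (series_of L * series_of (reversal L)) * exp_letter i (- \<sigma>)"
    by (simp add: reversal_def series_of_append mult.assoc)
  then show ?case using 2 by (simp add: exp_letter_inverse)
qed (simp add: reversal_def)

lemma order_ge_series_of: "order_ge 1 (series_of L - 1)"
proof -
  have "nc_coeff (series_of L) [] = 1"
    by (induction L rule: series_of.induct) (auto simp: nc_coeff_mult nc_coeff_exp_letter)
  then show ?thesis by (simp add: order_ge_def)
qed

text \<open>The group commutator of the path for I with the flow of the letter j, with all times
  \<plusminus>1; the parameter \<tau> enters through \<open>scale\<close>. The order of the factors
  matches \<open>bracket_series\<close>, so that the leading term is the bracket with its own
  sign.\<close>

fun commutator_path :: "'m list \<Rightarrow> ('m \<times> real) list" where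
  "commutator_path [] = []"
| "commutator_path [j] = [(j, 1)]"
| "commutator_path (j # I) = commutator_path I @ [(j, 1)] @ reversal (commutator_path I) @ [(j, - 1)]"

fun bracket_series :: "'m list \<Rightarrow> 'm ncseries" where
  "bracket_series [] = 0"
| "bracket_series [j] = letter j"
| "bracket_series (j # I) = bracket_series I * letter j - letter j * bracket_series I"

lemma bracket_series_Cons:
  "I \<noteq> [] \<Longrightarrow> bracket_series (j # I) = bracket_series I * letter j - letter j * bracket_series I"
  by (cases I) auto

lemma commutator_path_Cons:
  "I \<noteq> [] \<Longrightarrow> commutator_path (j # I) = commutator_path I @ [(j, 1)] @ reversal (commutator_path I) @ [(j, - 1)]"
  by (cases I) auto

lemma homogeneous_bracket_series: "I \<noteq> [] \<Longrightarrow> homogeneous (length I) (bracket_series I)"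
proof (induction I)
  case (Cons j I)
  show ?case
  proof (cases "I = []")
    case True
    then show ?thesis using homogeneous_letter[of j] by simp
  next
    case False
    with Cons have "homogeneous (length I) (bracket_series I)" by simp
    from homogeneous_mult[OF this homogeneous_letter[of j]] homogeneous_mult[OF homogeneous_letter[of j] this] False
    show ?thesis by (simp add: bracket_series_Cons homogeneous_def)
  qed
qed simp

lemma exp_letter_expand: "order_ge 2 (exp_letter j 1 - 1 - letter j)"
  unfolding order_ge_def
proof (intro allI impI)
  fix w :: "'a list" assume "length w < 2"
  then consider "w = []" | i where "w = [i]" by (cases w; cases "tl w") auto
  then show "nc_coeff (exp_letter j 1 - 1 - letter j) w = 0"
    by cases (auto simp: nc_coeff_exp_letter nc_coeff_letter)
qed

text \<open>From \<open>PQ - QP = (P - 1)(Q - 1) - (Q - 1)(P - 1)\<close>, the commutator of \<open>1 + B + \<dots>\<close> and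
  \<open>1 + X + \<dots>\<close> is \<open>1 + (BX - XB) + \<dots>\<close>.\<close>

lemma series_of_commutator_path:
  "I \<noteq> [] \<Longrightarrow> order_ge (Suc (length I)) (series_of (commutator_path I) - 1 - bracket_series I)"
proof (induction I)
  case (Cons j I)
  show ?case
  proof (cases "I = []")
    case True
    then show ?thesis using exp_letter_expand[of j] by (simp add: numeral_2_eq_2)
  next
    case False
    define n P P' Q Q' B X where defs: "n = length I" "P = series_of (commutator_path I)"
      "P' = series_of (reversal (commutator_path I))" "Q = exp_letter j 1" "Q' = exp_letter j (- 1)"
      "B = bracket_series I" "X = letter j"
    define h k where hk: "h = P - 1 - B" "k = Q - 1 - X"
    have h: "order_ge (Suc n) h" using Cons.IH[OF False] by (simp add: defs hk)
    have k: "order_ge 2 k" using exp_letter_expand[of j] by (simp add: defs hk)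
    have B: "order_ge n B" using homogeneous_order_ge[OF homogeneous_bracket_series[OF False]] by (simp add: defs)
    have X: "order_ge 1 X" using homogeneous_order_ge[OF homogeneous_letter[of j]] by (simp add: defs)
    have PP: "P * P' = 1" unfolding defs by (rule series_of_reversal)
    have QQ: "Q * Q' = 1" unfolding defs by (rule exp_letter_inverse)
    define C where "C = B * X - X * B"
    define e where "e = (B * k + h * X + h * k) - (X * h + k * B + k * h)"
    have C: "order_ge (Suc n) C"
      unfolding C_def using order_ge_mult[OF B X] order_ge_mult[OF X B] by (simp add: order_ge_diff)
    have e: "order_ge (Suc (Suc n)) e"
    proof -
      have "order_ge (Suc (Suc n)) (B * k)" "order_ge (Suc (Suc n)) (k * B)"
        using order_ge_mult[OF B k] order_ge_mult[OF k B] by simp_all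
      moreover have "order_ge (Suc (Suc n)) (h * X)" "order_ge (Suc (Suc n)) (X * h)"
        using order_ge_mult[OF h X] order_ge_mult[OF X h] by simp_all
      moreover have "order_ge (Suc (Suc n)) (h * k)" "order_ge (Suc (Suc n)) (k * h)"
        using order_ge_mult[OF h k] order_ge_mult[OF k h] by (auto elim: order_ge_mono)
      ultimately show ?thesis unfolding e_def by (intro order_ge_diff order_ge_add)
    qed
    have PQ: "P * Q - Q * P = C + e"
    proof -
      have "P = 1 + B + h" "Q = 1 + X + k" by (simp_all add: hk)
      then show ?thesis by (simp add: C_def e_def algebra_simps)
    qed
    have "series_of (commutator_path (j # I)) = P * Q * P' * Q'"
      using False by (simp add: commutator_path_Cons series_of_append defs mult.assoc)
    \<comment> \<open>Adding and subtracting \<open>Q * P * P' * Q'\<close>, which is 1, turns the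
      group commutator into the ring commutator times \<open>P' * Q'\<close>.\<close>
    also have "\<dots> = (P * Q - Q * P) * (P' * Q') + Q * (P * P') * Q'"
      by (simp add: algebra_simps)
    also have "\<dots> = (C + e) * (P' * Q') + 1" unfolding PQ PP by (simp add: QQ)
    \<comment> \<open>\<open>P' * Q'\<close> differs from 1 in order at least 1, so after C, of
      order at least \<open>Suc n\<close>, it may be replaced by 1; the term with e already has the
      required order.\<close>
    finally have eq: "series_of (commutator_path (j # I)) - 1 - bracket_series (j # I) = C * (P' * Q' - 1) + e * (P' * Q')"
      using False by (simp add: bracket_series_Cons C_def defs algebra_simps)
    have "order_ge 1 (P' * Q' - 1)"
    proof -
      have "P' * Q' = series_of (reversal (commutator_path I) @ [(j, - 1)])"
        by (simp add: series_of_append defs)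
      then show ?thesis using order_ge_series_of by metis
    qed
    then have "order_ge (Suc (Suc n)) (C * (P' * Q' - 1))"
      using order_ge_mult[OF C] by fastforce
    from order_ge_add[OF this order_ge_mult_left[OF e]] show ?thesis
      unfolding eq by (simp add: defs(1))
  qed
qed simp

text \<open>The inverse of 1 + B + ... is 1 - B + .... Negative coefficients rely on the reversed
  path, because changing the sign of \<tau> leaves \<open>\<tau> ^ n\<close> unchanged when n is
  even.\<close>

lemma series_of_reversal_commutator_path:
  assumes "I \<noteq> []"
  shows "order_ge (Suc (length I)) (series_of (reversal (commutator_path I)) - 1 + bracket_series I)"
proof -
  define n P P' B where defs: "n = length I" "P = series_of (commutator_path I)"
    "P' = series_of (reversal (commutator_path I))" "B = bracket_series I"
  have h: "order_ge (Suc n) (P - 1 - B)" using series_of_commutator_path[OF assms] by (simp add: defs)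
  have B: "order_ge n B" using homogeneous_order_ge[OF homogeneous_bracket_series[OF assms]] by (simp add: defs)
  have "P * P' = 1" unfolding defs by (rule series_of_reversal)
  then have "P' - 1 + B = (0 - B * (P' - 1)) - (P - 1 - B) * P'" by (simp add: algebra_simps)
  moreover have "order_ge (Suc n) (B * (P' - 1))"
    using order_ge_mult[OF B order_ge_series_of[of "reversal (commutator_path I)"]] by (simp add: defs)
  moreover have "order_ge (Suc n) 0" by (simp add: order_ge_def)
  ultimately show ?thesis
    using order_ge_diff order_ge_mult_left[OF h] by (metis defs)
qed

lemma nc_coeff_mult_letter:
  "nc_coeff (a * letter j) w = (if w \<noteq> [] \<and> last w = j then nc_coeff a (butlast w) else 0)"
proof (cases w rule: rev_cases)
  case Nil
  then show ?thesis by (simp add: nc_coeff_mult nc_coeff_letter)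
next
  case (snoc u x)
  have "nc_coeff (a * letter j) w = (\<Sum>k\<le>length w. if k = length u then (if x = j then nc_coeff a u else 0) else 0)"
    unfolding nc_coeff_mult
  proof (rule sum.cong[OF refl])
    fix k assume k: "k \<in> {..length w}"
    show "nc_coeff a (take k w) * nc_coeff (letter j) (drop k w) = (if k = length u then (if x = j then nc_coeff a u else 0) else 0)"
    proof (cases "k = length u")
      case True
      then show ?thesis using snoc by (simp add: nc_coeff_letter)
    next
      case False
      then have "length (drop k w) \<noteq> 1" using k snoc by auto
      then have "drop k w \<noteq> [j]" by (intro notI) (drule arg_cong[of _ _ length], simp)
      then show ?thesis using False by (simp add: nc_coeff_letter)
    qed
  qed
  then show ?thesis using snoc by simp
qed

lemma nc_coeff_letter_mult:
  "nc_coeff (letter j * a) w = (if w \<noteq> [] \<and> hd w = j then nc_coeff a (tl w) else 0)"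
proof (cases w)
  case Nil
  then show ?thesis by (simp add: nc_coeff_mult nc_coeff_letter)
next
  case (Cons x u)
  have "nc_coeff (letter j * a) w = (\<Sum>k\<le>length w. if k = 1 then (if x = j then nc_coeff a u else 0) else 0)"
    unfolding nc_coeff_mult
  proof (rule sum.cong[OF refl])
    fix k assume k: "k \<in> {..length w}"
    show "nc_coeff (letter j) (take k w) * nc_coeff a (drop k w) = (if k = 1 then (if x = j then nc_coeff a u else 0) else 0)"
    proof (cases "k = 1")
      case True
      then show ?thesis using Cons by (simp add: nc_coeff_letter)
    next
      case False
      then have "length (take k w) \<noteq> 1" using k Cons by auto
      then have "take k w \<noteq> [j]" by (intro notI) (drule arg_cong[of _ _ length], simp)
      then show ?thesis using False by (simp add: nc_coeff_letter)
    qed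
  qed
  then show ?thesis using Cons by (simp add: Suc_le_eq del: sum.atMost_Suc)
qed

lemma finite_words_length [simp]: "finite {w :: 'm::finite list. length w = n}"
  using finite_lists_length_eq[of "UNIV :: 'm set" n] by simp

lemma finite_words_less [simp]: "finite {w :: 'm::finite list. length w < n}"
  by (rule finite_subset[OF _ finite_lists_length_le[of "UNIV :: 'm set" n]]) auto

lemma sum_mult_letter:
  fixes \<phi> :: "'m::finite list \<Rightarrow> real"
  shows "(\<Sum>w | length w = Suc n. nc_coeff (a * letter j) w * \<phi> w) = (\<Sum>u | length u = n. nc_coeff a u * \<phi> (u @ [j]))"
proof -
  have inj: "inj_on (\<lambda>u. u @ [j]) {u. length u = n}" by (auto simp: inj_on_def)
  have "(\<Sum>w | length w = Suc n. nc_coeff (a * letter j) w * \<phi> w) =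
      (\<Sum>w\<in>(\<lambda>u. u @ [j]) ` {u. length u = n}. nc_coeff (a * letter j) w * \<phi> w)"
  proof (rule sum.mono_neutral_right)
    show "\<forall>w\<in>{w. length w = Suc n} - (\<lambda>u. u @ [j]) ` {u. length u = n}. nc_coeff (a * letter j) w * \<phi> w = 0"
    proof
      fix w assume w: "w \<in> {w. length w = Suc n} - (\<lambda>u. u @ [j]) ` {u. length u = n}"
      then have "w \<noteq> []" by auto
      have "last w \<noteq> j"
      proof
        assume "last w = j"
        then have "w = butlast w @ [j]" using append_butlast_last_id[OF \<open>w \<noteq> []\<close>] by simp
        moreover have "length (butlast w) = n" using w by simp
        ultimately show False using w by blast
      qed
      then show "nc_coeff (a * letter j) w * \<phi> w = 0" by (simp add: nc_coeff_mult_letter)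
    qed
  qed auto
  also have "\<dots> = (\<Sum>u | length u = n. nc_coeff a u * \<phi> (u @ [j]))"
    by (simp add: sum.reindex[OF inj] nc_coeff_mult_letter)
  finally show ?thesis .
qed

lemma sum_letter_mult:
  fixes \<phi> :: "'m::finite list \<Rightarrow> real"
  shows "(\<Sum>w | length w = Suc n. nc_coeff (letter j * a) w * \<phi> w) = (\<Sum>u | length u = n. nc_coeff a u * \<phi> (j # u))"
proof -
  have inj: "inj_on (\<lambda>u. j # u) {u. length u = n}" by (auto simp: inj_on_def)
  have "(\<Sum>w | length w = Suc n. nc_coeff (letter j * a) w * \<phi> w) =
      (\<Sum>w\<in>(\<lambda>u. j # u) ` {u. length u = n}. nc_coeff (letter j * a) w * \<phi> w)"
  proof (rule sum.mono_neutral_right)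
    show "\<forall>w\<in>{w. length w = Suc n} - (\<lambda>u. j # u) ` {u. length u = n}. nc_coeff (letter j * a) w * \<phi> w = 0"
    proof
      fix w assume w: "w \<in> {w. length w = Suc n} - (\<lambda>u. j # u) ` {u. length u = n}"
      then obtain x u where "w = x # u" by (cases w) auto
      then show "nc_coeff (letter j * a) w * \<phi> w = 0" using w by (auto simp: nc_coeff_letter_mult)
    qed
  qed auto
  also have "\<dots> = (\<Sum>u | length u = n. nc_coeff a u * \<phi> (j # u))"
    by (simp add: sum.reindex[OF inj] nc_coeff_letter_mult)
  finally show ?thesis .
qed

lemma iterated_derivative_Nil [simp]: "iterated_derivative f [] a = a"
  by (simp add: iterated_derivative_def)

lemma iterated_derivative_Cons: "iterated_derivative f (i # w) a = (\<lambda>p. f i p (iterated_derivative f w a))"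
  by (simp add: iterated_derivative_def)

lemma iterated_derivative_append:
  "iterated_derivative f (u @ w) a = iterated_derivative f u (iterated_derivative f w a)"
  by (simp add: iterated_derivative_def)

lemma iterated_bracket_Cons:
  "I \<noteq> [] \<Longrightarrow> iterated_bracket f (j # I) a = (\<lambda>p. iterated_bracket f I (\<lambda>x. f j x a) p - f j p (iterated_bracket f I a))"
  by (cases I) auto

section \<open>Differential equations with Lipschitz constant 1/2 on the unit time interval\<close>

lemma ode_stability:
  fixes y z :: "real \<Rightarrow> 'a::euclidean_space"
  assumes y: "\<And>t. t \<in> {0..1} \<Longrightarrow> (y has_vector_derivative g (y t)) (at t within {0..1})"
    and z: "\<And>t. t \<in> {0..1} \<Longrightarrow> (z has_vector_derivative h (z t)) (at t within {0..1})"
    and lip: "\<And>x x'. norm (g x - g x') \<le> norm (x - x') / 2"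
    and gh: "\<And>x. norm (g x - h x) \<le> \<delta>" and t: "t \<in> {0..1}"
  shows "norm (y t - z t) \<le> 2 * (norm (y 0 - z 0) + \<delta>)"
proof -
  have cont: "continuous_on {0..1} (\<lambda>t. norm (y t - z t))"
    using y z by (intro continuous_intros continuous_on_vector_derivative) auto
  obtain s where s: "s \<in> {0..1}" "\<And>t. t \<in> {0..1} \<Longrightarrow> norm (y t - z t) \<le> norm (y s - z s)"
    using continuous_attains_sup[OF compact_Icc _ cont] by auto
  \<comment> \<open>The largest deviation. Lipschitz constant 1/2 and unit length bound it by
    \<open>norm (y 0 - z 0) + ?M / 2 + \<delta>\<close>, and the term \<open>?M / 2\<close> is
    absorbed on the left.\<close>
  let ?M = "norm (y s - z s)"
  have "norm ((\<lambda>t. y t - z t) s - (\<lambda>t. y t - z t) 0) \<le> (?M / 2 + \<delta>) * norm (s - 0)"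
  proof (rule differentiable_bound[of "{0..1}" _ "\<lambda>t c. c *\<^sub>R (g (y t) - h (z t))"])
    fix x :: real assume x: "x \<in> {0..1}"
    show "((\<lambda>t. y t - z t) has_derivative (\<lambda>c. c *\<^sub>R (g (y x) - h (z x)))) (at x within {0..1})"
      using has_vector_derivative_diff[OF y[OF x] z[OF x]] by (simp add: has_vector_derivative_def)
    have "norm (g (y x) - h (z x)) \<le> norm (g (y x) - g (z x)) + norm (g (z x) - h (z x))"
      using norm_triangle_ineq[of "g (y x) - g (z x)" "g (z x) - h (z x)"] by simp
    also have "\<dots> \<le> ?M / 2 + \<delta>" using lip[of "y x" "z x"] gh[of "z x"] s(2)[OF x] by linarith
    finally show "onorm (\<lambda>c. c *\<^sub>R (g (y x) - h (z x))) \<le> ?M / 2 + \<delta>"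
      by (subst onorm_scaleR_left) (auto simp: bounded_linear_ident onorm_id)
  qed (use s in auto)
  moreover have "norm (s - 0) \<le> 1" using s by auto
  moreover have "0 \<le> ?M / 2 + \<delta>" using gh[of 0] norm_ge_zero[of "g 0 - h 0"] norm_ge_zero[of "y s - z s"] by linarith
  ultimately have "norm ((y s - z s) - (y 0 - z 0)) \<le> ?M / 2 + \<delta>"
    using mult_left_le[of "norm (s - 0)" "?M / 2 + \<delta>"] by linarith
  moreover have "?M \<le> norm ((y s - z s) - (y 0 - z 0)) + norm (y 0 - z 0)"
    using norm_triangle_ineq[of "(y s - z s) - (y 0 - z 0)" "y 0 - z 0"] by simp
  ultimately have "?M \<le> 2 * (norm (y 0 - z 0) + \<delta>)" by argo
  with s(2)[OF t] show ?thesis by linarith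
qed

lemma ode_exists:
  fixes g :: "'a::euclidean_space \<Rightarrow> 'a"
  assumes lip: "\<And>x x'. norm (g x - g x') \<le> norm (x - x') / 2"
  shows "\<exists>y. y 0 = p \<and> (\<forall>t\<in>{0..1}. (y has_vector_derivative g (y t)) (at t within {0..1::real}))"
proof -
  have cg: "continuous_on UNIV g"
    by (rule lipschitz_on_continuous_on[of "1/2"]) (rule lipschitz_onI; use lip in \<open>simp add: dist_norm\<close>)
  define T where "T y t = p + integral {0..t} (\<lambda>s. g (apply_bcontfun y s))" for y :: "real \<Rightarrow>\<^sub>C 'a" and t
  \<comment> \<open>Clamping time to the unit interval turns the Picard iterate into a bounded
    continuous function on the whole line, so that Banach's fixed point theorem applies in the
    complete space of such functions; the contraction factor is 1/2.\<close>
  define c :: "real \<Rightarrow> real" where "c t = max 0 (min 1 t)" for t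
  have int: "(\<lambda>s. g (apply_bcontfun y s)) integrable_on {0..t}" for y :: "real \<Rightarrow>\<^sub>C 'a" and t
    by (intro integrable_continuous_real continuous_on_compose2[OF cg]) auto
  have cT: "continuous_on {0..1} (T y)" for y
    unfolding T_def by (intro continuous_intros indefinite_integral_continuous_1 int)
  have bc: "(\<lambda>t. T y (c t)) \<in> bcontfun" for y
  proof -
    have c: "continuous_on UNIV c" unfolding c_def by (intro continuous_intros)
    have "continuous_on UNIV (\<lambda>t. T y (c t))"
      by (rule continuous_on_compose2[OF cT c]) (auto simp: c_def)
    moreover have "bounded (T y ` {0..1})"
      by (intro compact_imp_bounded compact_continuous_image cT compact_Icc)
    then have "bounded (range (\<lambda>t. T y (c t)))"
      by (rule bounded_subset) (auto simp: c_def)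
    ultimately show ?thesis by (simp add: bcontfun_def)
  qed
  define S where "S y = Bcontfun (\<lambda>t. T y (c t))" for y
  have S: "apply_bcontfun (S y) t = T y (c t)" for y t
    unfolding S_def using bc by (simp add: Bcontfun_inverse)
  have "dist (S y) (S z) \<le> 1/2 * dist y z" for y z
  proof (rule dist_bound)
    fix t
    have ct: "0 \<le> c t" "c t \<le> 1" by (auto simp: c_def)
    have "dist (S y t) (S z t) = norm (integral {0..c t} (\<lambda>s. g (y s) - g (z s)))"
      unfolding S T_def using integral_diff[OF int int] by (simp add: dist_norm)
    also have "\<dots> \<le> dist y z / 2 * (c t - 0)"
    proof (rule integral_bound)
      show "norm (g (y s) - g (z s)) \<le> dist y z / 2" for s
        using lip[of "y s" "z s"] dist_bounded[of y s z] by (simp add: dist_norm)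
      show "continuous_on {0..c t} (\<lambda>s. g (y s) - g (z s))"
        by (intro continuous_intros continuous_on_compose2[OF cg]) auto
    qed (use ct in auto)
    also have "\<dots> \<le> 1/2 * dist y z" using ct mult_left_le[of "c t" "dist y z"] by simp
    finally show "dist (S y t) (S z t) \<le> 1/2 * dist y z" .
  qed
  then have "\<exists>!y. S y = y" by (intro banach_fix_type[of "1/2"]) auto
  then obtain y where y: "S y = y" by auto
  have yt: "y t = T y t" if "t \<in> {0..1}" for t
  proof -
    have "c t = t" using that by (simp add: c_def)
    then show ?thesis using S[of y t] by (simp add: y)
  qed
  have "(apply_bcontfun y has_vector_derivative g (y t)) (at t within {0..1})" if t: "t \<in> {0..1}" for t
  proof -
    have "((\<lambda>t. integral {0..t} (\<lambda>s. g (y s))) has_vector_derivative g (y t)) (at t within {0..1})"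
      by (rule integral_has_vector_derivative[OF _ t]) (intro continuous_on_compose2[OF cg]; auto)
    then have Ty: "(T y has_vector_derivative g (y t)) (at t within {0..1})"
      unfolding T_def by (auto intro!: derivative_eq_intros)
    show ?thesis
      by (rule has_vector_derivative_transform[of t "{0..1}" "apply_bcontfun y" "T y"]) (use t yt Ty in auto)
  qed
  moreover have "y 0 = p" using yt[of 0] by (simp add: T_def)
  ultimately show ?thesis by blast
qed

section \<open>Flows of the control system in coordinates\<close>

text \<open>Packaged as a \<open>vfield\<close> on the coordinate space, so that
  \<open>iterated_derivative\<close> and \<open>iterated_bracket\<close> are the same constants in
  coordinates and on the manifold.\<close>

definition directional :: "('m \<Rightarrow> 'a \<Rightarrow> 'a) \<Rightarrow> 'm \<Rightarrow> 'a::real_normed_vector vfield" where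
  "directional F i x a = frechet_derivative a (at x) (F i x)"

text \<open>The coordinate picture detached from the manifold: W stands for the image of the chart,
  e for the constant drift; B bounds the fields and L their Lipschitz constants on one closed
  ball.\<close>

locale control_fields =
  fixes W :: "(real ^ 'n::finite) set" and F :: "'m::finite \<Rightarrow> real ^ 'n \<Rightarrow> real ^ 'n"
    and R B L :: real and e :: "real ^ 'n"
  assumes open_W: "open W" and cball_W: "cball 0 R \<subseteq> W" and R_pos: "0 < R"
    and F_smooth: "\<And>i. smooth_on W (F i)"
    and F_bound: "\<And>i x. x \<in> cball 0 R \<Longrightarrow> norm (F i x) \<le> B"
    and F_lip: "\<And>i x y. x \<in> cball 0 R \<Longrightarrow> y \<in> cball 0 R \<Longrightarrow> norm (F i x - F i y) \<le> L * norm (x - y)"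
    and B_pos: "0 < B" and L_pos: "0 < L" and e_norm: "norm e \<le> 1"
begin

abbreviation D :: "'m \<Rightarrow> (real ^ 'n) vfield" where "D \<equiv> directional F"

lemma D_smooth: "smooth_on W a \<Longrightarrow> smooth_on W (\<lambda>x. D i x a)"
  unfolding directional_def by (rule smooth_on_frechet_derivative_field[OF open_W _ F_smooth])

lemma iterated_smooth: "smooth_on W a \<Longrightarrow> smooth_on W (iterated_derivative D w a)"
  by (induction w) (auto simp: iterated_derivative_Cons D_smooth)

lemma bracket_smooth: "smooth_on W a \<Longrightarrow> smooth_on W (iterated_bracket D I a)"
proof (induction I arbitrary: a)
  case (Cons j I)
  show ?case
  proof (cases "I = []")
    case True
    then show ?thesis using D_smooth[OF Cons.prems] by simp
  next
    case False
    have "smooth_on W (\<lambda>x. iterated_bracket D I (\<lambda>x. D j x a) x + (- 1) * D j x (iterated_bracket D I a))"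
      by (intro smooth_on_add[OF open_W] smooth_on_mult[OF open_W] smooth_on_const Cons.IH[OF D_smooth[OF Cons.prems]]
          D_smooth Cons.IH[OF Cons.prems])
    then show ?thesis using False by (simp add: iterated_bracket_Cons)
  qed
qed simp

lemma D_sum:
  assumes "finite S" "\<And>u. u \<in> S \<Longrightarrow> smooth_on W (a u)" "x \<in> W"
  shows "D j x (\<lambda>y. \<Sum>u\<in>S. c u * a u y) = (\<Sum>u\<in>S. c u * D j x (a u))"
proof -
  have "((\<lambda>y. \<Sum>u\<in>S. c u * a u y) has_derivative (\<lambda>v. \<Sum>u\<in>S. c u * frechet_derivative (a u) (at x) v)) (at x)"
    using assms by (intro has_derivative_sum has_derivative_mult_right smooth_on_has_derivative) auto
  then show ?thesis by (simp add: directional_def frechet_derivative_eqI)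
qed

lemma D_cong:
  assumes "smooth_on W a" "x \<in> W" "\<And>y. y \<in> W \<Longrightarrow> a y = b y"
  shows "D j x a = D j x b"
proof -
  have "(b has_derivative frechet_derivative a (at x)) (at x)"
    by (rule has_derivative_transform_within_open[OF smooth_on_has_derivative[OF assms(1,2)] open_W assms(2,3)])
  then show ?thesis by (simp add: directional_def frechet_derivative_eqI)
qed

text \<open>Words act by composition of derivations. A letter multiplied on the right differentiates
  a before the rest, a letter on the left after it; the difference is the recursion of
  \<open>iterated_bracket\<close>. By homogeneity only words of the full length occur.\<close>

lemma bracket_series_action:
  assumes "I \<noteq> []" "smooth_on W a" "x \<in> W"
  shows "(\<Sum>w | length w = length I. nc_coeff (bracket_series I) w * iterated_derivative D w a x) =
    iterated_bracket D I a x"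
  using assms
proof (induction I arbitrary: a x)
  case (Cons j I)
  show ?case
  proof (cases "I = []")
    case True
    have "(\<Sum>w | length w = 1. nc_coeff (letter j) w * iterated_derivative D w a x) =
        (\<Sum>w\<in>{w. length w = 1}. if w = [j] then D j x a else 0)"
      by (rule sum.cong) (auto simp: nc_coeff_letter iterated_derivative_Cons)
    then show ?thesis using True by simp
  next
    case False
    let ?b = "bracket_series I" and ?n = "length I"
    note IH = Cons.IH[OF False]
    have "(\<Sum>w | length w = Suc ?n. nc_coeff (?b * letter j - letter j * ?b) w * iterated_derivative D w a x) =
      (\<Sum>u | length u = ?n. nc_coeff ?b u * iterated_derivative D (u @ [j]) a x)
      - (\<Sum>u | length u = ?n. nc_coeff ?b u * iterated_derivative D (j # u) a x)"
      using sum_mult_letter[where n="?n" and a="?b" and j=j and \<phi>="\<lambda>w. iterated_derivative D w a x"]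
        sum_letter_mult[where n="?n" and a="?b" and j=j and \<phi>="\<lambda>w. iterated_derivative D w a x"]
      by (simp add: left_diff_distrib sum_subtractf)
    also have "(\<Sum>u | length u = ?n. nc_coeff ?b u * iterated_derivative D (u @ [j]) a x) =
        iterated_bracket D I (\<lambda>x. D j x a) x"
      using IH[OF D_smooth[OF Cons.prems(2)] Cons.prems(3)]
      by (simp add: iterated_derivative_append iterated_derivative_Cons)
    also have "(\<Sum>u | length u = ?n. nc_coeff ?b u * iterated_derivative D (j # u) a x) =
        D j x (\<lambda>y. \<Sum>u | length u = ?n. nc_coeff ?b u * iterated_derivative D u a y)"
      by (subst D_sum) (auto simp: iterated_derivative_Cons Cons.prems iterated_smooth)
    also have "\<dots> = D j x (iterated_bracket D I a)"
      by (rule D_cong[OF bracket_smooth[OF Cons.prems(2)] Cons.prems(3), symmetric])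
        (rule IH[OF Cons.prems(2), symmetric])
    finally show ?thesis using False by (simp add: bracket_series_Cons iterated_bracket_Cons)
  qed
qed simp

text \<open>Composing with the nearest-point projection extends the fields to globally Lipschitz ones.\<close>

definition G :: "'m \<Rightarrow> real ^ 'n \<Rightarrow> real ^ 'n" where
  "G i x = F i (closest_point (cball 0 R) x)"

lemma proj: "closest_point (cball 0 R) x \<in> cball 0 R"
  using R_pos by (intro closest_point_in_set) auto

lemma G_bound: "norm (G i x) \<le> B"
  unfolding G_def by (rule F_bound[OF proj])

lemma G_lip: "norm (G i x - G i y) \<le> L * norm (x - y)"
proof -
  have "norm (G i x - G i y) \<le> L * norm (closest_point (cball 0 R) x - closest_point (cball 0 R) y)"
    unfolding G_def by (rule F_lip[OF proj proj])
  also have "\<dots> \<le> L * norm (x - y)"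
    using closest_point_lipschitz[of "cball 0 R" x y] R_pos L_pos by (intro mult_left_mono) (auto simp: dist_norm)
  finally show ?thesis .
qed

lemma G_eq: "x \<in> cball 0 R \<Longrightarrow> G i x = F i x"
  by (simp add: G_def closest_point_self)

text \<open>Here \<open>\<eta>\<close> is the duration: time is rescaled to \<open>[0, 1]\<close>, so \<open>\<theta>\<close> stands for the constant control \<open>\<theta> / \<eta>\<close>.\<close>

definition field :: "real \<Rightarrow> 'm \<Rightarrow> real \<Rightarrow> real ^ 'n \<Rightarrow> real ^ 'n" where
  "field \<eta> i \<theta> x = \<eta> *\<^sub>R e + \<theta> *\<^sub>R G i x"

text \<open>Chosen with \<open>SOME\<close>, hence informative only where a solution is known to
  exist. The lemmas below assume \<open>\<bar>\<theta>\<bar> * L \<le> 1 / 2\<close>, which makes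
  \<open>field\<close> Lipschitz with constant 1/2, its drift term being constant in x.\<close>

definition traj :: "real \<Rightarrow> 'm \<Rightarrow> real \<Rightarrow> real ^ 'n \<Rightarrow> real \<Rightarrow> real ^ 'n" where
  "traj \<eta> i \<theta> p = (SOME y. y 0 = p \<and>
     (\<forall>t\<in>{0..1}. (y has_vector_derivative field \<eta> i \<theta> (y t)) (at t within {0..1})))"

definition step :: "real \<Rightarrow> 'm \<times> real \<Rightarrow> real ^ 'n \<Rightarrow> real ^ 'n" where
  "step \<eta> = (\<lambda>(i, \<theta>) p. traj \<eta> i \<theta> p 1)"

lemma field_lip:
  assumes "\<bar>\<theta>\<bar> * L \<le> 1 / 2" shows "norm (field \<eta> i \<theta> x - field \<eta> i \<theta> x') \<le> norm (x - x') / 2"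
proof -
  have "norm (field \<eta> i \<theta> x - field \<eta> i \<theta> x') = \<bar>\<theta>\<bar> * norm (G i x - G i x')"
    unfolding field_def norm_scaleR[symmetric] by (simp add: scaleR_diff_right)
  also have "\<dots> \<le> \<bar>\<theta>\<bar> * (L * norm (x - x'))" by (intro mult_left_mono G_lip) auto
  also have "\<dots> \<le> 1 / 2 * norm (x - x')"
    using assms by (simp only: mult.assoc[symmetric]) (intro mult_right_mono; simp)
  finally show ?thesis by simp
qed

lemma traj:
  assumes "\<bar>\<theta>\<bar> * L \<le> 1 / 2"
  shows "traj \<eta> i \<theta> p 0 = p"
    "t \<in> {0..1} \<Longrightarrow> (traj \<eta> i \<theta> p has_vector_derivative field \<eta> i \<theta> (traj \<eta> i \<theta> p t)) (at t within {0..1})"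
  using someI_ex[OF ode_exists[OF field_lip[OF assms], of p]] unfolding traj_def by auto

lemma field_norm: "norm (field \<eta> i \<theta> x) \<le> \<bar>\<eta>\<bar> + \<bar>\<theta>\<bar> * B"
proof -
  have "norm (field \<eta> i \<theta> x) \<le> \<bar>\<eta>\<bar> * norm e + \<bar>\<theta>\<bar> * norm (G i x)"
    unfolding field_def by (rule order_trans[OF norm_triangle_ineq]) simp
  also have "\<dots> \<le> \<bar>\<eta>\<bar> * 1 + \<bar>\<theta>\<bar> * B" by (intro add_mono mult_left_mono e_norm G_bound) auto
  finally show ?thesis by simp
qed

lemma traj_lip:
  assumes "\<bar>\<theta>\<bar> * L \<le> 1 / 2" "t \<in> {0..1}" "t' \<in> {0..1}"
  shows "norm (traj \<eta> i \<theta> p t - traj \<eta> i \<theta> p t') \<le> (\<bar>\<eta>\<bar> + \<bar>\<theta>\<bar> * B) * \<bar>t - t'\<bar>"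
proof -
  let ?y = "traj \<eta> i \<theta> p"
  have "norm (?y t - ?y t') \<le> (\<bar>\<eta>\<bar> + \<bar>\<theta>\<bar> * B) * norm (t - t')"
  proof (rule differentiable_bound[of "{0..1}" _ "\<lambda>s c. c *\<^sub>R field \<eta> i \<theta> (?y s)"])
    fix s :: real assume "s \<in> {0..1}"
    then show "(?y has_derivative (\<lambda>c. c *\<^sub>R field \<eta> i \<theta> (?y s))) (at s within {0..1})"
      using traj(2)[OF assms(1)] by (simp add: has_vector_derivative_def)
    show "onorm (\<lambda>c. c *\<^sub>R field \<eta> i \<theta> (?y s)) \<le> \<bar>\<eta>\<bar> + \<bar>\<theta>\<bar> * B"
      by (subst onorm_scaleR_left) (auto simp: bounded_linear_ident onorm_id field_norm)
  qed (use assms in auto)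
  then show ?thesis by simp
qed

lemma traj_dist:
  assumes "\<bar>\<theta>\<bar> * L \<le> 1 / 2" "t \<in> {0..1}"
  shows "norm (traj \<eta> i \<theta> p t - p) \<le> \<bar>\<eta>\<bar> + \<bar>\<theta>\<bar> * B"
proof -
  have "norm (traj \<eta> i \<theta> p t - p) \<le> (\<bar>\<eta>\<bar> + \<bar>\<theta>\<bar> * B) * \<bar>t\<bar>"
    using traj_lip[OF assms, of 0 \<eta> i p] traj(1)[OF assms(1)] by simp
  also have "\<dots> \<le> (\<bar>\<eta>\<bar> + \<bar>\<theta>\<bar> * B) * 1" using assms(2) B_pos by (intro mult_left_mono) auto
  finally show ?thesis by simp
qed

lemma step_dist: "\<bar>\<theta>\<bar> * L \<le> 1 / 2 \<Longrightarrow> norm (step \<eta> (i, \<theta>) p - p) \<le> \<bar>\<eta>\<bar> + \<bar>\<theta>\<bar> * B"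
  unfolding step_def by (simp add: traj_dist)

text \<open>The right-hand sides differ by a field with drift \<open>\<eta> - \<eta>'\<close> and
  control \<open>\<theta> - \<theta>'\<close>. For equal drift this yields continuity in the
  parameters, for equal control the comparison with the driftless motion.\<close>

lemma step_stable:
  assumes "\<bar>\<theta>\<bar> * L \<le> 1 / 2" "\<bar>\<theta>'\<bar> * L \<le> 1 / 2"
  shows "norm (step \<eta> (i, \<theta>) p - step \<eta>' (i, \<theta>') p') \<le> 2 * (norm (p - p') + (\<bar>\<eta> - \<eta>'\<bar> + \<bar>\<theta> - \<theta>'\<bar> * B))"
proof -
  have "norm (field \<eta> i \<theta> x - field \<eta>' i \<theta>' x) \<le> \<bar>\<eta> - \<eta>'\<bar> + \<bar>\<theta> - \<theta>'\<bar> * B" for x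
    using field_norm[of "\<eta> - \<eta>'" i "\<theta> - \<theta>'" x] by (simp add: field_def algebra_simps)
  from ode_stability[OF traj(2)[OF assms(1)] traj(2)[OF assms(2)] field_lip[OF assms(1)] this, of 1]
  show ?thesis unfolding step_def by (simp add: traj(1)[OF assms(1)] traj(1)[OF assms(2)])
qed

lemma step_0: "step 0 (i, 0) p = p"
  using step_dist[of 0 0 i p] by simp

end

section \<open>Expansion of composite flows\<close>

definition uniform_order :: "nat \<Rightarrow> 'p set \<Rightarrow> (real \<Rightarrow> 'p \<Rightarrow> real) \<Rightarrow> bool" where
  "uniform_order N Q err \<longleftrightarrow>
     (\<exists>K\<ge>0. \<exists>\<tau>0>0. \<forall>\<tau> p. 0 \<le> \<tau> \<and> \<tau> \<le> \<tau>0 \<and> p \<in> Q \<longrightarrow> err \<tau> p \<le> K * \<tau> ^ N)"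

lemma uniform_orderI:
  "0 \<le> K \<Longrightarrow> 0 < \<tau>0 \<Longrightarrow> (\<And>\<tau> p. 0 \<le> \<tau> \<Longrightarrow> \<tau> \<le> \<tau>0 \<Longrightarrow> p \<in> Q \<Longrightarrow> err \<tau> p \<le> K * \<tau> ^ N) \<Longrightarrow> uniform_order N Q err"
  unfolding uniform_order_def by blast

lemma uniform_orderE:
  assumes "uniform_order N Q err"
  obtains K \<tau>0 where "0 \<le> K" "0 < \<tau>0" "\<forall>\<tau> p. 0 \<le> \<tau> \<and> \<tau> \<le> \<tau>0 \<and> p \<in> Q \<longrightarrow> err \<tau> p \<le> K * \<tau> ^ N"
  using assms unfolding uniform_order_def by blast

lemma uniform_order_subst:
  assumes "uniform_order N Q err" "0 < \<tau>1"
    "\<And>\<tau> p. 0 \<le> \<tau> \<Longrightarrow> \<tau> \<le> \<tau>1 \<Longrightarrow> p \<in> Q' \<Longrightarrow> \<phi> \<tau> p \<in> Q \<and> err' \<tau> p \<le> err \<tau> (\<phi> \<tau> p)"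
  shows "uniform_order N Q' err'"
proof -
  obtain K \<tau>0 where K: "0 \<le> K" "0 < \<tau>0" "\<forall>\<tau> p. 0 \<le> \<tau> \<and> \<tau> \<le> \<tau>0 \<and> p \<in> Q \<longrightarrow> err \<tau> p \<le> K * \<tau> ^ N"
    using uniform_orderE[OF assms(1)] .
  show ?thesis
  proof (rule uniform_orderI[OF K(1), of "min \<tau>0 \<tau>1"])
    fix \<tau> p assume "0 \<le> \<tau>" "\<tau> \<le> min \<tau>0 \<tau>1" "p \<in> Q'"
    then have "\<phi> \<tau> p \<in> Q" "err' \<tau> p \<le> err \<tau> (\<phi> \<tau> p)" "err \<tau> (\<phi> \<tau> p) \<le> K * \<tau> ^ N"
      using assms(3)[of \<tau> p] K(3) by auto
    then show "err' \<tau> p \<le> K * \<tau> ^ N" by linarith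
  qed (use K assms in auto)
qed

lemma uniform_order_mono:
  "uniform_order N Q err \<Longrightarrow> 0 < \<tau>1 \<Longrightarrow> (\<And>\<tau> p. 0 \<le> \<tau> \<Longrightarrow> \<tau> \<le> \<tau>1 \<Longrightarrow> p \<in> Q \<Longrightarrow> err' \<tau> p \<le> err \<tau> p) \<Longrightarrow> uniform_order N Q err'"
  by (rule uniform_order_subst[where \<phi>="\<lambda>\<tau> p. p"]) auto

lemma uniform_order_zero: "uniform_order N Q (\<lambda>\<tau> p. 0)"
  by (rule uniform_orderI[of 0 1]) auto

lemma uniform_order_add:
  assumes "uniform_order N Q f" "uniform_order N Q g"
  shows "uniform_order N Q (\<lambda>\<tau> p. f \<tau> p + g \<tau> p)"
proof -
  obtain K \<tau>0 where K: "0 \<le> K" "0 < \<tau>0" "\<forall>\<tau> p. 0 \<le> \<tau> \<and> \<tau> \<le> \<tau>0 \<and> p \<in> Q \<longrightarrow> f \<tau> p \<le> K * \<tau> ^ N"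
    using uniform_orderE[OF assms(1)] .
  obtain K' \<tau>1 where K': "0 \<le> K'" "0 < \<tau>1" "\<forall>\<tau> p. 0 \<le> \<tau> \<and> \<tau> \<le> \<tau>1 \<and> p \<in> Q \<longrightarrow> g \<tau> p \<le> K' * \<tau> ^ N"
    using uniform_orderE[OF assms(2)] .
  show ?thesis
  proof (rule uniform_orderI[of "K + K'" "min \<tau>0 \<tau>1"])
    fix \<tau> p assume "0 \<le> \<tau>" "\<tau> \<le> min \<tau>0 \<tau>1" "p \<in> Q"
    then have "f \<tau> p \<le> K * \<tau> ^ N" "g \<tau> p \<le> K' * \<tau> ^ N" using K(3) K'(3) by auto
    then show "f \<tau> p + g \<tau> p \<le> (K + K') * \<tau> ^ N" by (simp add: distrib_right)
  qed (use K K' in auto)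
qed

lemma uniform_order_sum:
  "(\<And>i. i \<in> I \<Longrightarrow> uniform_order N Q (f i)) \<Longrightarrow> uniform_order N Q (\<lambda>\<tau> p. \<Sum>i\<in>I. f i \<tau> p)"
  by (induction I rule: infinite_finite_induct) (auto intro: uniform_order_zero uniform_order_add)

lemma uniform_order_mult:
  assumes "uniform_order N Q f" "0 \<le> c"
  shows "uniform_order (k + N) Q (\<lambda>\<tau> p. \<tau> ^ k * c * f \<tau> p)"
proof -
  obtain K \<tau>0 where K: "0 \<le> K" "0 < \<tau>0" "\<forall>\<tau> p. 0 \<le> \<tau> \<and> \<tau> \<le> \<tau>0 \<and> p \<in> Q \<longrightarrow> f \<tau> p \<le> K * \<tau> ^ N"
    using uniform_orderE[OF assms(1)] .
  show ?thesis
  proof (rule uniform_orderI[of "c * K" \<tau>0])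
    fix \<tau> p assume "0 \<le> \<tau>" "\<tau> \<le> \<tau>0" "p \<in> Q"
    then have "f \<tau> p \<le> K * \<tau> ^ N" "0 \<le> \<tau> ^ k * c" using K(3) assms(2) by auto
    then have "\<tau> ^ k * c * f \<tau> p \<le> \<tau> ^ k * c * (K * \<tau> ^ N)" by (rule mult_left_mono)
    then show "\<tau> ^ k * c * f \<tau> p \<le> c * K * \<tau> ^ (k + N)" by (simp add: power_add mult_ac)
  qed (use K assms in auto)
qed

text \<open>A pair (w, k) corresponds to the word v obtained by putting k letters i in front of w,
  together with the marked prefix length k. A word v occurs once for every prefix consisting of
  letters i, exactly as in the product with the exponential, and the bound on k becomes
  \<open>length v < N\<close>.\<close>

lemma exp_letter_mult_sum:
  fixes \<phi> :: "'m::finite list \<Rightarrow> real"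
  shows "(\<Sum>w | length w < N. \<Sum>k<N - length w.
      \<tau> ^ (length w + k) * nc_coeff S w * (\<sigma> ^ k / fact k) * \<phi> (replicate k i @ w)) =
    (\<Sum>v | length v < N. \<tau> ^ length v * nc_coeff (exp_letter i \<sigma> * S) v * \<phi> v)"
proof -
  let ?A = "SIGMA w:{w::'m list. length w < N}. {..<N - length w}"
  let ?B = "SIGMA v:{v::'m list. length v < N}. {j. j \<le> length v \<and> take j v = replicate j i}"
  have "(\<Sum>w | length w < N. \<Sum>k<N - length w.
      \<tau> ^ (length w + k) * nc_coeff S w * (\<sigma> ^ k / fact k) * \<phi> (replicate k i @ w)) =
      (\<Sum>(w,k)\<in>?A. \<tau> ^ (length w + k) * nc_coeff S w * (\<sigma> ^ k / fact k) * \<phi> (replicate k i @ w))"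
    by (rule sum.Sigma) auto
  also have "\<dots> = (\<Sum>(v,j)\<in>?B. \<tau> ^ length v * ((\<sigma> ^ j / fact j) * nc_coeff S (drop j v)) * \<phi> v)"
  proof (rule sum.reindex_bij_witness[of _ "\<lambda>(v,j). (drop j v, j)" "\<lambda>(w,k). (replicate k i @ w, k)"])
    fix b assume "b \<in> ?B"
    then obtain v j where b: "b = (v, j)" "length v < N" "j \<le> length v" "take j v = replicate j i" by auto
    then have "replicate j i @ drop j v = v" by (metis append_take_drop_id)
    then show "(\<lambda>(w,k). (replicate k i @ w, k)) ((\<lambda>(v,j). (drop j v, j)) b) = b" using b by simp
    show "(\<lambda>(v,j). (drop j v, j)) b \<in> ?A" using b by auto
  qed (auto simp: add.commute)
  also have "\<dots> = (\<Sum>v | length v < N. \<Sum>j | j \<le> length v \<and> take j v = replicate j i.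
      \<tau> ^ length v * ((\<sigma> ^ j / fact j) * nc_coeff S (drop j v)) * \<phi> v)"
    by (rule sum.Sigma[symmetric]) auto
  also have "\<dots> = (\<Sum>v | length v < N. \<tau> ^ length v * nc_coeff (exp_letter i \<sigma> * S) v * \<phi> v)"
  proof (rule sum.cong[OF refl])
    fix v :: "'m list"
    have "nc_coeff (exp_letter i \<sigma> * S) v =
        (\<Sum>j\<le>length v. if take j v = replicate j i then (\<sigma> ^ j / fact j) * nc_coeff S (drop j v) else 0)"
      unfolding nc_coeff_mult by (rule sum.cong) (auto simp: nc_coeff_exp_letter min_def)
    also have "\<dots> = (\<Sum>j | j \<le> length v \<and> take j v = replicate j i. (\<sigma> ^ j / fact j) * nc_coeff S (drop j v))"
      by (subst sum.inter_filter[symmetric]) (auto intro: sum.cong)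
    finally show "(\<Sum>j | j \<le> length v \<and> take j v = replicate j i.
      \<tau> ^ length v * ((\<sigma> ^ j / fact j) * nc_coeff S (drop j v)) * \<phi> v) = \<tau> ^ length v * nc_coeff (exp_letter i \<sigma> * S) v * \<phi> v"
      by (simp add: sum_distrib_left sum_distrib_right)
  qed
  finally show ?thesis .
qed

definition scale :: "real \<Rightarrow> ('m \<times> real) list \<Rightarrow> ('m \<times> real) list" where
  "scale \<tau> L = map (\<lambda>(i, \<sigma>). (i, \<tau> * \<sigma>)) L"

context control_fields
begin

lemma smooth_bounded: "smooth_on W a \<Longrightarrow> \<exists>K\<ge>0. \<forall>x\<in>cball 0 R. norm (a x) \<le> K" for a :: "_ \<Rightarrow> 'c::real_normed_vector"
proof -
  assume "smooth_on W a"
  then have "continuous_on (cball 0 R) a"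
    using smooth_on_continuous cball_W continuous_on_subset by blast
  then have "bounded (a ` cball 0 R)"
    by (intro compact_imp_bounded compact_continuous_image compact_cball)
  then obtain K where "\<forall>x\<in>cball 0 R. norm (a x) \<le> K" by (auto simp: bounded_iff)
  then show ?thesis by (intro exI[of _ "max K 0"]) (auto intro: max.coboundedI1)
qed

lemma small_time:
  assumes "\<rho> < R"
  obtains \<tau>0 where "0 < \<tau>0"
    "\<And>\<tau>. 0 \<le> \<tau> \<Longrightarrow> \<tau> \<le> \<tau>0 \<Longrightarrow> \<bar>\<tau> * \<sigma>\<bar> * L \<le> 1 / 2"
    "\<And>\<tau>. 0 \<le> \<tau> \<Longrightarrow> \<tau> \<le> \<tau>0 \<Longrightarrow> \<bar>\<tau> * \<sigma>\<bar> * B \<le> R - \<rho>"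
proof
  \<comment> \<open>The added 1 keeps the divisors below positive when \<sigma> = 0.\<close>
  let ?s = "\<bar>\<sigma>\<bar> + 1"
  define \<tau>0 where "\<tau>0 = min (1 / (2 * L * ?s)) ((R - \<rho>) / (B * ?s))"
  show "0 < \<tau>0" unfolding \<tau>0_def using assms L_pos B_pos by (auto intro!: divide_pos_pos mult_pos_pos)
  fix \<tau> assume \<tau>: "0 \<le> \<tau>" "\<tau> \<le> \<tau>0"
  have le: "\<bar>\<tau> * \<sigma>\<bar> \<le> \<tau> * ?s" using \<tau>(1) by (simp add: abs_mult mult_left_mono)
  have "\<tau> * (2 * L * ?s) \<le> 1"
    using \<tau>(2) L_pos unfolding \<tau>0_def by (simp add: pos_le_divide_eq)
  then have "\<tau> * ?s * L \<le> 1 / 2" by (simp add: algebra_simps)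
  moreover have "\<bar>\<tau> * \<sigma>\<bar> * L \<le> \<tau> * ?s * L" using le L_pos by (intro mult_right_mono) auto
  ultimately show "\<bar>\<tau> * \<sigma>\<bar> * L \<le> 1 / 2" by linarith
  have "\<tau> * (B * ?s) \<le> R - \<rho>"
    using \<tau>(2) B_pos unfolding \<tau>0_def by (simp add: pos_le_divide_eq)
  moreover have "\<bar>\<tau> * \<sigma>\<bar> * B \<le> \<tau> * ?s * B" using le B_pos by (intro mult_right_mono) auto
  ultimately show "\<bar>\<tau> * \<sigma>\<bar> * B \<le> R - \<rho>" by (simp add: mult_ac)
qed

lemma traj_in_cball:
  assumes "\<bar>\<theta>\<bar> * L \<le> 1 / 2" "t \<in> {0..1}" "norm p + (\<bar>\<eta>\<bar> + \<bar>\<theta>\<bar> * B) \<le> R"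
  shows "traj \<eta> i \<theta> p t \<in> cball 0 R"
proof -
  have "norm (traj \<eta> i \<theta> p t) \<le> norm p + norm (traj \<eta> i \<theta> p t - p)"
    using norm_triangle_ineq[of p "traj \<eta> i \<theta> p t - p"] by simp
  then show ?thesis using traj_dist[OF assms(1,2), of \<eta> i p] assms(3) by simp
qed

text \<open>Along the driftless trajectory the m-th time derivative of a is
  \<open>\<theta> ^ m\<close> times its m-fold derivative along the i-th field. Taylor's formula
  from time 0 to time 1 with integral remainder gives the claim; M bounds the N-th derivative on the
  ball that the trajectory does not leave.\<close>

lemma taylor_along_traj:
  assumes a: "smooth_on W a" and \<theta>: "\<bar>\<theta>\<bar> * L \<le> 1 / 2" and stay: "norm p + \<bar>\<theta>\<bar> * B \<le> R"
    and M: "\<And>x. x \<in> cball 0 R \<Longrightarrow> \<bar>iterated_derivative D (replicate N i) a x\<bar> \<le> M"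
  shows "\<bar>a (step 0 (i, \<theta>) p) - (\<Sum>k<N. \<theta> ^ k / fact k * iterated_derivative D (replicate k i) a p)\<bar> \<le> M * \<bar>\<theta>\<bar> ^ N"
proof -
  let ?y = "traj 0 i \<theta> p"
  have y: "?y t \<in> cball 0 R" if "t \<in> {0..1}" for t
    using traj_in_cball[OF \<theta> that, of p 0] stay by simp
  have step: "step 0 (i, \<theta>) p = ?y 1" by (simp add: step_def)
  show ?thesis
  \<comment> \<open>The integral remainder involves \<open>N - 1\<close>, so the case of an empty
    Taylor sum is separate.\<close>
  proof (cases "N = 0")
    case True
    then show ?thesis using M[OF y[of 1]] by (simp add: step)
  next
    case False
    define Df where "Df m t = \<theta> ^ m * iterated_derivative D (replicate m i) a (?y t)" for m t
    have Df: "(Df m has_vector_derivative Df (Suc m) t) (at t within {0..1})" if t: "0 \<le> t" "t \<le> 1" for m t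
    proof -
      let ?b = "iterated_derivative D (replicate m i) a"
      have yW: "?y t \<in> W" using y[of t] t cball_W by auto
      have db: "(?b has_derivative frechet_derivative ?b (at (?y t))) (at (?y t))"
        by (rule smooth_on_has_derivative[OF iterated_smooth[OF a] yW])
      have "((?b \<circ> ?y) has_vector_derivative frechet_derivative ?b (at (?y t)) (field 0 i \<theta> (?y t))) (at t within {0..1})"
        by (rule vector_derivative_diff_chain_within[OF traj(2)[OF \<theta>] has_derivative_at_withinI[OF db]]) (use t in auto)
      moreover have "frechet_derivative ?b (at (?y t)) (field 0 i \<theta> (?y t)) = \<theta> * D i (?y t) ?b"
        using linear_scale[OF has_derivative_linear[OF db]] G_eq[OF y[of t]] t by (simp add: field_def directional_def)
      ultimately have "((\<lambda>t. \<theta> ^ m * ?b (?y t)) has_vector_derivative \<theta> ^ m * (\<theta> * D i (?y t) ?b)) (at t within {0..1})"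
        by (simp add: o_def has_vector_derivative_mult_right)
      then show ?thesis
        by (simp add: Df_def[abs_def] iterated_derivative_Cons mult_ac)
    qed
    let ?i = "\<lambda>x. ((1 - x) ^ (N - 1) / fact (N - 1)) *\<^sub>R Df N x"
    have T: "Df 0 1 = (\<Sum>k<N. ((1 - 0) ^ k / fact k) *\<^sub>R Df k 0) + integral {0..1} ?i" "?i integrable_on {0..1}"
      using Taylor_integral[of N Df "Df 0" 0 1] Taylor_integrable[of N Df "Df 0" 0 1] Df False by auto
    have le: "norm (integral {0..1} ?i) \<le> integral {0..1} (\<lambda>x::real. M * \<bar>\<theta>\<bar> ^ N)"
    proof (rule integral_norm_bound_integral[OF T(2)])
      fix x :: real assume x: "x \<in> {0..1}"
      have "\<bar>(1 - x) ^ (N - 1) / fact (N - 1)\<bar> \<le> 1"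
      proof -
        have "(1 - x) ^ (N - 1) \<le> 1" using x by (intro power_le_one) auto
        moreover have "(1::real) \<le> fact (N - 1)" by (rule fact_ge_1)
        ultimately have "(1 - x) ^ (N - 1) \<le> fact (N - 1)" by linarith
        then show ?thesis using x by (simp add: divide_le_eq_1)
      qed
      then have "norm (?i x) \<le> 1 * \<bar>Df N x\<bar>"
        unfolding real_norm_def real_scaleR_def abs_mult by (intro mult_right_mono) auto
      also have "\<bar>Df N x\<bar> \<le> \<bar>\<theta>\<bar> ^ N * M"
        unfolding Df_def abs_mult power_abs by (intro mult_left_mono M y x) auto
      finally show "norm (?i x) \<le> M * \<bar>\<theta>\<bar> ^ N" by (simp add: mult.commute)
    qed auto
    have eq: "integral {0..1} ?i = a (step 0 (i, \<theta>) p) - (\<Sum>k<N. \<theta> ^ k / fact k * iterated_derivative D (replicate k i) a p)"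
      using T(1) by (simp add: Df_def step traj(1)[OF \<theta>] mult_ac)
    have "integral {0..1} (\<lambda>x::real. M * \<bar>\<theta>\<bar> ^ N) = M * \<bar>\<theta>\<bar> ^ N" by simp
    with le show ?thesis unfolding eq real_norm_def by linarith
  qed
qed

lemma step_expansion:
  assumes a: "smooth_on W a" and \<rho>: "\<rho> < R"
  shows "uniform_order N (cball 0 \<rho>) (\<lambda>\<tau> p. \<bar>a (step 0 (i, \<tau> * \<sigma>) p) -
    (\<Sum>k<N. (\<tau> * \<sigma>) ^ k / fact k * iterated_derivative D (replicate k i) a p)\<bar>)"
proof -
  obtain M where M: "0 \<le> M" "\<And>x. x \<in> cball 0 R \<Longrightarrow> \<bar>iterated_derivative D (replicate N i) a x\<bar> \<le> M"
    using smooth_bounded[OF iterated_smooth[OF a, of "replicate N i"]] by auto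
  obtain \<tau>0 where \<tau>0: "0 < \<tau>0" "\<And>\<tau>. 0 \<le> \<tau> \<Longrightarrow> \<tau> \<le> \<tau>0 \<Longrightarrow> \<bar>\<tau> * \<sigma>\<bar> * L \<le> 1 / 2"
    "\<And>\<tau>. 0 \<le> \<tau> \<Longrightarrow> \<tau> \<le> \<tau>0 \<Longrightarrow> \<bar>\<tau> * \<sigma>\<bar> * B \<le> R - \<rho>"
    using small_time[OF \<rho>] by blast
  show ?thesis
  proof (rule uniform_orderI[of "M * \<bar>\<sigma>\<bar> ^ N" \<tau>0])
    fix \<tau> and p :: "real ^ 'n" assume \<tau>: "0 \<le> \<tau>" "\<tau> \<le> \<tau>0" and p: "p \<in> cball 0 \<rho>"
    have "norm p + \<bar>\<tau> * \<sigma>\<bar> * B \<le> R" using \<tau>0(3)[OF \<tau>] p by simp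
    from taylor_along_traj[OF a \<tau>0(2)[OF \<tau>] this M(2)]
    show "\<bar>a (step 0 (i, \<tau> * \<sigma>) p) - (\<Sum>k<N. (\<tau> * \<sigma>) ^ k / fact k * iterated_derivative D (replicate k i) a p)\<bar>
        \<le> M * \<bar>\<sigma>\<bar> ^ N * \<tau> ^ N"
      using \<tau>(1) by (simp add: abs_mult power_mult_distrib mult_ac)
  qed (use M \<tau>0 in auto)
qed

fun run :: "real \<Rightarrow> ('m \<times> real) list \<Rightarrow> real ^ 'n \<Rightarrow> real ^ 'n" where
  "run \<eta> [] p = p"
| "run \<eta> (c # cs) p = run \<eta> cs (step \<eta> c p)"

lemma run_append: "run \<eta> (cs @ ds) p = run \<eta> ds (run \<eta> cs p)"
  by (induction cs arbitrary: p) auto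

text \<open>Induction on the list of flows. The tail is expanded at the point reached by the first
  flow; each derivative \<open>iterated_derivative D w a\<close> at that point is then expanded to
  order \<open>N - length w\<close>, and the factor \<open>\<tau> ^ length w\<close> supplies the
  missing orders.\<close>

lemma run_expansion:
  assumes "smooth_on W a" "\<rho> < R"
  shows "uniform_order N (cball 0 \<rho>) (\<lambda>\<tau> p. \<bar>a (run 0 (scale \<tau> S) p) -
    (\<Sum>w | length w < N. \<tau> ^ length w * nc_coeff (series_of S) w * iterated_derivative D w a p)\<bar>)"
  using assms(2)
proof (induction S arbitrary: \<rho>)
  case Nil
  have "(\<Sum>w | length w < N. \<tau> ^ length w * nc_coeff 1 w * iterated_derivative D w a p) = (if 0 < N then a p else 0)"
    for \<tau> p
  proof -
    have "(\<Sum>w | length w < N. \<tau> ^ length w * nc_coeff 1 w * iterated_derivative D w a p) =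
       (\<Sum>w :: 'm list | length w < N. if w = [] then a p else 0)"
      by (rule sum.cong) auto
    then show ?thesis by simp
  qed
  note eq = this
  obtain K where K: "0 \<le> K" "\<And>x. x \<in> cball 0 R \<Longrightarrow> \<bar>a x\<bar> \<le> K" using smooth_bounded[OF assms(1)] by auto
  show ?case
  proof (rule uniform_orderI[OF K(1) zero_less_one])
    fix \<tau> :: real and p :: "real ^ 'n" assume \<tau>: "0 \<le> \<tau>" and p: "p \<in> cball 0 \<rho>"
    have "\<bar>a p\<bar> \<le> K" using K(2)[of p] p Nil by simp
    then show "\<bar>a (run 0 (scale \<tau> []) p) - (\<Sum>w | length w < N.
        \<tau> ^ length w * nc_coeff (series_of []) w * iterated_derivative D w a p)\<bar> \<le> K * \<tau> ^ N"
      unfolding series_of.simps eq using \<tau> K(1) by (cases "N = 0") (auto simp: scale_def)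
  qed
next
  case (Cons c S)
  obtain i \<sigma> where c: "c = (i, \<sigma>)" by (cases c)
  \<comment> \<open>An intermediate radius: for small \<tau> the first flow maps the ball of radius
    \<rho> into that of radius \<rho>', where the induction hypothesis is applied.\<close>
  define \<rho>' where "\<rho>' = (\<rho> + R) / 2"
  have \<rho>': "\<rho> < \<rho>'" "\<rho>' < R" using Cons.prems by (auto simp: \<rho>'_def)
  obtain \<tau>0 where \<tau>0: "0 < \<tau>0" "\<And>\<tau>. 0 \<le> \<tau> \<Longrightarrow> \<tau> \<le> \<tau>0 \<Longrightarrow> \<bar>\<tau> * \<sigma>\<bar> * L \<le> 1 / 2"
    "\<And>\<tau>. 0 \<le> \<tau> \<Longrightarrow> \<tau> \<le> \<tau>0 \<Longrightarrow> \<bar>\<tau> * \<sigma>\<bar> * B \<le> R - \<rho>'"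
    using small_time[OF \<rho>'(2)] by blast
  let ?p1 = "\<lambda>\<tau> p. step 0 (i, \<tau> * \<sigma>) p"
  have p1: "?p1 \<tau> p \<in> cball 0 \<rho>'" if "0 \<le> \<tau>" "\<tau> \<le> \<tau>0" "p \<in> cball 0 \<rho>" for \<tau> p
  proof -
    have "norm (?p1 \<tau> p - p) \<le> R - \<rho>'" using step_dist[OF \<tau>0(2)[OF that(1,2)], of 0 i p] \<tau>0(3)[OF that(1,2)] by simp
    moreover have "norm (?p1 \<tau> p) \<le> norm p + norm (?p1 \<tau> p - p)"
      using norm_triangle_ineq[of p "?p1 \<tau> p - p"] by simp
    ultimately show ?thesis using that(3) by (simp add: \<rho>'_def field_simps)
  qed
  let ?c = "nc_coeff (series_of S)"
  let ?e1 = "\<lambda>\<tau> p. \<bar>a (run 0 (scale \<tau> S) p) - (\<Sum>w | length w < N. \<tau> ^ length w * ?c w * iterated_derivative D w a p)\<bar>"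
  let ?e2 = "\<lambda>w \<tau> p. \<bar>iterated_derivative D w a (?p1 \<tau> p) -
    (\<Sum>k<N - length w. (\<tau> * \<sigma>) ^ k / fact k * iterated_derivative D (replicate k i) (iterated_derivative D w a) p)\<bar>"
  have e1: "uniform_order N (cball 0 \<rho>) (\<lambda>\<tau> p. ?e1 \<tau> (?p1 \<tau> p))"
    by (rule uniform_order_subst[OF Cons.IH[OF \<rho>'(2)] \<tau>0(1), where \<phi>="?p1"]) (use p1 in auto)
  have "uniform_order N (cball 0 \<rho>) (\<lambda>\<tau> p. \<tau> ^ length w * \<bar>?c w\<bar> * ?e2 w \<tau> p)" if w: "length w < N" for w
    using uniform_order_mult[OF step_expansion[OF iterated_smooth[OF assms(1)] Cons.prems, of "N - length w"],
        of "\<bar>?c w\<bar>" "length w"] w by simp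
  then have e2: "uniform_order N (cball 0 \<rho>) (\<lambda>\<tau> p. \<Sum>w | length w < N. \<tau> ^ length w * \<bar>?c w\<bar> * ?e2 w \<tau> p)"
    by (intro uniform_order_sum) simp
  show ?case
  proof (rule uniform_order_mono[OF uniform_order_add[OF e1 e2], of 1])
    fix \<tau> :: real and p :: "real ^ 'n" assume \<tau>: "0 \<le> \<tau>"
    let ?b = "\<lambda>w. \<Sum>k<N - length w. (\<tau> * \<sigma>) ^ k / fact k * iterated_derivative D (replicate k i) (iterated_derivative D w a) p"
    have main: "(\<Sum>w | length w < N. \<tau> ^ length w * nc_coeff (series_of (c # S)) w * iterated_derivative D w a p) =
        (\<Sum>w | length w < N. \<tau> ^ length w * ?c w * ?b w)"
      unfolding c series_of.simps exp_letter_mult_sum[symmetric]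
      by (rule sum.cong[OF refl]) (simp add: sum_distrib_left power_add power_mult_distrib iterated_derivative_append mult_ac)
    have "\<bar>a (run 0 (scale \<tau> (c # S)) p) - (\<Sum>w | length w < N. \<tau> ^ length w * ?c w * ?b w)\<bar> \<le>
       ?e1 \<tau> (?p1 \<tau> p) + \<bar>(\<Sum>w | length w < N. \<tau> ^ length w * ?c w * iterated_derivative D w a (?p1 \<tau> p))
           - (\<Sum>w | length w < N. \<tau> ^ length w * ?c w * ?b w)\<bar>"
      by (simp add: scale_def c)
    also have "(\<Sum>w | length w < N. \<tau> ^ length w * ?c w * iterated_derivative D w a (?p1 \<tau> p))
           - (\<Sum>w | length w < N. \<tau> ^ length w * ?c w * ?b w) =
         (\<Sum>w | length w < N. \<tau> ^ length w * ?c w * (iterated_derivative D w a (?p1 \<tau> p) - ?b w))"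
      by (simp add: right_diff_distrib sum_subtractf)
    also have "\<bar>\<dots>\<bar> \<le> (\<Sum>w | length w < N. \<tau> ^ length w * \<bar>?c w\<bar> * ?e2 w \<tau> p)"
      by (rule order_trans[OF sum_abs]) (use \<tau> in \<open>simp add: abs_mult\<close>)
    finally show "\<bar>a (run 0 (scale \<tau> (c # S)) p) -
        (\<Sum>w | length w < N. \<tau> ^ length w * nc_coeff (series_of (c # S)) w * iterated_derivative D w a p)\<bar>
      \<le> ?e1 \<tau> (?p1 \<tau> p) + (\<Sum>w | length w < N. \<tau> ^ length w * \<bar>?c w\<bar> * ?e2 w \<tau> p)"
      unfolding main by linarith
  qed simp
qed

definition bracket_field :: "'m list \<Rightarrow> real ^ 'n \<Rightarrow> real ^ 'n" where
  "bracket_field I x = (\<chi> l. iterated_bracket D I (\<lambda>y. y $ l) x)"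

lemma smooth_coord: "smooth_on W (\<lambda>y. y $ l)"
  by (rule smooth_on_bounded_linear[OF open_W bounded_linear_vec_nth smooth_on_id])

text \<open>The expansion of the coordinate functions to order \<open>Suc (length I)\<close>: among
  the retained words the empty one gives p, those of length \<open>length I\<close> give the
  bracket, and the others have coefficient 0. The flag \<open>pos\<close> covers a path and its
  reversal together.\<close>

lemma bracket_expansion:
  assumes I: "I \<noteq> []" and \<rho>: "\<rho> < R" and S: "order_ge (Suc (length I)) (series_of S - 1 - (if pos then bracket_series I else - bracket_series I))"
  shows "uniform_order (Suc (length I)) (cball 0 \<rho>)
    (\<lambda>\<tau> p. norm (run 0 (scale \<tau> S) p - (p + ((if pos then 1 else - 1) * \<tau> ^ length I) *\<^sub>R bracket_field I p)))"
proof -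
  let ?n = "length I" and ?e = "if pos then 1 else - 1 :: real"
  let ?err = "\<lambda>l \<tau> p. \<bar>run 0 (scale \<tau> S) p $ l -
    (\<Sum>w | length w < Suc ?n. \<tau> ^ length w * nc_coeff (series_of S) w * iterated_derivative D w (\<lambda>y. y $ l) p)\<bar>"
  have u: "uniform_order (Suc ?n) (cball 0 \<rho>) (\<lambda>\<tau> p. \<Sum>l\<in>UNIV. ?err l \<tau> p)"
    by (rule uniform_order_sum, rule run_expansion[OF smooth_coord \<rho>])
  show ?thesis
  proof (rule uniform_order_mono[OF u zero_less_one])
    fix \<tau> :: real and p :: "real ^ 'n" assume p: "p \<in> cball 0 \<rho>"
    have pW: "p \<in> W" using p \<rho> cball_W by (auto simp: subset_eq)
    have c: "nc_coeff (series_of S) w = (if w = [] then 1 else 0) + ?e * nc_coeff (bracket_series I) w" if "length w < Suc ?n" for w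
      using S that unfolding order_ge_def by (auto simp: algebra_simps split: if_splits)
    have "(\<Sum>w | length w < Suc ?n. \<tau> ^ length w * nc_coeff (series_of S) w * iterated_derivative D w (\<lambda>y. y $ l) p)
      = p $ l + ?e * \<tau> ^ ?n * bracket_field I p $ l" for l
    proof -
      let ?d = "\<lambda>w. iterated_derivative D w (\<lambda>y. y $ l) p"
      have "(\<Sum>w | length w < Suc ?n. \<tau> ^ length w * nc_coeff (series_of S) w * ?d w) =
         (\<Sum>w | length w < Suc ?n. (if w = [] then p $ l else 0) + ?e * (\<tau> ^ length w * nc_coeff (bracket_series I) w * ?d w))"
        by (rule sum.cong[OF refl], subst c) (auto simp: distrib_left distrib_right)
      also have "\<dots> = p $ l + ?e * (\<Sum>w | length w < Suc ?n. \<tau> ^ length w * nc_coeff (bracket_series I) w * ?d w)"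
        by (simp add: sum.distrib sum_distrib_left)
      also have "(\<Sum>w | length w < Suc ?n. \<tau> ^ length w * nc_coeff (bracket_series I) w * ?d w) =
          (\<Sum>w | length w = ?n. \<tau> ^ length w * nc_coeff (bracket_series I) w * ?d w)"
        using homogeneous_bracket_series[OF I] by (intro sum.mono_neutral_right) (auto simp: homogeneous_def)
      also have "\<dots> = \<tau> ^ ?n * (\<Sum>w | length w = ?n. nc_coeff (bracket_series I) w * ?d w)"
        by (simp add: sum_distrib_left mult.assoc)
      also have "\<dots> = \<tau> ^ ?n * bracket_field I p $ l"
        by (simp add: bracket_series_action[OF I smooth_coord pW] bracket_field_def)
      finally show ?thesis by (simp add: mult.assoc)
    qed
    then have "?err l \<tau> p = \<bar>(run 0 (scale \<tau> S) p - (p + (?e * \<tau> ^ ?n) *\<^sub>R bracket_field I p)) $ l\<bar>" for l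
      by simp
    then show "norm (run 0 (scale \<tau> S) p - (p + (?e * \<tau> ^ ?n) *\<^sub>R bracket_field I p)) \<le> (\<Sum>l\<in>UNIV. ?err l \<tau> p)"
      using norm_le_l1_cart[of "run 0 (scale \<tau> S) p - (p + (?e * \<tau> ^ ?n) *\<^sub>R bracket_field I p)"] by simp
  qed
qed

end

section \<open>Steering along brackets\<close>

definition cost_of :: "('m \<times> real) list \<Rightarrow> real" where
  "cost_of cs = (\<Sum>(i, \<theta>)\<leftarrow>cs. \<bar>\<theta>\<bar>)"

lemma cost_of_append: "cost_of (cs @ ds) = cost_of cs + cost_of ds"
  by (simp add: cost_of_def)

lemma cost_of_nonneg: "0 \<le> cost_of cs"
  unfolding cost_of_def by (rule sum_list_nonneg) auto

lemma cost_of_scale: "0 \<le> \<tau> \<Longrightarrow> cost_of (scale \<tau> S) = \<tau> * cost_of S"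
  by (induction S) (auto simp: cost_of_def scale_def abs_mult distrib_left)

text \<open>The positive part of \<open>s\<close> scales the commutator path and the negative part its reversal. Running
  both keeps the sequence of fields fixed, so that the end point is continuous in \<open>s\<close>.\<close>

definition block :: "'m list \<Rightarrow> real \<Rightarrow> ('m \<times> real) list" where
  "block I s = scale (root (length I) (max s 0)) (commutator_path I) @
     scale (root (length I) (max (- s) 0)) (reversal (commutator_path I))"

definition blocks :: "'m list list \<Rightarrow> ('m list \<Rightarrow> 'w \<Rightarrow> real) \<Rightarrow> 'w \<Rightarrow> ('m \<times> real) list" where
  "blocks Is s w = concat (map (\<lambda>I. block I (s I w)) Is)"

lemma blocks_simps [simp]:
  "blocks [] s w = []" "blocks (I # Is) s w = block I (s I w) @ blocks Is s w"
  by (simp_all add: blocks_def)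

lemma cost_of_block:
  assumes "I \<noteq> []"
  shows "cost_of (block I s) \<le> root (length I) \<bar>s\<bar> * (cost_of (commutator_path I) + cost_of (reversal (commutator_path I)))"
proof -
  have n: "0 < length I" using assms by simp
  have le: "root (length I) (max s 0) \<le> root (length I) \<bar>s\<bar>" "root (length I) (max (- s) 0) \<le> root (length I) \<bar>s\<bar>"
    using n by (auto simp: real_root_le_iff)
  have "cost_of (block I s) = root (length I) (max s 0) * cost_of (commutator_path I)
      + root (length I) (max (- s) 0) * cost_of (reversal (commutator_path I))"
    using n by (simp add: block_def cost_of_append cost_of_scale)
  also have "\<dots> \<le> root (length I) \<bar>s\<bar> * cost_of (commutator_path I) + root (length I) \<bar>s\<bar> * cost_of (reversal (commutator_path I))"
    using le by (intro add_mono mult_right_mono cost_of_nonneg)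
  finally show ?thesis by (simp add: distrib_left)
qed

lemma length_block: "length (block I s) = 2 * length (commutator_path I)"
  by (simp add: block_def scale_def reversal_def)

text \<open>The number of steps does not depend on the parameter, so the duration of the whole path
  and the factor in \<open>run_stable\<close> are known before the parameter is found.\<close>

lemma length_blocks: "length (blocks Is s w) = (\<Sum>I\<leftarrow>Is. 2 * length (commutator_path I))"
  by (induction Is) (auto simp: length_block)

context control_fields
begin

lemma run_scale_0: "run 0 (scale 0 S) p = p"
  by (induction S arbitrary: p) (auto simp: scale_def step_0)

text \<open>For \<tau> the n-th root of |s|, the error \<open>\<tau> ^ Suc n\<close> becomes |s|
  times its n-th root, which is o(|s|). The half of the block that belongs to the other sign runs
  for time 0 and is the identity.\<close>

lemma block_expansion:
  assumes I: "I \<noteq> []" and \<rho>: "\<rho> < R"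
  shows "\<exists>K\<ge>0. \<exists>s0>0. \<forall>s p. \<bar>s\<bar> \<le> s0 \<and> p \<in> cball 0 \<rho> \<longrightarrow>
     norm (run 0 (block I s) p - (p + s *\<^sub>R bracket_field I p)) \<le> K * (\<bar>s\<bar> * root (length I) \<bar>s\<bar>)"
proof -
  let ?n = "length I"
  have n: "0 < ?n" using I by simp
  have "uniform_order (Suc ?n) (cball 0 \<rho>) (\<lambda>\<tau> p. norm (run 0 (scale \<tau> (commutator_path I)) p -
      (p + ((if True then 1 else - 1) * \<tau> ^ ?n) *\<^sub>R bracket_field I p)))"
    by (rule bracket_expansion[OF I \<rho>]) (use series_of_commutator_path[OF I] in simp)
  then obtain K1 \<tau>1 where 1: "0 \<le> K1" "0 < \<tau>1" "\<forall>\<tau> p. 0 \<le> \<tau> \<and> \<tau> \<le> \<tau>1 \<and> p \<in> cball 0 \<rho> \<longrightarrow>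
     norm (run 0 (scale \<tau> (commutator_path I)) p - (p + ((if True then 1 else - 1) * \<tau> ^ ?n) *\<^sub>R bracket_field I p)) \<le> K1 * \<tau> ^ Suc ?n"
    by (rule uniform_orderE)
  have "uniform_order (Suc ?n) (cball 0 \<rho>) (\<lambda>\<tau> p. norm (run 0 (scale \<tau> (reversal (commutator_path I))) p -
      (p + ((if False then 1 else - 1) * \<tau> ^ ?n) *\<^sub>R bracket_field I p)))"
    by (rule bracket_expansion[OF I \<rho>]) (use series_of_reversal_commutator_path[OF I] in simp)
  then obtain K2 \<tau>2 where 2: "0 \<le> K2" "0 < \<tau>2" "\<forall>\<tau> p. 0 \<le> \<tau> \<and> \<tau> \<le> \<tau>2 \<and> p \<in> cball 0 \<rho> \<longrightarrow>
     norm (run 0 (scale \<tau> (reversal (commutator_path I))) p - (p + ((if False then 1 else - 1) * \<tau> ^ ?n) *\<^sub>R bracket_field I p)) \<le> K2 * \<tau> ^ Suc ?n"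
    by (rule uniform_orderE)
  show ?thesis
  proof (intro exI conjI allI impI)
    show "0 \<le> max K1 K2" using 1 by simp
    show "0 < (min \<tau>1 \<tau>2) ^ ?n" using 1 2 by simp
    fix s and p :: "real ^ 'n" assume sp: "\<bar>s\<bar> \<le> (min \<tau>1 \<tau>2) ^ ?n \<and> p \<in> cball 0 \<rho>"
    define \<tau> where "\<tau> = root ?n \<bar>s\<bar>"
    have \<tau>0: "0 \<le> \<tau>" using n by (simp add: \<tau>_def)
    have \<tau>n: "\<tau> ^ ?n = \<bar>s\<bar>" using n by (simp add: \<tau>_def)
    have "\<tau> \<le> root ?n ((min \<tau>1 \<tau>2) ^ ?n)" unfolding \<tau>_def using n sp by (simp add: real_root_le_iff)
    also have "\<dots> = min \<tau>1 \<tau>2" using n 1 2 by (intro real_root_power_cancel) auto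
    finally have \<tau>: "\<tau> \<le> \<tau>1" "\<tau> \<le> \<tau>2" by auto
    have K: "K1 * \<tau> ^ Suc ?n \<le> max K1 K2 * (\<bar>s\<bar> * \<tau>)" "K2 * \<tau> ^ Suc ?n \<le> max K1 K2 * (\<bar>s\<bar> * \<tau>)"
      using \<tau>0 by (auto simp: \<tau>n mult.commute intro!: mult_right_mono)
    show "norm (run 0 (block I s) p - (p + s *\<^sub>R bracket_field I p)) \<le> max K1 K2 * (\<bar>s\<bar> * root ?n \<bar>s\<bar>)"
    proof (cases "0 \<le> s")
      case True
      then have "run 0 (block I s) p = run 0 (scale \<tau> (commutator_path I)) p"
        by (simp add: block_def \<tau>_def run_append run_scale_0)
      moreover have "(if True then 1 else - 1) * \<tau> ^ ?n = s" using True \<tau>n by simp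
      ultimately have "norm (run 0 (block I s) p - (p + s *\<^sub>R bracket_field I p)) \<le> K1 * \<tau> ^ Suc ?n"
        using 1(3)[rule_format, of \<tau> p] \<tau>0 \<tau> sp by metis
      then show ?thesis using K(1) unfolding \<tau>_def[symmetric] by (rule order_trans)
    next
      case False
      then have "run 0 (block I s) p = run 0 (scale \<tau> (reversal (commutator_path I))) p"
        by (simp add: block_def \<tau>_def run_append run_scale_0)
      moreover have "(if False then 1 else - 1) * \<tau> ^ ?n = s" using False \<tau>n by simp
      ultimately have "norm (run 0 (block I s) p - (p + s *\<^sub>R bracket_field I p)) \<le> K2 * \<tau> ^ Suc ?n"
        using 2(3)[rule_format, of \<tau> p] \<tau>0 \<tau> sp by metis
      then show ?thesis using K(2) unfolding \<tau>_def[symmetric] by (rule order_trans)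
    qed
  qed
qed

text \<open>A first-order expansion at w = 0, uniform in p on every ball of radius less than R. The
  strict inequality leaves room for composition, since an intermediate point may leave the ball that
  contains the start.\<close>

definition small_approx :: "('w::real_normed_vector \<Rightarrow> real ^ 'n \<Rightarrow> real ^ 'n) \<Rightarrow> ('w \<Rightarrow> real ^ 'n \<Rightarrow> real ^ 'n) \<Rightarrow> bool" where
  "small_approx \<Psi> U \<longleftrightarrow> (\<forall>\<rho>. \<rho> < R \<longrightarrow> (\<forall>\<kappa>>0. \<exists>\<sigma>>0. \<forall>w p. norm w \<le> \<sigma> \<and> p \<in> cball 0 \<rho> \<longrightarrow>
     norm (\<Psi> w p - (p + U w p)) \<le> \<kappa> * norm w))"

lemma small_approx_block:
  fixes s :: "'w::real_normed_vector \<Rightarrow> real"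
  assumes I: "I \<noteq> []" and c: "0 < c" "\<And>w. \<bar>s w\<bar> \<le> c * norm w"
  shows "small_approx (\<lambda>w. run 0 (block I (s w))) (\<lambda>w p. s w *\<^sub>R bracket_field I p)"
  unfolding small_approx_def
proof (intro allI impI)
  fix \<rho> \<kappa> :: real assume \<rho>: "\<rho> < R" and \<kappa>: "0 < \<kappa>"
  let ?n = "length I"
  have n: "0 < ?n" using I by simp
  obtain K s0 where K: "0 \<le> K" "0 < s0" "\<forall>s p. \<bar>s\<bar> \<le> s0 \<and> p \<in> cball 0 \<rho> \<longrightarrow>
     norm (run 0 (block I s) p - (p + s *\<^sub>R bracket_field I p)) \<le> K * (\<bar>s\<bar> * root ?n \<bar>s\<bar>)"
    using block_expansion[OF I \<rho>] by blast
  \<comment> \<open>A bound for the root factor that makes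
    \<open>K * c * \<delta> \<le> \<kappa>\<close>; the added 1 covers K = 0.\<close>
  define \<delta> where "\<delta> = \<kappa> / (K * c + 1)"
  have Kc: "0 \<le> K * c" using K c by simp
  then have \<delta>: "0 < \<delta>" using \<kappa> by (simp add: \<delta>_def)
  have \<delta>K: "K * c * \<delta> \<le> \<kappa>" using \<kappa> Kc by (simp add: \<delta>_def field_simps)
  show "\<exists>\<sigma>>0. \<forall>w p. norm w \<le> \<sigma> \<and> p \<in> cball 0 \<rho> \<longrightarrow>
      norm (run 0 (block I (s w)) p - (p + s w *\<^sub>R bracket_field I p)) \<le> \<kappa> * norm w"
  proof (intro exI[of _ "min s0 (\<delta> ^ ?n) / c"] conjI allI impI)
    show "0 < min s0 (\<delta> ^ ?n) / c" using K \<delta> c by simp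
    fix w :: 'w and p :: "real ^ 'n" assume wp: "norm w \<le> min s0 (\<delta> ^ ?n) / c \<and> p \<in> cball 0 \<rho>"
    then have "c * norm w \<le> min s0 (\<delta> ^ ?n)" using c by (simp add: pos_le_divide_eq mult.commute)
    then have sw: "\<bar>s w\<bar> \<le> s0" "\<bar>s w\<bar> \<le> \<delta> ^ ?n" using c(2)[of w] by auto
    have "root ?n \<bar>s w\<bar> \<le> root ?n (\<delta> ^ ?n)" using n sw(2) by (simp add: real_root_le_iff)
    also have "\<dots> = \<delta>" using n \<delta> by (intro real_root_power_cancel) auto
    finally have rt: "root ?n \<bar>s w\<bar> \<le> \<delta>" .
    have "norm (run 0 (block I (s w)) p - (p + s w *\<^sub>R bracket_field I p)) \<le> K * (\<bar>s w\<bar> * root ?n \<bar>s w\<bar>)"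
      using K(3) sw(1) wp by blast
    also have "\<dots> \<le> K * ((c * norm w) * \<delta>)"
      using rt c K n by (intro mult_left_mono mult_mono) auto
    also have "\<dots> = (K * c * \<delta>) * norm w" by (simp add: mult_ac)
    also have "\<dots> \<le> \<kappa> * norm w" using \<delta>K by (intro mult_right_mono) auto
    finally show "norm (run 0 (block I (s w)) p - (p + s w *\<^sub>R bracket_field I p)) \<le> \<kappa> * norm w" .
  qed
qed

text \<open>Three errors, each at most \<open>\<kappa> / 3 * norm w\<close>: that of
  \<open>\<Psi>1\<close> at p, that of \<open>\<Psi>2\<close> at the moved point, and the change of
  \<open>U2\<close> between p and the moved point. The last is quadratic in w, because
  \<open>U2 w\<close> has a Lipschitz constant proportional to \<open>norm w\<close> and the
  displacement is itself of size \<open>norm w\<close>.\<close>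

lemma small_approx_compose:
  fixes \<Psi>1 \<Psi>2 U1 U2 :: "'w::real_normed_vector \<Rightarrow> real ^ 'n \<Rightarrow> real ^ 'n"
  assumes 1: "small_approx \<Psi>1 U1" and 2: "small_approx \<Psi>2 U2" and C: "0 \<le> C"
    and b: "\<And>w p. p \<in> cball 0 R \<Longrightarrow> norm (U1 w p) \<le> C * norm w"
    and l: "\<And>w p p'. p \<in> cball 0 R \<Longrightarrow> p' \<in> cball 0 R \<Longrightarrow> norm (U2 w p - U2 w p') \<le> C * norm w * norm (p - p')"
  shows "small_approx (\<lambda>w p. \<Psi>2 w (\<Psi>1 w p)) (\<lambda>w p. U1 w p + U2 w p)"
  unfolding small_approx_def
proof (intro allI impI)
  fix \<rho> \<kappa> :: real assume \<rho>: "\<rho> < R" and \<kappa>: "0 < \<kappa>"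
  define \<rho>' where "\<rho>' = (\<rho> + R) / 2"
  have \<rho>': "\<rho>' < R" "\<rho> < \<rho>'" using \<rho> by (auto simp: \<rho>'_def)
  have \<kappa>3: "0 < \<kappa> / 3" using \<kappa> by simp
  obtain \<sigma>1 where s1: "0 < \<sigma>1" "\<And>w p. norm w \<le> \<sigma>1 \<Longrightarrow> p \<in> cball 0 \<rho> \<Longrightarrow> norm (\<Psi>1 w p - (p + U1 w p)) \<le> \<kappa> / 3 * norm w"
    using 1 \<rho> \<kappa>3 unfolding small_approx_def by meson
  obtain \<sigma>2 where s2: "0 < \<sigma>2" "\<And>w p. norm w \<le> \<sigma>2 \<Longrightarrow> p \<in> cball 0 \<rho>' \<Longrightarrow> norm (\<Psi>2 w p - (p + U2 w p)) \<le> \<kappa> / 3 * norm w"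
    using 2 \<rho>'(1) \<kappa>3 unfolding small_approx_def by meson
  define E where "E = \<kappa> / 3 + C + 1"
  have E: "0 < E" using \<kappa> C by (simp add: E_def)
  \<comment> \<open>\<open>E * norm w\<close> bounds the displacement caused by
    \<open>\<Psi>1\<close>. The third entry keeps the moved point in the ball of radius \<rho>', the
    fourth makes the quadratic term at most \<open>\<kappa> / 3 * norm w\<close>.\<close>
  define \<sigma> where "\<sigma> = min (min \<sigma>1 \<sigma>2) (min ((R - \<rho>) / 2 / E) (\<kappa> / 3 / ((C + 1) * E)))"
  have \<sigma>: "0 < \<sigma>" unfolding \<sigma>_def using s1 s2 \<rho> \<kappa> C E by simp
  show "\<exists>\<sigma>>0. \<forall>w p. norm w \<le> \<sigma> \<and> p \<in> cball 0 \<rho> \<longrightarrow>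
      norm (\<Psi>2 w (\<Psi>1 w p) - (p + (U1 w p + U2 w p))) \<le> \<kappa> * norm w"
  proof (intro exI[of _ \<sigma>] conjI allI impI \<sigma>)
    fix w :: 'w and p :: "real ^ 'n" assume wp: "norm w \<le> \<sigma> \<and> p \<in> cball 0 \<rho>"
    let ?p = "\<Psi>1 w p"
    have pR: "p \<in> cball 0 R" using wp \<rho> by auto
    have e1: "norm (?p - (p + U1 w p)) \<le> \<kappa> / 3 * norm w" using s1(2)[of w p] wp by (simp add: \<sigma>_def)
    have "norm (?p - p) \<le> norm (?p - (p + U1 w p)) + norm (U1 w p)"
      using norm_triangle_ineq[of "?p - (p + U1 w p)" "U1 w p"] by simp
    also have "\<dots> \<le> \<kappa> / 3 * norm w + C * norm w" using e1 b[OF pR, of w] by linarith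
    also have "\<dots> \<le> E * norm w" unfolding E_def by (simp add: distrib_right)
    finally have d: "norm (?p - p) \<le> E * norm w" .
    have w1: "norm w \<le> (R - \<rho>) / 2 / E" and w2: "norm w \<le> \<kappa> / 3 / ((C + 1) * E)" using wp by (auto simp: \<sigma>_def)
    have "E * norm w \<le> (R - \<rho>) / 2" using w1 pos_le_divide_eq[OF E, of "norm w" "(R - \<rho>) / 2"] by (simp only: mult.commute)
    then have "norm ?p \<le> \<rho>'"
      using d wp norm_triangle_ineq[of p "?p - p"] by (simp add: \<rho>'_def field_simps)
    then have pR': "?p \<in> cball 0 \<rho>'" "?p \<in> cball 0 R" using \<rho>' by auto
    have e2: "norm (\<Psi>2 w ?p - (?p + U2 w ?p)) \<le> \<kappa> / 3 * norm w" using s2(2)[of w ?p] wp pR' by (simp add: \<sigma>_def)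
    have "C * norm w * norm (?p - p) \<le> (C + 1) * norm w * (E * norm w)"
      using C d by (intro mult_mono) (auto intro: mult_right_mono)
    also have "\<dots> = ((C + 1) * E * norm w) * norm w" by (simp add: mult_ac)
    also have "\<dots> \<le> \<kappa> / 3 * norm w"
    proof (rule mult_right_mono)
      show "(C + 1) * E * norm w \<le> \<kappa> / 3"
        using w2 C E by (subst (asm) pos_le_divide_eq) (auto simp: mult.commute)
    qed simp
    finally have e3: "norm (U2 w ?p - U2 w p) \<le> \<kappa> / 3 * norm w" using l[OF pR'(2) pR, of w] by linarith
    have "\<Psi>2 w ?p - (p + (U1 w p + U2 w p)) = (\<Psi>2 w ?p - (?p + U2 w ?p)) + (?p - (p + U1 w p)) + (U2 w ?p - U2 w p)"
      by simp
    then have "norm (\<Psi>2 w ?p - (p + (U1 w p + U2 w p))) \<le> norm (\<Psi>2 w ?p - (?p + U2 w ?p)) + norm (?p - (p + U1 w p)) + norm (U2 w ?p - U2 w p)"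
      by (metis norm_triangle_ineq norm_triangle_le add_right_mono)
    then show "norm (\<Psi>2 w ?p - (p + (U1 w p + U2 w p))) \<le> \<kappa> * norm w" using e1 e2 e3 by argo
  qed
qed

lemma smooth_bracket_field: "smooth_on W (bracket_field I)"
  unfolding smooth_on_vec_iff[OF open_W] bracket_field_def by (simp add: bracket_smooth smooth_coord)

lemma bracket_field_bounds:
  "\<exists>C\<ge>0. \<forall>p\<in>cball 0 R. \<forall>p'\<in>cball 0 R. norm (bracket_field I p) \<le> C \<and> norm (bracket_field I p - bracket_field I p') \<le> C * norm (p - p')"
proof -
  obtain C1 where C1: "0 \<le> C1" "\<forall>p\<in>cball 0 R. norm (bracket_field I p) \<le> C1"
    using smooth_bounded[OF smooth_bracket_field] by blast
  obtain C2 where C2: "0 \<le> C2" "\<forall>x\<in>cball 0 R. \<forall>y\<in>cball 0 R. norm (bracket_field I x - bracket_field I y) \<le> C2 * norm (x - y)"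
    using smooth_on_lipschitz[OF open_W smooth_bracket_field compact_cball convex_cball cball_W] by blast
  show ?thesis
  proof (intro exI[of _ "C1 + C2"] conjI ballI)
    fix p p' :: "real ^ 'n" assume p: "p \<in> cball 0 R" "p' \<in> cball 0 R"
    show "norm (bracket_field I p) \<le> C1 + C2" using C1 C2 p by (smt (verit))
    have "norm (bracket_field I p - bracket_field I p') \<le> C2 * norm (p - p')" using C2 p by blast
    also have "\<dots> \<le> (C1 + C2) * norm (p - p')" using C1 by (intro mult_right_mono) auto
    finally show "norm (bracket_field I p - bracket_field I p') \<le> (C1 + C2) * norm (p - p')" .
  qed (use C1 C2 in auto)
qed

definition combination :: "'m list list \<Rightarrow> ('m list \<Rightarrow> 'w \<Rightarrow> real) \<Rightarrow> 'w \<Rightarrow> real ^ 'n \<Rightarrow> real ^ 'n" where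
  "combination Is s w p = (\<Sum>I\<leftarrow>Is. s I w *\<^sub>R bracket_field I p)"

lemma combination_bounds:
  fixes s :: "'m list \<Rightarrow> 'w::real_normed_vector \<Rightarrow> real"
  assumes c: "0 < c" "\<And>I w. I \<in> set Is \<Longrightarrow> \<bar>s I w\<bar> \<le> c * norm w"
  shows "\<exists>C\<ge>0. \<forall>w. \<forall>p\<in>cball 0 R. \<forall>p'\<in>cball 0 R. norm (combination Is s w p) \<le> C * norm w \<and>
     norm (combination Is s w p - combination Is s w p') \<le> C * norm w * norm (p - p')"
  using c(2)
proof (induction Is)
  case Nil
  then show ?case by (auto simp: combination_def)
next
  case (Cons I Is)
  obtain C where C: "0 \<le> C" "\<forall>w. \<forall>p\<in>cball 0 R. \<forall>p'\<in>cball 0 R. norm (combination Is s w p) \<le> C * norm w \<and>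
     norm (combination Is s w p - combination Is s w p') \<le> C * norm w * norm (p - p')"
    using Cons.IH Cons.prems by auto
  obtain C' where C': "0 \<le> C'" "\<forall>p\<in>cball 0 R. \<forall>p'\<in>cball 0 R. norm (bracket_field I p) \<le> C' \<and> norm (bracket_field I p - bracket_field I p') \<le> C' * norm (p - p')"
    using bracket_field_bounds by blast
  show ?case
  proof (intro exI[of _ "c * C' + C"] conjI allI ballI)
    fix w :: 'w and p p' :: "real ^ 'n" assume p: "p \<in> cball 0 R" "p' \<in> cball 0 R"
    have s: "\<bar>s I w\<bar> \<le> c * norm w" using Cons.prems[of I w] by simp
    have "\<bar>s I w\<bar> * norm (bracket_field I p) \<le> (c * norm w) * C'"
      using s C' p c by (intro mult_mono) auto
    then have "norm (s I w *\<^sub>R bracket_field I p) \<le> c * C' * norm w" by (simp add: mult_ac)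
    then show "norm (combination (I # Is) s w p) \<le> (c * C' + C) * norm w"
      using C(2)[rule_format, OF p, of w] norm_triangle_ineq[of "s I w *\<^sub>R bracket_field I p" "combination Is s w p"]
      by (simp add: combination_def distrib_right)
    have "\<bar>s I w\<bar> * norm (bracket_field I p - bracket_field I p') \<le> (c * norm w) * (C' * norm (p - p'))"
      using s C' p c by (intro mult_mono) auto
    then have "norm (s I w *\<^sub>R (bracket_field I p - bracket_field I p')) \<le> c * C' * norm w * norm (p - p')" by (simp add: mult_ac)
    then show "norm (combination (I # Is) s w p - combination (I # Is) s w p') \<le> (c * C' + C) * norm w * norm (p - p')"
      using C(2)[rule_format, OF p, of w]
        norm_triangle_ineq[of "s I w *\<^sub>R (bracket_field I p - bracket_field I p')" "combination Is s w p - combination Is s w p'"]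
      by (simp add: combination_def algebra_simps)
  qed (use C C' c in auto)
qed

lemma small_approx_blocks:
  fixes s :: "'m list \<Rightarrow> 'w::real_normed_vector \<Rightarrow> real"
  assumes c: "0 < c" "\<And>I w. I \<in> set Is \<Longrightarrow> \<bar>s I w\<bar> \<le> c * norm w" and ne: "\<And>I. I \<in> set Is \<Longrightarrow> I \<noteq> []"
  shows "small_approx (\<lambda>w. run 0 (blocks Is s w)) (combination Is s)"
  using c(2) ne
proof (induction Is)
  case Nil
  show ?case unfolding small_approx_def by (auto simp: combination_def intro!: exI[of _ 1])
next
  case (Cons I Is)
  have 1: "small_approx (\<lambda>w. run 0 (block I (s I w))) (\<lambda>w p. s I w *\<^sub>R bracket_field I p)"
    using Cons.prems by (intro small_approx_block[OF _ c(1)]) auto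
  have 2: "small_approx (\<lambda>w. run 0 (blocks Is s w)) (combination Is s)"
    using Cons by auto
  obtain C where C: "0 \<le> C" "\<forall>w. \<forall>p\<in>cball 0 R. \<forall>p'\<in>cball 0 R. norm (combination Is s w p) \<le> C * norm w \<and>
     norm (combination Is s w p - combination Is s w p') \<le> C * norm w * norm (p - p')"
    using combination_bounds[OF c(1), of Is s] Cons.prems by auto
  obtain C' where C': "0 \<le> C'" "\<forall>w. \<forall>p\<in>cball 0 R. \<forall>p'\<in>cball 0 R. norm (combination [I] s w p) \<le> C' * norm w \<and>
     norm (combination [I] s w p - combination [I] s w p') \<le> C' * norm w * norm (p - p')"
    using combination_bounds[OF c(1), of "[I]" s] Cons.prems by auto
  have "small_approx (\<lambda>w p. run 0 (blocks Is s w) (run 0 (block I (s I w)) p)) (\<lambda>w p. s I w *\<^sub>R bracket_field I p + combination Is s w p)"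
  proof (rule small_approx_compose[OF 1 2, of "max C C'"])
    fix w :: 'w and p :: "real ^ 'n" assume "p \<in> cball 0 R"
    then have "norm (s I w *\<^sub>R bracket_field I p) \<le> C' * norm w" using C'(2) by (auto simp: combination_def)
    also have "\<dots> \<le> max C C' * norm w" by (intro mult_right_mono) auto
    finally show "norm (s I w *\<^sub>R bracket_field I p) \<le> max C C' * norm w" .
  next
    fix w :: 'w and p p' :: "real ^ 'n" assume "p \<in> cball 0 R" "p' \<in> cball 0 R"
    then have "norm (combination Is s w p - combination Is s w p') \<le> C * norm w * norm (p - p')" using C(2) by blast
    also have "\<dots> \<le> max C C' * norm w * norm (p - p')" by (intro mult_right_mono) auto
    finally show "norm (combination Is s w p - combination Is s w p') \<le> max C C' * norm w * norm (p - p')" .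
  qed (use C in auto)
  then show ?case
    by (simp add: run_append combination_def[abs_def])
qed

lemma continuous_on_step:
  fixes \<tau> :: "'w::metric_space \<Rightarrow> real"
  assumes \<tau>: "continuous_on S \<tau>" and f: "continuous_on S f" and s: "\<And>w. w \<in> S \<Longrightarrow> \<bar>\<tau> w\<bar> * L \<le> 1 / 2"
  shows "continuous_on S (\<lambda>w. step \<eta> (i, \<tau> w) (f w))"
  unfolding continuous_on_def
proof
  fix w assume w: "w \<in> S"
  have "((\<lambda>v. 2 * (norm (f v - f w) + (\<bar>\<eta> - \<eta>\<bar> + \<bar>\<tau> v - \<tau> w\<bar> * B))) \<longlongrightarrow> 2 * (norm (f w - f w) + (\<bar>\<eta> - \<eta>\<bar> + \<bar>\<tau> w - \<tau> w\<bar> * B))) (at w within S)"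
    using \<tau> f w unfolding continuous_on_def by (intro tendsto_intros) auto
  then have 0: "((\<lambda>v. 2 * (norm (f v - f w) + (\<bar>\<eta> - \<eta>\<bar> + \<bar>\<tau> v - \<tau> w\<bar> * B))) \<longlongrightarrow> 0) (at w within S)" by simp
  have ev: "\<forall>\<^sub>F v in at w within S. norm (step \<eta> (i, \<tau> v) (f v) - step \<eta> (i, \<tau> w) (f w)) \<le> 2 * (norm (f v - f w) + (\<bar>\<eta> - \<eta>\<bar> + \<bar>\<tau> v - \<tau> w\<bar> * B))"
    unfolding eventually_at_filter by (rule always_eventually) (use step_stable s w in blast)
  have "((\<lambda>v. step \<eta> (i, \<tau> v) (f v) - step \<eta> (i, \<tau> w) (f w)) \<longlongrightarrow> 0) (at w within S)"
    by (rule Lim_null_comparison[OF ev 0])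
  then show "((\<lambda>v. step \<eta> (i, \<tau> v) (f v)) \<longlongrightarrow> step \<eta> (i, \<tau> w) (f w)) (at w within S)"
    using Lim_null by blast
qed

lemma continuous_on_run_scale:
  fixes \<tau> :: "'w::metric_space \<Rightarrow> real"
  assumes "continuous_on S \<tau>" "continuous_on S f"
    "\<And>w. w \<in> S \<Longrightarrow> 0 \<le> \<tau> w" "\<And>w. w \<in> S \<Longrightarrow> cost_of (scale (\<tau> w) Q) * L \<le> 1 / 2"
  shows "continuous_on S (\<lambda>w. run \<eta> (scale (\<tau> w) Q) (f w))"
  using assms(2,4)
proof (induction Q arbitrary: f)
  case Nil
  then show ?case by (simp add: scale_def)
next
  case (Cons c Q)
  obtain i \<sigma> where c: "c = (i, \<sigma>)" by (cases c)
  have "\<bar>\<tau> w * \<sigma>\<bar> * L \<le> 1 / 2" "cost_of (scale (\<tau> w) Q) * L \<le> 1 / 2" if "w \<in> S" for w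
  proof -
    have "\<bar>\<tau> w * \<sigma>\<bar> * L + cost_of (scale (\<tau> w) Q) * L \<le> 1 / 2"
      using Cons.prems(2)[OF that] by (simp add: cost_of_def scale_def c distrib_right)
    moreover have "0 \<le> \<bar>\<tau> w * \<sigma>\<bar> * L" "0 \<le> cost_of (scale (\<tau> w) Q) * L"
      using L_pos mult_nonneg_nonneg[OF cost_of_nonneg less_imp_le[OF L_pos]] by auto
    ultimately show "\<bar>\<tau> w * \<sigma>\<bar> * L \<le> 1 / 2" "cost_of (scale (\<tau> w) Q) * L \<le> 1 / 2" by linarith+
  qed
  then have "continuous_on S (\<lambda>w. run \<eta> (scale (\<tau> w) Q) (step \<eta> (i, \<tau> w * \<sigma>) (f w)))"
    using assms(1) Cons.prems(1) by (intro Cons.IH continuous_on_step continuous_intros) auto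
  then show ?case by (simp add: scale_def c)
qed

text \<open>Only the total cost is bounded; costs being nonnegative, every single step inherits the
  bound under which it depends continuously on its data. The roots in \<open>block\<close> are
  continuous at 0, though in general not differentiable there.\<close>

lemma continuous_on_run_blocks:
  fixes s :: "'m list \<Rightarrow> 'w::metric_space \<Rightarrow> real"
  assumes "\<And>I. I \<in> set Is \<Longrightarrow> continuous_on S (s I)" "\<And>I. I \<in> set Is \<Longrightarrow> I \<noteq> []"
    "continuous_on S f" "\<And>w. w \<in> S \<Longrightarrow> cost_of (blocks Is s w) * L \<le> 1 / 2"
  shows "continuous_on S (\<lambda>w. run \<eta> (blocks Is s w) (f w))"
  using assms
proof (induction Is arbitrary: f)
  case (Cons I Is)
  let ?t1 = "\<lambda>w. root (length I) (max (s I w) 0)" and ?t2 = "\<lambda>w. root (length I) (max (- s I w) 0)"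
  let ?P = "commutator_path I" and ?Q = "reversal (commutator_path I)"
  have n: "0 < length I" using Cons.prems(2)[of I] by simp
  have c: "continuous_on S (s I)" using Cons.prems(1)[of I] by simp
  have t: "continuous_on S ?t1" "continuous_on S ?t2"
    by (intro continuous_intros c)+
  have split: "cost_of (scale (?t1 w) ?P) * L \<le> 1 / 2" "cost_of (scale (?t2 w) ?Q) * L \<le> 1 / 2"
     "cost_of (blocks Is s w) * L \<le> 1 / 2" if "w \<in> S" for w
  proof -
    have "cost_of (scale (?t1 w) ?P) * L + cost_of (scale (?t2 w) ?Q) * L + cost_of (blocks Is s w) * L \<le> 1 / 2"
      using Cons.prems(4)[OF that] by (simp add: cost_of_append block_def distrib_right)
    moreover have "0 \<le> cost_of cs * L" for cs :: "('m \<times> real) list" using L_pos cost_of_nonneg[of cs] by simp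
    note this[of "scale (?t1 w) ?P"] this[of "scale (?t2 w) ?Q"] this[of "blocks Is s w"]
    ultimately show "cost_of (scale (?t1 w) ?P) * L \<le> 1 / 2" "cost_of (scale (?t2 w) ?Q) * L \<le> 1 / 2"
     "cost_of (blocks Is s w) * L \<le> 1 / 2" by linarith+
  qed
  have "continuous_on S (\<lambda>w. run \<eta> (scale (?t1 w) ?P) (f w))"
    by (rule continuous_on_run_scale[OF t(1) Cons.prems(3)]) (use n split in auto)
  then have "continuous_on S (\<lambda>w. run \<eta> (scale (?t2 w) ?Q) (run \<eta> (scale (?t1 w) ?P) (f w)))"
    by (rule continuous_on_run_scale[OF t(2)]) (use n split in auto)
  then have "continuous_on S (\<lambda>w. run \<eta> (blocks Is s w) (run \<eta> (scale (?t2 w) ?Q) (run \<eta> (scale (?t1 w) ?P) (f w))))"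
    by (intro Cons.IH) (use Cons.prems split in auto)
  then show ?case by (simp add: run_append block_def)
qed simp

text \<open>A step at most doubles the sum of the current distance and \<eta>; adding \<eta> anew
  gives the factor 4 per step. The factor is harmless because the number of steps is fixed and
  \<eta> may be taken arbitrarily small.\<close>

lemma run_stable:
  assumes "cost_of cs * L \<le> 1 / 2" "0 \<le> \<eta>"
  shows "norm (run \<eta> cs p' - run 0 cs p) \<le> 4 ^ length cs * (norm (p' - p) + \<eta>)"
  using assms(1)
proof (induction cs arbitrary: p p')
  case Nil
  then show ?case using assms(2) by simp
next
  case (Cons c cs)
  obtain i \<theta> where c: "c = (i, \<theta>)" by (cases c)
  have "\<bar>\<theta>\<bar> * L + cost_of cs * L \<le> 1 / 2" using Cons.prems by (simp add: c cost_of_def distrib_right)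
  moreover have "0 \<le> \<bar>\<theta>\<bar> * L" "0 \<le> cost_of cs * L" using L_pos cost_of_nonneg[of cs] by auto
  ultimately have s: "\<bar>\<theta>\<bar> * L \<le> 1 / 2" "cost_of cs * L \<le> 1 / 2" by linarith+
  have "norm (step \<eta> c p' - step 0 c p) + \<eta> \<le> 2 * (norm (p' - p) + \<eta>) + \<eta>"
    using step_stable[OF s(1) s(1), of \<eta> i p' 0 p] assms(2) by (simp add: c)
  also have "\<dots> \<le> 4 * (norm (p' - p) + \<eta>)" using assms(2) norm_ge_zero[of "p' - p"] by (simp add: algebra_simps)
  finally have d: "norm (step \<eta> c p' - step 0 c p) + \<eta> \<le> 4 * (norm (p' - p) + \<eta>)" .
  have "norm (run \<eta> (c # cs) p' - run 0 (c # cs) p) \<le> 4 ^ length cs * (norm (step \<eta> c p' - step 0 c p) + \<eta>)"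
    using Cons.IH[OF s(2)] by simp
  also have "\<dots> \<le> 4 ^ length cs * (4 * (norm (p' - p) + \<eta>))" using d by (intro mult_left_mono) auto
  finally show ?case by (simp add: algebra_simps)
qed

end

text \<open>The source of the exponent 1/r. Since \<open>c * norm w \<le> 1\<close>, its power with
  exponent 1 / \<open>length I\<close> is at most the power with the smaller exponent 1/r, so the
  longest brackets dominate.\<close>

lemma cost_of_blocks:
  fixes s :: "'m list \<Rightarrow> 'w::real_normed_vector \<Rightarrow> real"
  assumes r: "1 \<le> r" and c: "0 < c" and w: "c * norm w \<le> 1"
    and s: "\<And>I. I \<in> set Is \<Longrightarrow> \<bar>s I w\<bar> \<le> c * norm w"
    and Is: "\<And>I. I \<in> set Is \<Longrightarrow> I \<noteq> [] \<and> length I \<le> r"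
  shows "cost_of (blocks Is s w) \<le>
    (\<Sum>I\<leftarrow>Is. (cost_of (commutator_path I) + cost_of (reversal (commutator_path I))) * c powr (1 / r)) * norm w powr (1 / r)"
  using s Is
proof (induction Is)
  case Nil
  then show ?case by (simp add: cost_of_def)
next
  case (Cons I Is)
  let ?k = "cost_of (commutator_path I) + cost_of (reversal (commutator_path I))"
  let ?n = "length I"
  have I: "I \<noteq> []" "?n \<le> r" using Cons.prems(2)[of I] by auto
  have n: "0 < ?n" using I by simp
  have "root ?n \<bar>s I w\<bar> \<le> root ?n (c * norm w)"
    using n Cons.prems(1)[of I] by (simp add: real_root_le_iff)
  also have "\<dots> = (c * norm w) powr (1 / ?n)" using n c by (simp add: root_powr_inverse)
  also have "\<dots> \<le> (c * norm w) powr (1 / r)"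
    using w c n I r by (intro powr_mono') (auto simp: frac_le)
  also have "\<dots> = c powr (1 / r) * norm w powr (1 / r)" using c by (simp add: powr_mult)
  finally have "root ?n \<bar>s I w\<bar> * ?k \<le> (c powr (1 / r) * norm w powr (1 / r)) * ?k"
    by (intro mult_right_mono) (auto intro: add_nonneg_nonneg cost_of_nonneg)
  then have "cost_of (block I (s I w)) \<le> ?k * c powr (1 / r) * norm w powr (1 / r)"
    using cost_of_block[OF I(1), of "s I w"] by (simp add: mult_ac)
  moreover have "cost_of (blocks Is s w) \<le>
    (\<Sum>I\<leftarrow>Is. (cost_of (commutator_path I) + cost_of (reversal (commutator_path I))) * c powr (1 / r)) * norm w powr (1 / r)"
    using Cons by auto
  ultimately show ?case by (simp add: cost_of_append distrib_right)
qed

context control_fields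
begin

text \<open>The drift \<open>\<eta> e\<close> perturbs the driftless end-point map, which is close to the identity in the
  parameter \<open>w\<close>, by a uniformly small amount; Brouwer's theorem absorbs both errors.\<close>

lemma steering:
  fixes g :: "'n \<Rightarrow> 'm list \<Rightarrow> real"
  assumes r: "1 \<le> r"
    and g: "\<And>j l. (\<Sum>I\<in>words_upto r. g j I * iterated_bracket D I (\<lambda>x. x $ l) 0) = (if l = j then 1 else 0)"
  shows "\<exists>N C \<rho>0 d0. 0 < C \<and> 0 < \<rho>0 \<and> 0 < d0 \<and>
    (\<forall>p x. norm p \<le> \<rho>0 \<and> 0 < norm (x - p) \<and> norm (x - p) \<le> d0 \<longrightarrow>
      (\<exists>H>0. \<forall>\<eta> p'. 0 \<le> \<eta> \<and> \<eta> \<le> H \<and> norm (p' - p) \<le> real N * \<eta> \<longrightarrow>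
        (\<exists>cs. length cs = N \<and> cost_of cs \<le> C * norm (x - p) powr (1 / r) \<and> run \<eta> cs p' = x \<and>
           cost_of cs * L \<le> 1 / 2 \<and> norm p' + (real N * \<eta> + cost_of cs * B) \<le> R)))"
proof -
  obtain Is :: "'m list list" where Is: "set Is = words_upto r" "distinct Is"
    using finite_distinct_list[OF finite_words_upto] by blast
  have IsD: "I \<noteq> [] \<and> length I \<le> r" if "I \<in> set Is" for I
    using that Is by (simp add: words_upto_def)
  \<comment> \<open>The coefficient of the bracket I when w is written through the brackets at the
    origin by means of g. Hence \<open>combination Is s w 0 = w\<close>, shown below as
    \<open>U0\<close>.\<close>
  define s :: "'m list \<Rightarrow> real ^ 'n \<Rightarrow> real" where "s I w = (\<Sum>j\<in>UNIV. w $ j * g j I)" for I w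
  define c where "c = 1 + (\<Sum>I\<in>words_upto r. \<Sum>j\<in>UNIV. \<bar>g j I\<bar>)"
  have c: "0 < c" unfolding c_def by (intro add_pos_nonneg sum_nonneg) auto
  have s: "\<bar>s I w\<bar> \<le> c * norm w" if "I \<in> set Is" for I w
  proof -
    have "\<bar>s I w\<bar> \<le> (\<Sum>j\<in>UNIV. \<bar>w $ j * g j I\<bar>)" unfolding s_def by (rule sum_abs)
    also have "\<dots> \<le> (\<Sum>j\<in>UNIV. norm w * \<bar>g j I\<bar>)"
      unfolding abs_mult by (intro sum_mono mult_right_mono component_le_norm_cart) auto
    also have "\<dots> = (\<Sum>j\<in>UNIV. \<bar>g j I\<bar>) * norm w" by (simp add: sum_distrib_left mult.commute)
    also have "(\<Sum>j\<in>UNIV. \<bar>g j I\<bar>) \<le> (\<Sum>I\<in>words_upto r. \<Sum>j\<in>UNIV. \<bar>g j I\<bar>)"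
      using that Is by (intro member_le_sum) (auto intro: sum_nonneg)
    also have "\<dots> \<le> c" by (simp add: c_def)
    finally show ?thesis by (simp add: mult_right_mono)
  qed
  let ?U = "combination Is s"
  have U0: "?U w 0 = w" for w
  proof -
    have "?U w 0 $ l = w $ l" for l
    proof -
      have "?U w 0 $ l = (\<Sum>I\<in>words_upto r. s I w * bracket_field I 0 $ l)"
        unfolding combination_def sum_list_distinct_conv_sum_set[OF Is(2)] Is(1) by simp
      also have "\<dots> = (\<Sum>I\<in>words_upto r. \<Sum>j\<in>UNIV. w $ j * (g j I * iterated_bracket D I (\<lambda>x. x $ l) 0))"
        by (simp add: s_def bracket_field_def sum_distrib_right mult.assoc)
      also have "\<dots> = (\<Sum>j\<in>UNIV. w $ j * (\<Sum>I\<in>words_upto r. g j I * iterated_bracket D I (\<lambda>x. x $ l) 0))"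
        by (subst sum.swap) (simp add: sum_distrib_left)
      also have "\<dots> = (\<Sum>j\<in>UNIV. if j = l then w $ l else 0)" unfolding g by (rule sum.cong) auto
      finally show ?thesis by simp
    qed
    then show ?thesis by (simp add: vec_eq_iff)
  qed
  have "\<exists>C\<ge>0. \<forall>w. \<forall>p\<in>cball 0 R. \<forall>p'\<in>cball 0 R. norm (?U w p) \<le> C * norm w \<and>
     norm (?U w p - ?U w p') \<le> C * norm w * norm (p - p')"
    by (rule combination_bounds[OF c s])
  then obtain C1 where C1_0: "0 \<le> C1" and C1_U: "\<forall>w. \<forall>p\<in>cball 0 R. \<forall>p'\<in>cball 0 R. norm (?U w p) \<le> C1 * norm w \<and>
     norm (?U w p - ?U w p') \<le> C1 * norm w * norm (p - p')"
    by (elim exE conjE)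
  have C1_lip: "norm (?U w p - ?U w p') \<le> C1 * norm w * norm (p - p')" if "p \<in> cball 0 R" "p' \<in> cball 0 R" for w p p'
    by (rule conjunct2[OF C1_U[rule_format, OF that]])
  note C1 = C1_0 C1_lip
  have "small_approx (\<lambda>w. run 0 (blocks Is s w)) ?U"
    by (rule small_approx_blocks[OF c s]) (use IsD in auto)
  moreover have "R / 2 < R" "0 < (1 / 8 :: real)" using R_pos by auto
  ultimately obtain \<sigma>1 where \<sigma>1: "0 < \<sigma>1" "\<And>w p. norm w \<le> \<sigma>1 \<Longrightarrow> p \<in> cball 0 (R / 2) \<Longrightarrow>
      norm (run 0 (blocks Is s w) p - (p + ?U w p)) \<le> 1 / 8 * norm w"
    unfolding small_approx_def by meson
  define K where "K = (\<Sum>I\<leftarrow>Is. (cost_of (commutator_path I) + cost_of (reversal (commutator_path I))) * c powr (1 / r))"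
  have K0: "0 \<le> K" unfolding K_def
    by (intro sum_list_nonneg) (auto intro!: mult_nonneg_nonneg add_nonneg_nonneg cost_of_nonneg)
  have cost: "cost_of (blocks Is s w) \<le> K * norm w powr (1 / r)" if "c * norm w \<le> 1" for w
    unfolding K_def by (rule cost_of_blocks[OF r c that]) (assumption | rule s IsD)+
  \<comment> \<open>A bound for \<open>norm w powr (1 / r)\<close>: the cost is then at most
    \<open>K * m\<close>, which satisfies both the condition for solving the equations of motion and
    the one for staying in the ball.\<close>
  define m where "m = min (1 / (2 * L * (K + 1))) (R / (4 * B * (K + 1)))"
  have m: "0 < m" unfolding m_def using L_pos B_pos R_pos K0 by (simp add: mult_pos_pos)
  have mL: "K * m * L \<le> 1 / 2" 
  proof -
    have "m * (2 * L * (K + 1)) \<le> 1"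
      using pos_le_divide_eq[of "2 * L * (K + 1)" m 1] L_pos K0 by (simp add: m_def)
    moreover have "K * m * L \<le> (K + 1) * m * L" using m L_pos by (intro mult_right_mono) auto
    ultimately show ?thesis by (simp add: algebra_simps)
  qed
  have mB: "K * m * B \<le> R / 4" 
  proof -
    have "m * (4 * B * (K + 1)) \<le> R"
      using pos_le_divide_eq[of "4 * B * (K + 1)" m R] B_pos K0 by (simp add: m_def)
    moreover have "K * m * B \<le> (K + 1) * m * B" using m B_pos by (intro mult_right_mono) auto
    ultimately show ?thesis by (simp add: algebra_simps)
  qed
  \<comment> \<open>The entry \<open>m ^ r\<close> yields
    \<open>norm w powr (1 / r) \<le> m\<close>, and \<open>1 / c\<close> yields the hypothesis
    \<open>c * norm w \<le> 1\<close> of the cost bound.\<close>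
  define \<sigma> where "\<sigma> = min \<sigma>1 (min (m ^ r) (1 / c))"
  have \<sigma>: "0 < \<sigma>" unfolding \<sigma>_def using \<sigma>1 m c by simp
  have small: "cost_of (blocks Is s w) * L \<le> 1 / 2" "cost_of (blocks Is s w) * B \<le> R / 4" 
      "cost_of (blocks Is s w) \<le> K * norm w powr (1 / r)" if w: "norm w \<le> \<sigma>" for w
  proof -
    have cw: "c * norm w \<le> 1" using w c pos_le_divide_eq[OF c, of "norm w" 1] by (simp add: \<sigma>_def mult.commute)
    then show 1: "cost_of (blocks Is s w) \<le> K * norm w powr (1 / r)" by (rule cost)
    have "norm w powr (1 / r) \<le> (m ^ r) powr (1 / r)" using w by (intro powr_mono2) (auto simp: \<sigma>_def)
    also have "\<dots> = m" using m r by (simp add: powr_realpow[symmetric] powr_powr)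
    finally have "K * norm w powr (1 / r) \<le> K * m" using K0 by (intro mult_left_mono)
    with 1 have 2: "cost_of (blocks Is s w) \<le> K * m" by linarith
    show "cost_of (blocks Is s w) * L \<le> 1 / 2"
      using mult_right_mono[OF 2, of L] L_pos mL by linarith
    show "cost_of (blocks Is s w) * B \<le> R / 4"
      using mult_right_mono[OF 2, of B] B_pos mB by linarith
  qed
  define N where "N = (\<Sum>I\<leftarrow>Is. 2 * length (commutator_path I))"
  \<comment> \<open>The second entry gives \<open>C1 * norm p \<le> 1 / 8\<close>: passing from the
    brackets at the origin to those at p changes the displacement w by at most an eighth of its
    norm.\<close>
  define \<rho>0 where "\<rho>0 = min (R / 4) (1 / (8 * (C1 + 1)))"
  have \<rho>0: "0 < \<rho>0" unfolding \<rho>0_def using R_pos C1 by simp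
  \<comment> \<open>The parameter is sought in the ball of radius twice the distance, hence the
    factor \<open>2 powr (1 / r)\<close>.\<close>
  define C where "C = (K + 1) * 2 powr (1 / r)"
  have main: "\<exists>H>0. \<forall>\<eta> p'. 0 \<le> \<eta> \<and> \<eta> \<le> H \<and> norm (p' - p) \<le> real N * \<eta> \<longrightarrow>
        (\<exists>cs. length cs = N \<and> cost_of cs \<le> C * norm (x - p) powr (1 / r) \<and> run \<eta> cs p' = x \<and>
           cost_of cs * L \<le> 1 / 2 \<and> norm p' + (real N * \<eta> + cost_of cs * B) \<le> R)"
    if p: "norm p \<le> \<rho>0" and x0: "0 < norm (x - p)" and x1: "norm (x - p) \<le> \<sigma> / 2" for p x
  proof -
    define d where "d = norm (x - p)"
    have d: "0 < d" "2 * d \<le> \<sigma>" using x0 x1 by (auto simp: d_def)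
    \<comment> \<open>The longest admissible duration of one step. The first entry keeps the effect
      of the drift and of the displaced start \<open>p'\<close>, amplified by at most
      \<open>4 ^ N\<close>, below d / 4; the second keeps the path in the ball. Dependence on d is
      allowed since time is chosen after the target.\<close>
    define H where "H = min (d / (4 * 4 ^ N * (real N + 1))) (R / (8 * (real N + 1)))"
    have H: "0 < H" unfolding H_def using d R_pos by simp
    show ?thesis
    proof (intro exI[of _ H] conjI H allI impI)
      fix \<eta> p' assume a: "0 \<le> \<eta> \<and> \<eta> \<le> H \<and> norm (p' - p) \<le> real N * \<eta>"
      then have \<eta>: "0 \<le> \<eta>" "\<eta> \<le> H" and p': "norm (p' - p) \<le> real N * \<eta>" by auto
      have N1: "0 < real N + 1" by simp
      have e1: "4 ^ N * ((real N + 1) * \<eta>) \<le> d / 4"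
      proof -
        have "\<eta> * (4 * 4 ^ N * (real N + 1)) \<le> d"
          using \<eta> pos_le_divide_eq[of "4 * 4 ^ N * (real N + 1)" \<eta> d] by (simp add: H_def)
        then show ?thesis by (simp add: algebra_simps)
      qed
      have e2: "real N * \<eta> \<le> R / 8"
      proof -
        have "\<eta> * (8 * (real N + 1)) \<le> R"
          using \<eta> pos_le_divide_eq[of "8 * (real N + 1)" \<eta> R] by (simp add: H_def)
        then show ?thesis using \<eta>(1) by (simp add: algebra_simps)
      qed
      have pR: "p \<in> cball 0 (R / 2)" "p \<in> cball 0 R" using p R_pos by (auto simp: \<rho>0_def)
      have C1p: "C1 * norm p \<le> 1 / 8"
      proof -
        have "norm p * (8 * (C1 + 1)) \<le> 1"
          using p pos_le_divide_eq[of "8 * (C1 + 1)" "norm p" 1] C1 by (simp add: \<rho>0_def)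
        then have "8 * (C1 * norm p) + 8 * norm p \<le> 1" by (simp add: algebra_simps)
        then show ?thesis using norm_ge_zero[of p] by linarith
      qed
      \<comment> \<open>Its fixed points are exactly the parameters whose path leads from
        \<open>p'\<close> to x.\<close>
      define h where "h w = w - (run \<eta> (blocks Is s w) p' - x)" for w
      have cont: "continuous_on (cball 0 (2 * d)) h"
        unfolding h_def
      proof (intro continuous_intros continuous_on_run_blocks)
        show "continuous_on (cball 0 (2 * d)) (s I)" for I
          unfolding s_def by (intro continuous_intros)
        show "I \<noteq> []" if "I \<in> set Is" for I using IsD[OF that] by simp
        show "cost_of (blocks Is s w) * L \<le> 1 / 2" if "w \<in> cball 0 (2 * d)" for w
          using small(1)[of w] that d by simp
      qed
      have bound: "norm (h w) \<le> 2 * d" if w: "norm w \<le> 2 * d" for w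
      proof -
        have w\<sigma>: "norm w \<le> \<sigma>" "norm w \<le> \<sigma>1" using w d by (auto simp: \<sigma>_def)
        have "norm (run \<eta> (blocks Is s w) p' - run 0 (blocks Is s w) p) \<le> 4 ^ N * (norm (p' - p) + \<eta>)"
          using run_stable[OF small(1)[OF w\<sigma>(1)] \<eta>(1), of p' p] by (simp add: length_blocks N_def)
        also have "\<dots> \<le> 4 ^ N * ((real N + 1) * \<eta>)"
          using p' by (intro mult_left_mono) (auto simp: distrib_right)
        finally have 1: "norm (run \<eta> (blocks Is s w) p' - run 0 (blocks Is s w) p) \<le> d / 4" using e1 by linarith
        have 2: "norm (run 0 (blocks Is s w) p - (p + ?U w p)) \<le> 1 / 8 * norm w"
          by (rule \<sigma>1(2)[OF w\<sigma>(2) pR(1)])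
        have "norm (?U w p - ?U w 0) \<le> C1 * norm w * norm (p - 0)"
          by (rule C1(2)[OF pR(2)]) (use R_pos in simp)
        also have "\<dots> = (C1 * norm p) * norm w" by simp
        also have "\<dots> \<le> 1 / 8 * norm w" using C1p by (intro mult_right_mono) auto
        finally have 3: "norm (?U w p - w) \<le> 1 / 8 * norm w" unfolding U0 .
        have nt: "norm (a - (b + c + b')) \<le> norm a + (norm b + norm c + norm b')" for a b c b' :: "real ^ 'n"
          using norm_triangle_ineq4[of a "b + c + b'"] norm_triangle_ineq[of "b + c" b'] norm_triangle_ineq[of b c] by linarith
        have h: "h w = (x - p) - ((run \<eta> (blocks Is s w) p' - run 0 (blocks Is s w) p) +
           (run 0 (blocks Is s w) p - (p + ?U w p)) + (?U w p - w))" by (simp add: h_def)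
        have "norm (h w) \<le> norm (x - p) + (norm (run \<eta> (blocks Is s w) p' - run 0 (blocks Is s w) p) +
           norm (run 0 (blocks Is s w) p - (p + ?U w p)) + norm (?U w p - w))"
          unfolding h by (rule nt)
        \<comment> \<open>The terms are the distance to x, the drift error, the expansion error and
          the error from using brackets at p instead of the origin. For
          \<open>norm w \<le> 2 * d\<close> they add up to at most 7 d / 4, so h maps the ball of
          radius 2 d into itself.\<close>
        also have "\<dots> \<le> d + (d / 4 + 1 / 8 * norm w + 1 / 8 * norm w)" using 1 2 3 unfolding d_def by linarith
        also have "\<dots> \<le> 2 * d" using w d by linarith
        finally show ?thesis .
      qed
      obtain w where w: "w \<in> cball 0 (2 * d)" "h w = w"
        by (rule brouwer_ball[OF _ cont]) (use d bound in auto)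
      have wd: "norm w \<le> 2 * d" "norm w \<le> \<sigma>" using w d by auto
      show "\<exists>cs. length cs = N \<and> cost_of cs \<le> C * norm (x - p) powr (1 / r) \<and> run \<eta> cs p' = x \<and>
           cost_of cs * L \<le> 1 / 2 \<and> norm p' + (real N * \<eta> + cost_of cs * B) \<le> R"
      proof (intro exI[of _ "blocks Is s w"] conjI)
        show "length (blocks Is s w) = N" by (simp add: length_blocks N_def)
        show "run \<eta> (blocks Is s w) p' = x" using w(2) by (simp add: h_def)
        show "cost_of (blocks Is s w) * L \<le> 1 / 2" by (rule small(1)[OF wd(2)])
        have "norm w powr (1 / r) \<le> (2 * d) powr (1 / r)" using wd by (intro powr_mono2) auto
        then have "K * norm w powr (1 / r) \<le> (K + 1) * (2 * d) powr (1 / r)"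
          using K0 by (intro mult_mono) auto
        also have "\<dots> = C * d powr (1 / r)" using d by (simp add: C_def powr_mult)
        finally show "cost_of (blocks Is s w) \<le> C * norm (x - p) powr (1 / r)"
          using small(3)[OF wd(2)] by (simp add: d_def)
        have "norm p' \<le> norm p + norm (p' - p)" using norm_triangle_ineq[of p "p' - p"] by simp
        moreover have "norm p \<le> R / 4" using p by (simp add: \<rho>0_def)
        ultimately show "norm p' + (real N * \<eta> + cost_of (blocks Is s w) * B) \<le> R"
          using p' e2 small(2)[OF wd(2)] R_pos by linarith
      qed
    qed
  qed
  have Cp: "0 < C" using K0 by (simp add: C_def)
  have \<sigma>2: "0 < \<sigma> / 2" using \<sigma> by simp
  show ?thesis
    by (rule exI[of _ N], rule exI[of _ C], rule exI[of _ \<rho>0], rule exI[of _ "\<sigma> / 2"])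
      (use main Cp \<rho>0 \<sigma>2 in blast)
qed

end

section \<open>Absolutely continuous curves\<close>

text \<open>\<open>abs_continuous_on\<close> speaks of intervals listed from left to right. A finite
  family with disjoint interiors is put in that form by sorting its left end points, which are
  distinct since the intervals are nondegenerate.\<close>

lemma ac_finite_intervals:
  fixes lo hi :: "'j \<Rightarrow> real" and h :: "real \<Rightarrow> 'b::metric_space"
  assumes ac: "\<forall>(N::nat) x y.
        (\<forall>i<N. a \<le> x i \<and> x i \<le> y i \<and> y i \<le> b) \<and> (\<forall>i. Suc i < N \<longrightarrow> y i \<le> x (Suc i)) \<and>
        (\<Sum>i<N. y i - x i) < d \<longrightarrow> (\<Sum>i<N. dist (h (x i)) (h (y i))) < e"
    and J: "finite J" "\<And>j. j \<in> J \<Longrightarrow> a \<le> lo j \<and> lo j < hi j \<and> hi j \<le> b"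
    and disj: "\<And>i j. i \<in> J \<Longrightarrow> j \<in> J \<Longrightarrow> i \<noteq> j \<Longrightarrow> {lo i<..<hi i} \<inter> {lo j<..<hi j} = {}"
    and less: "(\<Sum>j\<in>J. hi j - lo j) < d"
  shows "(\<Sum>j\<in>J. dist (h (lo j)) (h (hi j))) < e"
proof -
  have apart: "hi i \<le> lo j" if ij: "i \<in> J" "j \<in> J" "i \<noteq> j" "lo i \<le> lo j" for i j
  proof (rule ccontr)
    assume "\<not> hi i \<le> lo j"
    then have "(lo j + min (hi i) (hi j)) / 2 \<in> {lo i<..<hi i} \<inter> {lo j<..<hi j}"
      using ij(4) J(2)[OF ij(2)] by (auto simp: min_def field_simps)
    then show False using disj[OF ij(1-3)] by blast
  qed
  have inj: "inj_on lo J"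
  proof (rule inj_onI, rule ccontr)
    fix i j assume "i \<in> J" "j \<in> J" "lo i = lo j" "i \<noteq> j"
    then show False using apart[of i j] J(2)[of i] by simp
  qed
  define xs where "xs = sorted_list_of_set (lo ` J)"
  define k where "k = the_inv_into J lo"
  have k: "k (lo j) = j" if "j \<in> J" for j unfolding k_def using inj that by (rule the_inv_into_f_f)
  have set: "set xs = lo ` J" and dist: "distinct xs" using J(1) by (auto simp: xs_def)
  have mem: "\<exists>j\<in>J. xs ! i = lo j \<and> k (xs ! i) = j" if "i < length xs" for i
    using nth_mem[OF that] k unfolding set by auto
  have tr: "(\<Sum>i<length xs. F (xs ! i)) = (\<Sum>j\<in>J. F (lo j))" for F :: "real \<Rightarrow> real"
  proof -
    have "bij_betw (nth xs) {..<length xs} (lo ` J)" using bij_betw_nth[OF dist] set by simp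
    from sum.reindex_bij_betw[OF this, of F] show ?thesis by (simp add: sum.reindex[OF inj])
  qed
  have "(\<Sum>i<length xs. dist (h (xs ! i)) (h (hi (k (xs ! i))))) < e"
  proof (rule ac[rule_format], intro conjI allI impI)
    fix i assume "i < length xs"
    from mem[OF this] show "a \<le> xs ! i" "xs ! i \<le> hi (k (xs ! i))" "hi (k (xs ! i)) \<le> b"
      using J(2) by fastforce+
  next
    fix i assume i: "Suc i < length xs"
    then have "xs ! i < xs ! Suc i"
      using sorted_wrt_nth_less[of "(<)" xs i "Suc i"] strict_sorted_list_of_set[of "lo ` J"] by (simp add: xs_def)
    moreover obtain j j' where "j \<in> J" "xs ! i = lo j" "k (xs ! i) = j" "j' \<in> J" "xs ! Suc i = lo j'"
      using mem[of i] mem[of "Suc i"] i by auto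
    ultimately show "hi (k (xs ! i)) \<le> xs ! Suc i" using apart[of j j'] by auto
  next
    have "(\<Sum>i<length xs. hi (k (xs ! i)) - xs ! i) = (\<Sum>j\<in>J. hi j - lo j)"
      unfolding tr[of "\<lambda>x. hi (k x) - x"] by (intro sum.cong) (auto simp: k)
    then show "(\<Sum>i<length xs. hi (k (xs ! i)) - xs ! i) < d" using less by simp
  qed
  then show ?thesis
    unfolding tr[of "\<lambda>x. dist (h x) (h (hi (k x)))"] by (simp add: k cong: sum.cong)
qed

text \<open>The straddle lemma: as t lies between u and v, the linearisation errors at the two ends
  add up to at most \<open>e * (v - u)\<close>.\<close>

lemma has_vector_derivative_interval_bound:
  fixes h :: "real \<Rightarrow> 'b::real_normed_vector"
  assumes "(h has_vector_derivative h') (at t within S)" "0 < e"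
  shows "\<exists>d>0. \<forall>u v. u \<in> S \<and> v \<in> S \<and> u \<le> t \<and> t \<le> v \<and> {u..v} \<subseteq> ball t d \<longrightarrow>
     norm (h v - h u) \<le> (norm h' + e) * (v - u)"
proof -
  obtain d where d: "0 < d" "\<And>y. y \<in> S \<Longrightarrow> norm (y - t) < d \<Longrightarrow> norm (h y - h t - (y - t) *\<^sub>R h') \<le> e * norm (y - t)"
    using assms unfolding has_vector_derivative_def has_derivative_within_alt by blast
  show ?thesis
  proof (intro exI[of _ d] conjI d(1) allI impI)
    fix u v assume uv: "u \<in> S \<and> v \<in> S \<and> u \<le> t \<and> t \<le> v \<and> {u..v} \<subseteq> ball t d"
    then have "u \<in> {u..v}" "v \<in> {u..v}" by auto
    then have "u \<in> ball t d" "v \<in> ball t d" using uv by blast+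
    then have n: "norm (u - t) < d" "norm (v - t) < d" by (auto simp: dist_norm norm_minus_commute)
    have "h v - h u = (h v - h t - (v - t) *\<^sub>R h') - (h u - h t - (u - t) *\<^sub>R h') + (v - u) *\<^sub>R h'"
      by (simp add: algebra_simps)
    also have "norm \<dots> \<le> norm (h v - h t - (v - t) *\<^sub>R h') + norm (h u - h t - (u - t) *\<^sub>R h') + norm ((v - u) *\<^sub>R h')"
      by (intro norm_triangle_le add_right_mono norm_triangle_ineq4)
    also have "\<dots> \<le> e * (v - t) + e * (t - u) + (v - u) * norm h'"
      using d(2)[of v] d(2)[of u] n uv by (intro add_mono) auto
    finally show "norm (h v - h u) \<le> (norm h' + e) * (v - u)" by (simp add: algebra_simps)
  qed
qed

text \<open>In a fine tagged division of \<open>[a, b]\<close>, the intervals with tags in the exceptional null set have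
  small total length, so absolute continuity controls their contribution.\<close>

lemma ac_norm_le_integral:
  fixes h :: "real \<Rightarrow> 'b::euclidean_space"
  assumes ab: "a \<le> b" and ac: "abs_continuous_on a b h" and N: "negligible N"
    and g: "g integrable_on {a..b}"
    and der: "\<And>t. t \<in> {a..b} - N \<Longrightarrow> \<exists>h'. (h has_vector_derivative h') (at t within {a..b}) \<and> norm h' \<le> g t"
  shows "norm (h b - h a) \<le> integral {a..b} g"
proof (rule field_le_epsilon)
  fix \<epsilon> :: real assume \<epsilon>: "0 < \<epsilon>"
  \<comment> \<open>Three contributions are allotted: e for the Riemann sum, e for the intervals
    with exceptional tags, and \<open>e * (b - a)\<close> for the linearisation errors.\<close>
  define e where "e = \<epsilon> / (b - a + 2)"
  have ba: "0 < b - a + 2" using ab by simp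
  have e: "0 < e" using \<epsilon> ba by (simp add: e_def)
  \<comment> \<open>Set to 0 on N, so that intervals with exceptional tags add nothing to the
    Riemann sum.\<close>
  define g' where "g' t = (if t \<in> N then 0 else g t)" for t
  have g': "(g' has_integral integral {a..b} g) {a..b}"
    by (rule has_integral_spike[OF N _ integrable_integral[OF g]]) (auto simp: g'_def)
  obtain d where d: "0 < d" "\<forall>(N::nat) x y.
        (\<forall>i<N. a \<le> x i \<and> x i \<le> y i \<and> y i \<le> b) \<and> (\<forall>i. Suc i < N \<longrightarrow> y i \<le> x (Suc i)) \<and>
        (\<Sum>i<N. y i - x i) < d \<longrightarrow> (\<Sum>i<N. dist (h (x i)) (h (y i))) < e"
    using ac[unfolded abs_continuous_on_def, rule_format, OF e] by (elim exE conjE)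
  have nN: "N \<in> null_sets lebesgue" using N by (simp add: negligible_iff_null_sets)
  obtain Q where Q: "open Q" "N \<subseteq> Q" "Q \<in> lmeasurable" "measure lebesgue Q < d"
  proof -
    obtain T where T: "open T" "N \<subseteq> T" "T - N \<in> lmeasurable" "emeasure lebesgue (T - N) < ennreal d"
      using sets_lebesgue_outer_open[of N d] nN d(1) by auto
    have eq: "T = (T - N) \<union> N" using T by auto
    have TL: "T \<in> lmeasurable" using fmeasurable.Un[OF T(3) fmeasurableI_null_sets[OF nN]] eq by simp
    have "emeasure lebesgue T = emeasure lebesgue (T - N)"
      using emeasure_Un_null_set[OF fmeasurableD[OF T(3)] nN] eq by simp
    then have "ennreal (measure lebesgue T) < ennreal d"
      using T(4) emeasure_eq_measure2[OF TL] by simp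
    then have "measure lebesgue T < d" by (simp add: ennreal_less_iff)
    with TL show ?thesis using that T by blast
  qed
  from g'[unfolded has_integral_real, rule_format, OF e]
  obtain \<gamma>1 where \<gamma>1: "gauge \<gamma>1" "\<forall>p. p tagged_division_of {a..b} \<and> \<gamma>1 fine p \<longrightarrow>
      norm ((\<Sum>(x,K)\<in>p. measure lborel K *\<^sub>R g' x) - integral {a..b} g) < e"
    by (elim exE conjE)
  have "\<exists>\<delta>>0. t \<in> {a..b} - N \<longrightarrow> (\<forall>u v. u \<in> {a..b} \<and> v \<in> {a..b} \<and> u \<le> t \<and> t \<le> v \<and> {u..v} \<subseteq> ball t \<delta> \<longrightarrow>
     norm (h v - h u) \<le> (g t + e) * (v - u))" for t
  proof (cases "t \<in> {a..b} - N")
    case True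
    from der[OF True] obtain h' where h': "(h has_vector_derivative h') (at t within {a..b})" "norm h' \<le> g t" by auto
    obtain \<delta> where \<delta>: "\<delta> > 0" "\<forall>u v. u \<in> {a..b} \<and> v \<in> {a..b} \<and> u \<le> t \<and> t \<le> v \<and> {u..v} \<subseteq> ball t \<delta> \<longrightarrow>
     norm (h v - h u) \<le> (norm h' + e) * (v - u)"
      using has_vector_derivative_interval_bound[OF h'(1) e] by blast
    show ?thesis
    proof (intro exI[of _ \<delta>] conjI \<delta>(1) impI allI)
      fix u v assume uv: "u \<in> {a..b} \<and> v \<in> {a..b} \<and> u \<le> t \<and> t \<le> v \<and> {u..v} \<subseteq> ball t \<delta>"
      then have "norm (h v - h u) \<le> (norm h' + e) * (v - u)" using \<delta>(2) by blast
      also have "\<dots> \<le> (g t + e) * (v - u)" using uv h'(2) by (intro mult_right_mono) auto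
      finally show "norm (h v - h u) \<le> (g t + e) * (v - u)" .
    qed
  qed (use zero_less_one in blast)
  then obtain \<delta> where \<delta>: "\<And>t. 0 < \<delta> t" "\<And>t u v. t \<in> {a..b} - N \<Longrightarrow> u \<in> {a..b} \<Longrightarrow> v \<in> {a..b} \<Longrightarrow> u \<le> t \<Longrightarrow> t \<le> v \<Longrightarrow>
      {u..v} \<subseteq> ball t (\<delta> t) \<Longrightarrow> norm (h v - h u) \<le> (g t + e) * (v - u)"
    by metis
  \<comment> \<open>Intervals tagged in N are confined to the open set Q of measure less than d;
    those tagged elsewhere are short enough for the straddle estimate.\<close>
  define \<gamma> where "\<gamma> t = \<gamma>1 t \<inter> (if t \<in> N then Q else ball t (\<delta> t))" for t
  have "gauge \<gamma>" unfolding gauge_def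
  proof
    fix t show "t \<in> \<gamma> t \<and> open (\<gamma> t)" 
      using \<gamma>1(1) Q \<delta>(1)[of t] by (auto simp: \<gamma>_def gauge_def)
  qed
  then obtain p where p: "p tagged_division_of {a..b}" "\<gamma> fine p" using fine_division_exists_real by blast
  have fp: "finite p" using p(1) by auto
  have "\<gamma>1 fine p" using p(2) by (auto simp: fine_def \<gamma>_def)
  then have "norm ((\<Sum>(x,K)\<in>p. measure lborel K *\<^sub>R g' x) - integral {a..b} g) < e"
    using \<gamma>1(2) p(1) by simp
  then have I: "(\<Sum>(x,K)\<in>p. measure lborel K *\<^sub>R g' x) < integral {a..b} g + e" by (simp add: abs_if split: if_splits)
  have K: "\<exists>u v. K = {u..v} \<and> u \<le> x \<and> x \<le> v \<and> a \<le> u \<and> v \<le> b \<and> K \<subseteq> \<gamma> x" if xK: "(x, K) \<in> p" for x K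
  proof -
    obtain u v where uv: "K = {u..v}" using tagged_division_ofD(4)[OF p(1) xK] by auto
    have "x \<in> K" "K \<subseteq> {a..b}" using tagged_division_ofD(2,3)[OF p(1) xK] by auto
    then show ?thesis using uv p(2) xK by (intro exI[of _ u] exI[of _ v]) (auto simp: fine_def)
  qed
  define F where "F = (\<lambda>(x::real, K). h (Sup K) - h (Inf K))"
  have tele: "h b - h a = sum F p" unfolding F_def
    using additive_tagged_division_1[OF ab p(1), of h] by simp
  \<comment> \<open>Degenerate intervals are left out: they contribute 0, and without them distinct
    members of P have distinct underlying intervals, so sums over P can be reindexed by
    intervals.\<close>
  define P where "P = {(x, K) \<in> p. x \<in> N \<and> Inf K < Sup K}"
  have Pp: "P \<subseteq> p" by (auto simp: P_def)
  have good: "norm (F c) \<le> (case c of (x, K) \<Rightarrow> measure lborel K *\<^sub>R g' x + e * measure lborel K)" if c: "c \<in> p - P" for c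
  proof -
    obtain x K where xK: "c = (x, K)" "(x, K) \<in> p" using c by (cases c) auto
    obtain u v where uv: "K = {u..v}" "u \<le> x" "x \<le> v" "a \<le> u" "v \<le> b" "K \<subseteq> \<gamma> x" using K[OF xK(2)] by blast
    have SI: "Sup K = v" "Inf K = u" using uv by auto
    show ?thesis
    proof (cases "x \<in> N")
      case True
      then have "u = v" using c xK SI uv by (auto simp: P_def)
      then show ?thesis using xK SI by (simp add: F_def uv)
    next
      case False
      then have "norm (h v - h u) \<le> (g x + e) * (v - u)"
        using uv by (intro \<delta>(2)) (auto simp: \<gamma>_def)
      then show ?thesis using xK SI uv False by (simp add: F_def g'_def algebra_simps)
    qed
  qed
  have bad: "(\<Sum>c\<in>P. norm (F c)) \<le> e"
  proof -
    have finP: "finite P" using fp Pp finite_subset by blast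
    have P: "\<exists>u v. K = {u..v} \<and> u < v \<and> a \<le> u \<and> v \<le> b \<and> K \<subseteq> Q" if "(x, K) \<in> P" for x K
    proof -
      have "(x, K) \<in> p" "x \<in> N" "Inf K < Sup K" using that by (auto simp: P_def)
      then show ?thesis using K[of x K] by (auto simp: \<gamma>_def)
    qed
    have int: "interior K1 \<inter> interior K2 = {}" if "(x1, K1) \<in> P" "(x2, K2) \<in> P" "(x1, K1) \<noteq> (x2, K2)" for x1 K1 x2 K2
      using tagged_division_ofD(5)[OF p(1)] that Pp by blast
    have inj: "inj_on snd P"
    proof (rule inj_onI, rule ccontr)
      fix c c' assume a: "c \<in> P" "c' \<in> P" "snd c = snd c'" "c \<noteq> c'"
      then obtain x K x' where "c = (x, K)" "c' = (x', K)" by (metis prod.collapse)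
      then show False using int[of x K x' K] P[of x K] a by auto
    qed
    have tp: "P tagged_partial_division_of {a..b}"
      using tagged_partial_division_subset[OF _ Pp] p(1) by (auto simp: tagged_division_of_def)
    have dv: "snd ` P division_of \<Union>(snd ` P)"
      by (rule division_of_tagged_division[OF tagged_partial_division_of_Union_self[OF tp]])
    have "(\<Sum>K\<in>snd ` P. Sup K - Inf K) = (\<Sum>K\<in>snd ` P. measure lebesgue K)"
      by (rule sum.cong[OF refl]) (use P in force)
    also have "\<dots> = measure lebesgue (\<Union>(snd ` P))" by (rule content_division[OF dv])
    also have "\<dots> \<le> measure lebesgue Q"
      using P Q(3) by (intro measure_mono_fmeasurable) (force intro: fmeasurableD lmeasurable_division[OF dv])+
    finally have len: "(\<Sum>K\<in>snd ` P. Sup K - Inf K) < d" using Q(4) by linarith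
    have "(\<Sum>K\<in>snd ` P. dist (h (Inf K)) (h (Sup K))) < e"
    proof (rule ac_finite_intervals[OF d(2)])
      show "finite (snd ` P)" using finP by simp
      show "a \<le> Inf K \<and> Inf K < Sup K \<and> Sup K \<le> b" if K: "K \<in> snd ` P" for K
      proof -
        from K obtain x where "(x, K) \<in> P" by auto
        from P[OF this] show ?thesis by auto
      qed
      show "{Inf K<..<Sup K} \<inter> {Inf K'<..<Sup K'} = {}" if K: "K \<in> snd ` P" "K' \<in> snd ` P" "K \<noteq> K'" for K K'
      proof -
        from K(1,2) obtain x x' where x: "(x, K) \<in> P" "(x', K') \<in> P" by auto
        then have "interior K \<inter> interior K' = {}" using int K(3) by blast
        moreover obtain u v u' v' where "K = {u..v}" "u < v" "K' = {u'..v'}" "u' < v'"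
          using P[OF x(1)] P[OF x(2)] by blast
        ultimately show ?thesis by simp
      qed
    qed (rule len)
    then have "(\<Sum>c\<in>P. dist (h (Inf (snd c))) (h (Sup (snd c)))) < e"
      by (simp add: sum.reindex[OF inj] o_def)
    moreover have "(\<Sum>c\<in>P. norm (F c)) = (\<Sum>c\<in>P. dist (h (Inf (snd c))) (h (Sup (snd c))))"
      by (rule sum.cong) (auto simp: F_def dist_norm norm_minus_commute split: prod.splits)
    ultimately show ?thesis by simp
  qed
  have "norm (h b - h a) \<le> (\<Sum>c\<in>p. norm (F c))" unfolding tele by (rule norm_sum)
  also have "\<dots> = (\<Sum>c\<in>p - P. norm (F c)) + (\<Sum>c\<in>P. norm (F c))" by (rule sum.subset_diff[OF Pp fp])
  also have "(\<Sum>c\<in>p - P. norm (F c)) \<le> (\<Sum>c\<in>p - P. case c of (x, K) \<Rightarrow> measure lborel K *\<^sub>R g' x + e * measure lborel K)"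
    by (rule sum_mono[OF good])
  also have "\<dots> \<le> (\<Sum>c\<in>p. case c of (x, K) \<Rightarrow> measure lborel K *\<^sub>R g' x + e * measure lborel K)"
  proof (rule sum_mono2[OF fp])
    fix c assume "c \<in> p - (p - P)"
    then obtain x K where "c = (x, K)" "x \<in> N" by (auto simp: P_def)
    then show "0 \<le> (case c of (x, K) \<Rightarrow> measure lborel K *\<^sub>R g' x + e * measure lborel K)"
      using e by (simp add: g'_def)
  qed auto
  also have "\<dots> = (\<Sum>(x,K)\<in>p. measure lborel K *\<^sub>R g' x) + e * (\<Sum>(x,K)\<in>p. measure lborel K)"
    by (simp add: split_beta sum.distrib sum_distrib_left)
  also have "(\<Sum>(x,K)\<in>p. measure lborel K) = b - a"
    using additive_content_tagged_division[of p a b] p(1) ab by simp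
  finally have "norm (h b - h a) \<le> integral {a..b} g + e * (b - a + 2)" using I bad by (simp add: algebra_simps)
  also have "e * (b - a + 2) = \<epsilon>" using ba by (simp add: e_def)
  finally show "norm (h b - h a) \<le> integral {a..b} g + \<epsilon>" .
qed

section \<open>Admissible curves in the chart\<close>

lemma abs_continuous_on_lipschitz_image:
  assumes g: "abs_continuous_on a b g" and K: "0 \<le> K"
    and lip: "\<And>s s'. s \<in> {a..b} \<Longrightarrow> s' \<in> {a..b} \<Longrightarrow> dist (h s) (h s') \<le> K * dist (g s) (g s')"
  shows "abs_continuous_on a b h"
  unfolding abs_continuous_on_def
proof (intro allI impI)
  fix e :: real assume e: "0 < e"
  then have "0 < e / (K + 1)" using K by simp
  from g[unfolded abs_continuous_on_def, rule_format, OF this]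
  obtain d where d: "0 < d" "\<forall>(N::nat) x y. (\<forall>i<N. a \<le> x i \<and> x i \<le> y i \<and> y i \<le> b) \<and>
      (\<forall>i. Suc i < N \<longrightarrow> y i \<le> x (Suc i)) \<and> (\<Sum>i<N. y i - x i) < d \<longrightarrow>
      (\<Sum>i<N. dist (g (x i)) (g (y i))) < e / (K + 1)"
    by (elim exE conjE)
  show "\<exists>d>0. \<forall>(N::nat) x y. (\<forall>i<N. a \<le> x i \<and> x i \<le> y i \<and> y i \<le> b) \<and>
      (\<forall>i. Suc i < N \<longrightarrow> y i \<le> x (Suc i)) \<and> (\<Sum>i<N. y i - x i) < d \<longrightarrow>
      (\<Sum>i<N. dist (h (x i)) (h (y i))) < e"
  proof (intro exI[of _ d] conjI d(1) allI impI)
    fix N :: nat and x y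
    assume xy: "(\<forall>i<N. a \<le> x i \<and> x i \<le> y i \<and> y i \<le> b) \<and>
      (\<forall>i. Suc i < N \<longrightarrow> y i \<le> x (Suc i)) \<and> (\<Sum>i<N. y i - x i) < d"
    have "(\<Sum>i<N. dist (h (x i)) (h (y i))) \<le> (\<Sum>i<N. K * dist (g (x i)) (g (y i)))"
      by (intro sum_mono lip) (use xy in force)+
    also have "\<dots> = K * (\<Sum>i<N. dist (g (x i)) (g (y i)))" by (simp add: sum_distrib_left)
    also have "\<dots> \<le> K * (e / (K + 1))"
      using d(2)[rule_format, OF xy] K by (intro mult_left_mono) auto
    also have "\<dots> < e" using e K by (simp add: field_simps)
    finally show "(\<Sum>i<N. dist (h (x i)) (h (y i))) < e" .
  qed
qed

lemma abs_continuous_on_lipschitz: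
  assumes "0 \<le> K" "\<And>s s'. s \<in> {a..b} \<Longrightarrow> s' \<in> {a..b} \<Longrightarrow> dist (h s) (h s') \<le> K * \<bar>s - s'\<bar>"
  shows "abs_continuous_on a b h"
proof (rule abs_continuous_on_lipschitz_image[OF _ assms(1)])
  show "abs_continuous_on a b (\<lambda>t. t)"
    unfolding abs_continuous_on_def
  proof (intro allI impI)
    fix e :: real assume e: "0 < e"
    show "\<exists>d>0. \<forall>(N::nat) x y. (\<forall>i<N. a \<le> x i \<and> x i \<le> y i \<and> y i \<le> b) \<and>
      (\<forall>i. Suc i < N \<longrightarrow> y i \<le> x (Suc i)) \<and> (\<Sum>i<N. y i - x i) < d \<longrightarrow> (\<Sum>i<N. dist (x i) (y i)) < e"
    proof (intro exI[of _ e] conjI e allI impI)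
      fix N :: nat and x y
      assume xy: "(\<forall>i<N. a \<le> x i \<and> x i \<le> y i \<and> y i \<le> b) \<and>
        (\<forall>i. Suc i < N \<longrightarrow> y i \<le> x (Suc i)) \<and> (\<Sum>i<N. y i - x i) < e"
      have "(\<Sum>i<N. dist (x i) (y i)) = (\<Sum>i<N. y i - x i)"
        by (rule sum.cong) (use xy in \<open>auto simp: dist_real_def\<close>)
      then show "(\<Sum>i<N. dist (x i) (y i)) < e" using xy by simp
    qed
  qed
qed (use assms(2) in \<open>auto simp: dist_real_def\<close>)

text \<open>Used with \<open>c = ek\<close>, to subtract the drift from an admissible curve in
  coordinates.\<close>

lemma abs_continuous_on_diff_linear:
  fixes h :: "real \<Rightarrow> 'b::real_normed_vector"
  assumes h: "abs_continuous_on a b h"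
  shows "abs_continuous_on a b (\<lambda>t. h t - t *\<^sub>R c)"
  unfolding abs_continuous_on_def
proof (intro allI impI)
  fix e :: real assume e: "0 < e"
  then have "0 < e / 2" by simp
  from h[unfolded abs_continuous_on_def, rule_format, OF this]
  obtain d where d: "0 < d" "\<forall>(N::nat) x y. (\<forall>i<N. a \<le> x i \<and> x i \<le> y i \<and> y i \<le> b) \<and>
      (\<forall>i. Suc i < N \<longrightarrow> y i \<le> x (Suc i)) \<and> (\<Sum>i<N. y i - x i) < d \<longrightarrow>
      (\<Sum>i<N. dist (h (x i)) (h (y i))) < e / 2"
    by (elim exE conjE)
  let ?d = "min d (e / 2 / (norm c + 1))"
  have nc: "0 < norm c + 1" by (simp add: add_nonneg_pos)
  show "\<exists>d>0. \<forall>(N::nat) x y. (\<forall>i<N. a \<le> x i \<and> x i \<le> y i \<and> y i \<le> b) \<and>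
      (\<forall>i. Suc i < N \<longrightarrow> y i \<le> x (Suc i)) \<and> (\<Sum>i<N. y i - x i) < d \<longrightarrow>
      (\<Sum>i<N. dist (h (x i) - x i *\<^sub>R c) (h (y i) - y i *\<^sub>R c)) < e"
  proof (intro exI[of _ ?d] conjI allI impI)
    show "0 < ?d" using d e nc by simp
    fix N :: nat and x y
    assume xy: "(\<forall>i<N. a \<le> x i \<and> x i \<le> y i \<and> y i \<le> b) \<and>
      (\<forall>i. Suc i < N \<longrightarrow> y i \<le> x (Suc i)) \<and> (\<Sum>i<N. y i - x i) < ?d"
    have "(\<Sum>i<N. dist (h (x i) - x i *\<^sub>R c) (h (y i) - y i *\<^sub>R c)) \<le> (\<Sum>i<N. dist (h (x i)) (h (y i)) + (y i - x i) * norm c)"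
    proof (rule sum_mono)
      fix i assume "i \<in> {..<N}"
      then have "x i \<le> y i" using xy by auto
      then have n: "norm ((y i - x i) *\<^sub>R c) = (y i - x i) * norm c" by simp
      have eq: "h (x i) - x i *\<^sub>R c - (h (y i) - y i *\<^sub>R c) = (h (x i) - h (y i)) + (y i - x i) *\<^sub>R c"
        by (simp add: algebra_simps)
      show "dist (h (x i) - x i *\<^sub>R c) (h (y i) - y i *\<^sub>R c) \<le> dist (h (x i)) (h (y i)) + (y i - x i) * norm c"
        unfolding dist_norm eq n[symmetric] by (rule norm_triangle_ineq)
    qed
    also have "\<dots> = (\<Sum>i<N. dist (h (x i)) (h (y i))) + (\<Sum>i<N. y i - x i) * norm c"
      by (simp add: sum.distrib sum_distrib_right)
    also have "\<dots> < e / 2 + e / 2"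
    proof (rule add_less_le_mono)
      show "(\<Sum>i<N. dist (h (x i)) (h (y i))) < e / 2" by (rule d(2)[rule_format]) (use xy in auto)
      have "(\<Sum>i<N. y i - x i) * norm c \<le> e / 2 / (norm c + 1) * norm c" 
        using xy by (intro mult_right_mono) auto
      also have "\<dots> \<le> e / 2 / (norm c + 1) * (norm c + 1)" using e nc by (intro mult_left_mono) auto
      also have "\<dots> = e / 2"
      proof -
        have c: "v / w * w = v" if "w \<noteq> 0" for v w :: real using that by simp
        show ?thesis by (rule c) (use nc in simp)
      qed
      finally show "(\<Sum>i<N. y i - x i) * norm c \<le> e / 2" .
    qed
    finally show "(\<Sum>i<N. dist (h (x i) - x i *\<^sub>R c) (h (y i) - y i *\<^sub>R c)) < e" by simp
  qed
qed

lemma has_vector_derivative_vec: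
  fixes y :: "real \<Rightarrow> real ^ 'n::finite"
  assumes "\<And>j. ((\<lambda>t. y t $ j) has_real_derivative w $ j) (at t within S)"
  shows "(y has_vector_derivative w) (at t within S)"
  unfolding has_vector_derivative_def
proof (subst has_derivative_componentwise_within, rule ballI)
  fix i :: "real ^ 'n" assume "i \<in> Basis"
  then obtain j where "i = axis j 1" by (auto simp: Basis_vec_def)
  then show "((\<lambda>x. y x \<bullet> i) has_derivative (\<lambda>x. x *\<^sub>R w \<bullet> i)) (at t within S)"
    using assms[of j] by (simp add: inner_axis has_field_derivative_def mult_commute_abs)
qed

lemma continuous_curve_near:
  assumes "continuous_map (top_of_set {0..T}) M \<gamma>" "openin M Q" "\<gamma> t \<in> Q" "t \<in> {0..T::real}"
  obtains d where "0 < d" "\<And>s. s \<in> {0..T} \<Longrightarrow> \<bar>s - t\<bar> < d \<Longrightarrow> \<gamma> s \<in> Q"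
proof -
  have "openin (top_of_set {0..T}) {s \<in> topspace (top_of_set {0..T}). \<gamma> s \<in> Q}"
    by (rule openin_continuous_map_preimage[OF assms(1,2)])
  then have "openin (top_of_set {0..T}) {s \<in> {0..T}. \<gamma> s \<in> Q}" by simp
  then obtain d where "0 < d" "ball t d \<inter> {0..T} \<subseteq> {s \<in> {0..T}. \<gamma> s \<in> Q}"
    using assms(3,4) unfolding openin_contains_ball by blast
  then show ?thesis using that[of d] by (auto simp: dist_real_def abs_minus_commute subset_eq)
qed

text \<open>The constants R, B and L are parameters so that the coordinate flows become available
  through the interpretation of \<open>control_fields\<close> below.\<close>

locale drift_chart = chart_family M A U z f
  for M :: "'a topology" and A :: "('a, 'n::finite) chart set" and U z and f :: "'m::finite \<Rightarrow> 'a vfield" +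
  fixes f0 :: "'a vfield" and k :: 'n and R B L :: real and q :: 'a
  assumes f0_eq: "\<And>p. p \<in> U \<Longrightarrow> f0 p = coordinate_vfield M A (U, z) k p"
    and qU: "q \<in> U" and zq: "z q = 0"
    and cballU: "cball 0 R \<subseteq> z ` U" and R0: "0 < R"
    and F_bound: "\<And>i x. x \<in> cball 0 R \<Longrightarrow> norm (field_rep (f i) x) \<le> B"
    and F_lip: "\<And>i x y. x \<in> cball 0 R \<Longrightarrow> y \<in> cball 0 R \<Longrightarrow>
      norm (field_rep (f i) x - field_rep (f i) y) \<le> L * norm (x - y)"
    and B0: "0 < B" and L0: "0 < L"
begin

abbreviation ek :: "real ^ 'n" where "ek \<equiv> axis k 1"

abbreviation FF :: "'m \<Rightarrow> real ^ 'n \<Rightarrow> real ^ 'n" where "FF i \<equiv> field_rep (f i)"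

sublocale cf: control_fields "z ` U" FF R B L ek
  by unfold_locales (use open_zU cballU R0 smooth_field_rep[OF f_smooth] F_bound F_lip B0 L0 in auto)

definition velocity :: "real ^ 'm \<Rightarrow> 'a \<Rightarrow> 'a tvec" where
  "velocity u p = f0 p + (\<Sum>i\<in>UNIV. tscale (u $ i) (f i p))"

definition coord_velocity :: "real ^ 'm \<Rightarrow> real ^ 'n \<Rightarrow> real ^ 'n" where
  "coord_velocity u x = ek + (\<Sum>i\<in>UNIV. (u $ i) *\<^sub>R FF i x)"

lemma velocity_tangent: "p \<in> U \<Longrightarrow> velocity u p \<in> TS p"
  unfolding velocity_def f0_eq
  by (intro tvec.subspace_add tvec.subspace_sum tvec.subspace_scale tangent_subspace U_top cvec_tangent vfield_tangent f_smooth)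

lemma velocity_coord:
  assumes "p \<in> U" shows "(\<chi> j. velocity u p (\<lambda>x. z x $ j)) = coord_velocity u (z p)"
  by (simp add: vec_eq_iff velocity_def coord_velocity_def f0_eq[OF assms] cvec_z[OF assms] sum_fun_apply
      tscale_def field_rep_def zi_z[OF assms] axis_def)

lemma has_velocity_coord:
  assumes v: "has_velocity M A \<gamma> (velocity u (\<gamma> t)) t S" and U: "\<gamma> t \<in> U"
  shows "((\<lambda>\<tau>. z (\<gamma> \<tau>)) has_vector_derivative coord_velocity u (z (\<gamma> t))) (at t within S)"
proof (rule has_vector_derivative_vec)
  fix j
  have "((\<lambda>\<tau>. z (\<gamma> \<tau>) $ j) has_real_derivative velocity u (\<gamma> t) (\<lambda>x. z x $ j)) (at t within S)"
    using v near_z[OF U, of j] unfolding has_velocity_def by blast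
  then show "((\<lambda>\<tau>. z (\<gamma> \<tau>) $ j) has_real_derivative coord_velocity u (z (\<gamma> t)) $ j) (at t within S)"
    unfolding velocity_coord[OF U, symmetric] by simp
qed

lemma has_velocityI:
  assumes y: "(y has_vector_derivative coord_velocity u (y t)) (at t within S)" and U: "y t \<in> z ` U"
  shows "has_velocity M A (\<lambda>\<tau>. zi (y \<tau>)) (velocity u (zi (y t))) t S"
  unfolding has_velocity_def
proof (intro allI impI)
  fix a assume a: "near (zi (y t)) a"
  have p: "zi (y t) \<in> U" by (rule zi_U[OF U])
  have zy: "z (zi (y t)) = y t" by (rule z_zi[OF U])
  have d: "((\<lambda>x. a (zi x)) has_derivative frechet_derivative (\<lambda>x. a (zi x)) (at (y t))) (at (y t))"
    using near_has_derivative[OF p a] unfolding zy .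
  have "(((\<lambda>x. a (zi x)) \<circ> y) has_vector_derivative frechet_derivative (\<lambda>x. a (zi x)) (at (y t)) (coord_velocity u (y t))) (at t within S)"
    by (rule vector_derivative_diff_chain_within[OF y has_derivative_at_withinI[OF d]])
  moreover have "velocity u (zi (y t)) a = frechet_derivative (\<lambda>x. a (zi x)) (at (y t)) (coord_velocity u (y t))"
    using tangent_eq_derivative[OF p velocity_tangent[OF p] a] velocity_coord[OF p, of u] unfolding zy by simp
  ultimately show "((\<lambda>\<tau>. a (zi (y \<tau>))) has_real_derivative velocity u (zi (y t)) a) (at t within S)"
    by (simp add: o_def has_real_derivative_iff_has_vector_derivative)
qed

lemma coord_velocity_bound:
  assumes "x \<in> cball 0 R" shows "norm (coord_velocity u x - ek) \<le> (B * CARD('m)) * norm u"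
proof -
  have "norm (coord_velocity u x - ek) \<le> (\<Sum>i\<in>(UNIV::'m set). norm ((u $ i) *\<^sub>R FF i x))"
    unfolding coord_velocity_def add_diff_cancel_left' by (rule norm_sum)
  also have "\<dots> \<le> (\<Sum>i\<in>(UNIV::'m set). norm u * B)"
    unfolding norm_scaleR using assms F_bound B0 component_le_norm_cart[of u]
    by (intro sum_mono mult_mono) auto
  finally show ?thesis by (simp add: mult_ac)
qed

text \<open>Absolute continuity of a curve is given in the charts of the atlas only, and
  \<open>z\<close> need not be among them. Near time t the curve stays in a small ball of an atlas
  chart, on which the transition to \<open>z\<close> is Lipschitz. The statement is therefore local
  in time.\<close>

lemma ac_near:
  assumes \<gamma>: "abs_continuous_curve M A T \<gamma>" and t: "t \<in> {0..T}" and U: "\<gamma> t \<in> U"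
  shows "\<exists>d>0. \<forall>a b. 0 \<le> a \<and> a \<le> t \<and> t \<le> b \<and> b \<le> T \<and> b - a < d \<longrightarrow> abs_continuous_on a b (\<lambda>s. z (\<gamma> s))"
proof -
  have cont: "continuous_map (top_of_set {0..T}) M \<gamma>" using \<gamma> by (simp add: abs_continuous_curve_def)
  obtain V \<phi> where V: "(V, \<phi>) \<in> A" "\<gamma> t \<in> V" using covered[OF U_top[OF U]] by auto
  note cV = chart[OF V(1)]
  let ?c = "\<phi> (\<gamma> t)"
  have op: "open (\<phi> ` (V \<inter> U))" by (rule open_chart_image[OF V(1) openU])
  have "?c \<in> \<phi> ` (V \<inter> U)" using U V by auto
  then obtain e where e: "0 < e" "cball ?c e \<subseteq> \<phi> ` (V \<inter> U)" using op open_contains_cball by blast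
  have sm: "smooth_on (\<phi> ` (V \<inter> U)) (\<lambda>x. z (inv_into V \<phi> x))"
    using loc V(1) by (auto simp: local_coordinates_def smooth_transition_def)
  obtain K where K: "0 \<le> K" "\<forall>x\<in>cball ?c e. \<forall>y\<in>cball ?c e. norm (z (inv_into V \<phi> x) - z (inv_into V \<phi> y)) \<le> K * norm (x - y)"
    using smooth_on_lipschitz[OF op sm compact_cball convex_cball e(2)] by blast
  let ?Q = "inv_into V \<phi> ` ball ?c e"
  have sub: "ball ?c e \<subseteq> \<phi> ` V" using e(2) ball_subset_cball[of ?c e] by blast
  have Q: "openin M ?Q" by (rule chart_openin_inv[OF cV open_ball sub])
  have tQ: "\<gamma> t \<in> ?Q" using chart_inv[OF cV V(2)] e(1) by (metis centre_in_ball image_eqI)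
  obtain d where d: "0 < d" "\<And>s. s \<in> {0..T} \<Longrightarrow> \<bar>s - t\<bar> < d \<Longrightarrow> \<gamma> s \<in> ?Q"
    using continuous_curve_near[OF cont Q tQ t] by blast
  show ?thesis
  proof (intro exI[of _ d] conjI d(1) allI impI)
    fix a b assume ab: "0 \<le> a \<and> a \<le> t \<and> t \<le> b \<and> b \<le> T \<and> b - a < d"
    have Qs: "\<gamma> s \<in> V \<and> \<phi> (\<gamma> s) \<in> cball ?c e \<and> z (\<gamma> s) = z (inv_into V \<phi> (\<phi> (\<gamma> s)))" if s: "s \<in> {a..b}" for s
    proof -
      have "\<gamma> s \<in> ?Q" using d(2)[of s] s ab by auto
      then obtain x where x: "x \<in> ball ?c e" "\<gamma> s = inv_into V \<phi> x" by auto
      then have "x \<in> \<phi> ` V" using sub by blast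
      then show ?thesis using x inv_into_into[of x \<phi> V] f_inv_into_f[of x \<phi> V] by auto
    qed
    have "abs_continuous_on a b (\<lambda>s. \<phi> (\<gamma> s))"
    proof -
      have "\<forall>a b. 0 \<le> a \<and> a \<le> b \<and> b \<le> T \<and> \<gamma> ` {a..b} \<subseteq> V \<longrightarrow> abs_continuous_on a b (\<lambda>s. \<phi> (\<gamma> s))"
        using \<gamma> V(1) unfolding abs_continuous_curve_def by auto
      moreover have "\<gamma> ` {a..b} \<subseteq> V" using Qs by blast
      ultimately show ?thesis using ab by simp
    qed
    then show "abs_continuous_on a b (\<lambda>s. z (\<gamma> s))"
    proof (rule abs_continuous_on_lipschitz_image[OF _ K(1)])
      fix s s' assume "s \<in> {a..b}" "s' \<in> {a..b}"
      from Qs[OF this(1)] Qs[OF this(2)] K(2)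
      show "dist (z (\<gamma> s)) (z (\<gamma> s')) \<le> K * dist (\<phi> (\<gamma> s)) (\<phi> (\<gamma> s'))"
        by (metis dist_norm)
    qed
  qed
qed

text \<open>After subtraction of the drift, the coordinate velocity is the combination of the fields
  with coefficients u, bounded by a multiple of \<open>norm (u t)\<close>. On short intervals
  \<open>ac_norm_le_integral\<close> integrates this; the inequality is additive over adjacent
  intervals, so a bisection argument extends it to the whole interval.\<close>

lemma control_estimate:
  assumes \<gamma>: "abs_continuous_curve M A T \<gamma>" and u: "is_control M A f0 f T \<gamma> u"
    and ab: "0 \<le> a" "a \<le> b" "b \<le> T" and stay: "\<And>s. s \<in> {a..b} \<Longrightarrow> \<gamma> s \<in> U \<and> z (\<gamma> s) \<in> cball 0 R"
  shows "norm ((z (\<gamma> b) - b *\<^sub>R ek) - (z (\<gamma> a) - a *\<^sub>R ek)) \<le> (B * CARD('m)) * integral {a..b} (\<lambda>t. norm (u t))"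
proof -
  have iu: "set_integrable lebesgue {0..T} u"
    and "AE t\<in>{0..T} in lebesgue. has_velocity M A \<gamma> (velocity (u t) (\<gamma> t)) t {0..T}"
    using u by (auto simp: is_control_def velocity_def)
  then obtain N where N: "N \<in> null_sets lebesgue"
    "{t \<in> space lebesgue. \<not> (t \<in> {0..T} \<longrightarrow> has_velocity M A \<gamma> (velocity (u t) (\<gamma> t)) t {0..T})} \<subseteq> N"
    unfolding eventually_ae_filter by blast
  have nN: "negligible N" using N(1) by (simp add: negligible_iff_null_sets)
  have vel: "has_velocity M A \<gamma> (velocity (u t) (\<gamma> t)) t {0..T}" if "t \<in> {0..T} - N" for t
    using N(2) that by auto
  have iT: "(\<lambda>t. norm (u t)) integrable_on {0..T}"
    by (rule set_lebesgue_integral_eq_integral(1)[OF set_integrable_norm[OF iu]])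
  let ?h = "\<lambda>t. z (\<gamma> t) - t *\<^sub>R ek" and ?C = "B * CARD('m)"
  have ii: "(\<lambda>t. norm (u t)) integrable_on {x..y}" if "a \<le> x" "y \<le> b" for x y
    by (rule integrable_on_subinterval[OF iT]) (use that ab in auto)
  have "a \<le> a \<and> b \<le> b \<longrightarrow> norm (?h b - ?h a) \<le> ?C * integral {a..b} (\<lambda>t. norm (u t))"
  proof (rule Bolzano[OF ab(2), of "\<lambda>x y. a \<le> x \<and> y \<le> b \<longrightarrow> norm (?h y - ?h x) \<le> ?C * integral {x..y} (\<lambda>t. norm (u t))"])
    fix x y w assume 1: "a \<le> x \<and> y \<le> b \<longrightarrow> norm (?h y - ?h x) \<le> ?C * integral {x..y} (\<lambda>t. norm (u t))"
      and 2: "a \<le> y \<and> w \<le> b \<longrightarrow> norm (?h w - ?h y) \<le> ?C * integral {y..w} (\<lambda>t. norm (u t))"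
      and le: "x \<le> y" "y \<le> w"
    show "a \<le> x \<and> w \<le> b \<longrightarrow> norm (?h w - ?h x) \<le> ?C * integral {x..w} (\<lambda>t. norm (u t))"
    proof
      assume xw: "a \<le> x \<and> w \<le> b"
      have "norm (?h w - ?h x) \<le> norm (?h w - ?h y) + norm (?h y - ?h x)"
        using dist_triangle[of "?h w" "?h x" "?h y"] by (simp only: dist_norm)
      also have "\<dots> \<le> ?C * integral {y..w} (\<lambda>t. norm (u t)) + ?C * integral {x..y} (\<lambda>t. norm (u t))"
        using 1 2 xw le by (intro add_mono) auto
      also have "\<dots> = ?C * (integral {x..y} (\<lambda>t. norm (u t)) + integral {y..w} (\<lambda>t. norm (u t)))"
        by (simp add: distrib_left)
      also have "integral {x..y} (\<lambda>t. norm (u t)) + integral {y..w} (\<lambda>t. norm (u t)) = integral {x..w} (\<lambda>t. norm (u t))"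
        by (rule Henstock_Kurzweil_Integration.integral_combine[OF le ii]) (use xw in auto)
      finally show "norm (?h w - ?h x) \<le> ?C * integral {x..w} (\<lambda>t. norm (u t))" .
    qed
  next
    fix t assume t: "a \<le> t" "t \<le> b"
    have tT: "t \<in> {0..T}" using t ab by auto
    obtain d where d: "0 < d" "\<forall>a b. 0 \<le> a \<and> a \<le> t \<and> t \<le> b \<and> b \<le> T \<and> b - a < d \<longrightarrow> abs_continuous_on a b (\<lambda>s. z (\<gamma> s))"
      using ac_near[OF \<gamma> tT] stay[of t] t by auto
    show "\<exists>d>0. \<forall>x y. x \<le> t \<and> t \<le> y \<and> y - x < d \<longrightarrow> (a \<le> x \<and> y \<le> b \<longrightarrow> norm (?h y - ?h x) \<le> ?C * integral {x..y} (\<lambda>t. norm (u t)))"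
    proof (intro exI[of _ d] conjI d(1) allI impI)
      fix x y assume xy: "x \<le> t \<and> t \<le> y \<and> y - x < d" "a \<le> x \<and> y \<le> b"
      have ac: "abs_continuous_on x y ?h"
        by (rule abs_continuous_on_diff_linear) (use d(2) xy ab in auto)
      have "norm (?h y - ?h x) \<le> integral {x..y} (\<lambda>t. ?C * norm (u t))"
      proof (rule ac_norm_le_integral[OF _ ac nN])
        show "(\<lambda>t. ?C * norm (u t)) integrable_on {x..y}"
          by (intro integrable_on_mult_right ii) (use xy in auto)
        fix s assume s: "s \<in> {x..y} - N"
        then have sT: "s \<in> {0..T} - N" and sab: "s \<in> {a..b}" using xy ab by auto
        have "((\<lambda>\<tau>. z (\<gamma> \<tau>)) has_vector_derivative coord_velocity (u s) (z (\<gamma> s))) (at s within {x..y})"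
          using has_velocity_coord[OF vel[OF sT]] stay[OF sab] xy ab
          by (auto intro: has_vector_derivative_within_subset)
        then have "(?h has_vector_derivative coord_velocity (u s) (z (\<gamma> s)) - ek) (at s within {x..y})"
          by (auto intro!: derivative_eq_intros)
        then show "\<exists>h'. (?h has_vector_derivative h') (at s within {x..y}) \<and> norm h' \<le> ?C * norm (u s)"
          using coord_velocity_bound stay[OF sab] by blast
      qed (use xy in auto)
      then show "norm (?h y - ?h x) \<le> ?C * integral {x..y} (\<lambda>t. norm (u t))"
        by (simp add: integral_mult_right)
    qed
  qed
  then show ?thesis by simp
qed

lemma zi_continuous: "continuous_map (top_of_set (z ` U)) M zi"
proof -
  obtain g where g: "homeomorphic_maps (subtopology M U) (top_of_set (z ` U)) z g"
    using chart_homeo[OF is_chart] homeomorphic_map_maps by blast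
  have "g x = zi x" if "x \<in> z ` U" for x
  proof -
    from that obtain p where p: "p \<in> U" "x = z p" by auto
    then have "g (z p) = p" using g chart_topspace[OF is_chart] unfolding homeomorphic_maps_def by auto
    then show ?thesis using p zi_z by simp
  qed
  then have "continuous_map (top_of_set (z ` U)) (subtopology M U) zi"
    using g unfolding homeomorphic_maps_def by (auto elim!: continuous_map_eq)
  then show ?thesis by (rule continuous_map_into_fulltopology)
qed

text \<open>A continuity argument with an a priori estimate: as long as the curve remains in the
  ball of radius R, it is in fact in the ball of radius R1 < R. Let \<tau> be the supremum of the
  times up to which it stays in the smaller ball K. As K is compact and M is Hausdorff, K is closed
  and contains the point at time \<tau>; were \<tau> < T, the estimate would push past
  \<tau>.\<close>

lemma curve_stays:
  fixes \<gamma> :: "real \<Rightarrow> 'a"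
  assumes H: "Hausdorff_space M" and cont: "continuous_map (top_of_set {0..T}) M \<gamma>" and \<gamma>0: "\<gamma> 0 = q" and T: "0 \<le> T"
    and R1: "0 \<le> R1" "R1 < R"
    and est: "\<And>t. t \<in> {0..T} \<Longrightarrow> (\<And>s. s \<in> {0..t} \<Longrightarrow> \<gamma> s \<in> U \<and> z (\<gamma> s) \<in> cball 0 R) \<Longrightarrow> norm (z (\<gamma> t)) \<le> R1"
    and t: "t \<in> {0..T}"
  shows "\<gamma> t \<in> U \<and> norm (z (\<gamma> t)) \<le> R1"
proof -
  let ?K = "zi ` cball 0 R1" and ?O = "zi ` ball 0 R"
  have sub1: "cball 0 R1 \<subseteq> z ` U" using cballU R1 by (auto simp: subset_eq)
  have sub2: "ball 0 R \<subseteq> z ` U" using cballU by (auto simp: subset_eq)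
  have K: "x \<in> ?K \<longleftrightarrow> x \<in> U \<and> norm (z x) \<le> R1" for x
  proof
    assume "x \<in> ?K"
    then obtain y where "y \<in> cball 0 R1" "x = zi y" by auto
    then show "x \<in> U \<and> norm (z x) \<le> R1" using sub1 zi_U z_zi by auto
  next
    assume x: "x \<in> U \<and> norm (z x) \<le> R1"
    then have "x = zi (z x)" using zi_z by simp
    then show "x \<in> ?K" using x by (intro image_eqI[of _ _ "z x"]) auto
  qed
  have O': "x \<in> ?O \<Longrightarrow> x \<in> U \<and> norm (z x) \<le> R" for x using sub2 zi_U z_zi by (auto simp: subset_eq)
  have KO: "?K \<subseteq> ?O" using R1 by auto
  have oO: "openin M ?O" by (rule open_preimage[OF open_ball sub2])
  have cK: "closedin M ?K"
  proof (rule compactin_imp_closedin[OF H])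
    show "compactin M ?K"
      by (rule image_compactin[OF _ zi_continuous]) (use sub1 in \<open>auto simp: compactin_subtopology\<close>)
  qed
  define S where "S = {t \<in> {0..T}. \<forall>s\<in>{0..t}. \<gamma> s \<in> ?K}"
  have "q \<in> ?K" using K qU zq R1 by simp
  then have S0: "0 \<in> S" using \<gamma>0 T by (auto simp: S_def)
  define \<tau> where "\<tau> = Sup S"
  have bdd: "bdd_above S" by (rule bdd_aboveI[of _ T]) (auto simp: S_def)
  have "0 \<le> \<tau>" unfolding \<tau>_def by (rule cSup_upper[OF S0 bdd])
  moreover have "\<tau> \<le> T" unfolding \<tau>_def
  proof (rule cSup_least)
    show "S \<noteq> {}" using S0 by blast
  qed (simp add: S_def)
  ultimately have \<tau>T: "0 \<le> \<tau>" "\<tau> \<le> T" .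
  have before: "\<gamma> s \<in> ?K" if s: "0 \<le> s" "s < \<tau>" for s
  proof -
    obtain t where "t \<in> S" "s < t" using s(2) less_cSup_iff[OF _ bdd, of s] S0 unfolding \<tau>_def by auto
    then show ?thesis using s by (auto simp: S_def)
  qed
  have at: "\<gamma> \<tau> \<in> ?K"
  proof (rule ccontr)
    assume n: "\<gamma> \<tau> \<notin> ?K"
    have "\<gamma> \<tau> \<in> topspace M" using cont \<tau>T by (auto simp: continuous_map_def)
    then have "\<gamma> \<tau> \<in> topspace M - ?K" using n by simp
    moreover have "openin M (topspace M - ?K)" using cK by (simp add: closedin_def)
    ultimately obtain d where d: "0 < d" "\<And>s. s \<in> {0..T} \<Longrightarrow> \<bar>s - \<tau>\<bar> < d \<Longrightarrow> \<gamma> s \<in> topspace M - ?K"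
      using continuous_curve_near[OF cont, of "topspace M - ?K" \<tau>] \<tau>T by auto
    have "0 < \<tau>" using n \<gamma>0 \<open>q \<in> ?K\<close> \<tau>T by (cases "\<tau> = 0") auto
    then have "\<gamma> (max 0 (\<tau> - d / 2)) \<in> ?K" using d by (intro before) auto
    moreover have "\<gamma> (max 0 (\<tau> - d / 2)) \<in> topspace M - ?K" using d(1) \<tau>T \<open>0 < \<tau>\<close> by (intro d(2)) auto
    ultimately show False by simp
  qed
  have upto: "\<gamma> s \<in> ?K" if "0 \<le> s" "s \<le> \<tau>" for s using before at that by (cases "s = \<tau>") auto
  have "\<tau> = T"
  proof (rule ccontr)
    assume "\<tau> \<noteq> T"
    then have lt: "\<tau> < T" using \<tau>T by simp
    obtain d where d: "0 < d" "\<And>s. s \<in> {0..T} \<Longrightarrow> \<bar>s - \<tau>\<bar> < d \<Longrightarrow> \<gamma> s \<in> ?O"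
    proof -
      have O1: "\<gamma> \<tau> \<in> ?O" using at KO by blast
      have "\<tau> \<in> {0..T}" using \<tau>T by simp
      from continuous_curve_near[OF cont oO O1 this] show ?thesis using that by blast
    qed
    \<comment> \<open>By continuity the curve is still in the open ball of radius R up to a time
      slightly beyond \<tau>; the estimate then places it in K up to that time, contradicting the
      choice of \<tau>.\<close>
    define t' where "t' = min T (\<tau> + d / 2)"
    have t': "\<tau> < t'" "t' \<le> T" "t' < \<tau> + d" using lt d by (auto simp: t'_def)
    have O2: "\<gamma> s \<in> ?O" if "s \<in> {0..t'}" for s
    proof (cases "s \<le> \<tau>")
      case True
      then show ?thesis using upto that KO by auto
    next
      case False
      then show ?thesis using that t' by (intro d(2)) auto
    qed
    have "\<gamma> s \<in> ?K" if s: "s \<in> {0..t'}" for s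
    proof -
      have "norm (z (\<gamma> s)) \<le> R1"
        by (rule est) (use s t' O2 O' in auto)
      then show ?thesis using K O'[OF O2[OF s]] by simp
    qed
    then have "t' \<in> S" using t' \<tau>T by (auto simp: S_def)
    then have "t' \<le> \<tau>" unfolding \<tau>_def by (rule cSup_upper[OF _ bdd])
    then show False using t' by simp
  qed
  then have "\<gamma> t \<in> ?K" using upto t by auto
  then show ?thesis using K by simp
qed

end

section \<open>Piecewise constant controls\<close>

definition step_control :: "(real \<times> real \<times> 'c) list \<Rightarrow> real \<Rightarrow> 'c::real_normed_vector" where
  "step_control l t = (\<Sum>(a, b, c)\<leftarrow>l. if a \<le> t \<and> t < b then c else 0)"

definition step_cost :: "(real \<times> real \<times> 'c::real_normed_vector) list \<Rightarrow> real" where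
  "step_cost l = (\<Sum>(a, b, c)\<leftarrow>l. (b - a) * norm c)"

definition steps_within :: "real \<Rightarrow> (real \<times> real \<times> 'c) list \<Rightarrow> bool" where
  "steps_within T l \<longleftrightarrow> (\<forall>(a, b, c)\<in>set l. 0 \<le> a \<and> a \<le> b \<and> b \<le> T)"

text \<open>An entry (a, b, c) holds the value c on the half-open interval from a to b, so
  consecutive entries do not overlap. Values of overlapping entries would add, hence the triangle
  inequality and only an upper bound for the integral.\<close>

lemma step_control_integral:
  fixes l :: "(real \<times> real \<times> 'c::euclidean_space) list"
  assumes "steps_within T l"
  shows "set_integrable lebesgue {0..T} (step_control l)"
    and "(LINT t:{0..T}|lebesgue. norm (step_control l t)) \<le> step_cost l"
proof -
  have "set_integrable lebesgue {0..T} (step_control l) \<and> (LINT t:{0..T}|lebesgue. norm (step_control l t)) \<le> step_cost l"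
    using assms
  proof (induction l)
    case Nil
    then show ?case by (simp add: step_control_def[abs_def] step_cost_def set_integrable_def set_lebesgue_integral_def)
  next
    case (Cons s l)
    obtain a b c where s: "s = (a, b, c)" by (cases s) auto
    have ab: "0 \<le> a" "a \<le> b" "b \<le> T" and l: "steps_within T l" using Cons.prems by (auto simp: s steps_within_def)
    note IH = Cons.IH[OF l]
    define g where "g t = (if a \<le> t \<and> t < b then c else 0)" for t
    have ind: "indicator {0..T} t *\<^sub>R g t = indicator {a..<b} t *\<^sub>R c" for t
      using ab by (auto simp: g_def indicator_def)
    have ig: "set_integrable lebesgue {0..T} g"
      unfolding set_integrable_def ind by (intro integrable_scaleR_left) (simp add: ab)
    have indn: "indicator {0..T} t *\<^sub>R norm (g t) = indicator {a..<b} t *\<^sub>R norm c" for t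
      using ab by (auto simp: g_def indicator_def)
    have Ig: "(LINT t:{0..T}|lebesgue. norm (g t)) = (b - a) * norm c"
      unfolding set_lebesgue_integral_def indn using ab by simp
    have eq: "step_control (s # l) = (\<lambda>t. g t + step_control l t)"
      by (auto simp: step_control_def s g_def)
    have ii: "set_integrable lebesgue {0..T} (step_control (s # l))"
      unfolding eq using ig IH by (intro set_integral_add) auto
    have "(LINT t:{0..T}|lebesgue. norm (step_control (s # l) t)) \<le>
        (LINT t:{0..T}|lebesgue. norm (g t) + norm (step_control l t))"
      by (rule set_integral_mono)
        (use ii ig IH in \<open>auto simp: eq norm_triangle_ineq intro!: set_integral_add set_integrable_norm\<close>)
    also have "\<dots> = (LINT t:{0..T}|lebesgue. norm (g t)) + (LINT t:{0..T}|lebesgue. norm (step_control l t))"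
      using ig IH by (intro set_integral_add set_integrable_norm) auto
    also have "\<dots> \<le> step_cost (s # l)" using IH by (simp add: Ig step_cost_def s)
    finally show ?case using ii by simp
  qed
  then show "set_integrable lebesgue {0..T} (step_control l)"
    and "(LINT t:{0..T}|lebesgue. norm (step_control l t)) \<le> step_cost l" by auto
qed

text \<open>Lipschitz bounds on two adjacent intervals combine, with the sum of the constants, by
  passing through the common end point; bisection does the rest. Transition maps supply such bounds
  only near each point.\<close>

lemma locally_lipschitz_interval:
  fixes h :: "real \<Rightarrow> 'b::metric_space"
  assumes ab: "a \<le> b"
    and loc: "\<And>t. t \<in> {a..b} \<Longrightarrow> \<exists>d>0. \<exists>K\<ge>0. \<forall>s\<in>{a..b}. \<forall>s'\<in>{a..b}. \<bar>s - t\<bar> < d \<and> \<bar>s' - t\<bar> < d \<longrightarrow> dist (h s) (h s') \<le> K * \<bar>s - s'\<bar>"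
  shows "\<exists>K\<ge>0. \<forall>s\<in>{a..b}. \<forall>s'\<in>{a..b}. dist (h s) (h s') \<le> K * \<bar>s - s'\<bar>"
proof -
  have "a \<le> a \<and> b \<le> b \<longrightarrow> (\<exists>K\<ge>0. \<forall>s\<in>{a..b}. \<forall>s'\<in>{a..b}. dist (h s) (h s') \<le> K * \<bar>s - s'\<bar>)"
  proof (rule Bolzano[OF ab, of "\<lambda>x y. a \<le> x \<and> y \<le> b \<longrightarrow> (\<exists>K\<ge>0. \<forall>s\<in>{x..y}. \<forall>s'\<in>{x..y}. dist (h s) (h s') \<le> K * \<bar>s - s'\<bar>)"])
    fix x y w
    assume 1: "a \<le> x \<and> y \<le> b \<longrightarrow> (\<exists>K\<ge>0. \<forall>s\<in>{x..y}. \<forall>s'\<in>{x..y}. dist (h s) (h s') \<le> K * \<bar>s - s'\<bar>)"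
      and 2: "a \<le> y \<and> w \<le> b \<longrightarrow> (\<exists>K\<ge>0. \<forall>s\<in>{y..w}. \<forall>s'\<in>{y..w}. dist (h s) (h s') \<le> K * \<bar>s - s'\<bar>)"
      and le: "x \<le> y" "y \<le> w"
    show "a \<le> x \<and> w \<le> b \<longrightarrow> (\<exists>K\<ge>0. \<forall>s\<in>{x..w}. \<forall>s'\<in>{x..w}. dist (h s) (h s') \<le> K * \<bar>s - s'\<bar>)"
    proof
      assume xw: "a \<le> x \<and> w \<le> b"
      obtain K1 where K1: "0 \<le> K1" "\<And>s s'. s \<in> {x..y} \<Longrightarrow> s' \<in> {x..y} \<Longrightarrow> dist (h s) (h s') \<le> K1 * \<bar>s - s'\<bar>"
        using 1 xw le by auto
      obtain K2 where K2: "0 \<le> K2" "\<And>s s'. s \<in> {y..w} \<Longrightarrow> s' \<in> {y..w} \<Longrightarrow> dist (h s) (h s') \<le> K2 * \<bar>s - s'\<bar>"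
        using 2 xw le by auto
      let ?K = "K1 + K2"
      have le1: "K1 * \<bar>s - s'\<bar> \<le> ?K * \<bar>s - s'\<bar>" "K2 * \<bar>s - s'\<bar> \<le> ?K * \<bar>s - s'\<bar>" for s s'
        using K1(1) K2(1) by (auto intro!: mult_right_mono)
      have mid: "dist (h s) (h s') \<le> ?K * \<bar>s - s'\<bar>" if s: "s \<in> {x..y}" "s' \<in> {y..w}" for s s'
      proof -
        have "dist (h s) (h s') \<le> dist (h s) (h y) + dist (h y) (h s')" by (rule dist_triangle)
        also have "\<dots> \<le> K1 * \<bar>s - y\<bar> + K2 * \<bar>y - s'\<bar>"
          using s le by (intro add_mono K1(2) K2(2)) auto
        also have "\<dots> \<le> ?K * \<bar>s - y\<bar> + ?K * \<bar>y - s'\<bar>" by (intro add_mono le1)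
        also have "\<dots> = ?K * \<bar>s - s'\<bar>" using s by (simp add: distrib_left[symmetric])
        finally show ?thesis .
      qed
      have "dist (h s) (h s') \<le> ?K * \<bar>s - s'\<bar>" if s: "s \<in> {x..w}" "s' \<in> {x..w}" for s s'
      proof -
        consider "s \<in> {x..y} \<and> s' \<in> {x..y}" | "s \<in> {y..w} \<and> s' \<in> {y..w}"
          | "s \<in> {x..y} \<and> s' \<in> {y..w}" | "s' \<in> {x..y} \<and> s \<in> {y..w}" using s by fastforce
        then show ?thesis
        proof cases
          case 1 then show ?thesis using K1(2)[of s s'] le1(1)[of s s'] by auto
        next
          case 2 then show ?thesis using K2(2)[of s s'] le1(2)[of s s'] by auto
        next
          case 3 then show ?thesis using mid by auto
        next
          case 4 then show ?thesis using mid[of s' s] by (simp add: dist_commute abs_minus_commute)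
        qed
      qed
      then show "\<exists>K\<ge>0. \<forall>s\<in>{x..w}. \<forall>s'\<in>{x..w}. dist (h s) (h s') \<le> K * \<bar>s - s'\<bar>"
        using K1(1) K2(1) by (intro exI[of _ ?K]) auto
    qed
  next
    fix t assume "a \<le> t" "t \<le> b"
    then obtain d K where d: "0 < d" "0 \<le> K" "\<forall>s\<in>{a..b}. \<forall>s'\<in>{a..b}. \<bar>s - t\<bar> < d \<and> \<bar>s' - t\<bar> < d \<longrightarrow> dist (h s) (h s') \<le> K * \<bar>s - s'\<bar>"
      using loc[of t] by auto
    show "\<exists>d>0. \<forall>x y. x \<le> t \<and> t \<le> y \<and> y - x < d \<longrightarrow> (a \<le> x \<and> y \<le> b \<longrightarrow> (\<exists>K\<ge>0. \<forall>s\<in>{x..y}. \<forall>s'\<in>{x..y}. dist (h s) (h s') \<le> K * \<bar>s - s'\<bar>))"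
    proof (rule exI[of _ d], intro conjI d(1) allI impI)
      fix x y assume xy: "x \<le> t \<and> t \<le> y \<and> y - x < d" "a \<le> x \<and> y \<le> b"
      show "\<exists>K\<ge>0. \<forall>s\<in>{x..y}. \<forall>s'\<in>{x..y}. dist (h s) (h s') \<le> K * \<bar>s - s'\<bar>"
      proof (intro exI[of _ K] conjI d(2) ballI)
        fix s s' assume "s \<in> {x..y}" "s' \<in> {x..y}"
        then have "s \<in> {a..b}" "s' \<in> {a..b}" "\<bar>s - t\<bar> < d" "\<bar>s' - t\<bar> < d" using xy by auto
        then show "dist (h s) (h s') \<le> K * \<bar>s - s'\<bar>" using d(3) by blast
      qed
    qed
  qed
  then show ?thesis by simp
qed

lemma (in control_fields) bracket_cong:
  assumes "smooth_on W a" "smooth_on W b" "\<And>x. x \<in> W \<Longrightarrow> a x = b x" "x \<in> W"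
  shows "iterated_bracket D I a x = iterated_bracket D I b x"
  using assms
proof (induction I arbitrary: a b x)
  case (Cons j I)
  show ?case
  proof (cases "I = []")
    case True
    then show ?thesis using D_cong[OF Cons.prems(1,4,3)] by simp
  next
    case False
    have "iterated_bracket D I (\<lambda>x. D j x a) x = iterated_bracket D I (\<lambda>x. D j x b) x"
      by (rule Cons.IH[OF D_smooth[OF Cons.prems(1)] D_smooth[OF Cons.prems(2)] D_cong[OF Cons.prems(1) _ Cons.prems(3)] Cons.prems(4)])
    moreover have "D j x (iterated_bracket D I a) = D j x (iterated_bracket D I b)"
      by (rule D_cong[OF bracket_smooth[OF Cons.prems(1)] Cons.prems(4)]) (rule Cons.IH[OF Cons.prems(1-3)])
    ultimately show ?thesis using False by (simp add: iterated_bracket_Cons)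
  qed
qed simp

section \<open>The drift flow and admissible curves in coordinates\<close>

context drift_chart
begin

text \<open>Carries the spanning relation at q over to the brackets of the coordinate fields at the
  origin. The induction is over all a, since the recursion of brackets replaces a by its
  derivative.\<close>

lemma brk_coord:
  assumes "smooth_fun_on M A U a" "p \<in> U"
  shows "brk I a p = iterated_bracket cf.D I (\<lambda>x. a (zi x)) (z p)"
  using assms
proof (induction I arbitrary: a p)
  case (Cons j I)
  have sm: "smooth_on (z ` U) (\<lambda>x. b (zi x))" if "smooth_fun_on M A U b" for b
    using that smooth_fun_on_iff[OF openU order_refl] by simp
  have D: "cf.D j x (\<lambda>x. b (zi x)) = f j (zi x) b" if b: "smooth_fun_on M A U b" and x: "x \<in> z ` U" for b x
    using vfield_eq_derivative[OF zi_U[OF x] f_smooth smooth_fun_on_near[OF b zi_U[OF x]], of j]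
    by (simp add: directional_def z_zi[OF x])
  have zp: "z p \<in> z ` U" using Cons.prems(2) by simp
  show ?case
  proof (cases "I = []")
    case True
    then show ?thesis using D[OF Cons.prems(1) zp] zi_z[OF Cons.prems(2)] by simp
  next
    case False
    note fa = vfield_smooth_fun[OF f_smooth Cons.prems(1), of j]
    have "brk I (\<lambda>x. f j x a) p = iterated_bracket cf.D I (\<lambda>x. f j (zi x) a) (z p)"
      by (rule Cons.IH[OF fa Cons.prems(2)])
    also have "\<dots> = iterated_bracket cf.D I (\<lambda>x. cf.D j x (\<lambda>x. a (zi x))) (z p)"
      by (rule cf.bracket_cong[OF sm[OF fa] cf.D_smooth[OF sm[OF Cons.prems(1)]] _ zp]) (rule D[OF Cons.prems(1), symmetric])
    finally have 1: "brk I (\<lambda>x. f j x a) p = \<dots>" .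
    have "f j p (brk I a) = cf.D j (z p) (\<lambda>x. brk I a (zi x))"
      using D[OF brk_smooth_fun[OF Cons.prems(1)] zp] zi_z[OF Cons.prems(2)] by simp
    also have "\<dots> = cf.D j (z p) (iterated_bracket cf.D I (\<lambda>x. a (zi x)))"
    proof (rule cf.D_cong[OF sm[OF brk_smooth_fun[OF Cons.prems(1)]] zp])
      fix y assume y: "y \<in> z ` U"
      show "brk I a (zi y) = iterated_bracket cf.D I (\<lambda>x. a (zi x)) y"
        using Cons.IH[OF Cons.prems(1) zi_U[OF y]] z_zi[OF y] by simp
    qed
    finally show ?thesis using 1 False by (simp add: iterated_bracket_Cons)
  qed
qed simp

lemma smooth_coord_fun: "smooth_fun_on M A U (\<lambda>p. z p $ l)"
  unfolding smooth_fun_on_iff[OF openU order_refl]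
  by (rule smooth_on_transform[OF open_zU cf.smooth_coord]) (simp add: z_zi)

lemma brk_coord_at_q: "brk I (\<lambda>p. z p $ l) q = iterated_bracket cf.D I (\<lambda>x. x $ l) 0"
proof -
  have "0 \<in> z ` U" using qU zq by force
  moreover have "smooth_on (z ` U) (\<lambda>x. z (zi x) $ l)"
    using smooth_coord_fun smooth_fun_on_iff[OF openU order_refl] by simp
  ultimately show ?thesis
    unfolding brk_coord[OF smooth_coord_fun qU] zq
    by (intro cf.bracket_cong cf.smooth_coord) (auto simp: zi_z)
qed

lemma continuous_zi_comp:
  assumes "continuous_on S y" "y ` S \<subseteq> z ` U"
  shows "continuous_map (top_of_set S) M (\<lambda>t. zi (y t))"
proof -
  have "continuous_map (top_of_set S) (top_of_set (z ` U)) y"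
    using assms by (simp add: continuous_map_in_subtopology image_subset_iff_funcset)
  from continuous_map_compose[OF this zi_continuous] show ?thesis by (simp add: o_def)
qed

lemma f0_velocity: "f0 p = velocity 0 p"
  by (simp add: velocity_def tscale_def fun_eq_iff sum_fun_apply)

lemma coord_velocity_0: "coord_velocity 0 x = ek"
  by (simp add: coord_velocity_def)

lemma integral_curve_coord:
  assumes vel: "\<And>\<tau>. \<tau> \<in> {0..t} \<Longrightarrow> has_velocity M A \<gamma> (f0 (\<gamma> \<tau>)) \<tau> S" and S: "{0..s} \<subseteq> S" and s: "0 \<le> s" "s \<le> t"
    and stay: "\<And>\<tau>. \<tau> \<in> {0..s} \<Longrightarrow> \<gamma> \<tau> \<in> U" and \<gamma>0: "\<gamma> 0 = q"
  shows "z (\<gamma> s) = s *\<^sub>R ek"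
proof -
  have "((\<lambda>\<tau>. z (\<gamma> \<tau>)) has_vector_derivative ek) (at \<tau> within {0..s})" if \<tau>: "\<tau> \<in> {0..s}" for \<tau>
    using has_velocity_coord[of \<gamma> 0 \<tau> S] vel[of \<tau>] stay[OF \<tau>] \<tau> s S
    by (auto simp: f0_velocity coord_velocity_0 intro: has_vector_derivative_within_subset)
  then have 1: "((\<lambda>\<tau>. ek) has_integral (z (\<gamma> s) - z (\<gamma> 0))) {0..s}"
    by (intro fundamental_theorem_of_calculus s(1)) auto
  have 2: "((\<lambda>\<tau>. ek) has_integral (s - 0) *\<^sub>R ek) {0..s}"
    using has_integral_const_real[of ek 0 s] s by simp
  from has_integral_unique[OF 1 2] show ?thesis using \<gamma>0 zq by simp
qed

text \<open>\<open>flow\<close> is defined by \<open>THE\<close>, so uniqueness is required among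
  all integral curves on the manifold, including those that might leave the chart. In the chart the
  coordinates move on the line \<open>\<tau> *\<^sub>R ek\<close>, and \<open>curve_stays\<close>
  with radius t excludes an exit.\<close>

lemma flow_eq:
  assumes t: "0 \<le> t" "t < R"
  shows "flow_defined M A f0 t q" "flow M A f0 t q = zi (t *\<^sub>R ek)"
proof -
  have H: "Hausdorff_space M" using mfd by (simp add: smooth_manifold_def)
  have seg: "closed_segment 0 t = {0..t}" using t by (simp add: closed_segment_eq_real_ivl)
  have inU: "\<tau> *\<^sub>R ek \<in> z ` U" if "\<tau> \<in> {0..t}" for \<tau>
    using that t cballU by (auto simp: subset_eq)
  have ex: "integral_curve M A f0 q t (\<lambda>\<tau>. zi (\<tau> *\<^sub>R ek))"
    unfolding integral_curve_def seg
  proof (intro conjI ballI)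
    show "continuous_map (top_of_set {0..t}) M (\<lambda>\<tau>. zi (\<tau> *\<^sub>R ek))"
      by (rule continuous_zi_comp) (auto intro!: continuous_intros inU)
    show "zi (0 *\<^sub>R ek) = q" using zi_z[OF qU] zq by simp
    fix \<tau> assume \<tau>: "\<tau> \<in> {0..t}"
    have "((\<lambda>\<tau>. \<tau> *\<^sub>R ek) has_vector_derivative coord_velocity 0 (\<tau> *\<^sub>R ek)) (at \<tau> within {0..t})"
      unfolding coord_velocity_0 by (auto intro!: derivative_eq_intros)
    from has_velocityI[OF this inU[OF \<tau>]]
    show "has_velocity M A (\<lambda>\<tau>. zi (\<tau> *\<^sub>R ek)) (f0 (zi (\<tau> *\<^sub>R ek))) \<tau> {0..t}"
      by (simp add: f0_velocity)
  qed
  then show "flow_defined M A f0 t q" unfolding flow_defined_def by blast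
  have uniq: "\<gamma> t = zi (t *\<^sub>R ek)" if c: "integral_curve M A f0 q t \<gamma>" for \<gamma>
  proof -
    have c': "continuous_map (top_of_set {0..t}) M \<gamma>" "\<gamma> 0 = q"
      "\<And>\<tau>. \<tau> \<in> {0..t} \<Longrightarrow> has_velocity M A \<gamma> (f0 (\<gamma> \<tau>)) \<tau> {0..t}"
      using c unfolding integral_curve_def seg by auto
    have stay: "\<gamma> s \<in> U" if s: "s \<in> {0..t}" for s
    proof (rule conjunct1[OF curve_stays[OF H c'(1,2) t(1) t _ s]])
      fix s assume s: "s \<in> {0..t}" and st: "\<And>\<tau>. \<tau> \<in> {0..s} \<Longrightarrow> \<gamma> \<tau> \<in> U \<and> z (\<gamma> \<tau>) \<in> cball 0 R"
      have "z (\<gamma> s) = s *\<^sub>R ek"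
        by (rule integral_curve_coord[OF c'(3) _ _ _ _ c'(2)]) (use s st in auto)
      then show "norm (z (\<gamma> s)) \<le> t" using s by simp
    qed
    have "z (\<gamma> t) = t *\<^sub>R ek"
      by (rule integral_curve_coord[OF c'(3) _ _ _ _ c'(2)]) (use t stay in auto)
    then show ?thesis using zi_z[OF stay[of t]] t by simp
  qed
  show "flow M A f0 t q = zi (t *\<^sub>R ek)"
    unfolding flow_def
  proof (rule the_equality)
    show "\<exists>\<gamma>. integral_curve M A f0 q t \<gamma> \<and> zi (t *\<^sub>R ek) = \<gamma> t"
      by (rule exI, rule conjI[OF ex refl])
    show "p = zi (t *\<^sub>R ek)" if "\<exists>\<gamma>. integral_curve M A f0 q t \<gamma> \<and> p = \<gamma> t" for p
      using that uniq by (elim exE conjE) simp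
  qed
qed

text \<open>The hypothesis on time and cost is the a priori bound that \<open>curve_stays\<close>
  requires: while the curve is in the chart, drift and control together move it by at most R1 < R.
  The control estimate is thereby valid up to the final time.\<close>

lemma admissible_estimate:
  assumes \<gamma>: "abs_continuous_curve M A T \<gamma>" and u: "is_control M A f0 f T \<gamma> u" and \<gamma>0: "\<gamma> 0 = q" and T: "0 \<le> T"
    and R1: "T + (B * CARD('m)) * (LINT t:{0..T}|lebesgue. norm (u t)) \<le> R1" "R1 < R"
  shows "\<gamma> T \<in> U" "norm (z (\<gamma> T)) \<le> R1"
    "norm (z (\<gamma> T) - T *\<^sub>R ek) \<le> (B * CARD('m)) * (LINT t:{0..T}|lebesgue. norm (u t))"
proof -
  have H: "Hausdorff_space M" using mfd by (simp add: smooth_manifold_def)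
  have cont: "continuous_map (top_of_set {0..T}) M \<gamma>" using \<gamma> by (simp add: abs_continuous_curve_def)
  have iu: "set_integrable lebesgue {0..T} u" using u by (simp add: is_control_def)
  let ?C = "B * CARD('m)" and ?I = "LINT t:{0..T}|lebesgue. norm (u t)"
  have C0: "0 \<le> ?C" using B0 by simp
  have I: "(\<lambda>t. norm (u t)) integrable_on {0..T}" "?I = integral {0..T} (\<lambda>t. norm (u t))"
    by (rule set_lebesgue_integral_eq_integral[OF set_integrable_norm[OF iu]])+
  have I0: "0 \<le> ?I" unfolding I(2) by (rule integral_nonneg[OF I(1)]) simp
  have est: "norm (z (\<gamma> t) - t *\<^sub>R ek) \<le> ?C * ?I"
    if t: "t \<in> {0..T}" and st: "\<And>s. s \<in> {0..t} \<Longrightarrow> \<gamma> s \<in> U \<and> z (\<gamma> s) \<in> cball 0 R" for t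
  proof -
    have "norm ((z (\<gamma> t) - t *\<^sub>R ek) - (z (\<gamma> 0) - 0 *\<^sub>R ek)) \<le> ?C * integral {0..t} (\<lambda>t. norm (u t))"
      by (rule control_estimate[OF \<gamma> u _ _ _ st]) (use t in auto)
    also have "integral {0..t} (\<lambda>t. norm (u t)) \<le> ?I"
      unfolding I(2) using t by (intro integral_subset_le integrable_on_subinterval[OF I(1)] I(1)) auto
    finally show ?thesis using C0 \<gamma>0 zq by (simp add: mult_left_mono)
  qed
  have R10: "0 \<le> R1" using R1(1) T C0 I0 mult_nonneg_nonneg[OF C0 I0] by linarith
  have stay: "\<gamma> t \<in> U \<and> norm (z (\<gamma> t)) \<le> R1" if "t \<in> {0..T}" for t
  proof (rule curve_stays[OF H cont \<gamma>0 T R10 R1(2) _ that])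
    fix t assume t: "t \<in> {0..T}" and st: "\<And>s. s \<in> {0..t} \<Longrightarrow> \<gamma> s \<in> U \<and> z (\<gamma> s) \<in> cball 0 R"
    have "norm (z (\<gamma> t)) \<le> norm (z (\<gamma> t) - t *\<^sub>R ek) + norm (t *\<^sub>R ek)"
      using norm_triangle_ineq[of "z (\<gamma> t) - t *\<^sub>R ek" "t *\<^sub>R ek"] by simp
    then show "norm (z (\<gamma> t)) \<le> R1" using est[OF t st] R1(1) t by simp
  qed
  from stay[of T] T show "\<gamma> T \<in> U" "norm (z (\<gamma> T)) \<le> R1" by auto
  show "norm (z (\<gamma> T) - T *\<^sub>R ek) \<le> ?C * ?I"
    by (rule est) (use T stay R1(2) in force)+
qed

end

section \<open>Realisation of trajectories\<close>

context drift_chart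
begin

text \<open>A class of coordinate curves closed under concatenation and strong enough to be
  admissible: the Lipschitz bound yields absolute continuity in every chart, and the finite
  exceptional set is null.\<close>

definition trajectory :: "real \<Rightarrow> (real \<times> real \<times> (real ^ 'm)) list \<Rightarrow> (real \<Rightarrow> real ^ 'n) \<Rightarrow> bool" where
  "trajectory T l y \<longleftrightarrow> 0 \<le> T \<and> steps_within T l \<and> (\<forall>t\<in>{0..T}. y t \<in> cball 0 R) \<and>
     (\<exists>K\<ge>0. \<forall>s\<in>{0..T}. \<forall>t\<in>{0..T}. dist (y s) (y t) \<le> K * \<bar>s - t\<bar>) \<and>
     (\<exists>S. finite S \<and> (\<forall>t\<in>{0..T} - S.
        (y has_vector_derivative coord_velocity (step_control l t) (y t)) (at t within {0..T})))"

definition reach :: "real \<Rightarrow> real ^ 'n \<Rightarrow> real ^ 'n \<Rightarrow> real \<Rightarrow> bool" where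
  "reach T p x c \<longleftrightarrow> (\<exists>l y. trajectory T l y \<and> y 0 = p \<and> y T = x \<and> step_cost l \<le> c)"

lemma reach_drift:
  assumes "0 \<le> t" "t < R" shows "reach t 0 (t *\<^sub>R ek) 0"
  unfolding reach_def
proof (intro exI conjI)
  show "trajectory t [] (\<lambda>s. s *\<^sub>R ek)"
    unfolding trajectory_def
  proof (intro conjI ballI)
    show "\<exists>K\<ge>0. \<forall>s\<in>{0..t}. \<forall>s'\<in>{0..t}. dist (s *\<^sub>R ek) (s' *\<^sub>R ek) \<le> K * \<bar>s - s'\<bar>"
      by (intro exI[of _ 1]) (simp add: dist_norm scaleR_diff_left[symmetric])
    show "\<exists>S. finite S \<and> (\<forall>s\<in>{0..t} - S. ((\<lambda>s. s *\<^sub>R ek) has_vector_derivative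
        coord_velocity (step_control [] s) (s *\<^sub>R ek)) (at s within {0..t}))"
      by (intro exI[of _ "{}"]) (auto simp: step_control_def coord_velocity_0 intro!: derivative_eq_intros)
  qed (use assms in \<open>auto simp: steps_within_def\<close>)
qed (auto simp: step_cost_def)

text \<open>The trajectory on the unit interval is run in time \<eta>, which multiplies its velocity
  by 1 / \<eta>: the drift term becomes \<open>ek\<close> and the control \<theta> / \<eta>. Held
  for time \<eta>, that control costs \<open>\<bar>\<theta>\<bar>\<close>, independently of
  \<eta>.\<close>

lemma reach_step:
  assumes \<eta>: "0 < \<eta>" and \<theta>: "\<bar>\<theta>\<bar> * L \<le> 1 / 2" and stay: "norm p + (\<eta> + \<bar>\<theta>\<bar> * B) \<le> R"
  shows "reach \<eta> p (cf.step \<eta> (i, \<theta>) p) \<bar>\<theta>\<bar>"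
  unfolding reach_def
proof (intro exI conjI)
  let ?w = "cf.traj \<eta> i \<theta> p"
  let ?y = "\<lambda>t. ?w (t / \<eta>)" and ?l = "[(0, \<eta>, axis i (\<theta> / \<eta>) :: real ^ 'm)]"
  have in01: "t / \<eta> \<in> {0..1}" if "t \<in> {0..\<eta>}" for t using that \<eta> by auto
  have inR: "?y t \<in> cball 0 R" if "t \<in> {0..\<eta>}" for t
    by (rule cf.traj_in_cball[OF \<theta> in01[OF that]]) (use stay \<eta> in simp)
  show "trajectory \<eta> ?l ?y"
    unfolding trajectory_def
  proof (intro conjI ballI)
    show "?y t \<in> cball 0 R" if "t \<in> {0..\<eta>}" for t by (rule inR[OF that])
    show "\<exists>K\<ge>0. \<forall>s\<in>{0..\<eta>}. \<forall>t\<in>{0..\<eta>}. dist (?y s) (?y t) \<le> K * \<bar>s - t\<bar>"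
    proof (intro exI[of _ "(\<bar>\<eta>\<bar> + \<bar>\<theta>\<bar> * B) / \<eta>"] conjI ballI)
      fix s t assume "s \<in> {0..\<eta>}" "t \<in> {0..\<eta>}"
      then have "dist (?y s) (?y t) \<le> (\<bar>\<eta>\<bar> + \<bar>\<theta>\<bar> * B) * \<bar>s / \<eta> - t / \<eta>\<bar>"
        unfolding dist_norm by (intro cf.traj_lip[OF \<theta>] in01)
      also have "\<bar>s / \<eta> - t / \<eta>\<bar> = \<bar>s - t\<bar> / \<eta>" using \<eta> by (simp add: diff_divide_distrib[symmetric])
      finally show "dist (?y s) (?y t) \<le> (\<bar>\<eta>\<bar> + \<bar>\<theta>\<bar> * B) / \<eta> * \<bar>s - t\<bar>" by simp
    qed (use \<eta> B0 in simp)
    show "\<exists>S. finite S \<and> (\<forall>t\<in>{0..\<eta>} - S. (?y has_vector_derivative coord_velocity (step_control ?l t) (?y t)) (at t within {0..\<eta>}))"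
    \<comment> \<open>The final time is exceptional, because a control on a half-open interval is 0
      at its right end.\<close>
    proof (intro exI[of _ "{\<eta>}"] conjI ballI)
      fix t assume t: "t \<in> {0..\<eta>} - {\<eta>}"
      have sc: "step_control ?l t = axis i (\<theta> / \<eta>)" using t by (simp add: step_control_def)
      have f: "((\<lambda>t. t / \<eta>) has_vector_derivative 1 / \<eta>) (at t within {0..\<eta>})"
        using \<eta> by (auto intro!: derivative_eq_intros simp: has_real_derivative_iff_has_vector_derivative[symmetric])
      have "(?w has_vector_derivative cf.field \<eta> i \<theta> (?y t)) (at (t / \<eta>) within (\<lambda>t. t / \<eta>) ` {0..\<eta>})"
        by (rule has_vector_derivative_within_subset[OF cf.traj(2)[OF \<theta> in01]]) (use t in01 in auto)
      from vector_diff_chain_within[OF f this]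
      have "(?y has_vector_derivative (1 / \<eta>) *\<^sub>R cf.field \<eta> i \<theta> (?y t)) (at t within {0..\<eta>})" by (simp add: o_def)
      moreover have "(1 / \<eta>) *\<^sub>R cf.field \<eta> i \<theta> (?y t) = coord_velocity (step_control ?l t) (?y t)"
      proof -
        have "(\<Sum>j\<in>UNIV. axis i (\<theta> / \<eta>) $ j *\<^sub>R FF j (?y t)) = (\<Sum>j\<in>UNIV. if j = i then (\<theta> / \<eta>) *\<^sub>R FF i (?y t) else 0)"
          by (rule sum.cong) (auto simp: axis_def)
        then show ?thesis
          using \<eta> cf.G_eq[OF inR[of t]] t unfolding sc by (simp add: cf.field_def coord_velocity_def scaleR_add_right)
      qed
      ultimately show "(?y has_vector_derivative coord_velocity (step_control ?l t) (?y t)) (at t within {0..\<eta>})" by simp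
    qed simp
  qed (use \<eta> in \<open>auto simp: steps_within_def\<close>)
  show "?y 0 = p" using cf.traj(1)[OF \<theta>] by simp
  show "?y \<eta> = cf.step \<eta> (i, \<theta>) p" using \<eta> by (simp add: cf.step_def)
  have "(axis i (\<theta> / \<eta>) :: real ^ 'm) = (\<theta> / \<eta>) *\<^sub>R axis i 1" by (simp add: vec_eq_iff axis_def)
  then have "norm (axis i (\<theta> / \<eta>) :: real ^ 'm) = \<bar>\<theta> / \<eta>\<bar>" by simp
  then show "step_cost ?l \<le> \<bar>\<theta>\<bar>" using \<eta> by (simp add: step_cost_def)
qed

lemma reach_trans:
  assumes "reach T1 p x c1" "reach T2 x w c2"
  shows "reach (T1 + T2) p w (c1 + c2)"
proof -
  obtain l1 y1 where 1: "trajectory T1 l1 y1" "y1 0 = p" "y1 T1 = x" "step_cost l1 \<le> c1"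
    using assms(1) unfolding reach_def by blast
  obtain l2 y2 where 2: "trajectory T2 l2 y2" "y2 0 = x" "y2 T2 = w" "step_cost l2 \<le> c2"
    using assms(2) unfolding reach_def by blast
  obtain K1 S1 where t1: "0 \<le> T1" "steps_within T1 l1" "\<And>t. t \<in> {0..T1} \<Longrightarrow> y1 t \<in> cball 0 R"
    "0 \<le> K1" "\<And>s t. s \<in> {0..T1} \<Longrightarrow> t \<in> {0..T1} \<Longrightarrow> dist (y1 s) (y1 t) \<le> K1 * \<bar>s - t\<bar>"
    "finite S1" "\<And>t. t \<in> {0..T1} - S1 \<Longrightarrow> (y1 has_vector_derivative coord_velocity (step_control l1 t) (y1 t)) (at t within {0..T1})"
    using 1(1) unfolding trajectory_def by blast
  obtain K2 S2 where t2: "0 \<le> T2" "steps_within T2 l2" "\<And>t. t \<in> {0..T2} \<Longrightarrow> y2 t \<in> cball 0 R"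
    "0 \<le> K2" "\<And>s t. s \<in> {0..T2} \<Longrightarrow> t \<in> {0..T2} \<Longrightarrow> dist (y2 s) (y2 t) \<le> K2 * \<bar>s - t\<bar>"
    "finite S2" "\<And>t. t \<in> {0..T2} - S2 \<Longrightarrow> (y2 has_vector_derivative coord_velocity (step_control l2 t) (y2 t)) (at t within {0..T2})"
    using 2(1) unfolding trajectory_def by blast
  let ?T = "T1 + T2"
  define y where "y t = (if t \<le> T1 then y1 t else y2 (t - T1))" for t
  define l where "l = l1 @ map (\<lambda>(a, b, c). (a + T1, b + T1, c)) l2"
  \<comment> \<open>At the junction both formulas agree, as the first piece ends where the second
    begins; so the second formula may be used on the closed interval from T1 on.\<close>
  have y2': "y t = y2 (t - T1)" if "T1 \<le> t" for t using that 1(3) 2(2) by (auto simp: y_def)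
  have zero: "(\<Sum>(a, b, c)\<leftarrow>m. if a \<le> t \<and> t < b then c else 0) = 0"
    if "\<forall>(a, b, c)\<in>set m. \<not> (a \<le> t \<and> t < b)" for m and t :: real
    using that by (induction m) auto
  have shift: "(\<Sum>(a, b, c)\<leftarrow>map (\<lambda>(a, b, c). (a + T1, b + T1, c)) m. if a \<le> t \<and> t < b then c else 0)
      = step_control m (t - T1)" for m t
    by (induction m) (auto simp: step_control_def le_diff_eq diff_less_eq)
  have c1: "step_control l t = step_control l1 t" if "t < T1" for t
  proof -
    have "(\<Sum>(a, b, c)\<leftarrow>map (\<lambda>(a, b, c). (a + T1, b + T1, c)) l2. if a \<le> t \<and> t < b then c else 0) = 0"
      by (rule zero) (use t2(2) that in \<open>auto simp: steps_within_def\<close>)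
    then show ?thesis by (simp add: l_def step_control_def)
  qed
  have c2: "step_control l t = step_control l2 (t - T1)" if "T1 < t" for t
  proof -
    have "step_control l1 t = 0"
      unfolding step_control_def by (rule zero) (use t1(2) that in \<open>auto simp: steps_within_def\<close>)
    then show ?thesis using shift[of t l2] by (simp add: l_def step_control_def)
  qed
  have "trajectory ?T l y"
    unfolding trajectory_def
  proof (intro conjI ballI)
    show "steps_within ?T l"
      using t1(1,2) t2(1,2) by (fastforce simp: steps_within_def l_def)
    show "y t \<in> cball 0 R" if "t \<in> {0..?T}" for t
    proof (cases "t \<le> T1")
      case True
      then show ?thesis using t1(3)[of t] that by (simp add: y_def)
    next
      case False
      then show ?thesis using t2(3)[of "t - T1"] that by (simp add: y_def)
    qed
    have mid: "dist (y s) (y t) \<le> (K1 + K2) * \<bar>s - t\<bar>" if s: "s \<in> {0..?T}" "t \<in> {0..?T}" "s \<le> t" for s t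
    proof -
      have le: "K1 * r \<le> (K1 + K2) * r" "K2 * r \<le> (K1 + K2) * r" if "0 \<le> r" for r
        using that t1(4) t2(4) by (auto intro: mult_right_mono)
      consider "t \<le> T1" | "T1 \<le> s" | "s \<le> T1" "T1 \<le> t" by linarith
      then show ?thesis
      proof cases
        case 1
        then have "dist (y s) (y t) \<le> K1 * \<bar>s - t\<bar>" using t1(5)[of s t] s by (simp add: y_def)
        then show ?thesis using le(1)[of "\<bar>s - t\<bar>"] by simp
      next
        case 2
        then have "dist (y s) (y t) \<le> K2 * \<bar>s - t\<bar>" using t2(5)[of "s - T1" "t - T1"] s by (simp add: y2')
        then show ?thesis using le(2)[of "\<bar>s - t\<bar>"] by simp
      next
        case 3
        have "dist (y s) (y t) \<le> dist (y s) (y T1) + dist (y T1) (y t)" by (rule dist_triangle)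
        also have "\<dots> \<le> K1 * \<bar>s - T1\<bar> + K2 * \<bar>T1 - t\<bar>"
        proof (rule add_mono)
          show "dist (y s) (y T1) \<le> K1 * \<bar>s - T1\<bar>" using t1(5)[of s T1] t1(1) s 3 by (simp add: y_def)
          show "dist (y T1) (y t) \<le> K2 * \<bar>T1 - t\<bar>" using t2(5)[of 0 "t - T1"] t2(1) s 3 by (simp add: y2' abs_minus_commute)
        qed
        also have "\<dots> \<le> (K1 + K2) * \<bar>s - T1\<bar> + (K1 + K2) * \<bar>T1 - t\<bar>" by (intro add_mono le) auto
        also have "\<dots> = (K1 + K2) * \<bar>s - t\<bar>" using 3 by (simp add: distrib_left[symmetric])
        finally show ?thesis .
      qed
    qed
    show "\<exists>K\<ge>0. \<forall>s\<in>{0..?T}. \<forall>t\<in>{0..?T}. dist (y s) (y t) \<le> K * \<bar>s - t\<bar>"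
    proof (intro exI[of _ "K1 + K2"] conjI ballI)
      fix s t assume "s \<in> {0..?T}" "t \<in> {0..?T}"
      then show "dist (y s) (y t) \<le> (K1 + K2) * \<bar>s - t\<bar>"
        using mid[of s t] mid[of t s] by (cases "s \<le> t") (auto simp: dist_commute abs_minus_commute)
    qed (use t1(4) t2(4) in simp)
    show "\<exists>S. finite S \<and> (\<forall>t\<in>{0..?T} - S. (y has_vector_derivative coord_velocity (step_control l t) (y t)) (at t within {0..?T}))"
    \<comment> \<open>The junction is exceptional too, since the velocity may jump there.\<close>
    proof (intro exI[of _ "insert T1 (S1 \<union> (\<lambda>s. s + T1) ` S2)"] conjI ballI)
      show "finite (insert T1 (S1 \<union> (\<lambda>s. s + T1) ` S2))" using t1(6) t2(6) by simp
      fix t assume t: "t \<in> {0..?T} - insert T1 (S1 \<union> (\<lambda>s. s + T1) ` S2)"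
      show "(y has_vector_derivative coord_velocity (step_control l t) (y t)) (at t within {0..?T})"
      proof (cases "t < T1")
        case True
        have a: "at t within {0..?T} = at t within {0..T1}"
          by (rule at_within_nhd[of t "{..<T1}"]) (use True t t2(1) in auto)
        have "(y1 has_vector_derivative coord_velocity (step_control l1 t) (y1 t)) (at t within {0..T1})"
          using t1(7)[of t] t True by auto
        then have "(y has_vector_derivative coord_velocity (step_control l1 t) (y1 t)) (at t within {0..T1})"
          by (rule has_vector_derivative_transform[rotated 2]) (use t True in \<open>auto simp: y_def\<close>)
        then show ?thesis using True unfolding a c1[OF True] by (simp add: y_def)
      next
        case False
        then have lt: "T1 < t" using t by auto
        have a: "at t within {0..?T} = at t within {T1..?T}"
          by (rule at_within_nhd[of t "{T1<..}"]) (use lt t t1(1) in auto)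
        have "t - T1 \<notin> S2" using t by force
        then have "(y2 has_vector_derivative coord_velocity (step_control l2 (t - T1)) (y2 (t - T1))) (at (t - T1) within (\<lambda>s. s - T1) ` {T1..?T})"
          using t2(7)[of "t - T1"] t lt by (auto intro: has_vector_derivative_within_subset)
        moreover have "((\<lambda>s. s - T1) has_vector_derivative 1) (at t within {T1..?T})"
          by (auto intro!: derivative_eq_intros)
        ultimately have "((y2 \<circ> (\<lambda>s. s - T1)) has_vector_derivative 1 *\<^sub>R coord_velocity (step_control l2 (t - T1)) (y2 (t - T1))) (at t within {T1..?T})"
          by (intro vector_diff_chain_within)
        then have "(y has_vector_derivative 1 *\<^sub>R coord_velocity (step_control l2 (t - T1)) (y2 (t - T1))) (at t within {T1..?T})"
          by (rule has_vector_derivative_transform[rotated 2]) (use t lt in \<open>auto simp: y2'\<close>)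
        then show ?thesis unfolding a c2[OF lt] using lt by (simp add: y2')
      qed
    qed
  qed (use t1(1) t2(1) in simp)
  moreover have "y 0 = p" using t1(1) 1(2) by (simp add: y_def)
  moreover have "y ?T = w" using t2(1) 2(3) by (simp add: y2')
  moreover have "step_cost l \<le> c1 + c2"
  proof -
    have "step_cost (map (\<lambda>(a, b, c). (a + T1, b + T1, c)) m) = step_cost m" for m :: "(real \<times> real \<times> (real ^ 'm)) list"
      by (induction m) (auto simp: step_cost_def)
    then have "step_cost l = step_cost l1 + step_cost l2" by (simp add: l_def step_cost_def)
    then show ?thesis using 1(4) 2(4) by simp
  qed
  ultimately show ?thesis unfolding reach_def by blast
qed

text \<open>The norm bound is a budget: a step of duration \<eta> with control \<theta> moves the
  point by at most \<open>\<eta> + \<bar>\<theta>\<bar> * B\<close> and uses up the same amount, so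
  the remaining path still stays in the ball.\<close>

lemma reach_run:
  assumes "reach T a p c" "0 < \<eta>" "cost_of cs * L \<le> 1 / 2" "norm p + (real (length cs) * \<eta> + cost_of cs * B) \<le> R"
  shows "reach (T + real (length cs) * \<eta>) a (cf.run \<eta> cs p) (c + cost_of cs)"
  using assms(1,3,4)
proof (induction cs arbitrary: T p c)
  case Nil
  then show ?case by (simp add: cost_of_def)
next
  case (Cons s cs)
  obtain i \<theta> where s: "s = (i, \<theta>)" by (cases s)
  have co: "cost_of (s # cs) = \<bar>\<theta>\<bar> + cost_of cs" by (simp add: s cost_of_def)
  have nn: "0 \<le> \<bar>\<theta>\<bar> * L" "0 \<le> cost_of cs * L" "0 \<le> \<bar>\<theta>\<bar> * B" "0 \<le> cost_of cs * B" "0 \<le> real (length cs) * \<eta>"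
    using L0 B0 cost_of_nonneg[of cs] assms(2) by auto
  have th: "\<bar>\<theta>\<bar> * L \<le> 1 / 2" "cost_of cs * L \<le> 1 / 2"
    using Cons.prems(2) nn unfolding co distrib_right by linarith+
  have bd: "norm p + (\<eta> + \<bar>\<theta>\<bar> * B) + (real (length cs) * \<eta> + cost_of cs * B) \<le> R"
    using Cons.prems(3) unfolding co distrib_right by (simp add: algebra_simps)
  have "norm (cf.step \<eta> s p) \<le> norm p + norm (cf.step \<eta> s p - p)"
    using norm_triangle_ineq[of p "cf.step \<eta> s p - p"] by simp
  also have "\<dots> \<le> norm p + (\<eta> + \<bar>\<theta>\<bar> * B)" using cf.step_dist[OF th(1), of \<eta> i p] assms(2) by (simp add: s)
  finally have n: "norm (cf.step \<eta> s p) + (real (length cs) * \<eta> + cost_of cs * B) \<le> R" using bd by linarith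
  have "reach \<eta> p (cf.step \<eta> s p) \<bar>\<theta>\<bar>"
    unfolding s by (rule reach_step[OF assms(2) th(1)]) (use bd nn in linarith)
  from Cons.IH[OF reach_trans[OF Cons.prems(1) this] th(2) n]
  show ?case by (simp add: co algebra_simps)
qed

text \<open>Every chart of the atlas has to be tested, on every time interval that the curve spends
  in it. Near each time the transition map from \<open>z\<close> is Lipschitz on a compact ball;
  compactness of the time interval makes the bound global.\<close>

lemma abs_continuous_curve_zi:
  assumes y: "\<And>t. t \<in> {0..T} \<Longrightarrow> y t \<in> z ` U"
    and K: "0 \<le> K" "\<And>s t. s \<in> {0..T} \<Longrightarrow> t \<in> {0..T} \<Longrightarrow> dist (y s) (y t) \<le> K * \<bar>s - t\<bar>"
  shows "abs_continuous_curve M A T (\<lambda>t. zi (y t))"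
proof -
  have cy: "continuous_on {0..T} y"
    by (rule lipschitz_on_continuous_on[of K]) (intro lipschitz_onI, use K in \<open>auto simp: dist_real_def\<close>)
  have main: "abs_continuous_on a b (\<lambda>t. \<phi> (zi (y t)))"
    if V: "(V, \<phi>) \<in> A" and ab: "0 \<le> a" "a \<le> b" "b \<le> T" and sub: "(\<lambda>t. zi (y t)) ` {a..b} \<subseteq> V" for V \<phi> a b
  proof -
    have o: "open (z ` (U \<inter> V))" using openU chart_open[OF chart[OF V]] by (intro open_image) auto
    have sm: "smooth_on (z ` (U \<inter> V)) (\<lambda>x. \<phi> (zi x))"
      using loc V by (auto simp: local_coordinates_def smooth_transition_def)
    have yin: "y t \<in> z ` (U \<inter> V)" if t: "t \<in> {a..b}" for t
    proof -
      have "y t \<in> z ` U" using y[of t] t ab by auto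
      moreover have "zi (y t) \<in> V" using sub t by blast
      ultimately show ?thesis using zi_U z_zi by (intro image_eqI[of _ _ "zi (y t)"]) auto
    qed
    have "\<exists>C\<ge>0. \<forall>s\<in>{a..b}. \<forall>s'\<in>{a..b}. dist (\<phi> (zi (y s))) (\<phi> (zi (y s'))) \<le> C * \<bar>s - s'\<bar>"
    proof (rule locally_lipschitz_interval[OF ab(2)])
      fix t assume t: "t \<in> {a..b}"
      obtain e where e: "0 < e" "cball (y t) e \<subseteq> z ` (U \<inter> V)" using o yin[OF t] open_contains_cball by blast
      obtain C where C: "0 \<le> C" "\<forall>x\<in>cball (y t) e. \<forall>x'\<in>cball (y t) e. norm (\<phi> (zi x) - \<phi> (zi x')) \<le> C * norm (x - x')"
        using smooth_on_lipschitz[OF o sm compact_cball convex_cball e(2)] by blast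
      have K1: "0 < K + 1" using K(1) by simp
      have near: "y s \<in> cball (y t) e" if s: "s \<in> {a..b}" "\<bar>s - t\<bar> < e / (K + 1)" for s
      proof -
        have "dist (y t) (y s) \<le> K * \<bar>t - s\<bar>" using K(2)[of t s] s t ab by auto
        also have "\<dots> \<le> (K + 1) * \<bar>s - t\<bar>" by (simp add: abs_minus_commute mult_right_mono)
        also have "\<dots> \<le> e" using s(2) pos_less_divide_eq[OF K1, of "\<bar>s - t\<bar>" e] by (simp add: mult.commute)
        finally show ?thesis by simp
      qed
      show "\<exists>d>0. \<exists>C\<ge>0. \<forall>s\<in>{a..b}. \<forall>s'\<in>{a..b}. \<bar>s - t\<bar> < d \<and> \<bar>s' - t\<bar> < d \<longrightarrow>
          dist (\<phi> (zi (y s))) (\<phi> (zi (y s'))) \<le> C * \<bar>s - s'\<bar>"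
      proof (rule exI[of _ "e / (K + 1)"], rule conjI, simp add: e(1) K1, rule exI[of _ "C * K"], rule conjI, simp add: C(1) K(1), intro ballI impI)
        fix s s' assume s: "s \<in> {a..b}" "s' \<in> {a..b}" "\<bar>s - t\<bar> < e / (K + 1) \<and> \<bar>s' - t\<bar> < e / (K + 1)"
        have "dist (\<phi> (zi (y s))) (\<phi> (zi (y s'))) \<le> C * dist (y s) (y s')"
          using C(2) near[of s] near[of s'] s unfolding dist_norm by blast
        also have "\<dots> \<le> C * (K * \<bar>s - s'\<bar>)"
          using K(2)[of s s'] s ab C(1) by (intro mult_left_mono) auto
        finally show "dist (\<phi> (zi (y s))) (\<phi> (zi (y s'))) \<le> C * K * \<bar>s - s'\<bar>" by (simp add: mult.assoc)
      qed
    qed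
    then obtain C where "0 \<le> C" "\<forall>s\<in>{a..b}. \<forall>s'\<in>{a..b}. dist (\<phi> (zi (y s))) (\<phi> (zi (y s'))) \<le> C * \<bar>s - s'\<bar>" by blast
    then show ?thesis by (intro abs_continuous_on_lipschitz[of C]) auto
  qed
  have "continuous_map (top_of_set {0..T}) M (\<lambda>t. zi (y t))"
    by (rule continuous_zi_comp[OF cy]) (use y in auto)
  then show ?thesis
    unfolding abs_continuous_curve_def using main by blast
qed

lemma value_le_reach:
  assumes r: "reach T' 0 x c" and T: "T' \<le> T"
  shows "value_function M A f0 f T q (zi x) \<le> ereal c"
proof -
  obtain l y where y: "trajectory T' l y" "y 0 = 0" "y T' = x" "step_cost l \<le> c"
    using r unfolding reach_def by blast
  obtain K S where t: "0 \<le> T'" "steps_within T' l" "\<And>t. t \<in> {0..T'} \<Longrightarrow> y t \<in> cball 0 R"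
    "0 \<le> K" "\<And>s t. s \<in> {0..T'} \<Longrightarrow> t \<in> {0..T'} \<Longrightarrow> dist (y s) (y t) \<le> K * \<bar>s - t\<bar>"
    "finite S" "\<And>t. t \<in> {0..T'} - S \<Longrightarrow> (y has_vector_derivative coord_velocity (step_control l t) (y t)) (at t within {0..T'})"
    using y(1) unfolding trajectory_def by blast
  have yU: "y t \<in> z ` U" if "t \<in> {0..T'}" for t using t(3)[OF that] cballU by blast
  let ?\<gamma> = "\<lambda>t. zi (y t)"
  have ac: "abs_continuous_curve M A T' ?\<gamma>" by (rule abs_continuous_curve_zi[OF yU t(4,5)])
  have ctrl: "is_control M A f0 f T' ?\<gamma> (step_control l)"
    unfolding is_control_def velocity_def[symmetric]
  proof
    show "set_integrable lebesgue {0..T'} (step_control l)" by (rule step_control_integral(1)[OF t(2)])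
    have "S \<in> null_sets lebesgue" using t(6) negligible_iff_null_sets negligible_finite by blast
    then show "AE t\<in>{0..T'} in lebesgue. has_velocity M A ?\<gamma> (velocity (step_control l t) (?\<gamma> t)) t {0..T'}"
      by (rule AE_I') (use has_velocityI[OF t(7) yU] in auto)
  qed
  have "cost M A f0 f T' ?\<gamma> \<le> ereal (LINT t:{0..T'}|lebesgue. norm (step_control l t))"
    unfolding cost_def by (rule Inf_lower) (use ctrl in blast)
  also have "\<dots> \<le> ereal c" using step_control_integral(2)[OF t(2)] y(4) by simp
  finally have c: "cost M A f0 f T' ?\<gamma> \<le> ereal c" .
  have "value_function M A f0 f T q (zi x) \<le> cost M A f0 f T' ?\<gamma>"
    unfolding value_function_def
  proof (rule Inf_lower, intro CollectI exI conjI)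
    show "admissible M A f0 f T' ?\<gamma>" unfolding admissible_def using ac ctrl by blast
    show "?\<gamma> 0 = q" using y(2) zi_z[OF qU] zq by simp
  qed (use t(1) T y(3) in auto)
  with c show ?thesis by (rule order_trans[rotated])
qed

end

section \<open>The two-sided estimate of the value function\<close>

context drift_chart
begin

lemma value_function_bounds:
  assumes H: "hormander M A f" and E: "equiregular M A f" and r: "r = nonholonomy_degree M A f"
  shows "\<exists>T0>0. \<exists>\<epsilon>0>0. \<forall>T \<epsilon>. 0 < T \<and> T \<le> T0 \<and> 0 < \<epsilon> \<and> \<epsilon> \<le> \<epsilon>0 \<longrightarrow>
    (\<forall>t\<in>{0..T}. flow_defined M A f0 t q \<and> flow M A f0 t q \<in> U) \<and>
    (\<exists>C::real>0. \<forall>q'\<in>topspace M. value_function M A f0 f T q q' \<le> ereal \<epsilon> \<longrightarrow>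
       q' \<in> U \<and>
       ereal (1 / C * infdist (z q') (z ` (\<lambda>t. flow M A f0 t q) ` {0..T})) \<le> value_function M A f0 f T q q' \<and>
       value_function M A f0 f T q q' \<le> ereal (C * infdist (z q') (z ` (\<lambda>t. flow M A f0 t q) ` {0..T}) powr (1 / real r)))"
proof -
  have r1: "1 \<le> r" by (rule brackets_span(1)[OF H E qU r])
  obtain g where g: "\<And>j l. (\<Sum>I\<in>words_upto r. g j I * brk I (\<lambda>x. z x $ l) q) = (if l = j then 1 else (0::real))"
    using brackets_span(2)[OF H E qU r] by auto
  have g': "(\<Sum>I\<in>words_upto r. g j I * iterated_bracket cf.D I (\<lambda>x. x $ l) 0) = (if l = j then 1 else 0)" for j l
    using g[of j l] by (simp add: brk_coord_at_q)
  obtain N C' \<rho>0 d0 where C': "0 < C'" and \<rho>0: "0 < \<rho>0" and d0: "0 < d0" and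
    steer: "\<forall>p x. norm p \<le> \<rho>0 \<and> 0 < norm (x - p) \<and> norm (x - p) \<le> d0 \<longrightarrow>
      (\<exists>H>0. \<forall>\<eta> p'. 0 \<le> \<eta> \<and> \<eta> \<le> H \<and> norm (p' - p) \<le> real N * \<eta> \<longrightarrow>
        (\<exists>cs. length cs = N \<and> cost_of cs \<le> C' * norm (x - p) powr (1 / r) \<and> cf.run \<eta> cs p' = x \<and>
           cost_of cs * L \<le> 1 / 2 \<and> norm p' + (real N * \<eta> + cost_of cs * B) \<le> R))"
    using cf.steering[OF r1 g'] by (elim exE conjE)
  define C where "C = B * CARD('m)"
  have C0: "0 < C" using B0 by (simp add: C_def)
  \<comment> \<open>A curve of time at most R / 4 and cost at most \<epsilon>1 stays in the
    coordinate ball of radius R / 2 and ends within d0 of the drift segment, the range in which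
    steering is available.\<close>
  define \<epsilon>1 where "\<epsilon>1 = min (R / 4) d0 / C"
  have \<epsilon>1: "0 < \<epsilon>1" unfolding \<epsilon>1_def using R0 d0 C0 by simp
  have C\<epsilon>1: "C * \<epsilon>1 = min (R / 4) d0" using C0 by (simp add: \<epsilon>1_def)
  define T0 where "T0 = min (R / 4) \<rho>0"
  have T0: "0 < T0" unfolding T0_def using R0 \<rho>0 by simp
  show ?thesis
  \<comment> \<open>The threshold is halved because attainment of the infimum is not assumed: from a
    value at most \<epsilon> one obtains a curve of cost less than 2 \<epsilon>, which has to be at
    most \<epsilon>1.\<close>
  proof (rule exI[of _ T0], rule conjI[OF T0], rule exI[of _ "\<epsilon>1 / 2"], intro conjI allI impI)
    show "0 < \<epsilon>1 / 2" using \<epsilon>1 by simp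
    fix T \<epsilon> :: real
    assume a: "0 < T \<and> T \<le> T0 \<and> 0 < \<epsilon> \<and> \<epsilon> \<le> \<epsilon>1 / 2"
    then have T: "0 < T" "T \<le> R / 4" "T \<le> \<rho>0" and \<epsilon>: "0 < \<epsilon>" "\<epsilon> \<le> \<epsilon>1 / 2" by (auto simp: T0_def)
    have fl: "flow_defined M A f0 t q" "flow M A f0 t q = zi (t *\<^sub>R ek)" "zi (t *\<^sub>R ek) \<in> U" "z (zi (t *\<^sub>R ek)) = t *\<^sub>R ek"
      if "t \<in> {0..T}" for t
    proof -
      have t: "0 \<le> t" "t < R" using that T R0 by auto
      have "t *\<^sub>R ek \<in> cball 0 R" using t by simp
      then have "t *\<^sub>R ek \<in> z ` U" using cballU by blast
      then show "flow_defined M A f0 t q" "flow M A f0 t q = zi (t *\<^sub>R ek)" "zi (t *\<^sub>R ek) \<in> U" "z (zi (t *\<^sub>R ek)) = t *\<^sub>R ek"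
        using flow_eq[OF t] zi_U z_zi by auto
    qed
    show "\<forall>t\<in>{0..T}. flow_defined M A f0 t q \<and> flow M A f0 t q \<in> U" using fl by simp
    define S where "S = (\<lambda>t. t *\<^sub>R ek) ` {0..T}"
    have S: "z ` (\<lambda>t. flow M A f0 t q) ` {0..T} = S"
      unfolding S_def image_image by (rule image_cong[OF refl]) (simp add: fl)
    have cS: "closed S" "S \<noteq> {}"
      unfolding S_def using T by (auto intro!: compact_imp_closed compact_continuous_image continuous_intros)
    have S0: "0 \<in> S" unfolding S_def using T by (intro image_eqI[of _ _ 0]) auto
    \<comment> \<open>C serves the lower bound for curves of cost at most \<epsilon>1,
      \<open>R / \<epsilon>1\<close> the lower bound for costlier ones, and C' the upper
      bound.\<close>
    define K where "K = max (max C (R / \<epsilon>1)) C'"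
    have K: "C \<le> K" "R / \<epsilon>1 \<le> K" "C' \<le> K" by (auto simp: K_def)
    have K0: "0 < K" using K C0 by linarith
    show "\<exists>C::real>0. \<forall>q'\<in>topspace M. value_function M A f0 f T q q' \<le> ereal \<epsilon> \<longrightarrow>
       q' \<in> U \<and>
       ereal (1 / C * infdist (z q') (z ` (\<lambda>t. flow M A f0 t q) ` {0..T})) \<le> value_function M A f0 f T q q' \<and>
       value_function M A f0 f T q q' \<le> ereal (C * infdist (z q') (z ` (\<lambda>t. flow M A f0 t q) ` {0..T}) powr (1 / real r))"
      unfolding S
    proof (rule exI[of _ K], rule conjI[OF K0], intro ballI impI)
      fix q' assume q': "q' \<in> topspace M" and v: "value_function M A f0 f T q q' \<le> ereal \<epsilon>"
      let ?v = "value_function M A f0 f T q q'"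
      have "?v < ereal (2 * \<epsilon>)" using v \<epsilon> by (auto elim!: order.strict_trans1)
      then obtain T' \<gamma> where T': "0 \<le> T'" "T' \<le> T" "admissible M A f0 f T' \<gamma>" "\<gamma> 0 = q" "\<gamma> T' = q'"
        and c: "cost M A f0 f T' \<gamma> < ereal (2 * \<epsilon>)"
        unfolding value_function_def Inf_less_iff by auto
      then obtain u where u: "is_control M A f0 f T' \<gamma> u" "(LINT t:{0..T'}|lebesgue. norm (u t)) < 2 * \<epsilon>"
        unfolding cost_def Inf_less_iff by auto
      have adm: "abs_continuous_curve M A T' \<gamma>" using T'(3) by (simp add: admissible_def)
      have half: "T' + B * CARD('m) * (LINT t:{0..T'}|lebesgue. norm (u t)) \<le> R / 2"
        if "T' \<le> T" "(LINT t:{0..T'}|lebesgue. norm (u t)) \<le> \<epsilon>1" for T' and u :: "real \<Rightarrow> real ^ 'm"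
      proof -
        have "C * (LINT t:{0..T'}|lebesgue. norm (u t)) \<le> C * \<epsilon>1" using that(2) C0 by (intro mult_left_mono) auto
        then show ?thesis using that(1) T unfolding C\<epsilon>1 C_def[symmetric] by linarith
      qed
      have uI: "(LINT t:{0..T'}|lebesgue. norm (u t)) \<le> \<epsilon>1" using u(2) \<epsilon> by linarith
      have R2: "R / 2 < R" using R0 by simp
      note est = admissible_estimate[OF adm u(1) T'(4,1) half[OF T'(2) uI] R2]
      define x where "x = z q'"
      have qU': "q' \<in> U" and nx: "norm x \<le> R / 2" using est(1,2) T'(5) by (auto simp: x_def)
      have zx: "zi x = q'" unfolding x_def by (rule zi_z[OF qU'])
      define d where "d = infdist x S"
      have d_le: "d \<le> norm (x - t *\<^sub>R ek)" if "0 \<le> t" "t \<le> T" for t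
        unfolding d_def dist_norm[symmetric] by (rule infdist_le) (use that in \<open>auto simp: S_def\<close>)
      have dd0: "d \<le> d0"
      proof -
        have "d \<le> C * (LINT t:{0..T'}|lebesgue. norm (u t))"
          using d_le[OF T'(1,2)] est(3) T'(5) by (simp add: x_def C_def)
        also have "\<dots> \<le> C * \<epsilon>1" using uI C0 by (intro mult_left_mono) auto
        finally show ?thesis unfolding C\<epsilon>1 by simp
      qed
      have dnn: "0 \<le> d" unfolding d_def by (rule infdist_nonneg)
      have lower: "ereal (1 / K * d) \<le> ?v"
        unfolding value_function_def
      proof (rule Inf_greatest)
        fix w assume "w \<in> {cost M A f0 f T' \<gamma> |T' \<gamma>. 0 \<le> T' \<and> T' \<le> T \<and> admissible M A f0 f T' \<gamma> \<and> \<gamma> 0 = q \<and> \<gamma> T' = q'}"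
        then obtain T' \<gamma> where w: "w = cost M A f0 f T' \<gamma>" "0 \<le> T'" "T' \<le> T" "admissible M A f0 f T' \<gamma>" "\<gamma> 0 = q" "\<gamma> T' = q'" by auto
        show "ereal (1 / K * d) \<le> w"
          unfolding w(1) cost_def
        proof (rule Inf_greatest)
          fix c assume "c \<in> {ereal (LINT t:{0..T'}|lebesgue. norm (u t)) |u. is_control M A f0 f T' \<gamma> u}"
          then obtain u where u: "is_control M A f0 f T' \<gamma> u" "c = ereal (LINT t:{0..T'}|lebesgue. norm (u t))" by auto
          let ?I = "LINT t:{0..T'}|lebesgue. norm (u t)"
          have ac: "abs_continuous_curve M A T' \<gamma>" using w(4) by (simp add: admissible_def)
          have "d \<le> K * ?I"
          proof (cases "?I \<le> \<epsilon>1")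
            case True
            have I0: "0 \<le> ?I" unfolding set_lebesgue_integral_def by (rule integral_nonneg_AE) auto
            have "d \<le> C * ?I"
              using d_le[OF w(2,3)] admissible_estimate(3)[OF ac u(1) w(5,2) half[OF w(3) True] R2] w(6)
              by (simp add: x_def C_def)
            also have "\<dots> \<le> K * ?I" using K(1) I0 by (rule mult_right_mono)
            finally show ?thesis .
          next
            case False
            \<comment> \<open>A costly curve may leave the chart, so nothing is derived from its
              path. The end point is known to lie in the ball of radius R / 2 from a cheap curve,
              and the drift segment contains 0, so the distance is at most R while the cost exceeds
              \<epsilon>1.\<close>
            have "d \<le> R" using d_le[of 0] T nx R0 by simp
            also have "R = R / \<epsilon>1 * \<epsilon>1" using \<epsilon>1 by simp
            also have "\<dots> \<le> K * ?I" using K \<epsilon>1 False K0 by (intro mult_mono) auto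
            finally show ?thesis .
          qed
          then have "1 / K * d \<le> ?I" using K0 by (simp add: pos_divide_le_eq mult.commute)
          then show "ereal (1 / K * d) \<le> c" by (simp add: u(2))
        qed
      qed
      have upper: "?v \<le> ereal (K * d powr (1 / real r))"
      proof -
        obtain s where s: "s \<in> S" "infdist x S = dist x s" using infdist_attains_inf[OF cS] by blast
        then obtain t where t: "0 \<le> t" "t \<le> T" "s = t *\<^sub>R ek" by (auto simp: S_def)
        have ds: "norm (x - t *\<^sub>R ek) = d" using s(2) t(3) by (simp add: d_def dist_norm)
        show ?thesis
        \<comment> \<open>On the drift segment the drift alone arrives at cost 0, and
          \<open>0 powr (1 / real r)\<close> is 0. The steering result asks for a positive
          distance.\<close>
        proof (cases "d = 0")
          case True
          then have x: "x = t *\<^sub>R ek" using ds by simp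
          have "t < R" using t T R0 by linarith
          from value_le_reach[OF reach_drift[OF t(1) this] t(2)] show ?thesis
            unfolding x[symmetric] zx using True by (simp add: zero_ereal_def)
        next
          case False
          then have dp: "0 < d" using dnn by simp
          have "norm (t *\<^sub>R ek) \<le> \<rho>0 \<and> 0 < norm (x - t *\<^sub>R ek) \<and> norm (x - t *\<^sub>R ek) \<le> d0"
            using t T dp dd0 by (simp add: ds)
          from steer[rule_format, OF this] obtain H where H: "0 < H" "\<forall>\<eta> p'. 0 \<le> \<eta> \<and> \<eta> \<le> H \<and> norm (p' - t *\<^sub>R ek) \<le> real N * \<eta> \<longrightarrow>
              (\<exists>cs. length cs = N \<and> cost_of cs \<le> C' * norm (x - t *\<^sub>R ek) powr (1 / r) \<and> cf.run \<eta> cs p' = x \<and>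
                 cost_of cs * L \<le> 1 / 2 \<and> norm p' + (real N * \<eta> + cost_of cs * B) \<le> R)"
            by (elim exE conjE)
          \<comment> \<open>The second entry makes N steps of duration \<eta> fit into time
            T.\<close>
          define \<eta> where "\<eta> = min H (T / (real N + 1))"
          have \<eta>: "0 < \<eta>" "\<eta> \<le> H" using H(1) T by (auto simp: \<eta>_def)
          have N1: "0 < real N + 1" by simp
          have "\<eta> * (real N + 1) \<le> T"
            using pos_le_divide_eq[OF N1, of \<eta> T] by (simp add: \<eta>_def)
          then have N\<eta>: "real N * \<eta> \<le> T" using \<eta>(1) by (simp add: algebra_simps)
          have N\<eta>0: "0 \<le> real N * \<eta>" using \<eta>(1) by simp
          \<comment> \<open>Steering begins \<open>real N * \<eta>\<close> before the time t of the
            nearest point, or at once if t is smaller than that. The total time then does not exceed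
            T, and the start lies within \<open>real N * \<eta>\<close> of the nearest point, as
            \<open>steering\<close> allows.\<close>
          define t1 where "t1 = max 0 (t - real N * \<eta>)"
          have t1: "0 \<le> t1" "t1 < R" "t1 + real N * \<eta> \<le> T" using t T N\<eta> N\<eta>0 R0 by (auto simp: t1_def)
          have "norm (t1 *\<^sub>R ek - t *\<^sub>R ek) \<le> real N * \<eta>"
            unfolding scaleR_diff_left[symmetric] using t N\<eta>0 by (auto simp: t1_def)
          then obtain cs where cs: "length cs = N" "cost_of cs \<le> C' * d powr (1 / r)" "cf.run \<eta> cs (t1 *\<^sub>R ek) = x"
            "cost_of cs * L \<le> 1 / 2" "norm (t1 *\<^sub>R ek) + (real N * \<eta> + cost_of cs * B) \<le> R"
            using H(2)[rule_format, of \<eta> "t1 *\<^sub>R ek"] \<eta> unfolding ds by auto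
          have "reach (t1 + real (length cs) * \<eta>) 0 (cf.run \<eta> cs (t1 *\<^sub>R ek)) (0 + cost_of cs)"
            by (rule reach_run[OF reach_drift[OF t1(1,2)] \<eta>(1) cs(4)]) (use cs(1,5) in simp)
          then have "reach (t1 + real N * \<eta>) 0 x (cost_of cs)" unfolding cs(1,3) by simp
          from value_le_reach[OF this t1(3)] have "?v \<le> ereal (cost_of cs)" unfolding zx .
          also have "\<dots> \<le> ereal (K * d powr (1 / r))"
            using cs(2) K(3) by (simp add: order_trans[OF _ mult_right_mono])
          finally show ?thesis .
        qed
      qed
      show "q' \<in> U \<and> ereal (1 / K * infdist (z q') S) \<le> ?v \<and> ?v \<le> ereal (K * infdist (z q') S powr (1 / real r))"
        using qU' lower upper unfolding d_def x_def by blast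
    qed
  qed
qed

end

lemma (in chart_family) field_bounds:
  assumes cb: "cball 0 R \<subseteq> z ` U"
  obtains B L where "0 < B" "0 < L" "\<And>i x. x \<in> cball 0 R \<Longrightarrow> norm (field_rep (f i) x) \<le> B"
    "\<And>i x y. x \<in> cball 0 R \<Longrightarrow> y \<in> cball 0 R \<Longrightarrow> norm (field_rep (f i) x - field_rep (f i) y) \<le> L * norm (x - y)"
proof -
  have "\<exists>b\<ge>0. \<forall>x\<in>cball 0 R. norm (field_rep (f i) x) \<le> b" for i
  proof -
    have "continuous_on (cball 0 R) (field_rep (f i))"
      using smooth_on_continuous[OF smooth_field_rep[OF f_smooth]] cb by (rule continuous_on_subset)
    then have "bounded (field_rep (f i) ` cball 0 R)"
      by (intro compact_imp_bounded compact_continuous_image compact_cball)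
    then obtain b where "\<forall>x\<in>cball 0 R. norm (field_rep (f i) x) \<le> b" by (auto simp: bounded_iff)
    then show ?thesis by (intro exI[of _ "max b 0"]) (auto intro: max.coboundedI1)
  qed
  then obtain b where b: "\<And>i. 0 \<le> b i" "\<And>i x. x \<in> cball 0 R \<Longrightarrow> norm (field_rep (f i) x) \<le> b i" by metis
  have "\<exists>l\<ge>0. \<forall>x\<in>cball 0 R. \<forall>y\<in>cball 0 R. norm (field_rep (f i) x - field_rep (f i) y) \<le> l * norm (x - y)" for i
    by (rule smooth_on_lipschitz[OF open_zU smooth_field_rep[OF f_smooth] compact_cball convex_cball cb])
  then obtain l where l: "\<And>i. 0 \<le> l i" "\<And>i x y. x \<in> cball 0 R \<Longrightarrow> y \<in> cball 0 R \<Longrightarrow> norm (field_rep (f i) x - field_rep (f i) y) \<le> l i * norm (x - y)"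
    by metis
  have le: "b i \<le> 1 + (\<Sum>i\<in>UNIV. b i)" "l i \<le> 1 + (\<Sum>i\<in>UNIV. l i)" for i
    using member_le_sum[of i UNIV b] member_le_sum[of i UNIV l] b(1) l(1) by auto
  show ?thesis
  proof
    show "0 < 1 + (\<Sum>i\<in>UNIV. b i)" "0 < 1 + (\<Sum>i\<in>UNIV. l i)" using b(1) l(1) by (auto intro!: add_pos_nonneg sum_nonneg)
    show "norm (field_rep (f i) x) \<le> 1 + (\<Sum>i\<in>UNIV. b i)" if "x \<in> cball 0 R" for i x
      using b(2)[OF that, of i] le(1)[of i] by linarith
    show "norm (field_rep (f i) x - field_rep (f i) y) \<le> (1 + (\<Sum>i\<in>UNIV. l i)) * norm (x - y)"
      if "x \<in> cball 0 R" "y \<in> cball 0 R" for i x y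
      by (rule order_trans[OF l(2)[OF that] mult_right_mono[OF le(2) norm_ge_zero]])
  qed
qed

theorem theorem1:
  fixes M :: "'a topology"
    and A :: "('a, 'n::{finite,linorder}) chart set"
    and f0 :: "'a vfield"
    and f :: "'m::finite \<Rightarrow> 'a vfield"
    and r s :: nat
    and q :: 'a
    and U :: "'a set"
    and z :: "'a \<Rightarrow> real ^ 'n::{finite,linorder}"
    and k :: 'n
  assumes "smooth_manifold M A"
    and "connected_space M"
    and "smooth_vfield M A f0"
    and "\<And>i. smooth_vfield M A (f i)"
    and "hormander M A f"
    and "equiregular M A f"
    and "r = nonholonomy_degree M A f"
    and "1 \<le> s"
    and "\<And>p. p \<in> topspace M \<Longrightarrow> f0 p \<in> flag_at M A f s p - flag_at M A f (s - 1) p"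
    and "q \<in> topspace M"
    and "privileged_coordinates M A f q (U, z)"
    and "\<And>p. p \<in> U \<Longrightarrow> f0 p = coordinate_vfield M A (U, z) k p"
  shows "\<exists>T0>0. \<exists>\<epsilon>0>0. \<forall>T \<epsilon>. 0 < T \<and> T \<le> T0 \<and> 0 < \<epsilon> \<and> \<epsilon> \<le> \<epsilon>0 \<longrightarrow>
    (\<forall>t\<in>{0..T}. flow_defined M A f0 t q \<and> flow M A f0 t q \<in> U) \<and>
    (\<exists>C::real>0. \<forall>q'\<in>topspace M. value_function M A f0 f T q q' \<le> ereal \<epsilon> \<longrightarrow>
       q' \<in> U \<and>
       ereal (1 / C * infdist (z q') (z ` (\<lambda>t. flow M A f0 t q) ` {0..T}))
         \<le> value_function M A f0 f T q q' \<and>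
       value_function M A f0 f T q q'
         \<le> ereal (C * infdist (z q') (z ` (\<lambda>t. flow M A f0 t q) ` {0..T}) powr (1 / real r)))"
proof -
  have z: "local_coordinates M A (U, z)" "q \<in> U" "z q = 0"
    using assms(11) by (auto simp: privileged_coordinates_def)
  interpret cf: chart_family M A U z f
    by unfold_locales (use assms(1,4) z(1) in auto)
  have "0 \<in> z ` U" using z(2,3) by force
  then obtain R where R: "0 < R" "cball 0 R \<subseteq> z ` U"
    using cf.open_zU open_contains_cball by blast
  obtain B L where BL: "0 < B" "0 < L" "\<And>i x. x \<in> cball 0 R \<Longrightarrow> norm (cf.field_rep (f i) x) \<le> B"
    "\<And>i x y. x \<in> cball 0 R \<Longrightarrow> y \<in> cball 0 R \<Longrightarrow> norm (cf.field_rep (f i) x - cf.field_rep (f i) y) \<le> L * norm (x - y)"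
    using cf.field_bounds[OF R(2)] by blast
  interpret drift_chart M A U z f f0 k R B L q
    by unfold_locales (use assms(12) z R BL in auto)
  show ?thesis by (rule value_function_bounds[OF assms(5-7)])
qed

end
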